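(* For every prime number $p$ there is a constant $C_p>0$ such that for every integer $n>0$ and every power $q$ of $p$ there exists a smooth, projective, absolutely irreducible curve $X$ over $\mathbb{F}_q$ of genus $g\leq C_p q^n$ which has no points of degree strictly smaller than $n$.
   Context: Here "power $q$ of $p$" means $q=p^c$ with $c\geq 1$ an integer, and $\mathbb{F}_q$ is the finite field with $q$ elements. A point of degree $d$ of $X$ is a closed point of $X$ whose residue field is $\mathbb{F}_{q^d}$; equivalently, a place of degree $d$ of the function field of $X$ over $\mathbb{F}_q$. *)

theory Defs
  imports
    "HOL-Library.Poly_Mapping"
    "HOL-Library.Function_Algebras"
    "HOL-Computational_Algebra.Polynomial"
    "HOL-Algebra.Algebraic_Closure_Type"
    "Berlekamp_Zassenhaus.Finite_Field"
begin

text \<open>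
  Curves are classical projective varieties: closed subsets of projective N-space over an
  algebraically closed field K of characteristic p, cut out by forms with coefficients in the
  subfield with q elements.  As finite fields are perfect, such a set V is the set of geometric
  points of a unique reduced, geometrically reduced closed subscheme over the field with q elements,
  and smoothness, absolute irreducibility and genus may be read off over K.
\<close>

definition Fq :: "nat \<Rightarrow> 'k::field set" where
  "Fq q = {x. x ^ q = x}"


subsection \<open>Polynomials in the variables $X_0, X_1, \ldots$\<close>

type_synonym 'k mpoly = "(nat \<Rightarrow>\<^sub>0 nat) \<Rightarrow>\<^sub>0 'k"

definition mpoly_eval :: "'k::field mpoly \<Rightarrow> (nat \<Rightarrow> 'k) \<Rightarrow> 'k" where
  "mpoly_eval f x =
     (\<Sum>m\<in>Poly_Mapping.keys f. Poly_Mapping.lookup f m *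
       (\<Prod>i\<in>Poly_Mapping.keys m. x i ^ Poly_Mapping.lookup m i))"

definition mpoly_pderiv :: "nat \<Rightarrow> 'k::field mpoly \<Rightarrow> 'k mpoly" where
  "mpoly_pderiv i f =
     (\<Sum>m\<in>Poly_Mapping.keys f. Poly_Mapping.single (m - Poly_Mapping.single i 1)
       (of_nat (Poly_Mapping.lookup m i) * Poly_Mapping.lookup f m))"

definition mpoly_scale :: "'k::field \<Rightarrow> 'k mpoly \<Rightarrow> 'k mpoly" where
  "mpoly_scale c f = Poly_Mapping.single 0 c * f"

interpretation mpoly: vector_space "mpoly_scale :: 'k::field \<Rightarrow> 'k mpoly \<Rightarrow> 'k mpoly"
  by unfold_locales
     (simp_all add: mpoly_scale_def distrib_left distrib_right single_add mult_single
        flip: mult.assoc)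

text \<open>
  \<open>forms k N d\<close>: the homogeneous polynomials of degree d in $X_0, \ldots, X_N$ with coefficients
  in k, including 0.
\<close>
definition forms :: "'k::field set \<Rightarrow> nat \<Rightarrow> nat \<Rightarrow> 'k mpoly set" where
  "forms k N d =
     {f. \<forall>m\<in>Poly_Mapping.keys f. Poly_Mapping.lookup f m \<in> k \<and>
       Poly_Mapping.keys m \<subseteq> {..N} \<and>
       (\<Sum>i\<in>Poly_Mapping.keys m. Poly_Mapping.lookup m i) = d}"


subsection \<open>Projective algebraic sets\<close>

text \<open>
  A point of projective N-space is the set of all its homogeneous coordinate vectors, that is, of
  nonzero functions supported on the indices 0, ..., N, up to scaling.
\<close>

type_synonym 'k proj_point = "(nat \<Rightarrow> 'k) set"

definition proj_space :: "nat \<Rightarrow> 'k::field proj_point set" where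
  "proj_space N =
     Equiv_Relations.quotient {x. (\<forall>i>N. x i = 0) \<and> (\<exists>i\<le>N. x i \<noteq> 0)}
       {(x, y). \<exists>c. c \<noteq> 0 \<and> y = (\<lambda>i. c * x i)}"

definition zero_locus :: "nat \<Rightarrow> 'k::field mpoly set \<Rightarrow> 'k proj_point set" where
  "zero_locus N S = {P \<in> proj_space N. \<forall>f\<in>S. \<forall>x\<in>P. mpoly_eval f x = 0}"

definition closed_over :: "'k::field set \<Rightarrow> nat \<Rightarrow> 'k proj_point set \<Rightarrow> bool" where
  "closed_over k N V \<longleftrightarrow> (\<exists>S. S \<subseteq> (\<Union>d. forms k N d) \<and> V = zero_locus N S)"

definition vanishing_forms :: "nat \<Rightarrow> 'k::field proj_point set \<Rightarrow> nat \<Rightarrow> 'k mpoly set" where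
  "vanishing_forms N V d = {f \<in> forms UNIV N d. \<forall>P\<in>V. \<forall>x\<in>P. mpoly_eval f x = 0}"

text \<open>
  Irreducibility in the Zariski topology of the algebraically closed field, hence absolute
  irreducibility of the underlying scheme.
\<close>
definition abs_irreducible :: "nat \<Rightarrow> 'k::alg_closed_field proj_point set \<Rightarrow> bool" where
  "abs_irreducible N V \<longleftrightarrow> closed_over UNIV N V \<and> V \<noteq> {} \<and>
     (\<forall>A B. closed_over UNIV N A \<and> closed_over UNIV N B \<and> V = A \<union> B \<longrightarrow> V = A \<or> V = B)"

definition irreducible_chain :: "nat \<Rightarrow> 'k::alg_closed_field proj_point set \<Rightarrow> nat \<Rightarrow> bool" where
  "irreducible_chain N V d \<longleftrightarrow> (\<exists>Z. (\<forall>i\<le>d. abs_irreducible N (Z i) \<and> Z i \<subseteq> V) \<and>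
     (\<forall>i<d. Z i \<subset> Z (Suc i)))"

definition has_dimension :: "nat \<Rightarrow> 'k::alg_closed_field proj_point set \<Rightarrow> nat \<Rightarrow> bool" where
  "has_dimension N V d \<longleftrightarrow> irreducible_chain N V d \<and> \<not> irreducible_chain N V (Suc d)"

interpretation coord: vector_space "\<lambda>(c::'k::field) (v::nat \<Rightarrow> 'k) i. c * v i"
  by unfold_locales (simp_all add: fun_eq_iff algebra_simps)

text \<open>
  The Jacobian criterion for irreducible V of dimension r: at every geometric point the Jacobian
  matrix of the homogeneous ideal of V has rank N - r.  The rank is the dimension of the
  span of its rows, the gradients of the elements of the ideal.
\<close>
definition smooth_of_dim :: "nat \<Rightarrow> 'k::alg_closed_field proj_point set \<Rightarrow> nat \<Rightarrow> bool" where
  "smooth_of_dim N V r \<longleftrightarrow> (\<forall>P\<in>V. \<forall>x\<in>P.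
     vector_space.dim (\<lambda>c v i. c * v i)
       {\<lambda>i. mpoly_eval (mpoly_pderiv i f) x | f. f \<in> (\<Union>d. vanishing_forms N V d)} + r = N)"

definition smooth_proj_abs_irreducible_curve ::
    "nat \<Rightarrow> nat \<Rightarrow> 'k::alg_closed_field proj_point set \<Rightarrow> bool" where
  "smooth_proj_abs_irreducible_curve q N V \<longleftrightarrow>
     closed_over (Fq q) N V \<and> abs_irreducible N V \<and> has_dimension N V 1 \<and> smooth_of_dim N V 1"


subsection \<open>Genus\<close>

definition hilbert_function :: "nat \<Rightarrow> 'k::alg_closed_field proj_point set \<Rightarrow> nat \<Rightarrow> nat" where
  "hilbert_function N V t =
     vector_space.dim mpoly_scale (forms UNIV N t :: 'k mpoly set)
       - vector_space.dim mpoly_scale (vanishing_forms N V t)"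

text \<open>
  The genus of a smooth projective curve V with Hilbert polynomial H, as arithmetic genus:
  \<open>1 - H(0)\<close>, i.e. 1 minus the Euler characteristic of the structure sheaf, which is the
  dimension of its first cohomology group.
\<close>
definition has_genus :: "nat \<Rightarrow> 'k::alg_closed_field proj_point set \<Rightarrow> nat \<Rightarrow> bool" where
  "has_genus N V g \<longleftrightarrow> (\<exists>H :: rat poly.
     (\<forall>\<^sub>F t in sequentially. poly H (of_nat t) = of_nat (hilbert_function N V t)) \<and>
     of_nat g = 1 - poly H 0)"


subsection \<open>Closed points and their degrees\<close>

text \<open>
  A closed point of the scheme V over the field with q elements is an orbit of the q-power
  Frobenius on the geometric points of V (those defined over a finite field, which are all of them
  when K is the algebraic closure of a finite field).
  Its residue field is generated over \<open>Fq q\<close> by the ratios of the homogeneous coordinates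
  of any geometric point in the orbit.
\<close>

definition frobenius_orbit :: "nat \<Rightarrow> 'k::field proj_point \<Rightarrow> 'k proj_point set" where
  "frobenius_orbit q P = {(\<lambda>x i. x i ^ (q ^ j)) ` P | j. True}"

definition closed_points :: "nat \<Rightarrow> 'k::field proj_point set \<Rightarrow> 'k proj_point set set" where
  "closed_points q V = frobenius_orbit q ` V"

definition is_subfield :: "'k::field set \<Rightarrow> bool" where
  "is_subfield L \<longleftrightarrow> 0 \<in> L \<and> 1 \<in> L \<and>
     (\<forall>a\<in>L. \<forall>b\<in>L. a + b \<in> L \<and> a - b \<in> L \<and> a * b \<in> L \<and> a / b \<in> L)"

definition residue_field :: "nat \<Rightarrow> 'k::field proj_point \<Rightarrow> 'k set" where
  "residue_field q P =
     \<Inter>{L. is_subfield L \<and> Fq q \<subseteq> L \<and> {x i / x j | x i j. x \<in> P \<and> x j \<noteq> 0} \<subseteq> L}"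

definition has_degree :: "nat \<Rightarrow> 'k::field proj_point set \<Rightarrow> nat \<Rightarrow> bool" where
  "has_degree q x d \<longleftrightarrow> d > 0 \<and> (\<forall>P\<in>x. residue_field q P = Fq (q ^ d))"

end

theory Submission
  imports Defs "HOL-Computational_Algebra.Computational_Algebra" "Jordan_Normal_Form.Determinant"
begin

text \<open>
  The curve lies in a triple product of projective lines. It is an Artin-Schreier cover
  H(x) N(y) (z^p - z) = U(x, y) of a curve E(x) B(y) = G(x), where B is irreducible of degree n over
  the field with q elements, G = h^p, E = 1 + x h^p, and h is divisible by x^(q^m) - x for all m up to n/2.
  Since E' = G and G' = 0, the lower curve is smooth.  A point of it with B(y) = 0 has degree at
  least n, hence an affine point of degree m < n has h(x) nonzero and x of degree m > n/2. As h has a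
  free factor C of degree less than n, averaging over C makes the number of these points at most q^n.
  At each of them U is chosen such that z^p - z = U/(HN) has no solution in the residue field of the
  point.  Interpolation over the field with q elements gives such a U of small bidegree, and a union
  bound makes U nonzero where HN vanishes, so that the cover is totally ramified there with the least
  possible conductor.  The genus is read off the Hilbert function of the Segre embedding, for which the
  functions of tridegree (t, t, t) have an explicit basis; up to a factor depending on p it is bounded
  by q^n plus n^2 times the degree of E, which is of order q^(n/2).
\<close>

section \<open>Finite fields in an algebraically closed field\<close>

text \<open>On every finite field \<open>z ^ p - z\<close> is additive with 1 in its kernel, hence
  not onto; a value outside its image over the field of degree m removes all points of degree m
  above a point of degree m. Over the field of degree p * m the same value is attained, so the
  prescription, which depends on x alone, works only if x generates the residue field of the point.
  This is why h vanishes on all fields of degree up to n/2: a proper multiple of m > n/2 exceeds n.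
  Each prescribed value is a linear condition on U, so the pole divisor of U/(HN), and with it the
  genus, grows with the number of these points. Counting y above each x allows about n * q^n of
  them, and averaging removes the factor n. The loss n^2 * deg E fits under q^n because n^2 is at
  most a constant times q^(n/2). Points at infinity are of three kinds. If x is infinite, B(y) = 0.
  If z is infinite, HN = 0, and H and N are built so that y then has degree above n. If y is
  infinite, E(x) = 0, which allows small degrees; there the coefficient W of the top power of y in U
  is prescribed.\<close>

lemma card_roots_separable:
  fixes f :: "'k::alg_closed_field poly"
  assumes f0: "f \<noteq> 0" and sep: "\<And>x. poly f x = 0 \<Longrightarrow> poly (pderiv f) x \<noteq> 0"
  shows "card {x. poly f x = 0} = degree f"
proof -
  obtain A where A: "size A = degree f" "f = smult (lead_coeff f) (\<Prod>x\<in>#A. [:-x, 1:])"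
    using alg_closed_imp_factorization[OF f0] by blast
  have lc: "lead_coeff f \<noteq> 0" using f0 by simp
  have pr: "proots f = A"
  proof -
    have "proots f = proots (\<Prod>x\<in>#A. [:-x, 1:])"
      by (subst A(2)) (use lc in simp)
    also have "\<dots> = A"
    proof (induction A)
      case (add x A)
      have "(\<Prod>x\<in>#A. [:-x, 1:]) \<noteq> (0 :: 'k poly)" by auto
      hence "proots ([:-x, 1:] * (\<Prod>x\<in>#A. [:-x, 1:])) = {#x#} + A"
        using add by (subst proots_mult) auto
      thus ?case by simp
    qed simp
    finally show ?thesis .
  qed
  have cnt: "count A x \<le> 1" for x
  proof (rule ccontr)
    assume "\<not> count A x \<le> 1"
    hence "order x f \<ge> 2" using pr count_proots[of f x] f0 by auto
    hence "[:-x,1:]^2 dvd f" using order_divides[of x 2 f] by auto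
    then obtain g where g: "f = [:-x,1:]^2 * g" by auto
    have "poly f x = 0" by (simp add: g)
    moreover have "poly (pderiv ([:-x,1:] * ([:-x,1:] * g))) x = 0"
      by (subst pderiv_mult) simp
    hence "poly (pderiv f) x = 0" by (simp only: g power2_eq_square mult.assoc)
    ultimately show False using sep by auto
  qed
  have "A = mset_set (set_mset A)"
    using cnt by (intro multiset_eqI) (metis count_mset_set(1,3) count_greater_zero_iff finite_set_mset
      le_neq_implies_less less_one not_in_iff)
  hence "size A = card (set_mset A)" by (metis size_mset_set)
  moreover have "set_mset A = {x. poly f x = 0}" using pr f0 by auto
  ultimately show ?thesis using A(1) by simp
qed

lemma card_proots_le:
  fixes f :: "'k::idom poly"
  assumes "f \<noteq> 0" shows "finite {x. poly f x = 0}" "card {x. poly f x = 0} \<le> degree f"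
  using assms poly_roots_finite card_poly_roots_bound by blast+

lemma prod_linear:
  fixes S :: "'a::idom set"
  assumes "finite S"
  shows "degree (\<Prod>y\<in>S. [:-y, 1:]) = card S" "lead_coeff (\<Prod>y\<in>S. [:-y, 1:]) = 1"
    "poly (\<Prod>y\<in>S. [:-y, 1:]) z = 0 \<longleftrightarrow> z \<in> S"
    "z \<in> S \<Longrightarrow> poly (pderiv (\<Prod>y\<in>S. [:-y, 1:])) z \<noteq> 0"
proof -
  show "degree (\<Prod>y\<in>S. [:-y, 1:]) = card S" by (subst degree_prod_sum_eq) auto
  show "lead_coeff (\<Prod>y\<in>S. [:-y, 1:]) = 1" by (subst lead_coeff_prod) auto
  show *: "poly (\<Prod>y\<in>S. [:-y, 1:]) z = 0 \<longleftrightarrow> z \<in> S" for z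
    using assms by (simp add: poly_prod)
  assume z: "z \<in> S"
  have "(\<Prod>y\<in>S. [:-y, 1:]) = [:-z, 1:] * (\<Prod>y\<in>S - {z}. [:-y, 1:])"
    using assms z by (simp add: prod.remove)
  thus "poly (pderiv (\<Prod>y\<in>S. [:-y, 1:])) z \<noteq> 0"
    using assms by (simp add: pderiv_mult pderiv_pCons poly_prod del: mult_pCons_left)
qed

text \<open>The assumption \<open>algebraic\<close> makes K an algebraic closure of its prime field.
  It puts every finite set of scalars into some \<open>FF k\<close>, which Galois descent needs, and
  makes Frobenius surjective.\<close>

locale fq_closure =
  fixes q c :: nat and ty :: "'k::alg_closed_field itself"
  assumes prime_char: "prime (CHAR('k))" and q_def: "q = CHAR('k) ^ c" and c_pos: "c \<ge> 1"
    and algebraic: "\<exists>k\<ge>1. (x::'k) ^ (q ^ k) = x"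
begin

lemma q_ge2: "q \<ge> 2"
proof -
  have "2 \<le> CHAR('k)" using prime_char prime_ge_2_nat by blast
  also have "\<dots> \<le> CHAR('k) ^ c" using c_pos \<open>2 \<le> CHAR('k)\<close> by (intro self_le_power) auto
  finally show ?thesis using q_def by simp
qed

lemma q_pos: "q > 0" "q ^ k > 0" using q_ge2 by auto

lemma qk: "q ^ k = CHAR('k) ^ (c * k)" by (simp add: q_def power_mult)

lemma fr_add: "((x::'k) + y) ^ (q ^ k) = x ^ (q ^ k) + y ^ (q ^ k)"
  using freshmans_dream'[OF prime_char qk] .

lemma fr_sum: "(sum f A :: 'k) ^ (q ^ k) = (\<Sum>i\<in>A. f i ^ (q ^ k))"
  using freshmans_dream_sum'[OF prime_char qk] .

lemma fr_minus: "(- (x::'k)) ^ (q ^ k) = - (x ^ (q ^ k))"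
  using fr_add[of x "-x" k] q_pos by (simp add: eq_neg_iff_add_eq_0 add.commute zero_power)

lemma fr_diff: "((x::'k) - y) ^ (q ^ k) = x ^ (q ^ k) - y ^ (q ^ k)"
  using fr_add[of x "-y" k] by (simp add: fr_minus)

lemma fr_inj: "(x::'k) ^ (q ^ k) = y ^ (q ^ k) \<Longrightarrow> x = y"
  using fr_diff[of x y k] by simp

lemmas fr1 = fr_add[of _ _ 1, simplified] fr_minus[of _ 1, simplified] fr_diff[of _ _ 1, simplified]
lemmas fr1_sum = fr_sum[of _ _ 1, simplified]

lemma frob_hom: "comm_ring_hom (\<lambda>x::'k. x ^ q)"
  by unfold_locales (auto simp: fr1 power_mult_distrib q_pos)

abbreviation FF :: "nat \<Rightarrow> 'k set" where "FF k \<equiv> Fq (q ^ k)"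

lemma FF_iff: "x \<in> FF k \<longleftrightarrow> x ^ (q ^ k) = x" by (simp add: Fq_def)

lemma FF_add: "x \<in> FF k \<Longrightarrow> y \<in> FF k \<Longrightarrow> x + y \<in> FF k"
  and FF_diff: "x \<in> FF k \<Longrightarrow> y \<in> FF k \<Longrightarrow> x - y \<in> FF k"
  and FF_minus: "x \<in> FF k \<Longrightarrow> - x \<in> FF k"
  and FF_mult: "x \<in> FF k \<Longrightarrow> y \<in> FF k \<Longrightarrow> x * y \<in> FF k"
  and FF_divide: "x \<in> FF k \<Longrightarrow> y \<in> FF k \<Longrightarrow> x / y \<in> FF k"
  and FF_0: "0 \<in> FF k" and FF_1: "1 \<in> FF k"
  by (simp_all add: FF_iff fr_add fr_diff fr_minus power_mult_distrib power_divide q_pos zero_power)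

lemma FF_pow: "x \<in> FF k \<Longrightarrow> x ^ i \<in> FF k"
  by (metis FF_iff mult.commute power_mult)

lemma FF_iterate: "x \<in> FF k \<Longrightarrow> x ^ (q ^ (k * j)) = x"
  by (induction j) (auto simp: FF_iff power_add power_mult)

lemma FF_dvd: "x \<in> FF k \<Longrightarrow> k dvd m \<Longrightarrow> x \<in> FF m"
  using FF_iterate by (auto simp: FF_iff elim!: dvdE)

lemma Fq_sub_FF: "x \<in> Fq q \<Longrightarrow> x \<in> FF k"
  using FF_dvd[of x 1 k] by simp

lemma FF_frob: "x \<in> FF k \<Longrightarrow> x ^ q ^ j \<in> FF k" by (rule FF_pow)

lemma FF_frob_iff: "x ^ q ^ j \<in> FF k \<longleftrightarrow> x \<in> FF k"
proof
  assume "x ^ q ^ j \<in> FF k"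
  hence "(x ^ q ^ k) ^ q ^ j = x ^ q ^ j" by (simp add: FF_iff mult.commute flip: power_mult)
  thus "x \<in> FF k" using fr_inj FF_iff by blast
qed (rule FF_frob)

text \<open>The derivative of x^(q^k) - x is the constant -1, so all q^k roots are simple.\<close>

lemma card_FF: assumes "k \<ge> 1" shows "finite (FF k)" "card (FF k) = q ^ k"
proof -
  let ?f = "monom 1 (q ^ k) - [:0, 1:] :: 'k poly"
  have q2: "q ^ k \<ge> 2" using q_ge2 assms self_le_power[of q k] by linarith
  have deg: "degree ?f = q ^ k"
    by (subst diff_conv_add_uminus, subst degree_add_eq_left) (use q2 in \<open>auto simp: degree_monom_eq\<close>)
  have f0: "?f \<noteq> 0" using deg q2 by (metis degree_0 not_numeral_le_zero)
  have cz: "(of_nat (q ^ k) :: 'k) = 0" using assms c_pos by (simp add: qk zero_power)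
  have pd: "pderiv ?f = [:-1:]"
    by (simp add: pderiv_diff pderiv_monom cz pderiv_pCons del: of_nat_power)
  have eq: "{x. poly ?f x = 0} = FF k" by (auto simp: FF_iff poly_monom)
  have c1: "card {x. poly ?f x = 0} = degree ?f"
    by (rule card_roots_separable[OF f0]) (simp add: pd)
  show "card (FF k) = q ^ k" using c1 eq deg by simp
  show "finite (FF k)" using card_proots_le(1)[OF f0] eq by simp
qed

section \<open>Polynomials over the small field\<close>

definition fqpoly :: "'k poly \<Rightarrow> bool" where "fqpoly f \<longleftrightarrow> (\<forall>i. coeff f i \<in> Fq q)"

lemma fqpoly_iff: "fqpoly f \<longleftrightarrow> map_poly (\<lambda>x. x ^ q) f = f"
  by (auto simp: fqpoly_def poly_eq_iff coeff_map_poly Fq_def q_pos)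

lemma fqpoly_mult: assumes "fqpoly f" "fqpoly g" shows "fqpoly (f * g)"
proof -
  interpret comm_ring_hom "\<lambda>x::'k. x ^ q" by (rule frob_hom)
  interpret m: map_poly_comm_ring_hom "\<lambda>x::'k. x ^ q" ..
  show ?thesis using assms by (simp add: fqpoly_iff m.hom_mult)
qed

lemma fqpoly_add: "fqpoly f \<Longrightarrow> fqpoly g \<Longrightarrow> fqpoly (f + g)"
  and fqpoly_diff: "fqpoly f \<Longrightarrow> fqpoly g \<Longrightarrow> fqpoly (f - g)"
  and fqpoly_0: "fqpoly 0"
  using FF_add[of _ 1] FF_diff[of _ 1] FF_0[of 1] by (auto simp: fqpoly_def)

lemma fqpoly_1: "fqpoly 1" using FF_0[of 1] FF_1[of 1] by (auto simp: fqpoly_def)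

lemma fqpoly_X: "fqpoly [:0, 1:]"
  using FF_0[of 1] FF_1[of 1] by (auto simp: fqpoly_def coeff_pCons split: nat.split)

lemma fqpoly_monom: "a \<in> Fq q \<Longrightarrow> fqpoly (monom a i)"
  using FF_0[of 1] by (auto simp: fqpoly_def)

lemma fqpoly_power: "fqpoly f \<Longrightarrow> fqpoly (f ^ k)"
  by (induction k) (auto intro: fqpoly_mult fqpoly_1)

lemma fqpoly_prod: "(\<And>i. i \<in> A \<Longrightarrow> fqpoly (f i)) \<Longrightarrow> fqpoly (prod f A)"
  by (induction A rule: infinite_finite_induct) (auto intro: fqpoly_mult fqpoly_1)

lemma fqpoly_sum: "(\<And>i. i \<in> A \<Longrightarrow> fqpoly (f i)) \<Longrightarrow> fqpoly (sum f A)"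
  by (induction A rule: infinite_finite_induct) (auto intro: fqpoly_add fqpoly_0)

lemma fqpoly_coeff_FF: "fqpoly f \<Longrightarrow> coeff f i \<in> FF k" using Fq_sub_FF by (auto simp: fqpoly_def)

lemma poly_fr: assumes "fqpoly f" shows "poly f (x ^ (q ^ j)) = poly f x ^ (q ^ j)"
proof -
  have "(poly f x) ^ (q ^ j) = (\<Sum>i\<le>degree f. (coeff f i * x ^ i) ^ (q ^ j))"
    by (simp add: poly_altdef fr_sum)
  also have "\<dots> = (\<Sum>i\<le>degree f. coeff f i * (x ^ (q ^ j)) ^ i)"
    using fqpoly_coeff_FF[OF assms, of _ j] by (intro sum.cong refl)
      (simp add: power_mult_distrib FF_iff mult.commute flip: power_mult)
  finally show ?thesis by (simp add: poly_altdef)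
qed

lemma poly_FF: "fqpoly f \<Longrightarrow> x \<in> FF k \<Longrightarrow> poly f x \<in> FF k"
  unfolding FF_iff using poly_fr[of f x k] by simp

lemma fr_eq_FF:
  assumes "i < j" "(x::'k) ^ (q ^ i) = x ^ (q ^ j)" shows "x \<in> FF (j - i)"
proof -
  have "(x ^ (q ^ (j - i))) ^ (q ^ i) = x ^ (q ^ i)"
    unfolding assms(2) using assms(1) by (simp flip: power_mult power_add)
  from fr_inj[OF this] show ?thesis by (simp add: FF_iff)
qed

text \<open>Frobenius maps roots of g to roots of g, so two of the first degree g + 1 iterates of x
  coincide, and injectivity cancels the common power. Read contrapositively: a polynomial over the
  small field does not vanish at an element of larger degree.\<close>

lemma root_fqpoly_in_FF:
  assumes "fqpoly g" "g \<noteq> 0" "poly g x = 0"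
  shows "\<exists>k. 1 \<le> k \<and> k \<le> degree g \<and> x \<in> FF k"
proof -
  let ?r = "degree g" and ?f = "\<lambda>i. x ^ (q ^ i)"
  have sub: "?f ` {..?r} \<subseteq> {x. poly g x = 0}" using assms by (auto simp: poly_fr q_pos)
  have "card (?f ` {..?r}) \<le> ?r"
    using card_mono[OF card_proots_le(1)[OF assms(2)] sub] card_proots_le(2)[OF assms(2)] by linarith
  hence "\<not> inj_on ?f {..?r}" by (metis card_atMost card_image lessI not_less)
  then obtain i j where ij: "i < j" "j \<le> ?r" "?f i = ?f j"
    unfolding inj_on_def by (metis atMost_iff linorder_neqE_nat)
  have "x \<in> FF (j - i)" using fr_eq_FF ij by blast
  thus ?thesis using ij by (intro exI[of _ "j - i"]) auto
qed

section \<open>Degrees of elements, conjugates and minimal polynomials\<close>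

definition exact_deg :: "nat \<Rightarrow> 'k \<Rightarrow> bool" where
  "exact_deg d x \<longleftrightarrow> d \<ge> 1 \<and> x \<in> FF d \<and> (\<forall>k. 1 \<le> k \<and> k < d \<longrightarrow> x \<notin> FF k)"

text \<open>The fields of degree below d have together at most q + ... + q^(d-1) elements, which is
  less than q^d.\<close>

lemma exact_deg_exists: assumes "d \<ge> 1" shows "\<exists>x. exact_deg d x"
proof (rule ccontr)
  assume "\<not> ?thesis"
  hence sub: "FF d \<subseteq> (\<Union>k\<in>{1..<d}. FF k)" using assms unfolding exact_deg_def by fastforce
  have fin: "finite (\<Union>k\<in>{1..<d}. FF k)" using card_FF(1) by auto
  have "card (FF d) \<le> card (\<Union>k\<in>{1..<d}. FF k)" by (rule card_mono[OF fin sub])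
  also have "\<dots> \<le> (\<Sum>k\<in>{1..<d}. card (FF k))" by (rule card_UN_le) auto
  also have "\<dots> = (\<Sum>k\<in>{1..<d}. q ^ k)" by (intro sum.cong) (auto simp: card_FF)
  also have "\<dots> < q ^ d"
  proof -
    have "(\<Sum>k\<in>{1..<d}. q ^ k) < q ^ d" for d
    proof (induction d)
      case (Suc d)
      show ?case
      proof (cases "d = 0")
        case False
        hence "(\<Sum>k\<in>{1..<Suc d}. q ^ k) = (\<Sum>k\<in>{1..<d}. q ^ k) + q ^ d" by simp
        also have "\<dots> < q ^ d + q ^ d" using Suc by simp
        also have "\<dots> = 2 * q ^ d" by simp
        also have "\<dots> \<le> q ^ Suc d" using q_ge2 by (simp only: power_Suc mult_le_mono1)
        finally show ?thesis .
      qed (use q_pos in auto)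
    qed auto
    thus ?thesis .
  qed
  finally show False using card_FF[OF assms] by simp
qed

lemma exact_deg_dvd: assumes "exact_deg d x" "x \<in> FF m" shows "d dvd m"
proof -
  have "x \<in> FF (m mod d)"
  proof -
    have "(x ^ (q ^ (d * (m div d)))) ^ (q ^ (m mod d)) = x"
      using assms(2) by (simp add: FF_iff flip: power_mult power_add)
    moreover have "x ^ (q ^ (d * (m div d))) = x" using FF_iterate assms by (auto simp: exact_deg_def)
    ultimately show ?thesis by (simp add: FF_iff)
  qed
  hence "m mod d = 0" using assms(1) mod_less_divisor[of d m] unfolding exact_deg_def
    by (metis One_nat_def Suc_leI less_eq_Suc_le neq0_conv)
  thus ?thesis by auto
qed

lemma exact_deg_no_root:
  assumes "exact_deg d x" "fqpoly g" "g \<noteq> 0" "degree g < d" shows "poly g x \<noteq> 0"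
  using root_fqpoly_in_FF[of g x] assms by (auto simp: exact_deg_def)

lemma exact_deg_frob: "exact_deg d (x ^ q ^ j) \<longleftrightarrow> exact_deg d x"
  by (simp add: exact_deg_def FF_frob_iff)

definition conjs :: "nat \<Rightarrow> 'k \<Rightarrow> 'k set" where "conjs d x = (\<lambda>i. x ^ (q ^ i)) ` {..<d}"

lemma card_conjs: assumes "exact_deg d x" shows "finite (conjs d x)" "card (conjs d x) = d"
proof -
  have "inj_on (\<lambda>i. x ^ (q ^ i)) {..<d}"
  proof (rule linorder_inj_onI)
    fix i j assume ij: "i < j" "i \<in> {..<d}" "j \<in> {..<d}"
    show "x ^ (q ^ i) \<noteq> x ^ (q ^ j)"
    proof
      assume eq: "x ^ (q ^ i) = x ^ (q ^ j)"
      have "x \<in> FF (j - i)" using fr_eq_FF[OF ij(1) eq] .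
      moreover have "1 \<le> j - i" "j - i < d" using ij by auto
      hence "x \<notin> FF (j - i)" using assms unfolding exact_deg_def by blast
      ultimately show False by simp
    qed
  qed auto
  thus "card (conjs d x) = d" by (simp add: conjs_def card_image)
qed (simp add: conjs_def)

lemma conjs_exact: "exact_deg d x \<Longrightarrow> y \<in> conjs d x \<Longrightarrow> exact_deg d y"
  by (auto simp: conjs_def exact_deg_frob)

lemma conjs_frob: assumes "exact_deg d x" shows "(\<lambda>y. y ^ q) ` conjs d x = conjs d x"
proof (rule card_subset_eq)
  show "(\<lambda>y. y ^ q) ` conjs d x \<subseteq> conjs d x"
  proof
    fix z assume "z \<in> (\<lambda>y. y ^ q) ` conjs d x"
    then obtain i where i: "i < d" "z = x ^ (q ^ Suc i)"
      unfolding conjs_def by (auto simp: mult.commute simp flip: power_mult)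
    show "z \<in> conjs d x"
    proof (cases "Suc i < d")
      case True thus ?thesis using i(2) unfolding conjs_def by blast
    next
      case False
      hence "Suc i = d" using i by simp
      hence "z = x ^ (q ^ 0)" using i(2) assms unfolding exact_deg_def FF_iff by (metis power_0 power_one_right)
      moreover have "0 < d" using i by simp
      ultimately show ?thesis unfolding conjs_def by blast
    qed
  qed
  show "card ((\<lambda>y. y ^ q) ` conjs d x) = card (conjs d x)"
    by (rule card_image) (auto intro!: inj_onI dest: fr_inj[of _ 1, simplified])
qed (use card_conjs[OF assms] in auto)

text \<open>Applying Frobenius to the coefficients only permutes the linear factors.\<close>

lemma fqpoly_stable_prod:
  assumes "finite S" "(\<lambda>y. y ^ q) ` S = S" shows "fqpoly (\<Prod>y\<in>S. [:-y, 1:])"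
proof -
  interpret comm_ring_hom "\<lambda>x::'k. x ^ q" by (rule frob_hom)
  interpret m: map_poly_comm_ring_hom "\<lambda>x::'k. x ^ q" ..
  have inj: "inj_on (\<lambda>y::'k. y ^ q) S" by (auto intro!: inj_onI dest: fr_inj[of _ 1, simplified])
  have "map_poly (\<lambda>x. x ^ q) (\<Prod>y\<in>S. [:-y, 1:]) = (\<Prod>y\<in>S. [:-(y ^ q), 1:])"
    by (simp add: m.hom_prod fr1 map_poly_pCons)
  also have "\<dots> = (\<Prod>y\<in>(\<lambda>y. y ^ q) ` S. [:-y, 1:])" by (simp add: prod.reindex[OF inj])
  finally show ?thesis using assms(2) by (simp add: fqpoly_iff)
qed

text \<open>The minimal polynomial of x over the small field when x has degree d.\<close>

definition conj_poly :: "nat \<Rightarrow> 'k \<Rightarrow> 'k poly" where "conj_poly d x = (\<Prod>y\<in>conjs d x. [:-y, 1:])"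

lemma conj_poly: assumes "exact_deg d x"
  shows "fqpoly (conj_poly d x)" "degree (conj_poly d x) = d" "lead_coeff (conj_poly d x) = 1"
   "poly (conj_poly d x) y = 0 \<longleftrightarrow> y \<in> conjs d x"
   "y \<in> conjs d x \<Longrightarrow> poly (pderiv (conj_poly d x)) y \<noteq> 0"
  using card_conjs[OF assms] conjs_frob[OF assms] prod_linear[of "conjs d x"]
  by (auto simp: conj_poly_def intro: fqpoly_stable_prod)

lemma common_field: assumes "finite (A::'k set)" shows "\<exists>k\<ge>1. \<forall>x\<in>A. x \<in> FF k"
  using assms
proof induction
  case (insert x A)
  then obtain k where k: "k \<ge> 1" "\<forall>x\<in>A. x \<in> FF k" by auto
  obtain l where l: "l \<ge> 1" "x \<in> FF l" using algebraic[of x] by (auto simp: FF_iff)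
  have "\<forall>y\<in>insert x A. y \<in> FF (k * l)" using k l FF_dvd by (metis dvd_triv_left dvd_triv_right insert_iff)
  thus ?case using k l by (intro exI[of _ "k * l"]) auto
qed auto

text \<open>Galois descent: traces of scalar multiples of a relation are relations over the small field,
  and not all of them vanish on a vector on which the relation itself does not.\<close>
lemma descent:
  fixes a :: "'i \<Rightarrow> 'k" and W :: "('i \<Rightarrow> 'k) set"
  assumes fin: "finite I" and stable: "\<And>w. w \<in> W \<Longrightarrow> \<exists>w'\<in>W. \<forall>i\<in>I. w i = w' i ^ q"
    and orth: "\<And>w. w \<in> W \<Longrightarrow> (\<Sum>i\<in>I. a i * w i) = 0" and w0: "(\<Sum>i\<in>I. a i * w0 i) \<noteq> 0"
  shows "\<exists>b. (\<forall>i\<in>I. b i \<in> Fq q) \<and> (\<forall>w\<in>W. (\<Sum>i\<in>I. b i * w i) = 0) \<and> (\<Sum>i\<in>I. b i * w0 i) \<noteq> 0"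
proof -
  obtain k where k: "k \<ge> 1" "\<And>i. i \<in> I \<Longrightarrow> a i \<in> FF k" using common_field[of "a ` I"] fin by auto
  define s where "s j = (\<Sum>i\<in>I. a i ^ q ^ j * w0 i)" for j
  \<comment> \<open>P(l) is the value at w0 of the trace of l times the relation. Its coefficient at
    l is the original nonzero value \<open>s 0\<close>, and its degree is below q^k, so some l in
    \<open>FF k\<close> is not a root.\<close>
  define P where "P = (\<Sum>j<k. monom (s j) (q ^ j))"
  have inj: "q ^ j = 1 \<longleftrightarrow> j = 0" for j using q_ge2 by (metis One_nat_def Suc_eq_numeral(1) nat_power_eq_Suc_0_iff not_less_eq_eq numeral_2_eq_2 power_0 order_refl)
  have "coeff P 1 = s 0"
  proof -
    have "coeff P 1 = (\<Sum>j<k. if j = 0 then s j else 0)"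
      unfolding P_def coeff_sum coeff_monom inj by simp
    thus ?thesis using k by simp
  qed
  hence P0: "P \<noteq> 0" using w0 by (auto simp: s_def)
  have degP: "degree P \<le> q ^ (k - 1)"
    unfolding P_def using q_ge2 by (intro degree_sum_le) (auto intro!: order.trans[OF degree_monom_le] power_increasing)
  have "q ^ (k - 1) < q ^ k" using q_ge2 k by (intro power_strict_increasing) auto
  hence "\<not> FF k \<subseteq> {x. poly P x = 0}"
    using card_mono[OF card_proots_le(1)[OF P0], of "FF k"] card_proots_le(2)[OF P0] card_FF[OF k(1)] degP by auto
  then obtain l where l: "l \<in> FF k" "poly P l \<noteq> 0" by auto
  define b where "b i = (\<Sum>j<k. (l * a i) ^ q ^ j)" for i
  have "b i \<in> Fq q" if "i \<in> I" for i
  proof -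
    have "b i ^ q = (\<Sum>j<k. (l * a i) ^ q ^ Suc j)"
      unfolding b_def by (simp add: fr1_sum mult.commute flip: power_mult)
    also have "\<dots> = (\<Sum>j\<in>{1..<Suc k}. (l * a i) ^ q ^ j)"
      by (rule sum.reindex_bij_witness[of _ "\<lambda>j. j - 1" Suc]) auto
    also have "\<dots> = (\<Sum>j\<in>{1..<k}. (l * a i) ^ q ^ j) + (l * a i) ^ q ^ k" using k by simp
    also have "(l * a i) ^ q ^ k = l * a i" using FF_mult[OF l(1) k(2)[OF that]] by (simp add: FF_iff)
    also have "(\<Sum>j\<in>{1..<k}. (l * a i) ^ q ^ j) + l * a i = (\<Sum>j\<in>insert 0 {1..<k}. (l * a i) ^ q ^ j)" by simp
    also have "insert 0 {1..<k} = {..<k}" using k by auto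
    finally show ?thesis by (simp add: Fq_def b_def)
  qed
  moreover have "(\<Sum>i\<in>I. b i * w i) = 0" if w: "w \<in> W" for w
  proof -
    have st: "\<exists>w'\<in>W. \<forall>i\<in>I. w i = w' i ^ q ^ j" for j
    proof (induction j)
      case (Suc j)
      then obtain w' where w': "w' \<in> W" "\<forall>i\<in>I. w i = w' i ^ q ^ j" by auto
      obtain w'' where "w'' \<in> W" "\<forall>i\<in>I. w' i = w'' i ^ q" using stable[OF w'(1)] by auto
      thus ?case using w'(2) by (intro bexI[of _ w'']) (auto simp flip: power_mult)
    qed (use w in auto)
    \<comment> \<open>By stability w is the q^j-th power of some w' in W, and the relation for w'
      raised to the power q^j is the conjugate relation for w.\<close>
    have "(\<Sum>i\<in>I. (l * a i) ^ q ^ j * w i) = 0" for j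
    proof -
      obtain w' where w': "w' \<in> W" "\<forall>i\<in>I. w i = w' i ^ q ^ j" using st by blast
      have "(\<Sum>i\<in>I. (l * a i) ^ q ^ j * w i) = (\<Sum>i\<in>I. l * (a i * w' i)) ^ q ^ j"
        unfolding fr_sum using w'(2) by (intro sum.cong) (auto simp: power_mult_distrib)
      also have "(\<Sum>i\<in>I. l * (a i * w' i)) = 0" using orth[OF w'(1)] by (simp flip: sum_distrib_left)
      finally show ?thesis using q_pos by (simp add: zero_power)
    qed
    moreover have "(\<Sum>i\<in>I. b i * w i) = (\<Sum>j<k. \<Sum>i\<in>I. (l * a i) ^ q ^ j * w i)"
      unfolding b_def sum_distrib_right by (rule sum.swap)
    ultimately show ?thesis by simp
  qed
  moreover have "(\<Sum>i\<in>I. b i * w0 i) = poly P l"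
  proof -
    have "(\<Sum>i\<in>I. b i * w0 i) = (\<Sum>j<k. \<Sum>i\<in>I. (l * a i) ^ q ^ j * w0 i)"
      unfolding b_def sum_distrib_right by (rule sum.swap)
    also have "\<dots> = (\<Sum>j<k. s j * l ^ q ^ j)"
      unfolding s_def sum_distrib_right by (intro sum.cong refl) (simp add: power_mult_distrib mult_ac)
    finally show ?thesis by (simp add: P_def poly_sum poly_monom)
  qed
  ultimately show ?thesis using l(2) by metis
qed

end

section \<open>Eisenstein polynomials and Hensel's lemma\<close>

lemma fps_nth_0_hom: "comm_ring_hom (\<lambda>a::'k::field fps. a $ 0)"
  by unfold_locales auto

text \<open>An Eisenstein criterion turned upside down: modulo X the polynomial is a nonzero
  constant, while its leading coefficient has order exactly one. If both factors had positive
  degree, both would reduce to constants, so both leading coefficients would vanish at 0 and their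
  product would have order at least two. The scalar a allows for denominators; it is removed one
  order at a time, as in Gauss's lemma.\<close>

lemma eisenstein_fps:
  fixes F P Q :: "'k::field fps poly"
  assumes "subdegree (lead_coeff F) = 1"
    and mid: "\<And>i. i > 0 \<Longrightarrow> coeff F i $ 0 = 0" and const: "coeff F 0 $ 0 \<noteq> 0"
    and "a \<noteq> 0" "smult a F = P * Q"
  shows "degree P = 0 \<or> degree Q = 0"
  using assms(4,5)
proof (induction "subdegree a" arbitrary: a P Q)
  interpret n0: comm_ring_hom "\<lambda>a::'k fps. a $ 0" by (rule fps_nth_0_hom)
  interpret m: map_poly_comm_ring_hom "\<lambda>a::'k fps. a $ 0" ..
  let ?r = "map_poly (\<lambda>a::'k fps. a $ 0)"
  have F0: "F \<noteq> 0" using const by auto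
  {
    case 0
    hence a0: "a $ 0 \<noteq> 0" using subdegree_eq_0_iff[of a] by auto
    have "?r (P * Q) = [:a $ 0 * coeff F 0 $ 0:]"
      unfolding 0(3)[symmetric]
    proof (rule poly_eqI)
      fix i show "coeff (?r (smult a F)) i = coeff [:a $ 0 * coeff F 0 $ 0:] i"
        using mid[of i] by (cases i) (auto simp: coeff_map_poly fps_mult_nth_0 coeff_pCons)
    qed
    hence pq: "?r P * ?r Q = [:a $ 0 * coeff F 0 $ 0:]" by (simp add: m.hom_mult)
    hence "?r P \<noteq> 0" "?r Q \<noteq> 0" using a0 const by auto
    hence "degree (?r P) + degree (?r Q) = 0" using arg_cong[OF pq, of degree] by (simp add: degree_mult_eq)
    hence dg: "degree (?r P) = 0" "degree (?r Q) = 0" by auto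
    show ?case
    proof (rule ccontr)
      assume neg: "\<not> (degree P = 0 \<or> degree Q = 0)"
      have "coeff (?r P) (degree P) = 0" "coeff (?r Q) (degree Q) = 0"
        using neg dg by (metis coeff_eq_0 neq0_conv)+
      hence z: "lead_coeff P $ 0 = 0" "lead_coeff Q $ 0 = 0" by (simp_all add: coeff_map_poly)
      have nz: "lead_coeff P \<noteq> 0" "lead_coeff Q \<noteq> 0" using neg by auto
      have "subdegree (lead_coeff P) \<ge> 1" "subdegree (lead_coeff Q) \<ge> 1"
        using z nz subdegree_eq_0_iff by (metis One_nat_def Suc_leI neq0_conv)+
      moreover have "lead_coeff P * lead_coeff Q = a * lead_coeff F"
        using arg_cong[OF 0(3), of lead_coeff] 0(2) by (simp add: lead_coeff_mult)
      hence "subdegree (lead_coeff P) + subdegree (lead_coeff Q) = subdegree a + subdegree (lead_coeff F)"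
        using nz 0(2) F0 by (metis leading_coeff_neq_0 subdegree_mult)
      ultimately show False using assms(1) 0(1) by simp
    qed
  next
    case (Suc n)
    hence a0: "a $ 0 = 0" using subdegree_eq_0_iff[of a] by auto
    have "?r (P * Q) = 0" unfolding Suc(4)[symmetric] using a0
      by (intro poly_eqI) (simp add: coeff_map_poly fps_mult_nth_0)
    hence or: "?r P = 0 \<or> ?r Q = 0" by (simp add: m.hom_mult)
    have shift: "f = fps_X * fps_shift 1 f" if "f $ 0 = 0" for f :: "'k fps"
      using that by (intro fps_ext) (auto simp: fps_X_mult_nth)
    define a' where "a' = fps_shift 1 a"
    have a': "a = fps_X * a'" unfolding a'_def by (rule shift[OF a0])
    have a'0: "a' \<noteq> 0" "subdegree a' = n" using Suc(2,3) a' by (auto simp: subdegree_mult)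
    have key: "\<exists>P'. P = smult fps_X P'" if "?r P = 0" for P :: "'k fps poly"
    proof -
      have "coeff P i $ 0 = 0" for i using arg_cong[OF that, of "\<lambda>f. coeff f i"] by (simp add: coeff_map_poly)
      hence "coeff P i = fps_X * fps_shift 1 (coeff P i)" for i
        by (rule shift)
      hence "P = smult fps_X (map_poly (fps_shift 1) P)"
        by (intro poly_eqI) (simp add: coeff_map_poly)
      thus ?thesis by blast
    qed
    have cancel: "f = g" if "smult fps_X f = smult fps_X g" for f g :: "'k fps poly"
    proof -
      have "smult fps_X (f - g) = 0" using that by (simp add: smult_diff_right)
      thus ?thesis by simp
    qed
    from or show ?case
    proof
      assume "?r P = 0"
      then obtain P' where P': "P = smult fps_X P'" using key by blast
      have "smult fps_X (smult a' F) = smult fps_X (P' * Q)" using Suc(4) by (simp add: a' P')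
      hence "smult a' F = P' * Q" by (rule cancel)
      from Suc(1)[OF a'0(2)[symmetric] a'0(1) this] show ?thesis by (simp add: P')
    next
      assume "?r Q = 0"
      then obtain Q' where Q': "Q = smult fps_X Q'" using key by blast
      have "smult fps_X (smult a' F) = smult fps_X (P * Q')" using Suc(4) by (simp add: a' Q')
      hence "smult a' F = P * Q'" by (rule cancel)
      from Suc(1)[OF a'0(2)[symmetric] a'0(1) this] show ?thesis by (simp add: Q')
    qed
  }
qed

text \<open>An Eisenstein polynomial stays irreducible over the fraction field of the image of \<open>\<rho>\<close>: modulo the
  kernel, f is a multiple of F up to leading coefficients, or the ideal of f and F meets the base ring.\<close>
lemma eisenstein_dichotomy:
  fixes \<rho> :: "'r::idom \<Rightarrow> 'k::field fps" and F f :: "'r poly"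
  assumes hom: "comm_ring_hom \<rho>" and d1: "degree F \<ge> 1"
    and lead: "subdegree (\<rho> (lead_coeff F)) = 1"
    and mid: "\<And>i. i > 0 \<Longrightarrow> \<rho> (coeff F i) $ 0 = 0" and const: "\<rho> (coeff F 0) $ 0 \<noteq> 0"
  shows "(\<exists>j u. map_poly \<rho> (smult (lead_coeff F ^ j) f - u * F) = 0) \<or>
    (\<exists>r s u. \<rho> r \<noteq> 0 \<and> map_poly \<rho> (s * f + u * F - [:r:]) = 0)"
proof -
  interpret comm_ring_hom \<rho> by (rule hom)
  interpret m: map_poly_comm_ring_hom \<rho> ..
  let ?m = "map_poly \<rho>"
  have lead0: "\<rho> (lead_coeff F) \<noteq> 0" using lead by auto
  \<comment> \<open>J is the ideal of f and F together with the polynomials killed by \<rho>. An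
    element g of least degree among those whose leading coefficient survives under \<rho> plays the
    part of a greatest common divisor over the fraction field.\<close>
  define J where "J = {g. \<exists>s u. ?m (g - (s * f + u * F)) = 0}"
  define S where "S = {g\<in>J. \<rho> (lead_coeff g) \<noteq> 0}"
  have "F \<in> J" unfolding J_def by (intro CollectI exI[of _ 0] exI[of _ 1]) simp
  hence FS: "F \<in> S" using lead0 by (simp add: S_def)
  have "\<exists>g. g \<in> S \<and> (\<forall>h. h \<in> S \<longrightarrow> degree g \<le> degree h)"
    using ex_has_least_nat[of "\<lambda>g. g \<in> S" F degree] FS by blast
  then obtain g where gS: "g \<in> S" and least: "\<And>h. h \<in> S \<Longrightarrow> degree g \<le> degree h" by blast
  have ker: "?m h = 0" if h: "h \<in> J" "degree h < degree g" for h
  proof (rule ccontr)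
    assume nz: "?m h \<noteq> 0"
    define k where "k = degree (?m h)"
    \<comment> \<open>The top coefficients of h may lie in the kernel. Truncation at the degree of
      the image changes h by kernel elements only and gives an element to which the minimality of g
      applies.\<close>
    define h' where "h' = (\<Sum>i\<le>k. monom (coeff h i) i)"
    have c': "coeff h' i = (if i \<le> k then coeff h i else 0)" for i
      unfolding h'_def coeff_sum coeff_monom by simp
    have "?m h' = ?m h"
    proof (rule poly_eqI)
      fix i show "coeff (?m h') i = coeff (?m h) i"
        using coeff_eq_0[of "?m h" i] by (auto simp: coeff_map_poly c' k_def not_le)
    qed
    hence eq: "?m (h' - x) = ?m (h - x)" for x by (simp add: m.hom_minus)
    have "h' \<in> J" using h(1) by (simp add: J_def eq)
    have kk: "\<rho> (coeff h k) \<noteq> 0" using nz unfolding k_def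
      by (metis coeff_map_poly hom_zero leading_coeff_0_iff)
    hence "coeff h k \<noteq> 0" by auto
    hence deg: "degree h' = k" by (intro antisym degree_le le_degree) (auto simp: c')
    have "k \<le> degree h" unfolding k_def by (rule degree_map_poly_le)
    moreover have "h' \<in> S" using \<open>h' \<in> J\<close> kk by (simp add: S_def deg c')
    ultimately show False using least[of h'] deg h(2) by simp
  qed
  obtain s u where su: "?m (g - (s * f + u * F)) = 0" using gS by (auto simp: S_def J_def)
  have g0: "g \<noteq> 0" "\<rho> (lead_coeff g) \<noteq> 0" using gS by (auto simp: S_def)
  have JJ: "smult a f + b * g + t * F \<in> J" for a b t
    unfolding J_def mem_Collect_eq
  proof (intro exI)
    have "smult a f + b * g + t * F - (([:a:] + b * s) * f + (b * u + t) * F) = b * (g - (s * f + u * F))"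
      by (simp add: algebra_simps)
    thus "?m (smult a f + b * g + t * F - (([:a:] + b * s) * f + (b * u + t) * F)) = 0"
      using su by (simp only: m.hom_mult mult_zero_right)
  qed
  show ?thesis
  proof (cases "degree g = 0")
    case True
    then obtain r where r: "g = [:r:]" using degree_eq_zeroE by blast
    have "?m (s * f + u * F - [:r:]) = - ?m (g - (s * f + u * F))"
      unfolding r m.hom_minus by simp
    thus ?thesis using su g0(2) r by (intro disjI2 exI[of _ r] exI[of _ s] exI[of _ u]) auto
  next
    case False
    \<comment> \<open>The remainder lies in J and has smaller degree than g, so it is killed by
      \<rho>. Thus the image of g divides a multiple of the image of F, and irreducibility makes the
      cofactor constant.\<close>
    obtain Q R where QR: "pseudo_divmod F g = (Q, R)" by force
    define a where "a = coeff g (degree g) ^ (Suc (degree F) - degree g)"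
    note pd = pseudo_divmod[OF g0(1) QR, folded a_def]
    have "R = smult 0 f + (-Q) * g + [:a:] * F" using pd(1) by (simp add: algebra_simps)
    hence "R \<in> J" using JJ[of 0 "-Q" "[:a:]"] by simp
    hence R0: "?m R = 0" using pd(2) ker[of R] False by auto
    have "smult (\<rho> a) (?m F) = ?m g * ?m Q"
      using arg_cong[OF pd(1), of ?m] R0 by (simp add: m.hom_add m.hom_mult map_poly_smult hom_mult)
    moreover have degF: "degree (?m F) = degree F"
      using lead0 by (intro antisym degree_map_poly_le le_degree) (simp add: coeff_map_poly)
    moreover have degg: "degree (?m g) = degree g"
      using g0 by (intro antisym degree_map_poly_le le_degree) (simp add: coeff_map_poly)
    moreover have "\<rho> a \<noteq> 0" using g0 by (simp add: a_def hom_power)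
    ultimately have "degree (?m g) = 0 \<or> degree (?m Q) = 0"
      using lead mid const by (intro eisenstein_fps[of "?m F"]) (auto simp: coeff_map_poly)
    hence "degree (?m Q) = 0" using degg False by simp
    moreover have "?m F \<noteq> 0" using degF d1 by auto
    ultimately have "degree F = degree g"
      using \<open>smult (\<rho> a) (?m F) = ?m g * ?m Q\<close> degF degg \<open>\<rho> a \<noteq> 0\<close>
      by (metis add.right_neutral degree_mult_eq degree_smult_eq mult_eq_0_iff smult_eq_0_iff)
    \<comment> \<open>F now has the least degree itself, so dividing f by F leaves nothing modulo
      the kernel.\<close>
    obtain Q' R' where QR': "pseudo_divmod f F = (Q', R')" by force
    have F0: "F \<noteq> 0" using d1 by auto
    note pd' = pseudo_divmod[OF F0 QR']
    let ?j = "Suc (degree f) - degree F"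
    have "R' = smult (lead_coeff F ^ ?j) f + 0 * g + (-Q') * F" using pd'(1) by (simp add: algebra_simps)
    hence "R' \<in> J" using JJ[of "lead_coeff F ^ ?j" 0 "-Q'"] by simp
    hence "?m R' = 0" using pd'(2) ker[of R'] \<open>degree F = degree g\<close> False by auto
    moreover have "smult (lead_coeff F ^ ?j) f - Q' * F = R'" using pd'(1) by (simp add: algebra_simps)
    ultimately show ?thesis by (intro disjI1 exI[of _ ?j] exI[of _ Q']) simp
  qed
qed

section \<open>Taylor expansion at a point\<close>

definition taylor_fps :: "'k::field \<Rightarrow> 'k poly \<Rightarrow> 'k fps" where
  "taylor_fps a f = fps_of_poly (f \<circ>\<^sub>p [:a, 1:])"

lemma taylor_fps_hom: "comm_ring_hom (taylor_fps a)"
  by unfold_locales (auto simp: taylor_fps_def pcompose_add pcompose_mult fps_of_poly_add fps_of_poly_mult)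

lemma taylor_fps_0: "taylor_fps a f $ 0 = poly f a"
  by (simp add: taylor_fps_def poly_pcompose flip: poly_0_coeff_0)

lemma taylor_fps_1: "taylor_fps a f $ 1 = poly (pderiv f) a"
proof -
  have "coeff (f \<circ>\<^sub>p [:a, 1:]) 1 = poly (pderiv (f \<circ>\<^sub>p [:a, 1:])) 0"
    by (simp add: poly_0_coeff_0 coeff_pderiv)
  also have "\<dots> = poly (pderiv f) a" by (simp add: pderiv_pcompose poly_pcompose pderiv_pCons)
  finally show ?thesis by (simp add: taylor_fps_def)
qed

lemma taylor_fps_eq_0: "taylor_fps a f = 0 \<longleftrightarrow> f = 0"
  using fps_of_poly_eq_iff[of "f \<circ>\<^sub>p [:a, 1:]" 0] by (auto simp: taylor_fps_def pcompose_eq_0)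

lemma subdegree_taylor_1:
  assumes "poly f a = 0" "poly (pderiv f) a \<noteq> 0" shows "subdegree (taylor_fps a f) = 1"
  using assms by (intro subdegreeI) (auto simp: taylor_fps_0 taylor_fps_1[unfolded One_nat_def])

lemma taylor_fps_compose:
  fixes S :: "'k::field fps"
  assumes S: "S $ 0 = 0" shows "taylor_fps a g oo S = poly (map_poly fps_const g) (fps_const a + S)"
proof (induction g)
  case (pCons c g)
  have "taylor_fps a (pCons c g) = fps_const c + (fps_const a + fps_X) * taylor_fps a g"
    by (simp add: taylor_fps_def pcompose_pCons fps_of_poly_add fps_of_poly_mult fps_of_poly_const fps_of_poly_pCons)
  also have "\<dots> oo S = fps_const c + (fps_const a + S) * (taylor_fps a g oo S)"
    using S by (simp add: fps_compose_add_distrib fps_compose_mult_distrib[OF S])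
  also have "\<dots> = poly (map_poly fps_const (pCons c g)) (fps_const a + S)"
    using pCons by (simp add: map_poly_pCons)
  finally show ?case .
qed (simp add: taylor_fps_def)

text \<open>Hensel's lemma, via compositional inverses.\<close>
lemma fps_solve_poly:
  fixes B :: "'k::field poly" and R :: "'k fps"
  assumes "poly B b = R $ 0" "poly (pderiv B) b \<noteq> 0"
  shows "\<exists>Y. Y $ 0 = b \<and> poly (map_poly fps_const B) Y = R"
proof -
  \<comment> \<open>T is B expanded at b without its constant term; it has a compositional inverse
    because the derivative of B at b is nonzero. Composing that inverse with R minus its constant
    term gives the correction to b.\<close>
  define T where "T = taylor_fps b B - fps_const (poly B b)"
  have T: "T $ 0 = 0" "T $ 1 \<noteq> 0" using assms by (simp_all add: T_def taylor_fps_0 taylor_fps_1[unfolded One_nat_def])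
  define W where "W = R - fps_const (R $ 0)"
  have W: "W $ 0 = 0" by (simp add: W_def)
  define S where "S = fps_inv T oo W"
  have I0: "fps_inv T $ 0 = 0" by (simp add: fps_inv_def)
  have S0: "S $ 0 = 0" using I0 by (simp add: S_def)
  have "T oo S = (T oo fps_inv T) oo W" unfolding S_def using I0 W by (intro fps_compose_assoc) auto
  also have "\<dots> = W" using fps_inv_right[OF T] W by simp
  finally have TS: "taylor_fps b B oo S = R"
    using assms(1) by (simp add: T_def W_def fps_compose_sub_distrib)
  thus ?thesis using S0 TS taylor_fps_compose[OF S0, of b B] by (intro exI[of _ "fps_const b + S"]) simp
qed

section \<open>The affine curve\<close>

text \<open>An element of the polynomial ring in x, y is a polynomial in y over the polynomials in x, one in x, y, z a
  polynomial in z over these.\<close>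

definition ev2 :: "'k::comm_ring_1 poly poly \<Rightarrow> 'k \<Rightarrow> 'k \<Rightarrow> 'k" where
  "ev2 f x y = poly (poly f [:y:]) x"

definition ev3 :: "'k::comm_ring_1 poly poly poly \<Rightarrow> 'k \<Rightarrow> 'k \<Rightarrow> 'k \<Rightarrow> 'k" where
  "ev3 f x y z = ev2 (poly f [:[:z:]:]) x y"

abbreviation lift :: "'k::comm_ring_1 poly \<Rightarrow> 'k poly poly" where "lift \<equiv> map_poly (\<lambda>c. [:c:])"

lemma ev2_simps [simp]:
  "ev2 (f + g) x y = ev2 f x y + ev2 g x y" "ev2 (f - g) x y = ev2 f x y - ev2 g x y"
  "ev2 (- f) x y = - ev2 f x y"
  "ev2 (f * g) x y = ev2 f x y * ev2 g x y" "ev2 (smult h f) x y = poly h x * ev2 f x y"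
  "ev2 [:h:] x y = poly h x" "ev2 0 x y = 0" "ev2 1 x y = 1" "ev2 (f ^ n) x y = ev2 f x y ^ n"
  "ev2 (monom h n) x y = poly h x * y ^ n"
  by (simp_all add: ev2_def poly_monom)

lemma ev2_pCons [simp]: "ev2 (pCons h f) x y = poly h x + y * ev2 f x y"
  by (simp add: ev2_def)

lemma ev2_sum [simp]: "ev2 (sum f A) x y = (\<Sum>i\<in>A. ev2 (f i) x y)"
  by (induction A rule: infinite_finite_induct) auto

lemma ev3_simps [simp]:
  "ev3 (f + g) x y z = ev3 f x y z + ev3 g x y z" "ev3 (f - g) x y z = ev3 f x y z - ev3 g x y z"
  "ev3 (f * g) x y z = ev3 f x y z * ev3 g x y z" "ev3 (smult h f) x y z = ev2 h x y * ev3 f x y z"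
  "ev3 0 x y z = 0" "ev3 1 x y z = 1"
  "ev3 (monom h n) x y z = ev2 h x y * z ^ n" "ev3 (pCons h f) x y z = ev2 h x y + z * ev3 f x y z"
  by (simp_all add: ev3_def poly_monom)

lemma ev3_sum [simp]: "ev3 (sum f A) x y z = (\<Sum>i\<in>A. ev3 (f i) x y z)"
  by (induction A rule: infinite_finite_induct) auto

lemma ev2_lift [simp]: "ev2 (lift B) x y = poly B y"
  by (induction B) (auto simp: map_poly_pCons)

lemma poly_lift [simp]: "poly (lift B) [:y:] = [:poly B y:]"
  by (induction B) (auto simp: map_poly_pCons mult.commute)

lemma ev2_hom: "comm_ring_hom (\<lambda>f. ev2 f x y)" by unfold_locales auto

lemma ev2_poly: "ev2 f x y = poly (map_poly (\<lambda>g. poly g x) f) y"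
  by (induction f) (auto simp: map_poly_pCons)

lemma ev3_poly: "ev3 f x y z = poly (map_poly (\<lambda>g. ev2 g x y) f) z"
  by (induction f) (auto simp: map_poly_pCons)

lemma poly_hom: "comm_ring_hom (\<lambda>g. poly g (x::'a::comm_ring_1))" by unfold_locales auto

lemma lift_hom: "comm_ring_hom (lift :: 'k::comm_ring_1 poly \<Rightarrow> _)"
proof -
  interpret c: comm_ring_hom "\<lambda>c::'k. [:c:]" by unfold_locales (auto simp: one_pCons)
  interpret m: map_poly_comm_ring_hom "\<lambda>c::'k. [:c:]" ..
  show ?thesis by unfold_locales (auto simp: m.hom_add m.hom_mult)
qed

lemma prod_roots_dvd:
  fixes f :: "'a::idom poly"
  assumes "finite S" "\<And>r. r \<in> S \<Longrightarrow> poly f r = 0" shows "(\<Prod>r\<in>S. [:-r, 1:]) dvd f"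
  using assms
proof (induction arbitrary: f)
  case (insert r S)
  obtain g where g: "f = [:-r, 1:] * g" using insert(4)[of r] poly_eq_0_iff_dvd by (metis dvdE insertI1)
  have "poly g s = 0" if "s \<in> S" for s
    using insert(2) insert(4)[of s] that by (auto simp: g simp del: mult_pCons_left)
  hence "(\<Prod>r\<in>S. [:-r, 1:]) dvd g" by (rule insert.IH)
  thus ?case using insert(1,2) g by (simp add: mult_dvd_mono del: mult_pCons_left)
qed simp

lemma separable_factor:
  fixes f :: "'k::alg_closed_field poly"
  assumes "f \<noteq> 0" and "\<And>x. poly f x = 0 \<Longrightarrow> poly (pderiv f) x \<noteq> 0"
  shows "f = smult (lead_coeff f) (\<Prod>r\<in>{x. poly f x = 0}. [:-r, 1:])"
proof -
  let ?S = "{x. poly f x = 0}" let ?P = "\<Prod>r\<in>?S. [:-r, 1:]"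
  have fin: "finite ?S" using assms(1) poly_roots_finite by blast
  have c: "card ?S = degree f" using card_roots_separable assms by blast
  obtain g where g: "f = ?P * g" using prod_roots_dvd[OF fin, of f] by auto
  have P: "degree ?P = card ?S" "lead_coeff ?P = 1" using prod_linear[OF fin] by auto
  have "?P \<noteq> 0" "g \<noteq> 0" using assms(1) g by auto
  hence "degree g = 0" using arg_cong[OF g, of degree] P c by (simp add: degree_mult_eq)
  then obtain a where "g = [:a:]" using degree_eq_zeroE by blast
  hence a: "f = smult a ?P" using g by simp
  have "lead_coeff f = a" by (metis a lead_coeff_smult P(2) mult.right_neutral)
  thus ?thesis using a by simp
qed

text \<open>A separable polynomial is a constant times the product over its distinct roots, so
  divisibility can be tested pointwise. This turns vanishing at points into ideal
  membership.\<close>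

lemma separable_dvd:
  fixes f g :: "'k::alg_closed_field poly"
  assumes "f \<noteq> 0" and "\<And>x. poly f x = 0 \<Longrightarrow> poly (pderiv f) x \<noteq> 0"
    and "\<And>x. poly f x = 0 \<Longrightarrow> poly g x = 0"
  shows "f dvd g"
proof -
  have "(\<Prod>r\<in>{x. poly f x = 0}. [:-r, 1:]) dvd g"
    using assms(1,3) poly_roots_finite by (intro prod_roots_dvd) auto
  thus ?thesis by (subst separable_factor[OF assms(1,2)]) (use assms(1) in \<open>auto simp: smult_dvd_iff\<close>)
qed

text \<open>A bound for the degree in x, the inner variable; together with the outer
  \<open>degree\<close>, which is the degree in y, it confines the bidegree.\<close>

definition dx :: "'k::zero poly poly \<Rightarrow> nat \<Rightarrow> bool" where "dx f t \<longleftrightarrow> (\<forall>j. degree (coeff f j) \<le> t)"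

lemma dx_add: "dx f t \<Longrightarrow> dx g t \<Longrightarrow> dx (f + g) t" by (simp add: dx_def degree_add_le)
lemma dx_diff: "dx f t \<Longrightarrow> dx g t \<Longrightarrow> dx (f - g) t" for f :: "'k::ab_group_add poly poly"
  by (simp add: dx_def degree_diff_le)
lemma dx_mono: "dx f t \<Longrightarrow> t \<le> t' \<Longrightarrow> dx f t'" by (auto simp: dx_def intro: order.trans)
lemma dx_0 [simp]: "dx 0 t" by (simp add: dx_def)
lemma dx_sum: "(\<And>i. i \<in> A \<Longrightarrow> dx (f i) t) \<Longrightarrow> dx (sum f A) t"
  by (induction A rule: infinite_finite_induct) (auto simp: dx_add)
lemma dx_mult: "dx f s \<Longrightarrow> dx g t \<Longrightarrow> dx (f * g) (s + t)" for f :: "'k::comm_semiring_0 poly poly"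
  unfolding dx_def coeff_mult
  by (auto intro!: degree_sum_le order.trans[OF degree_mult_le] add_mono)
lemma dx_smult: "degree h \<le> s \<Longrightarrow> dx f t \<Longrightarrow> dx (smult h f) (s + t)" for f :: "'k::comm_semiring_0 poly poly"
  by (auto simp: dx_def intro!: order.trans[OF degree_mult_le] add_mono)
lemma dx_lift: "dx (lift B) t" by (simp add: dx_def coeff_map_poly)
lemma dx_const: "degree h \<le> t \<Longrightarrow> dx [:h:] t" by (auto simp: dx_def coeff_pCons split: nat.split)
lemma dx_monom: "degree h \<le> t \<Longrightarrow> dx (monom h j) t" by (auto simp: dx_def)

lemma degree_poly_const:
  fixes f :: "'k::comm_ring_1 poly poly"
  assumes "dx f t" shows "degree (poly f [:y:]) \<le> t"
proof -
  have "poly f [:y:] = (\<Sum>i\<le>degree f. smult (y ^ i) (coeff f i))"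
    by (simp add: poly_altdef poly_const_pow mult.commute)
  thus ?thesis using assms by (auto simp: dx_def intro!: degree_sum_le order.trans[OF degree_smult_le])
qed

text \<open>A factor in y alone multiplies the coefficient of each power of x separately, so
  cancelling it cannot raise the degree in x.\<close>

lemma dx_lift_quot:
  fixes N :: "'k::idom poly"
  assumes "N \<noteq> 0" "dx (lift N * f) t" shows "dx f t"
proof -
  have lin: "map_poly (\<lambda>c. coeff c s) (lift N * f) = N * map_poly (\<lambda>c. coeff c s) f" for s
    by (intro poly_eqI) (simp add: coeff_map_poly coeff_mult coeff_sum)
  show ?thesis unfolding dx_def
  proof (intro allI degree_le impI)
    fix j s assume s: "s > t"
    have "map_poly (\<lambda>c. coeff c s) (lift N * f) = 0"
    proof (rule poly_eqI)
      fix j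
      have "degree (coeff (lift N * f) j) < s" using assms(2) s le_less_trans unfolding dx_def by blast
      thus "coeff (map_poly (\<lambda>c. coeff c s) (lift N * f)) j = coeff 0 j"
        by (simp add: coeff_map_poly coeff_eq_0)
    qed
    hence "map_poly (\<lambda>c. coeff c s) f = 0" using assms(1) lin by simp
    from arg_cong[OF this, of "\<lambda>h. coeff h j"] show "coeff (coeff f j) s = 0" by (simp add: coeff_map_poly)
  qed
qed

lemma lagrange:
  fixes S :: "'k::field set"
  assumes "finite S"
  shows "\<exists>l. \<forall>r\<in>S. degree (l r) < card S \<and> (\<forall>s\<in>S. poly (l r) s = (if s = r then 1 else (0::'k)))"
proof -
  define P where "P r = (\<Prod>s\<in>S - {r}. [:-s, 1:])" for r
  define l where "l r = smult (1 / poly (P r) r) (P r)" for r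
  have "degree (l r) < card S \<and> (\<forall>s\<in>S. poly (l r) s = (if s = r then 1 else 0))" if "r \<in> S" for r
  proof -
    have nz: "poly (P r) r \<noteq> 0" using assms by (auto simp: P_def poly_prod)
    have "degree (P r) = card (S - {r})" unfolding P_def using assms prod_linear(1)[of "S - {r}"] by simp
    hence "degree (l r) < card S"
      using degree_smult_le[of "1 / poly (P r) r" "P r"] assms that
      by (metis card_Diff1_less l_def order.strict_trans1)
    moreover have "poly (P r) s = 0" if "s \<in> S" "s \<noteq> r" for s
      using assms that prod_linear(3)[of "S - {r}" s] by (simp add: P_def)
    ultimately show ?thesis using nz by (auto simp: l_def)
  qed
  thus ?thesis by blast
qed

text \<open>What the geometry over K requires. \<open>EG\<close> and \<open>sepE\<close> give simple
  total ramification over the roots of E, where y is infinite; \<open>smooth1\<close> is the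
  Jacobian criterion for the affine plane curve. \<open>HB\<close> and \<open>NE\<close> make x,
  respectively y, a local parameter at the zeros of H, respectively N, so that with
  \<open>sepH\<close>, \<open>sepN\<close> and \<open>HN\<close> the product HN has only simple
  zeros on the curve. \<open>HE\<close> and \<open>NB\<close> keep these zeros away from the points
  at infinity. \<open>Unz\<close> then gives U/(HN) a simple pole at each of them.\<close>

locale curve =
  fixes E G B H N :: "'k::alg_closed_field poly" and u :: "nat \<Rightarrow> nat \<Rightarrow> 'k" and p D e a b :: nat
  assumes p_def: "p = CHAR('k)" and prime_p: "prime p"
    and degE: "degree E = D" and degG: "degree G < D" and degB: "degree B = e" and e1: "e \<ge> 1"
    and degH: "degree H = a" and a1: "a \<ge> 1" and degN: "degree N = b" and b1: "b \<ge> 1"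
    and monicB: "lead_coeff B = 1"
    and EG: "poly E x = 0 \<Longrightarrow> poly G x \<noteq> 0" and sepE: "poly E x = 0 \<Longrightarrow> poly (pderiv E) x \<noteq> 0"
    and smooth1: "poly E x * poly B y = poly G x \<Longrightarrow>
       poly E x * poly (pderiv B) y \<noteq> 0 \<or> poly (pderiv E) x * poly B y \<noteq> poly (pderiv G) x"
    and sepB: "poly B y = 0 \<Longrightarrow> poly (pderiv B) y \<noteq> 0"
    and sepH: "poly H x = 0 \<Longrightarrow> poly (pderiv H) x \<noteq> 0" and HE: "poly H x = 0 \<Longrightarrow> poly E x \<noteq> 0"
    and HB: "poly H x = 0 \<Longrightarrow> poly E x * poly B y = poly G x \<Longrightarrow> poly (pderiv B) y \<noteq> 0"
    and HN: "poly H x = 0 \<Longrightarrow> poly E x * poly B y = poly G x \<Longrightarrow> poly N y \<noteq> 0"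
    and sepN: "poly N y = 0 \<Longrightarrow> poly (pderiv N) y \<noteq> 0" and NB: "poly N y = 0 \<Longrightarrow> poly B y \<noteq> 0"
    and NE: "poly N y = 0 \<Longrightarrow> poly E x * poly B y = poly G x \<Longrightarrow>
       poly (pderiv E) x * poly B y \<noteq> poly (pderiv G) x"
    and Unz: "poly E x * poly B y = poly G x \<Longrightarrow> poly H x * poly N y = 0 \<Longrightarrow>
       (\<Sum>i\<le>a. \<Sum>j\<le>b. u i j * x ^ i * y ^ j) \<noteq> 0"
begin

definition U :: "'k \<Rightarrow> 'k \<Rightarrow> 'k" where "U x y = (\<Sum>i\<le>a. \<Sum>j\<le>b. u i j * x ^ i * y ^ j)"

definition X1 :: "('k \<times> 'k) set" where "X1 = {(x, y). poly E x * poly B y = poly G x}"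

definition X0 :: "('k \<times> 'k \<times> 'k) set" where
  "X0 = {(x, y, z). poly E x * poly B y = poly G x \<and> poly H x * poly N y * (z ^ p - z) = U x y}"

text \<open>The branch locus of the cover; above it z is infinite.\<close>

definition Gam :: "('k \<times> 'k) set" where
  "Gam = {(x, y). poly E x * poly B y = poly G x \<and> poly H x * poly N y = 0}"

definition F1 :: "'k poly poly" where "F1 = smult E (lift B) - [:G:]"
definition HN2 :: "'k poly poly" where "HN2 = smult H (lift N)"
definition U2 :: "'k poly poly" where "U2 = (\<Sum>j\<le>b. monom (\<Sum>i\<le>a. monom (u i j) i) j)"
definition F2 :: "'k poly poly poly" where "F2 = smult HN2 (monom 1 p - monom 1 1) - [:U2:]"

lemma p2: "p \<ge> 2" using prime_p prime_ge_2_nat by blast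
lemma D1: "D \<ge> 1" using degG by simp
lemma nz [simp]: "E \<noteq> 0" "B \<noteq> 0" "H \<noteq> 0" "N \<noteq> 0"
  using degE D1 degB e1 degH a1 degN b1 by auto

lemma ev2_F1 [simp]: "ev2 F1 x y = poly E x * poly B y - poly G x" by (simp add: F1_def)
lemma ev2_HN2 [simp]: "ev2 HN2 x y = poly H x * poly N y" by (simp add: HN2_def)
lemma ev2_U2 [simp]: "ev2 U2 x y = U x y"
proof -
  have "ev2 U2 x y = (\<Sum>j\<le>b. \<Sum>i\<le>a. u i j * x ^ i * y ^ j)"
    by (simp add: U2_def poly_sum poly_monom sum_distrib_right)
  thus ?thesis unfolding U_def by (subst sum.swap)
qed
lemma ev3_F2 [simp]: "ev3 F2 x y z = poly H x * poly N y * (z ^ p - z) - U x y"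
  by (simp add: F2_def)

lemma X1_iff: "(x, y) \<in> X1 \<longleftrightarrow> ev2 F1 x y = 0" by (simp add: X1_def)
lemma X0_iff: "(x, y, z) \<in> X0 \<longleftrightarrow> (x, y) \<in> X1 \<and> ev3 F2 x y z = 0" by (simp add: X0_def X1_def)
lemma Gam_iff: "(x, y) \<in> Gam \<longleftrightarrow> (x, y) \<in> X1 \<and> ev2 HN2 x y = 0" by (simp add: Gam_def X1_def)

lemma X1_E: "(x, y) \<in> X1 \<Longrightarrow> poly E x \<noteq> 0" using EG by (force simp: X1_def)
lemma Gam_U: "(x, y) \<in> Gam \<Longrightarrow> U x y \<noteq> 0" using Unz by (auto simp: Gam_def U_def)
lemma X0_HN: "(x, y, z) \<in> X0 \<Longrightarrow> poly H x * poly N y \<noteq> 0"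
  using Gam_U[of x y] by (auto simp: X0_def Gam_def)

lemma fiber1:
  assumes "poly E x \<noteq> 0"
  shows "degree (smult (poly E x) B - [:poly G x:]) = e" "finite {y. (x, y) \<in> X1}" "{y. (x, y) \<in> X1} \<noteq> {}"
proof -
  let ?f = "smult (poly E x) B - [:poly G x:]"
  show d: "degree ?f = e"
    using assms degB e1 by (subst diff_conv_add_uminus, subst degree_add_eq_left) (auto simp: degree_smult_eq)
  hence "?f \<noteq> 0" using e1 by auto
  hence "finite {y. poly ?f y = 0}" by (rule poly_roots_finite)
  moreover have eq: "{y. (x, y) \<in> X1} = {y. poly ?f y = 0}" by (auto simp: X1_def)
  ultimately show "finite {y. (x, y) \<in> X1}" by (simp only:)
  show "{y. (x, y) \<in> X1} \<noteq> {}" unfolding eq using d e1 alg_closed_imp_poly_has_root[of ?f] by auto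
qed

lemma finite_X1_over: assumes "r \<noteq> 0" shows "finite {(x, y) \<in> X1. poly r x = 0}"
proof -
  have "{(x, y) \<in> X1. poly r x = 0} \<subseteq> (SIGMA x:{x. poly r x = 0 \<and> poly E x \<noteq> 0}. {y. (x, y) \<in> X1})"
    using X1_E by auto
  moreover have "finite (SIGMA x:{x. poly r x = 0 \<and> poly E x \<noteq> 0}. {y. (x, y) \<in> X1})"
    using poly_roots_finite[OF assms] fiber1(2) by (intro finite_SigmaI) auto
  ultimately show ?thesis by (rule finite_subset)
qed

lemma infinite_K: "infinite (UNIV :: 'k set)"
proof
  assume f: "finite (UNIV :: 'k set)"
  let ?f = "(\<Prod>r\<in>UNIV. [:-r, 1:]) + 1 :: 'k poly"
  have "card (UNIV::'k set) > 0" using f by (simp add: card_gt_0_iff)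
  hence "degree ?f > 0" using f prod_linear(1)[OF f] by (subst degree_add_eq_left) auto
  then obtain x where "poly ?f x = 0" using alg_closed_imp_poly_has_root by blast
  moreover have "poly (\<Prod>r\<in>UNIV. [:-r, 1:]) x = 0" using prod_linear(3)[OF f] by auto
  ultimately show False by simp
qed

lemma infinite_X1: "infinite X1"
proof
  assume "finite X1"
  hence "finite (fst ` X1)" by simp
  moreover have "UNIV - {x. poly E x = 0} \<subseteq> fst ` X1" using fiber1(3) by (force simp: image_iff)
  ultimately have "finite (UNIV - {x. poly E x = 0})" by (rule finite_subset[rotated])
  moreover have "finite {x. poly E x = 0}" using poly_roots_finite nz(1) by blast
  ultimately show False using infinite_K by (metis Diff_infinite_finite)
qed

lemma degree_lift [simp]: "degree (lift f) = degree (f :: 'k poly)"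
  by (rule degree_map_poly) auto

lemma coeff_F1: "coeff F1 i = (if i = 0 then smult (coeff B 0) E - G else smult (coeff B i) E)"
  by (cases i) (auto simp: F1_def coeff_map_poly coeff_pCons)

lemma deg_F1: "degree F1 = e" "lead_coeff F1 = E"
proof -
  show d: "degree F1 = e"
    using e1 degB monicB by (intro antisym degree_le le_degree) (auto simp: coeff_F1 coeff_eq_0)
  show "lead_coeff F1 = E" unfolding d using e1 degB monicB by (auto simp: coeff_F1)
qed

lemma F1_nz [simp]: "F1 \<noteq> 0" using deg_F1 e1 by auto

lemma ex_root_E: "\<exists>x. poly E x = 0" using alg_closed_imp_poly_has_root[of E] degE D1 by auto

text \<open>The points at which E vanishes are totally ramified, so that F1 is an Eisenstein polynomial there.\<close>
lemma dichotomy1: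
  "(\<exists>j v. smult (E ^ j) f = v * F1) \<or> (\<exists>r s v. r \<noteq> 0 \<and> s * f + v * F1 = [:r:])"
proof -
  obtain x0 where x0: "poly E x0 = 0" using ex_root_E by blast
  let ?r = "taylor_fps x0"
  interpret comm_ring_hom ?r by (rule taylor_fps_hom)
  have z: "map_poly ?r h = 0 \<longleftrightarrow> h = 0" for h
    by (metis coeff_map_poly hom_zero leading_coeff_0_iff map_poly_0 coeff_0 taylor_fps_eq_0)
  have "(\<exists>j v. map_poly ?r (smult (lead_coeff F1 ^ j) f - v * F1) = 0) \<or>
    (\<exists>r s v. ?r r \<noteq> 0 \<and> map_poly ?r (s * f + v * F1 - [:r:]) = 0)"
    using e1 x0 sepE[OF x0] EG[OF x0] monicB[unfolded degB]
    by (intro eisenstein_dichotomy taylor_fps_hom, unfold deg_F1)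
      (auto simp: subdegree_taylor_1 taylor_fps_0 coeff_F1)
  thus ?thesis unfolding z taylor_fps_eq_0 deg_F1(2) by (metis eq_iff_diff_eq_0)
qed

text \<open>In the other alternative of the dichotomy S would lie above the finitely many roots of
  r.\<close>

lemma vanish1_E:
  assumes "infinite S" "S \<subseteq> X1" "\<And>x y. (x, y) \<in> S \<Longrightarrow> ev2 f x y = 0"
  shows "\<exists>j v. smult (E ^ j) f = v * F1"
proof (rule ccontr)
  assume "\<not> ?thesis"
  then obtain r s v where r: "r \<noteq> 0" "s * f + v * F1 = [:r:]" using dichotomy1[of f] by blast
  have "poly r x = 0" if "(x, y) \<in> S" for x y
  proof -
    have "ev2 f x y = 0" "ev2 F1 x y = 0" using assms that X1_iff by auto
    hence "ev2 (s * f + v * F1) x y = 0" by (simp del: ev2_F1)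
    thus ?thesis by (simp add: r(2))
  qed
  hence "S \<subseteq> {(x, y) \<in> X1. poly r x = 0}" using assms(2) by auto
  thus False using finite_X1_over[OF r(1)] assms(1) finite_subset by blast
qed

text \<open>The power of E left by \<open>vanish1_E\<close> is cancelled one factor at a time: at a
  root of E the polynomial F1 becomes the nonzero constant - G, so the cofactor v vanishes there,
  and as E is separable it divides v.\<close>

lemma ideal1:
  assumes "infinite S" "S \<subseteq> X1" "\<And>x y. (x, y) \<in> S \<Longrightarrow> ev2 f x y = 0" shows "F1 dvd f"
proof -
  obtain j v where "smult (E ^ j) f = v * F1" using vanish1_E[OF assms] by blast
  thus ?thesis
  proof (induction j arbitrary: v)
    case (Suc j)
    have "E dvd coeff v i" for i
    proof (rule separable_dvd[OF nz(1) sepE])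
      fix x assume x: "poly E x = 0"
      interpret h: comm_ring_hom "\<lambda>g::'k poly. poly g x" by (rule poly_hom)
      interpret m: map_poly_comm_ring_hom "\<lambda>g::'k poly. poly g x" ..
      have "map_poly (\<lambda>g. poly g x) (v * F1) = 0"
        using x by (intro poly_eqI) (simp add: coeff_map_poly flip: Suc(2))
      moreover have "map_poly (\<lambda>g. poly g x) F1 \<noteq> 0"
      proof -
        have "coeff (map_poly (\<lambda>g. poly g x) F1) 0 = - poly G x" using x by (simp add: coeff_map_poly coeff_F1)
        thus ?thesis using EG[OF x] by (metis coeff_0 neg_equal_0_iff_equal)
      qed
      ultimately have "map_poly (\<lambda>g. poly g x) v = 0" by (simp add: m.hom_mult)
      from arg_cong[OF this, of "\<lambda>h. coeff h i"] show "poly (coeff v i) x = 0" by (simp add: coeff_map_poly)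
    qed
    hence "[:E:] dvd v" by (simp add: const_poly_dvd_iff)
    then obtain w where w: "v = [:E:] * w" by auto
    have "[:E:] * smult (E ^ j) f = [:E:] * (w * F1)"
      using Suc(2) w by (simp add: mult.commute[of E])
    hence "smult (E ^ j) f = w * F1" by (subst (asm) mult_cancel_left) auto
    thus ?case by (rule Suc.IH)
  qed auto
qed

lemma vanish1:
  assumes "infinite S" "S \<subseteq> X1" "\<And>x y. (x, y) \<in> S \<Longrightarrow> ev2 f x y = 0" "(x, y) \<in> X1"
  shows "ev2 f x y = 0"
proof -
  obtain g where "f = F1 * g" using ideal1[OF assms(1-3)] by (auto elim: dvdE)
  thus ?thesis using assms(4) by (simp add: X1_def)
qed

lemma finite_zeros1: assumes "(x, y) \<in> X1" "ev2 f x y \<noteq> 0" shows "finite {(x, y) \<in> X1. ev2 f x y = 0}"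
proof (rule ccontr)
  assume inf: "infinite {(x, y) \<in> X1. ev2 f x y = 0}"
  have "ev2 f x y = 0" by (rule vanish1[OF inf _ _ assms(1)]) auto
  thus False using assms(2) by simp
qed

lemma degree_fiberN: assumes "poly N y = 0"
  shows "degree (smult (poly B y) E - G) = D"
    "poly (smult (poly B y) E - G) x = 0 \<Longrightarrow> poly (pderiv (smult (poly B y) E - G)) x \<noteq> 0"
    "smult (poly B y) E - G \<noteq> 0"
proof -
  show "degree (smult (poly B y) E - G) = D"
    using NB[OF assms] degE degG by (subst diff_conv_add_uminus, subst degree_add_eq_left) (auto simp: degree_smult_eq)
  thus "smult (poly B y) E - G \<noteq> 0" using D1 by auto
  assume "poly (smult (poly B y) E - G) x = 0"
  thus "poly (pderiv (smult (poly B y) E - G)) x \<noteq> 0"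
    using NE[OF assms, of x] by (simp add: pderiv_diff pderiv_smult mult.commute)
qed

lemma fiberH_sep: assumes "poly H x = 0" "poly (smult (poly E x) B - [:poly G x:]) y = 0"
  shows "poly (pderiv (smult (poly E x) B - [:poly G x:])) y \<noteq> 0"
  using HB[OF assms(1), of y] HE[OF assms(1)] assms(2) by (simp add: pderiv_diff pderiv_smult pderiv_pCons)

text \<open>The fibres over the roots of N have D points each and those over the roots of H have e,
  because the fibre polynomials are separable of full degree; \<open>HN\<close> makes the two
  families disjoint. This number of branch points enters the genus.\<close>

lemma card_Gam: "finite Gam" "card Gam = D * b + e * a"
proof -
  define GN where "GN = (SIGMA y:{y. poly N y = 0}. {x. poly (smult (poly B y) E - G) x = 0})"
  define GH where "GH = (SIGMA x:{x. poly H x = 0}. {y. poly (smult (poly E x) B - [:poly G x:]) y = 0})"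
  have fN: "finite {y. poly N y = 0}" and fH: "finite {y. poly H y = 0}"
    using poly_roots_finite nz by blast+
  have finN: "finite {x. poly (smult (poly B y) E - G) x = 0}" if "poly N y = 0" for y
    using degree_fiberN(3)[OF that] poly_roots_finite by blast
  have finH: "finite {y. poly (smult (poly E x) B - [:poly G x:]) y = 0}" if "poly H x = 0" for x
    using fiber1(1)[OF HE[OF that]] e1 by (intro poly_roots_finite) auto
  have cfN: "card {x. poly (smult (poly B y) E - G) x = 0} = D" if "poly N y = 0" for y
    using card_roots_separable[OF degree_fiberN(3,2)[OF that]] degree_fiberN(1)[OF that] that by metis
  have "card GN = (\<Sum>y\<in>{y. poly N y = 0}. card {x. poly (smult (poly B y) E - G) x = 0})"
    unfolding GN_def using fN finN by (intro card_SigmaI) auto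
  also have "\<dots> = (\<Sum>y\<in>{y. poly N y = 0}. D)" using cfN by (intro sum.cong) auto
  also have "(\<Sum>y\<in>{y. poly N y = 0}. D) = D * card {y. poly N y = 0}" by simp
  also have "card {y. poly N y = 0} = b" using card_roots_separable[OF nz(4) sepN] degN by simp
  finally have cN: "card GN = D * b" .
  have cfH: "card {y. poly (smult (poly E x) B - [:poly G x:]) y = 0} = e" if "poly H x = 0" for x
  proof -
    have "smult (poly E x) B - [:poly G x:] \<noteq> 0" using fiber1(1)[OF HE[OF that]] e1 by auto
    from card_roots_separable[OF this fiberH_sep[OF that]] show ?thesis
      using fiber1(1)[OF HE[OF that]] by simp
  qed
  have "card GH = (\<Sum>x\<in>{x. poly H x = 0}. card {y. poly (smult (poly E x) B - [:poly G x:]) y = 0})"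
    unfolding GH_def using fH finH by (intro card_SigmaI) auto
  also have "\<dots> = (\<Sum>y\<in>{x. poly H x = 0}. e)" using cfH by (intro sum.cong) auto
  also have "\<dots> = e * card {x. poly H x = 0}" by simp
  also have "card {x. poly H x = 0} = a" using card_roots_separable[OF nz(3) sepH] degH by simp
  finally have cH: "card GH = e * a" .
  have fGN: "finite GN" "finite GH" unfolding GN_def GH_def using fN fH finN finH by auto
  have eq: "Gam = prod.swap ` GN \<union> GH" by (auto simp: Gam_def GN_def GH_def image_iff mult.commute)
  show "finite Gam" unfolding eq using fGN by simp
  have "prod.swap ` GN \<inter> GH = {}"
  proof (rule ccontr)
    assume "prod.swap ` GN \<inter> GH \<noteq> {}"
    then obtain x y where "poly N y = 0" "poly H x = 0" "poly E x * poly B y = poly G x"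
      by (auto simp: GN_def GH_def mult.commute)
    thus False using HN by blast
  qed
  thus "card Gam = D * b + e * a" unfolding eq using fGN cN cH
    by (subst card_Un_disjoint) (auto simp: card_image)
qed

lemma Gam_H: "\<exists>x y. poly H x = 0 \<and> (x, y) \<in> Gam"
proof -
  obtain x where x: "poly H x = 0" using alg_closed_imp_poly_has_root[of H] degH a1 by auto
  obtain y where "(x, y) \<in> X1" using fiber1(3)[OF HE[OF x]] by blast
  thus ?thesis using x by (intro exI[of _ x] exI[of _ y]) (auto simp: Gam_def X1_def)
qed

end

lemma ex_dx: "\<exists>t. dx f t"
proof -
  have "degree (coeff f i) \<le> (\<Sum>i\<le>degree f. degree (coeff f i))" for i
    by (cases "i \<le> degree f") (auto intro!: member_le_sum simp: coeff_eq_0)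
  thus ?thesis unfolding dx_def by blast
qed

section \<open>The ideal of the branch points, with bounds on the degrees\<close>

context curve begin

lemma dx_F1: "dx F1 D" unfolding dx_def coeff_F1
  using degE degG by (auto intro!: degree_diff_le order.trans[OF degree_smult_le])

lemma lift_N_dvd:
  assumes "\<And>y. poly N y = 0 \<Longrightarrow> poly g [:y:] = 0" shows "lift N dvd g"
proof -
  interpret l: comm_ring_hom "lift :: 'k poly \<Rightarrow> _" by (rule lift_hom)
  let ?S = "{y. poly N y = 0}"
  have fin: "finite ?S" using poly_roots_finite nz by blast
  have "(\<Prod>r\<in>(\<lambda>y. [:y:]) ` ?S. [:-r, 1:]) dvd g" using fin assms by (intro prod_roots_dvd) auto
  moreover have "(\<Prod>r\<in>(\<lambda>y. [:y:]) ` ?S. [:-r, 1:]) = (\<Prod>y\<in>?S. [:-[:y:], 1:])"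
    by (subst prod.reindex) (auto simp: inj_on_def)
  moreover have l: "lift N = smult [:lead_coeff N:] (\<Prod>y\<in>?S. [:-[:y:], 1:])"
  proof -
    have *: "N = [:lead_coeff N:] * (\<Prod>r\<in>?S. [:-r, 1:])" using separable_factor[OF nz(4) sepN] by simp
    have "lift N = lift [:lead_coeff N:] * (\<Prod>y\<in>?S. lift [:-y, 1:])"
      by (subst *) (simp only: l.hom_mult l.hom_prod)
    thus ?thesis by (simp add: map_poly_pCons one_pCons)
  qed
  ultimately obtain k where k: "g = (\<Prod>y\<in>?S. [:-[:y:], 1:]) * k" unfolding dvd_def by metis
  have "[:lead_coeff N:] * [:inverse (lead_coeff N):] = 1" using nz(4) by (simp add: one_pCons)
  hence "g = lift N * smult [:inverse (lead_coeff N):] k" unfolding k l by (simp add: one_pCons[symmetric])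
  thus ?thesis by (rule dvdI)
qed

text \<open>The zeros of HN on the curve are simple, so a function vanishing at them is a multiple
  of HN modulo F1. To keep the degrees under control this is done in two rounds: on each line y =
  const with N(y) = 0 the restriction is a multiple of F1, and interpolating the quotients in y
  gives a correction after which N divides; then the same with the lines x = const and H. The bounds
  on the cofactor leave room for multiplying it by HN or by U within bidegree (t, t).\<close>

lemma gam_ideal:
  assumes van: "\<And>x y. (x, y) \<in> Gam \<Longrightarrow> ev2 g x y = 0" and dg: "degree g \<le> t" and dxg: "dx g t"
    and t: "D + a \<le> t" "b + e \<le> t"
  shows "\<exists>\<alpha> \<beta>. g = \<alpha> * F1 + \<beta> * HN2 \<and> degree \<beta> \<le> t - b \<and> dx \<beta> (t - a)"
proof -
  let ?RN = "{y. poly N y = 0}" and ?RH = "{x. poly H x = 0}"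
  have fN: "finite ?RN" "card ?RN = b" and fH: "finite ?RH" "card ?RH = a"
    using poly_roots_finite[OF nz(4)] poly_roots_finite[OF nz(3)]
      card_roots_separable[OF nz(4) sepN] card_roots_separable[OF nz(3) sepH] degN degH by auto
  obtain lN where lN: "\<And>r. r \<in> ?RN \<Longrightarrow> degree (lN r) < b"
      "\<And>r s. r \<in> ?RN \<Longrightarrow> s \<in> ?RN \<Longrightarrow> poly (lN r) s = (if s = r then 1 else 0)"
  proof -
    obtain l where "\<forall>r\<in>?RN. degree (l r) < card ?RN \<and> (\<forall>s\<in>?RN. poly (l r) s = (if s = r then 1 else 0))"
      using lagrange[OF fN(1)] by blast
    thus thesis using that[of l] unfolding fN(2) by blast
  qed
  obtain lH where lH: "\<And>r. r \<in> ?RH \<Longrightarrow> degree (lH r) < a"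
      "\<And>r s. r \<in> ?RH \<Longrightarrow> s \<in> ?RH \<Longrightarrow> poly (lH r) s = (if s = r then 1 else 0)"
  proof -
    obtain l where "\<forall>r\<in>?RH. degree (l r) < card ?RH \<and> (\<forall>s\<in>?RH. poly (l r) s = (if s = r then 1 else 0))"
      using lagrange[OF fH(1)] by blast
    thus thesis using that[of l] unfolding fH(2) by blast
  qed
  have "\<exists>h. poly g [:y:] = (smult (poly B y) E - G) * h" if y: "y \<in> ?RN" for y
  proof -
    have "smult (poly B y) E - G dvd poly g [:y:]"
    proof (rule separable_dvd)
      fix x assume "poly (smult (poly B y) E - G) x = 0"
      hence "(x, y) \<in> Gam" using y by (simp add: Gam_def mult.commute)
      thus "poly (poly g [:y:]) x = 0" using van by (simp add: ev2_def)
    qed (use y degree_fiberN in auto)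
    thus ?thesis by (auto elim: dvdE)
  qed
  then obtain al where al: "\<And>y. y \<in> ?RN \<Longrightarrow> poly g [:y:] = (smult (poly B y) E - G) * al y" by metis
  have dal: "degree (al y) \<le> t - D" if y: "y \<in> ?RN" for y
  proof (cases "al y = 0")
    case False
    have "D + degree (al y) = degree (poly g [:y:])"
      using al[OF y] degree_fiberN(1,3)[of y] y False by (simp add: degree_mult_eq)
    also have "\<dots> \<le> t" by (rule degree_poly_const[OF dxg])
    finally show ?thesis by simp
  qed simp
  \<comment> \<open>Interpolation between the lines y = r with N(r) = 0: on each of them
    \<open>aN\<close> is the quotient by F1 found there.\<close>
  define aN where "aN = (\<Sum>y\<in>?RN. smult (al y) (lift (lN y)))"
  have paN: "poly aN [:y:] = al y" if y: "y \<in> ?RN" for y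
  proof -
    have "poly aN [:y:] = (\<Sum>s\<in>?RN. if s = y then al s else 0)"
      unfolding aN_def poly_sum using lN(2) y by (intro sum.cong) auto
    thus ?thesis using fN y by simp
  qed
  have pF1: "poly F1 [:y:] = smult (poly B y) E - G" for y by (simp add: F1_def mult.commute)
  define g1 where "g1 = g - aN * F1"
  have "lift N dvd g1"
    by (rule lift_N_dvd) (simp add: g1_def paN pF1 al mult.commute)
  then obtain f1 where f1: "g1 = lift N * f1" by (auto elim: dvdE)
  have lN0: "lift N \<noteq> 0" "degree (lift N) = b" using degN b1 by (auto simp: map_poly_eq_0_iff)
  have dxaN: "dx aN (t - D)" unfolding aN_def
    using dal by (intro dx_sum) (use dx_smult[OF dal dx_lift[of _ 0]] in auto)
  have degaN: "degree aN \<le> b - 1" unfolding aN_def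
  proof (intro degree_sum_le fN(1))
    fix y assume "y \<in> ?RN"
    hence "degree (lift (lN y)) \<le> b - 1" using lN(1) by fastforce
    thus "degree (smult (al y) (lift (lN y))) \<le> b - 1" using degree_smult_le le_trans by blast
  qed
  have "dx (aN * F1) t" using dx_mult[OF dxaN dx_F1] t by simp
  hence dxg1: "dx g1 t" unfolding g1_def by (intro dx_diff dxg)
  have "degree (aN * F1) \<le> t"
    using degree_mult_le[of aN F1] degaN deg_F1(1) t b1 by simp
  hence degg1: "degree g1 \<le> t" unfolding g1_def by (intro degree_diff_le dg)
  have dxf1: "dx f1 t" using dx_lift_quot[OF nz(4)] dxg1 f1 by metis
  have degf1: "degree f1 \<le> t - b"
  proof (cases "f1 = 0")
    case False
    thus ?thesis using degg1 f1 lN0 by (simp add: degree_mult_eq)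
  qed simp
  let ?k = "\<lambda>x. smult (poly E x) B - [:poly G x:]"
  let ?e = "\<lambda>x. map_poly (\<lambda>c. poly c x)"
  have "\<exists>h. ?e x f1 = ?k x * h" if x: "x \<in> ?RH" for x
  proof -
    have "?k x dvd ?e x f1"
    proof (rule separable_dvd)
      show "?k x \<noteq> 0" using fiber1(1)[OF HE, of x] x e1 by auto
      fix y assume y: "poly (?k x) y = 0"
      show "poly (pderiv (?k x)) y \<noteq> 0" using fiberH_sep y x by auto
      have G: "(x, y) \<in> Gam" using x y by (simp add: Gam_def)
      hence "ev2 g1 x y = 0" using van y by (simp add: g1_def)
      moreover have "poly N y \<noteq> 0" using HN[of x y] x y by simp
      ultimately show "poly (?e x f1) y = 0" by (simp add: f1 flip: ev2_poly)
    qed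
    thus ?thesis by (auto elim: dvdE)
  qed
  then obtain ka where ka: "\<And>x. x \<in> ?RH \<Longrightarrow> ?e x f1 = ?k x * ka x" by metis
  have dka: "degree (ka x) \<le> t - b - e" if x: "x \<in> ?RH" for x
  proof (cases "ka x = 0")
    case False
    have "?k x \<noteq> 0" using fiber1(1)[OF HE, of x] x e1 by auto
    hence "e + degree (ka x) = degree (?e x f1)"
      using ka[OF x] fiber1(1)[OF HE, of x] x False by (simp add: degree_mult_eq)
    also have "\<dots> \<le> t - b" using degree_map_poly_le degf1 le_trans by blast
    finally show ?thesis by simp
  qed simp
  define aH where "aH = (\<Sum>x\<in>?RH. smult (lH x) (lift (ka x)))"
  have eaH: "?e x aH = ka x" if x: "x \<in> ?RH" for x
  proof (rule poly_eqI)
    fix i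
    have "coeff (?e x aH) i = (\<Sum>s\<in>?RH. poly (lH s) x * coeff (ka s) i)"
      unfolding aH_def by (simp add: coeff_map_poly coeff_sum poly_sum mult.commute)
    also have "\<dots> = (\<Sum>s\<in>?RH. if s = x then coeff (ka s) i else 0)"
      using lH(2) x by (intro sum.cong) auto
    finally show "coeff (?e x aH) i = coeff (ka x) i" using fH x by simp
  qed
  define f2 where "f2 = f1 - aH * F1"
  have "[:H:] dvd f2"
    unfolding const_poly_dvd_iff
  proof
    fix i show "H dvd coeff f2 i"
    proof (rule separable_dvd[OF nz(3) sepH])
      fix x assume x: "poly H x = 0"
      interpret h: comm_ring_hom "\<lambda>g::'k poly. poly g x" by (rule poly_hom)
      interpret m: map_poly_comm_ring_hom "\<lambda>g::'k poly. poly g x" ..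
      have "?e x F1 = ?k x"
        by (intro poly_eqI) (auto simp: coeff_map_poly coeff_F1 coeff_pCons split: nat.split)
      hence "?e x f2 = 0" using ka[of x] eaH[of x] x by (simp add: f2_def m.hom_minus m.hom_mult)
      from arg_cong[OF this, of "\<lambda>h. coeff h i"] show "poly (coeff f2 i) x = 0" by (simp add: coeff_map_poly)
    qed
  qed
  then obtain \<beta> where \<beta>: "f2 = smult H \<beta>" by (auto elim!: dvdE)
  have "dx aH (a - 1 + 0)" unfolding aH_def
  proof (intro dx_sum dx_smult dx_lift)
    fix x assume "x \<in> ?RH"
    from lH(1)[OF this] show "degree (lH x) \<le> a - 1" by simp
  qed
  hence "dx (aH * F1) (a - 1 + D)" using dx_mult[OF _ dx_F1] by simp
  hence "dx (aH * F1) t" using t by (elim dx_mono) simp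
  hence dxf2: "dx f2 t" unfolding f2_def by (intro dx_diff dxf1)
  have "degree aH \<le> t - b - e" unfolding aH_def
  proof (intro degree_sum_le fH(1))
    fix x assume "x \<in> ?RH"
    from dka[OF this] show "degree (smult (lH x) (lift (ka x))) \<le> t - b - e"
      by (metis degree_lift degree_smult_le order.trans)
  qed
  hence "degree (aH * F1) \<le> t - b" using degree_mult_le[of aH F1] deg_F1(1) t by simp
  hence "degree f2 \<le> t - b" unfolding f2_def by (intro degree_diff_le degf1)
  hence "degree \<beta> \<le> t - b" unfolding \<beta> by simp
  moreover have "dx \<beta> (t - a)" unfolding dx_def
  proof
    fix j
    have "degree (H * coeff \<beta> j) \<le> t" using dxf2 by (simp add: \<beta> dx_def)
    thus "degree (coeff \<beta> j) \<le> t - a" using degH by (cases "coeff \<beta> j = 0") (auto simp: degree_mult_eq)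
  qed
  moreover have "g = (aN + lift N * aH) * F1 + \<beta> * HN2"
  proof -
    have "g = aN * F1 + lift N * (aH * F1 + smult H \<beta>)"
      using g1_def f1 f2_def \<beta> by (metis add.commute diff_add_cancel)
    thus ?thesis by (simp add: HN2_def algebra_simps)
  qed
  ultimately show ?thesis by blast
qed

lemma F1_dvd_iff: "F1 dvd g \<longleftrightarrow> (\<forall>x y. (x, y) \<in> X1 \<longrightarrow> ev2 g x y = 0)"
  using ideal1[OF infinite_X1 order.refl, of g] by (auto simp: X1_def elim!: dvdE)

lemma F1_dvdI:
  assumes "finite S" "\<And>x y. (x, y) \<in> X1 \<Longrightarrow> (x, y) \<notin> S \<Longrightarrow> ev2 g x y = 0" shows "F1 dvd g"
  by (rule ideal1[of "X1 - S"]) (use assms infinite_X1 Diff_infinite_finite in auto)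

text \<open>HN has finitely many zeros on the curve, and vanishing off a finite set already forces
  divisibility.\<close>

lemma F1_dvd_cancel: assumes "F1 dvd HN2 * g" shows "F1 dvd g"
proof (rule F1_dvdI[OF card_Gam(1)])
  fix x y assume "(x, y) \<in> X1" "(x, y) \<notin> Gam"
  thus "ev2 g x y = 0" using assms unfolding F1_dvd_iff Gam_iff by auto
qed

section \<open>The ideal of the Artin-Schreier cover\<close>

lemma coeff_F2: "coeff F2 i = (if i = p then HN2 else if i = 1 then - HN2 else if i = 0 then - U2 else 0)"
  using p2 by (cases i) (auto simp: F2_def coeff_pCons)

lemma deg_F2: "degree F2 = p" "lead_coeff F2 = HN2"
proof -
  have "HN2 \<noteq> 0" using nz by (auto simp: HN2_def map_poly_eq_0_iff)
  thus d: "degree F2 = p" using p2 by (intro antisym degree_le le_degree) (auto simp: coeff_F2)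
  show "lead_coeff F2 = HN2" unfolding d by (simp add: coeff_F2)
qed

abbreviation atp :: "'k \<Rightarrow> 'k \<Rightarrow> 'k poly poly poly \<Rightarrow> 'k poly" where "atp x y \<equiv> map_poly (\<lambda>c. ev2 c x y)"

lemma at_hom: "comm_ring_hom (atp x y)"
proof -
  interpret h: comm_ring_hom "\<lambda>c::'k poly poly. ev2 c x y" by (rule ev2_hom)
  interpret m: map_poly_comm_ring_hom "\<lambda>c::'k poly poly. ev2 c x y" ..
  show ?thesis by unfold_locales (auto simp: m.hom_add m.hom_mult)
qed

lemma at_simps:
  "atp x y (f + g) = atp x y f + atp x y g" "atp x y (f - g) = atp x y f - atp x y g"
  "atp x y (f * g) = atp x y f * atp x y g" "atp x y (smult c f) = smult (ev2 c x y) (atp x y f)"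
  "coeff (atp x y f) i = ev2 (coeff f i) x y"
proof -
  interpret h: comm_ring_hom "atp x y" by (rule at_hom)
  show "atp x y (f + g) = atp x y f + atp x y g" "atp x y (f - g) = atp x y f - atp x y g"
    "atp x y (f * g) = atp x y f * atp x y g" by (rule h.hom_add h.hom_minus h.hom_mult)+
  show "atp x y (smult c f) = smult (ev2 c x y) (atp x y f)" by (intro poly_eqI) (simp add: coeff_map_poly)
qed (simp add: coeff_map_poly)

lemma at_F2_Gam: "(x, y) \<in> Gam \<Longrightarrow> atp x y F2 = [:- U x y:]"
  using p2 by (intro poly_eqI) (auto simp: at_simps coeff_F2 coeff_pCons Gam_iff split: nat.split)

lemma at_F2_deg: "(x, y) \<in> X1 \<Longrightarrow> (x, y) \<notin> Gam \<Longrightarrow> degree (atp x y F2) = p"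
  unfolding Gam_iff using p2 by (intro antisym degree_le le_degree) (auto simp: at_simps coeff_F2)

lemma const_F1_dvd_iff: "[:F1:] dvd f \<longleftrightarrow> (\<forall>x y. (x, y) \<in> X1 \<longrightarrow> atp x y f = 0)"
  unfolding const_poly_dvd_iff F1_dvd_iff by (auto simp: poly_eq_iff at_simps)

lemma finite_X0_over: assumes "finite A" shows "finite {(x, y, z) \<in> X0. (x, y) \<in> A}"
proof -
  have fib: "finite {z. (x, y, z) \<in> X0}" for x y
  proof (cases "(x, y) \<in> X1 \<and> (x, y) \<notin> Gam")
    case True
    hence "atp x y F2 \<noteq> 0" using at_F2_deg p2 by fastforce
    hence "finite {z. poly (atp x y F2) z = 0}" by (rule poly_roots_finite)
    moreover have "{z. (x, y, z) \<in> X0} \<subseteq> {z. poly (atp x y F2) z = 0}"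
      by (auto simp: X0_iff simp flip: ev3_poly)
    ultimately show ?thesis by (rule finite_subset[rotated])
  next
    case False
    hence "{z. (x, y, z) \<in> X0} = {}" using X0_HN by (auto simp: X0_iff Gam_iff X1_def)
    thus ?thesis by simp
  qed
  show ?thesis
  proof (rule finite_subset)
    show "{(x, y, z) \<in> X0. (x, y) \<in> A} \<subseteq> (\<lambda>((x, y), z). (x, y, z)) ` (SIGMA xy:A. {z. (fst xy, snd xy, z) \<in> X0})"
      by (force simp: image_iff)
    show "finite ((\<lambda>((x, y), z). (x, y, z)) ` (SIGMA xy:A. {z. (fst xy, snd xy, z) \<in> X0}))"
      using assms fib by (intro finite_imageI finite_SigmaI) auto
  qed
qed

lemma X0_over: assumes "(x, y) \<in> X1" "(x, y) \<notin> Gam" shows "\<exists>z. (x, y, z) \<in> X0"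
proof -
  obtain z where "poly (atp x y F2) z = 0"
    using alg_closed_imp_poly_has_root[of "atp x y F2"] at_F2_deg[OF assms] p2 by auto
  thus ?thesis using assms by (auto simp: X0_iff simp flip: ev3_poly)
qed

lemma infinite_X0: "infinite X0"
proof
  assume "finite X0"
  hence "finite ((\<lambda>(x, y, z). (x, y)) ` X0)" by simp
  moreover have "X1 - Gam \<subseteq> (\<lambda>(x, y, z). (x, y)) ` X0" using X0_over by (force simp: image_iff)
  ultimately have "finite (X1 - Gam)" by (rule finite_subset[rotated])
  thus False using infinite_X1 card_Gam(1) by (metis Diff_infinite_finite)
qed

text \<open>The functions on the plane curve are embedded into power series in x - x1 at a branch
  point with H(x1) = 0: since the derivative of B at y1 is nonzero, Hensel's lemma solves the curve
  equation for y there. Under this embedding the leading coefficient HN of F2 has order one, the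
  coefficient of z is divisible by H, and the constant coefficient - U is a unit, which is the
  Eisenstein shape.\<close>

lemma dichotomy2:
  "(\<exists>j v. [:F1:] dvd smult (HN2 ^ j) f - v * F2) \<or>
   (\<exists>r s v. \<not> F1 dvd r \<and> [:F1:] dvd s * f + v * F2 - [:r:])"
proof -
  obtain x1 y1 where G: "poly H x1 = 0" "(x1, y1) \<in> Gam" using Gam_H by blast
  have X: "poly E x1 * poly B y1 = poly G x1" using G(2) by (simp add: Gam_def)
  let ?T = "taylor_fps x1"
  interpret T: comm_ring_hom ?T by (rule taylor_fps_hom)
  interpret mT: map_poly_comm_ring_hom ?T ..
  have E0: "poly E x1 \<noteq> 0" using HE G by blast
  have "poly B y1 = fps_nth (?T G * inverse (?T E)) 0"
    using X E0 by (simp add: taylor_fps_0 field_simps)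
  then obtain Y where Y: "fps_nth Y 0 = y1" "poly (map_poly fps_const B) Y = ?T G * inverse (?T E)"
    using fps_solve_poly[OF _ HB[OF G(1) X]] by blast
  define \<rho> where "\<rho> f = poly (map_poly ?T f) Y" for f
  have hom: "comm_ring_hom \<rho>"
    by unfold_locales (auto simp: \<rho>_def mT.hom_add mT.hom_mult)
  interpret R: comm_ring_hom \<rho> by (rule hom)
  interpret mR: map_poly_comm_ring_hom \<rho> ..
  have Tc: "?T [:c:] = fps_const c" for c by (simp add: taylor_fps_def fps_of_poly_const)
  have \<rho>lift: "\<rho> (lift h) = poly (map_poly fps_const h) Y" for h
    by (induction h) (auto simp: \<rho>_def map_poly_pCons Tc)
  have \<rho>const: "\<rho> [:h:] = ?T h" for h by (cases "h = 0") (auto simp: \<rho>_def map_poly_pCons)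
  have \<rho>smult: "\<rho> (smult h f) = ?T h * \<rho> f" for h f
    using R.hom_mult[of "[:h:]" f] by (simp add: \<rho>const)
  have \<rho>0: "fps_nth (\<rho> f) 0 = ev2 f x1 y1" for f
    by (induction f) (auto simp: \<rho>_def map_poly_pCons taylor_fps_0 Y(1))
  have TE: "?T E * inverse (?T E) = 1"
    using E0 by (simp add: taylor_fps_0 inverse_mult_eq_1')
  have \<rho>F1: "\<rho> F1 = 0"
  proof -
    have "\<rho> F1 = ?T E * (?T G * inverse (?T E)) - ?T G"
      by (simp add: F1_def R.hom_minus \<rho>smult \<rho>lift \<rho>const Y(2))
    also have "\<dots> = ?T G * (?T E * inverse (?T E)) - ?T G" by (simp only: mult_ac)
    finally show ?thesis by (simp add: TE)
  qed
  \<comment> \<open>By \<open>dichotomy1\<close> a kernel element outside the ideal of F1 would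
    produce a nonzero polynomial in x alone with vanishing Taylor expansion.\<close>
  have ker: "\<rho> f = 0 \<longleftrightarrow> F1 dvd f" for f
  proof
    assume "F1 dvd f" thus "\<rho> f = 0" using \<rho>F1 by (auto elim!: dvdE simp: R.hom_mult)
  next
    assume f: "\<rho> f = 0"
    from dichotomy1[of f] show "F1 dvd f"
    proof (elim disjE exE conjE)
      fix j v assume jv: "smult (E ^ j) f = v * F1"
      show ?thesis unfolding F1_dvd_iff
      proof (intro allI impI)
        fix x y assume xy: "(x, y) \<in> X1"
        have "ev2 (smult (E ^ j) f) x y = 0" unfolding jv using xy by (simp add: X1_def)
        thus "ev2 f x y = 0" using X1_E[OF xy] by simp
      qed
    next
      fix r s v assume r: "r \<noteq> 0" "s * f + v * F1 = [:r:]"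
      have "\<rho> (s * f + v * F1) = 0" by (simp add: R.hom_add R.hom_mult f \<rho>F1)
      hence "?T r = 0" by (simp add: r(2) \<rho>const)
      thus ?thesis using r(1) taylor_fps_eq_0 by blast
    qed
  qed
  have mker: "map_poly \<rho> f = 0 \<longleftrightarrow> [:F1:] dvd f" for f
    unfolding const_poly_dvd_iff ker[symmetric] by (auto simp: poly_eq_iff coeff_map_poly)
  have sub: "subdegree (\<rho> HN2) = 1"
  proof -
    have "fps_nth (\<rho> (lift N)) 0 \<noteq> 0" using HN[OF G(1) X] by (simp add: \<rho>0)
    hence "subdegree (\<rho> (lift N)) = 0" "\<rho> (lift N) \<noteq> 0" by auto
    moreover have "subdegree (?T H) = 1" using subdegree_taylor_1 G(1) sepH by blast
    moreover from this have "?T H \<noteq> 0" by auto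
    ultimately show ?thesis by (simp add: HN2_def \<rho>smult)
  qed
  have "(\<exists>j u. map_poly \<rho> (smult (lead_coeff F2 ^ j) f - u * F2) = 0) \<or>
    (\<exists>r s u. \<rho> r \<noteq> 0 \<and> map_poly \<rho> (s * f + u * F2 - [:r:]) = 0)"
  proof (intro eisenstein_dichotomy hom)
    show "1 \<le> degree F2" using deg_F2 p2 by simp
    show "subdegree (\<rho> (lead_coeff F2)) = 1" using deg_F2 sub by simp
    show "fps_nth (\<rho> (coeff F2 0)) 0 \<noteq> 0" unfolding \<rho>0 using Gam_U[OF G(2)] p2 by (simp add: coeff_F2)
    fix i :: nat assume "i > 0"
    thus "fps_nth (\<rho> (coeff F2 i)) 0 = 0" unfolding \<rho>0 using G(1) by (simp add: coeff_F2)
  qed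
  thus ?thesis unfolding mker ker deg_F2(2) .
qed

text \<open>After excluding the second alternative by finiteness, the power of HN is cancelled one
  factor at a time, as E was in \<open>ideal1\<close>: at a branch point F2 becomes the nonzero
  constant - U, so the cofactor v vanishes on Gam, and \<open>gam_ideal\<close> writes its
  coefficients as multiples of HN modulo F1.\<close>

lemma ideal2:
  assumes S: "infinite S" "S \<subseteq> X0" "\<And>x y z. (x, y, z) \<in> S \<Longrightarrow> ev3 f x y z = 0"
  shows "\<exists>v. [:F1:] dvd f - v * F2"
proof -
  have "\<exists>j v. [:F1:] dvd smult (HN2 ^ j) f - v * F2"
  proof (rule ccontr)
    assume "\<not> ?thesis"
    then obtain r s v where r: "\<not> F1 dvd r" "[:F1:] dvd s * f + v * F2 - [:r:]" using dichotomy2[of f] by blast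
    define A where "A = {(x, y) \<in> X1. ev2 r x y = 0}"
    have "finite A" unfolding A_def using r(1) finite_zeros1 unfolding F1_dvd_iff by blast
    moreover have "S \<subseteq> {(x, y, z) \<in> X0. (x, y) \<in> A}"
    proof (clarify, intro conjI)
      fix x y z assume xyz: "(x, y, z) \<in> S"
      thus *: "(x, y, z) \<in> X0" using S(2) by blast
      have "poly (atp x y (s * f + v * F2 - [:r:])) z = 0"
        using r(2) * unfolding const_F1_dvd_iff X0_iff by simp
      hence "ev3 (s * f + v * F2 - [:r:]) x y z = 0" by (simp only: ev3_poly)
      thus "(x, y) \<in> A" using S(3)[OF xyz] * by (simp add: X0_iff A_def del: ev3_F2)
    qed
    ultimately show False using finite_X0_over S(1) finite_subset by blast
  qed
  then obtain j v where "[:F1:] dvd smult (HN2 ^ j) f - v * F2" by blast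
  thus ?thesis
  proof (induction j arbitrary: v)
    case (Suc j)
    have "ev2 (coeff v i) x y = 0" if G: "(x, y) \<in> Gam" for x y i
    proof -
      have X: "(x, y) \<in> X1" "ev2 HN2 x y = 0" using G by (auto simp: Gam_iff)
      have "atp x y (smult (HN2 ^ Suc j) f - v * F2) = 0" using Suc(2) X(1) unfolding const_F1_dvd_iff by blast
      moreover have "ev2 (HN2 ^ Suc j) x y = 0" using X(2) by (simp del: ev2_HN2)
      ultimately have "smult (U x y) (atp x y v) = 0"
        unfolding at_simps at_F2_Gam[OF G] by (simp only: smult_0_left) simp
      hence "atp x y v = 0" using Gam_U[OF G] by simp
      from arg_cong[OF this, of "\<lambda>h. coeff h i"] show ?thesis by (simp add: at_simps)
    qed
    hence "\<exists>\<beta>. F1 dvd coeff v i - \<beta> * HN2" for i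
    proof -
      obtain t0 where "dx (coeff v i) t0" using ex_dx by blast
      \<comment> \<open>Any common bound large enough for \<open>gam_ideal\<close> serves
        here.\<close>
      hence "dx (coeff v i) (t0 + degree (coeff v i) + D + a + b + e)" by (elim dx_mono) simp
      hence "\<exists>\<alpha> \<beta>. coeff v i = \<alpha> * F1 + \<beta> * HN2"
        using gam_ideal[of "coeff v i" "t0 + degree (coeff v i) + D + a + b + e"] \<open>\<And>x y i. (x, y) \<in> Gam \<Longrightarrow> ev2 (coeff v i) x y = 0\<close>
        by fastforce
      thus ?thesis by (metis add_diff_cancel_right' dvd_triv_right)
    qed
    then obtain \<beta> where \<beta>: "\<And>i. F1 dvd coeff v i - \<beta> i * HN2" by metis
    define w where "w = (\<Sum>i\<le>degree v. monom (\<beta> i) i)"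
    have cw: "F1 dvd coeff v i - coeff w i * HN2" for i
      unfolding w_def coeff_sum coeff_monom using \<beta>[of i] by (auto simp: coeff_eq_0)
    have "F1 dvd coeff (v - smult HN2 w) i" for i using cw[of i] by (simp add: mult.commute[of HN2])
    hence "[:F1:] dvd v - smult HN2 w" unfolding const_poly_dvd_iff by blast
    hence "[:F1:] dvd (smult (HN2 ^ Suc j) f - v * F2) + (v - smult HN2 w) * F2"
      using Suc(2) by (intro dvd_add dvd_mult2)
    also have "(smult (HN2 ^ Suc j) f - v * F2) + (v - smult HN2 w) * F2 = smult HN2 (smult (HN2 ^ j) f - w * F2)"
      by (simp add: left_diff_distrib smult_diff_right)
    finally have *: "[:F1:] dvd smult HN2 (smult (HN2 ^ j) f - w * F2)" .
    have "F1 dvd coeff (smult (HN2 ^ j) f - w * F2) i" for i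
    proof (rule F1_dvd_cancel)
      show "F1 dvd HN2 * coeff (smult (HN2 ^ j) f - w * F2) i"
        using const_poly_dvd_iff[THEN iffD1, OF *, THEN spec, of i] by (simp only: coeff_smult)
    qed
    hence "[:F1:] dvd smult (HN2 ^ j) f - w * F2" unfolding const_poly_dvd_iff by blast
    thus ?case by (rule Suc.IH)
  qed auto
qed

lemma at_ideal2:
  assumes "infinite S" "S \<subseteq> X0" "\<And>x y z. (x, y, z) \<in> S \<Longrightarrow> ev3 f x y z = 0"
  shows "\<exists>v. \<forall>x y. (x, y) \<in> X1 \<longrightarrow> atp x y f = atp x y v * atp x y F2"
proof -
  obtain v where "[:F1:] dvd f - v * F2" using ideal2[OF assms] by blast
  thus ?thesis unfolding const_F1_dvd_iff at_simps by auto
qed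

lemma vanish2:
  assumes "infinite S" "S \<subseteq> X0" "\<And>x y z. (x, y, z) \<in> S \<Longrightarrow> ev3 f x y z = 0" "(x, y, z) \<in> X0"
  shows "ev3 f x y z = 0"
proof -
  obtain v where v: "\<forall>x y. (x, y) \<in> X1 \<longrightarrow> atp x y f = atp x y v * atp x y F2" using at_ideal2[OF assms(1-3)] by blast
  have "ev3 f x y z = ev3 v x y z * ev3 F2 x y z" using v assms(4) by (simp add: ev3_poly X0_iff del: ev3_F2)
  thus ?thesis using assms(4) by (simp add: X0_iff del: ev3_F2)
qed

text \<open>At a point outside Gam the polynomial F2 has degree p in z, so a multiple of it of
  degree below p is zero.\<close>

lemma low_degree_vanish:
  assumes van: "\<And>x y z. (x, y, z) \<in> X0 \<Longrightarrow> ev3 f x y z = 0" and deg: "degree f < p"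
  shows "F1 dvd coeff f i"
proof (rule F1_dvdI[OF card_Gam(1)])
  fix x y assume xy: "(x, y) \<in> X1" "(x, y) \<notin> Gam"
  obtain v where v: "atp x y f = atp x y v * atp x y F2" using at_ideal2[OF infinite_X0 order.refl van] xy by blast
  have "degree (atp x y f) < p" using degree_map_poly_le deg le_less_trans by blast
  moreover have "atp x y F2 \<noteq> 0" using at_F2_deg[OF xy] p2 by force
  ultimately have "atp x y f = 0" using v at_F2_deg[OF xy] by (cases "atp x y v = 0") (auto simp: degree_mult_eq)
  from arg_cong[OF this, of "\<lambda>h. coeff h i"] show "ev2 (coeff f i) x y = 0" by (simp add: at_simps)
qed

text \<open>Outside Gam the cofactor v of F2 has degree at most K - p in z, so its coefficient at K
  vanishes there and hence on the whole curve. On Gam, where F2 is the constant - U, the coefficient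
  of f at K is - U times that of v.\<close>

lemma top_vanish_Gam:
  assumes van: "\<And>x y z. (x, y, z) \<in> X0 \<Longrightarrow> ev3 f x y z = 0" and deg: "degree f \<le> K" and K: "p \<le> K"
    and G: "(x, y) \<in> Gam"
  shows "ev2 (coeff f K) x y = 0"
proof -
  obtain v where v: "\<And>x y. (x, y) \<in> X1 \<Longrightarrow> atp x y f = atp x y v * atp x y F2"
    using at_ideal2[OF infinite_X0 order.refl van] by blast
  have "F1 dvd coeff v K"
  proof (rule F1_dvdI[OF card_Gam(1)])
    fix x y assume xy: "(x, y) \<in> X1" "(x, y) \<notin> Gam"
    have "degree (atp x y f) \<le> K" using degree_map_poly_le deg le_trans by blast
    moreover have "atp x y F2 \<noteq> 0" using at_F2_deg[OF xy] p2 by force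
    ultimately have "atp x y v = 0 \<or> degree (atp x y v) + p \<le> K"
      using v[OF xy(1)] at_F2_deg[OF xy] p2 by (cases "atp x y v = 0") (auto simp: degree_mult_eq)
    hence "coeff (atp x y v) K = 0" using p2 by (auto intro: coeff_eq_0)
    thus "ev2 (coeff v K) x y = 0" by (simp add: at_simps)
  qed
  hence "ev2 (coeff v K) x y = 0" using G by (simp add: F1_dvd_iff Gam_iff)
  moreover have "atp x y f = smult (- U x y) (atp x y v)"
    using v[of x y] G at_F2_Gam[OF G] by (simp add: Gam_iff)
  from arg_cong[OF this, of "\<lambda>h. coeff h K"] have "ev2 (coeff f K) x y = - U x y * ev2 (coeff v K) x y"
    by (simp add: at_simps)
  ultimately show ?thesis by simp
qed

end

section \<open>A basis of the functions of bounded degree\<close>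

context curve begin

text \<open>Exponents of the monomials of bidegree at most (t, t) that are not divisible by x^D y^e,
  the leading monomial of F1.\<close>

definition T1 :: "nat \<Rightarrow> (nat \<times> nat) set" where
  "T1 t = ({..t} \<times> {..<e}) \<union> ({..<D} \<times> {e..t})"

lemma card_T1: assumes "D \<le> t" "e \<le> t"
  shows "finite (T1 t)" "card (T1 t) = (t + 1) * e + D * (t + 1 - e)"
proof -
  show "finite (T1 t)" by (simp add: T1_def)
  have "({..t} \<times> {..<e}) \<inter> ({..<D} \<times> {e..t}) = {}" by auto
  thus "card (T1 t) = (t + 1) * e + D * (t + 1 - e)"
    by (simp add: T1_def card_Un_disjoint card_cartesian_product Suc_diff_le assms)
qed

definition mono2 :: "nat \<times> nat \<Rightarrow> 'k poly poly" where "mono2 m = monom (monom 1 (fst m)) (snd m)"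

text \<open>A nonzero multiple of F1 has degree at least e in y, and its leading coefficient in y is
  a multiple of E, hence of degree at least D in x; the exponents in \<open>T1 t\<close> do not
  allow this.\<close>

lemma T1_indep:
  assumes "F1 dvd (\<Sum>m\<in>T1 t. smult [:l m:] (mono2 m))" "m \<in> T1 t" shows "l m = 0"
proof -
  let ?f = "\<Sum>m\<in>T1 t. smult [:l m:] (mono2 m)"
  have fin: "finite (T1 t)" by (simp add: T1_def)
  have co: "coeff (coeff ?f j) i = (if (i, j) \<in> T1 t then l (i, j) else 0)" for i j
  proof -
    have "coeff (coeff ?f j) i = (\<Sum>m\<in>T1 t. if m = (i, j) then l m else 0)"
      unfolding coeff_sum by (intro sum.cong) (auto simp: mono2_def smult_monom)
    thus ?thesis using fin by simp
  qed
  have "?f = 0"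
  proof (rule ccontr)
    assume nz: "?f \<noteq> 0"
    obtain g where g: "?f = F1 * g" using assms(1) by (auto elim: dvdE)
    hence g0: "g \<noteq> 0" using nz by auto
    have dj: "degree ?f = e + degree g" using g0 by (simp add: g degree_mult_eq deg_F1)
    have "lead_coeff ?f = E * lead_coeff g" by (simp add: g lead_coeff_mult deg_F1(2)[unfolded deg_F1(1)] deg_F1(1))
    hence "degree (lead_coeff ?f) \<ge> D" using g0 degE by (simp add: degree_mult_eq)
    moreover have "degree (lead_coeff ?f) \<le> D - 1"
    proof (rule degree_le, intro allI impI)
      fix i assume "D - 1 < i"
      hence "(i, degree ?f) \<notin> T1 t" using dj by (auto simp: T1_def)
      thus "coeff (lead_coeff ?f) i = 0" unfolding co by simp
    qed
    ultimately show False using D1 by simp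
  qed
  hence "coeff (coeff ?f (snd m)) (fst m) = 0" by simp
  thus ?thesis using assms(2) unfolding co by simp
qed

text \<open>Descent on the degree in y. The leading coefficient is divided by E with remainder, and
  a multiple of F1 replaces the quotient part; the quotient has degree at most t - D, so the degree
  in x stays within t.\<close>

lemma T1_span:
  assumes "degree f \<le> t" "dx f t" "D \<le> t"
  shows "\<exists>l. F1 dvd f - (\<Sum>m\<in>T1 t. smult [:l m:] (mono2 m))"
proof -
  let ?c = "\<lambda>l. \<Sum>m\<in>T1 t. smult [:l m:] (mono2 m)"
  have fin: "finite (T1 t)" by (simp add: T1_def)
  have co: "coeff (coeff (?c l) j) i = (if (i, j) \<in> T1 t then l (i, j) else 0)" for i j l
  proof -
    have "coeff (coeff (?c l) j) i = (\<Sum>m\<in>T1 t. if m = (i, j) then l m else 0)"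
      unfolding coeff_sum by (intro sum.cong) (auto simp: mono2_def smult_monom)
    thus ?thesis using fin by simp
  qed
  have "\<exists>l. F1 dvd f - ?c l" if "\<And>j. j \<ge> s \<Longrightarrow> coeff f j = 0" "dx f t" "s \<le> t + 1" for s f
    using that
  proof (induction s arbitrary: f)
    case 0
    hence "f = 0" by (intro poly_eqI) simp
    thus ?case by (intro exI[of _ "\<lambda>_. 0"]) simp
  next
    case (Suc s)
    show ?case
    proof (cases "s < e")
      case True
      have "f = ?c (\<lambda>m. coeff (coeff f (snd m)) (fst m))"
      proof (intro poly_eqI)
        fix i j
        show "coeff (coeff f j) i = coeff (coeff (?c (\<lambda>m. coeff (coeff f (snd m)) (fst m))) j) i"
        proof (cases "(i, j) \<in> T1 t")
          case False
          hence "i > t \<or> j \<ge> Suc s" using True Suc.prems(3) by (auto simp: T1_def not_le not_less)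
          hence "coeff (coeff f j) i = 0"
          proof
            assume "i > t"
            hence "degree (coeff f j) < i" using Suc.prems(2) unfolding dx_def by (meson le_less_trans)
            thus ?thesis by (rule coeff_eq_0)
          qed (use Suc.prems(1) in simp)
          thus ?thesis using False unfolding co by simp
        qed (simp add: co)
      qed
      hence "F1 dvd f - ?c (\<lambda>m. coeff (coeff f (snd m)) (fst m))" by (simp only: diff_self dvd_0_right)
      thus ?thesis by (rule exI[of _ "\<lambda>m. coeff (coeff f (snd m)) (fst m)"])
    next
      case False
      define Q R where "Q = coeff f s div E" and "R = coeff f s mod E"
      have QR: "coeff f s = E * Q + R" by (simp add: Q_def R_def)
      have degR: "degree R < D" using degree_mod_less[of E "coeff f s"] degE D1 nz(1)
        by (cases "R = 0") (auto simp: R_def)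
      have degQ: "degree Q \<le> t - D"
      proof -
        have "degree (coeff f s) \<le> t" using Suc.prems(2) by (simp add: dx_def)
        hence "degree (coeff f s - R) \<le> t" using degR assms(3) by (intro degree_diff_le) auto
        moreover have "coeff f s - R = E * Q" using QR by (simp only: add_diff_cancel_right')
        ultimately have "degree (E * Q) \<le> t" by (simp only:)
        thus ?thesis using degE by (cases "Q = 0") (auto simp: degree_mult_eq)
      qed
      define f' where "f' = f - monom Q (s - e) * F1 - monom R s"
      have cF: "coeff (monom Q (s - e) * F1) j = (if j < s - e then 0 else Q * coeff F1 (j - (s - e)))" for j
        by (simp add: coeff_monom_mult)
      have z: "coeff f' j = 0" if "j \<ge> s" for j
      proof (cases "j = s")
        case True
        have "coeff F1 e = E" using deg_F1 by metis
        thus ?thesis using True False QR by (simp add: f'_def cF)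
      next
        case False
        hence "coeff F1 (j - (s - e)) = 0" using deg_F1 that \<open>\<not> s < e\<close> by (intro coeff_eq_0) auto
        thus ?thesis using False that Suc.prems(1)[of j] by (simp add: f'_def cF)
      qed
      have "dx (monom Q (s - e) * F1) (t - D + D)" by (intro dx_mult dx_monom degQ dx_F1)
      hence "dx f' t" unfolding f'_def using degR assms(3) Suc.prems(2)
        by (intro dx_diff dx_monom) auto
      then obtain l where l: "F1 dvd f' - ?c l" using Suc.IH[of f'] z Suc.prems(3) by auto
      define l' where "l' m = l m + (if snd m = s then coeff R (fst m) else 0)" for m
      have "?c l' = ?c l + monom R s"
      proof (intro poly_eqI)
        fix i j
        have "coeff R i = 0" if "(i, s) \<notin> T1 t"
          using that degR False Suc.prems(3) by (intro coeff_eq_0) (auto simp: T1_def not_less)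
        thus "coeff (coeff (?c l') j) i = coeff (coeff (?c l + monom R s) j) i"
          unfolding coeff_add co by (auto simp: l'_def)
      qed
      hence "f - ?c l' = (f' - ?c l) + monom Q (s - e) * F1" by (simp add: f'_def)
      moreover have "F1 dvd (f' - ?c l) + monom Q (s - e) * F1" using l by (intro dvd_add dvd_triv_right)
      ultimately have "F1 dvd f - ?c l'" by (simp only:)
      thus ?thesis by (rule exI[of _ l'])
    qed
  qed
  note main = this
  show ?thesis
  proof (rule main[OF _ assms(2) order.refl])
    fix j assume "t + 1 \<le> j"
    thus "coeff f j = 0" using assms(1) by (intro coeff_eq_0) simp
  qed
qed

text \<open>For each other branch point a linear factor in x or in y, whichever coordinate differs,
  kills that point and not \<gamma>.\<close>

lemma Gam_separating:
  "\<exists>c. \<forall>\<gamma>\<in>Gam. degree (c \<gamma>) \<le> card Gam \<and> dx (c \<gamma>) (card Gam) \<and>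
     (\<forall>\<gamma>'\<in>Gam. ev2 (c \<gamma>) (fst \<gamma>') (snd \<gamma>') = (if \<gamma>' = \<gamma> then 1 else 0))"
proof -
  define lin where "lin \<gamma> \<gamma>' = (if fst \<gamma> \<noteq> fst \<gamma>' then [:[:- fst \<gamma>', 1:]:] else [:[:- snd \<gamma>':], 1:])"
    for \<gamma> \<gamma>' :: "'k \<times> 'k"
  define P where "P \<gamma> = (\<Prod>\<gamma>'\<in>Gam - {\<gamma>}. lin \<gamma> \<gamma>')" for \<gamma>
  define c where "c \<gamma> = smult [:1 / ev2 (P \<gamma>) (fst \<gamma>) (snd \<gamma>):] (P \<gamma>)" for \<gamma>
  have evP: "ev2 (P \<gamma>) x y = (\<Prod>\<gamma>'\<in>Gam - {\<gamma>}. ev2 (lin \<gamma> \<gamma>') x y)" for \<gamma> x y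
  proof -
    interpret h: comm_ring_hom "\<lambda>f::'k poly poly. ev2 f x y" by (rule ev2_hom)
    show ?thesis by (simp add: P_def h.hom_prod)
  qed
  have bound: "degree (\<Prod>\<gamma>'\<in>S. lin \<gamma> \<gamma>') \<le> card S \<and> dx (\<Prod>\<gamma>'\<in>S. lin \<gamma> \<gamma>') (card S)" if "finite S" for S \<gamma>
    using that
  proof induction
    case empty
    show ?case by (auto simp: dx_def coeff_1)
  next
    case (insert g S)
    have "degree (lin \<gamma> g) \<le> 1" "dx (lin \<gamma> g) 1"
      by (auto simp: lin_def dx_def coeff_pCons split: nat.split)
    thus ?case using insert degree_mult_le[of "lin \<gamma> g" "\<Prod>\<gamma>'\<in>S. lin \<gamma> \<gamma>'"]
        dx_mult[of "lin \<gamma> g" 1 "\<Prod>\<gamma>'\<in>S. lin \<gamma> \<gamma>'" "card S"] by auto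
  qed
  have "degree (c \<gamma>) \<le> card Gam \<and> dx (c \<gamma>) (card Gam) \<and>
     (\<forall>\<gamma>'\<in>Gam. ev2 (c \<gamma>) (fst \<gamma>') (snd \<gamma>') = (if \<gamma>' = \<gamma> then 1 else 0))" if g: "\<gamma> \<in> Gam" for \<gamma>
  proof (intro conjI ballI)
    have le: "card (Gam - {\<gamma>}) \<le> card Gam" by (rule card_mono) (auto simp: card_Gam)
    note b = bound[of "Gam - {\<gamma>}" \<gamma>, folded P_def]
    show "degree (c \<gamma>) \<le> card Gam"
      unfolding c_def using b le card_Gam(1) degree_smult_le by (meson finite_Diff order.trans)
    show "dx (c \<gamma>) (card Gam)"
      unfolding c_def using b le card_Gam(1) by (intro dx_mono[OF dx_smult[of _ 0]]) auto
    fix \<gamma>' assume g': "\<gamma>' \<in> Gam"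
    have "ev2 (P \<gamma>) (fst \<gamma>) (snd \<gamma>) \<noteq> 0"
      unfolding evP using card_Gam(1) by (auto simp: lin_def prod_eq_iff)
    moreover have "ev2 (P \<gamma>) (fst \<gamma>') (snd \<gamma>') = 0" if "\<gamma>' \<noteq> \<gamma>"
      unfolding evP using card_Gam(1) g' that by (intro prod_zero) (auto simp: lin_def intro!: bexI[of _ \<gamma>'])
    ultimately show "ev2 (c \<gamma>) (fst \<gamma>') (snd \<gamma>') = (if \<gamma>' = \<gamma> then 1 else 0)" by (simp add: c_def)
  qed
  thus ?thesis by blast
qed

definition cg :: "'k \<times> 'k \<Rightarrow> 'k poly poly" where
  "cg = (SOME c. \<forall>\<gamma>\<in>Gam. degree (c \<gamma>) \<le> card Gam \<and> dx (c \<gamma>) (card Gam) \<and>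
     (\<forall>\<gamma>'\<in>Gam. ev2 (c \<gamma>) (fst \<gamma>') (snd \<gamma>') = (if \<gamma>' = \<gamma> then 1 else 0)))"

lemma cg: "\<gamma> \<in> Gam \<Longrightarrow> degree (cg \<gamma>) \<le> card Gam" "\<gamma> \<in> Gam \<Longrightarrow> dx (cg \<gamma>) (card Gam)"
   "\<gamma> \<in> Gam \<Longrightarrow> \<gamma>' \<in> Gam \<Longrightarrow> ev2 (cg \<gamma>) (fst \<gamma>') (snd \<gamma>') = (if \<gamma>' = \<gamma> then 1 else 0)"
  using someI_ex[OF Gam_separating, folded cg_def] by auto

definition tri :: "'k poly poly poly \<Rightarrow> nat \<Rightarrow> bool" where
  "tri f t \<longleftrightarrow> degree f \<le> t \<and> (\<forall>k. degree (coeff f k) \<le> t \<and> dx (coeff f k) t)"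

text \<open>Below the power z^p all functions on the plane curve occur as coefficients. From z^p on,
  a coefficient divisible by HN can be traded for lower powers of z by the equation of the cover, so
  only the values of the coefficient on Gam remain: one basis element for each power and each branch
  point.\<close>

definition BI :: "nat \<Rightarrow> (nat \<times> (nat \<times> nat) + nat \<times> ('k \<times> 'k)) set" where
  "BI t = ({..<p} \<times> T1 t) <+> ({p..t} \<times> Gam)"

definition Bel :: "nat \<times> (nat \<times> nat) + nat \<times> ('k \<times> 'k) \<Rightarrow> 'k poly poly poly" where
  "Bel s = (case s of Inl km \<Rightarrow> monom (mono2 (snd km)) (fst km) | Inr kg \<Rightarrow> monom (cg (snd kg)) (fst kg))"

lemma card_BI: assumes "D \<le> t" "e \<le> t" "p \<le> t"
  shows "finite (BI t)" "card (BI t) = p * ((t + 1) * e + D * (t + 1 - e)) + (t + 1 - p) * (D * b + e * a)"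
  using assms unfolding BI_def
  by (auto simp: card_T1 card_Gam card_Plus card_cartesian_product Suc_diff_le)

lemma sum_BI:
  "(\<Sum>s\<in>BI t. f s) = (\<Sum>k<p. \<Sum>m\<in>T1 t. f (Inl (k, m))) + (\<Sum>k=p..t. \<Sum>\<gamma>\<in>Gam. f (Inr (k, \<gamma>)))"
  unfolding BI_def using card_Gam(1)
  by (subst sum.Plus) (auto simp: T1_def sum.cartesian_product)

lemma tri_Bel: assumes "card Gam \<le> t" "p \<le> t" "D \<le> t" "e \<le> t" "s \<in> BI t" shows "tri (Bel s) t"
  using assms cg(1,2) unfolding tri_def
  by (auto simp: BI_def Bel_def mono2_def T1_def degree_monom_eq
      intro!: order.trans[OF degree_monom_le] dx_monom order.trans[OF cg(1)] dx_mono[OF cg(2)])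

text \<open>The powers of z are treated from the top. Down to z^p, \<open>top_vanish_Gam\<close>
  makes the leading coefficient vanish on Gam, where the \<open>cg\<close> are dual to the points;
  below that, \<open>low_degree_vanish\<close> and \<open>T1_indep\<close> apply.\<close>

lemma Bel_indep:
  assumes van: "\<And>x y z. (x, y, z) \<in> X0 \<Longrightarrow> (\<Sum>s\<in>BI t. l s * ev3 (Bel s) x y z) = 0" and s: "s \<in> BI t"
  shows "l s = 0"
proof -
  define f where "f = (\<Sum>s\<in>BI t. smult [:[:l s:]:] (Bel s))"
  define fg where "fg k = (\<Sum>\<gamma>\<in>Gam. smult [:l (Inr (k, \<gamma>)):] (cg \<gamma>))" for k
  define fm where "fm k = (\<Sum>m\<in>T1 t. smult [:l (Inl (k, m)):] (mono2 m))" for k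
  have vf: "ev3 f x y z = 0" if "(x, y, z) \<in> X0" for x y z using van[OF that] by (simp add: f_def)
  have "f = (\<Sum>k<p. \<Sum>m\<in>T1 t. monom (smult [:l (Inl (k, m)):] (mono2 m)) k)
     + (\<Sum>k=p..t. \<Sum>\<gamma>\<in>Gam. monom (smult [:l (Inr (k, \<gamma>)):] (cg \<gamma>)) k)"
    unfolding f_def sum_BI by (simp add: Bel_def smult_monom)
  hence feq: "f = (\<Sum>k<p. monom (fm k) k) + (\<Sum>k=p..t. monom (fg k) k)"
    by (simp add: fm_def fg_def monom_sum)
  have cf: "coeff f k = (if k < p then fm k else if k \<le> t then fg k else 0)" for k
    unfolding feq by (simp add: coeff_sum)
  have zero: "l (Inr (k, \<gamma>)) = 0" if "p \<le> k" "k \<le> t" "\<gamma> \<in> Gam" for k \<gamma>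
  proof (rule ccontr)
    assume nz: "l (Inr (k, \<gamma>)) \<noteq> 0"
    define S where "S = {k. p \<le> k \<and> k \<le> t \<and> (\<exists>\<gamma>\<in>Gam. l (Inr (k, \<gamma>)) \<noteq> 0)}"
    have S: "finite S" "k \<in> S" using that nz by (auto simp: S_def)
    define K where "K = Max S"
    have K: "K \<in> S" unfolding K_def using S by (intro Max_in) auto
    then obtain \<gamma>1 where g1: "\<gamma>1 \<in> Gam" "l (Inr (K, \<gamma>1)) \<noteq> 0" "p \<le> K" "K \<le> t" by (auto simp: S_def)
    have "degree f \<le> K"
    proof (rule degree_le, intro allI impI)
      fix i assume i: "K < i"
      have "i \<notin> S" using i S(1) Max_ge K_def not_le by blast
      hence "fg i = 0" if "i \<le> t" using i g1(3) that by (auto simp: S_def fg_def intro!: sum.neutral)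
      thus "coeff f i = 0" using i g1(3) by (auto simp: cf)
    qed
    hence "ev2 (coeff f K) (fst \<gamma>1) (snd \<gamma>1) = 0" using top_vanish_Gam[of f K "fst \<gamma>1" "snd \<gamma>1"] vf g1 by simp
    moreover have "ev2 (coeff f K) (fst \<gamma>1) (snd \<gamma>1) = (\<Sum>\<gamma>\<in>Gam. if \<gamma> = \<gamma>1 then l (Inr (K, \<gamma>)) else 0)"
      using g1 by (auto simp: cf fg_def cg intro!: sum.cong)
    ultimately show False using g1 card_Gam(1) by simp
  qed
  hence "fg k = 0" if "p \<le> k" "k \<le> t" for k using that by (auto simp: fg_def intro!: sum.neutral)
  hence "degree f < p" using p2 by (intro le_less_trans[OF degree_le[of "p - 1"]]) (auto simp: cf)
  hence "F1 dvd fm k" if "k < p" for k using low_degree_vanish[OF vf, of k] that by (simp add: cf)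
  hence zero': "l (Inl (k, m)) = 0" if "k < p" "m \<in> T1 t" for k m
    using T1_indep[where t = t and l = "\<lambda>m. l (Inl (k, m))" and m = m] that by (simp add: fm_def)
  show ?thesis using s zero zero' by (auto simp: BI_def)
qed

lemma dx_HN2: "dx HN2 a" "degree HN2 \<le> b"
  using dx_smult[of H a "lift N" 0] degH degN by (auto simp: HN2_def dx_lift intro: order.trans[OF degree_smult_le])

lemma dx_U2: "dx U2 a" "degree U2 \<le> b"
  unfolding U2_def
  by (auto intro!: dx_sum dx_monom degree_sum_le order.trans[OF degree_monom_le])

text \<open>Descent on the degree in z. Subtracting its values on Gam by means of the
  \<open>cg\<close> makes the leading coefficient a multiple \<beta> * HN modulo F1, and the
  equation of the cover lowers the power of z. The bounds for \<beta> in \<open>gam_ideal\<close>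
  are exactly what keeps the result within tridegree (t, t, t).\<close>

lemma Bel_span:
  assumes t: "D + a \<le> t" "b + e \<le> t" "p \<le> t" "card Gam \<le> t" and f: "tri f t"
  shows "\<exists>l. \<forall>x y z. (x, y, z) \<in> X0 \<longrightarrow> ev3 f x y z = (\<Sum>s\<in>BI t. l s * ev3 (Bel s) x y z)"
proof -
  let ?Sp = "\<lambda>f. \<exists>l. \<forall>x y z. (x, y, z) \<in> X0 \<longrightarrow> ev3 f x y z = (\<Sum>s\<in>BI t. l s * ev3 (Bel s) x y z)"
  have Sp_eq: "?Sp g" if "?Sp h" "\<And>x y z. (x, y, z) \<in> X0 \<Longrightarrow> ev3 g x y z = ev3 h x y z" for g h
  proof -
    obtain l where "\<forall>x y z. (x, y, z) \<in> X0 \<longrightarrow> ev3 h x y z = (\<Sum>s\<in>BI t. l s * ev3 (Bel s) x y z)"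
      using \<open>?Sp h\<close> by (elim exE)
    thus ?thesis using that(2) by (intro exI[of _ l]) simp
  qed
  have Sp_add: "?Sp (g + h)" if "?Sp g" "?Sp h" for g h
  proof -
    obtain l l' where "\<forall>x y z. (x, y, z) \<in> X0 \<longrightarrow> ev3 g x y z = (\<Sum>s\<in>BI t. l s * ev3 (Bel s) x y z)"
      "\<forall>x y z. (x, y, z) \<in> X0 \<longrightarrow> ev3 h x y z = (\<Sum>s\<in>BI t. l' s * ev3 (Bel s) x y z)" using \<open>?Sp g\<close> \<open>?Sp h\<close> by (elim exE)
    thus ?thesis by (intro exI[of _ "\<lambda>s. l s + l' s"]) (simp add: sum.distrib distrib_right)
  qed
  have Sp_0: "?Sp 0" by (intro exI[of _ "\<lambda>_. 0"]) simp
  have Sp_sum: "?Sp (sum g A)" if "\<And>i. i \<in> A \<Longrightarrow> ?Sp (g i)" for g and A :: "'i set"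
    using that
  proof (induction A rule: infinite_finite_induct)
    case (insert i A)
    thus ?case using Sp_add[of "g i" "sum g A"] by simp
  qed (use Sp_0 in auto)
  have Sp_el: "?Sp (smult [:[:v:]:] (Bel s))" if s: "s \<in> BI t" for s v
  proof (intro exI allI impI)
    fix x y z
    show "ev3 (smult [:[:v:]:] (Bel s)) x y z = (\<Sum>s'\<in>BI t. (if s' = s then v else 0) * ev3 (Bel s') x y z)"
    proof -
      have "(\<Sum>s'\<in>BI t. (if s' = s then v else 0) * ev3 (Bel s') x y z) = (\<Sum>s'\<in>BI t. if s' = s then v * ev3 (Bel s) x y z else 0)"
        by (intro sum.cong) auto
      moreover have "finite (BI t)" using card_BI(1) t by simp
      ultimately show ?thesis using s by simp
    qed
  qed
  have main: "?Sp f" if "tri f t" "\<And>k. k \<ge> K \<Longrightarrow> coeff f k = 0" "K \<le> t + 1" for f K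
    using that
  proof (induction K arbitrary: f rule: less_induct)
    case (less K)
    show ?case
    proof (cases "K \<le> p")
      case True
      have "f = (\<Sum>k<p. monom (coeff f k) k)"
        using less.prems(2) True by (intro poly_eqI) (auto simp: coeff_sum)
      moreover have "?Sp (monom (coeff f k) k)" if k: "k < p" for k
      proof -
        obtain l where l: "F1 dvd coeff f k - (\<Sum>m\<in>T1 t. smult [:l m:] (mono2 m))"
          using T1_span[of "coeff f k" t] less.prems(1) t by (auto simp: tri_def)
        have "?Sp (\<Sum>m\<in>T1 t. smult [:[:l m:]:] (Bel (Inl (k, m))))"
          using k by (intro Sp_sum Sp_el) (auto simp: BI_def)
        thus ?thesis
        proof (rule Sp_eq)
          fix x y z assume "(x, y, z) \<in> X0"
          hence "ev2 (coeff f k) x y = (\<Sum>m\<in>T1 t. l m * ev2 (mono2 m) x y)"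
            using l unfolding F1_dvd_iff by (auto simp: X0_iff)
          thus "ev3 (monom (coeff f k) k) x y z = ev3 (\<Sum>m\<in>T1 t. smult [:[:l m:]:] (Bel (Inl (k, m)))) x y z"
            by (simp add: Bel_def sum_distrib_right mult.assoc)
        qed
      qed
      hence "?Sp (\<Sum>k<p. monom (coeff f k) k)" by (intro Sp_sum) auto
      ultimately show ?thesis by simp
    next
      case False
      then obtain k where K: "K = Suc k" "k \<ge> p" by (cases K) auto
      define g where "g = coeff f k"
      define f0 where "f0 = f - monom g k"
      define g1 where "g1 = g - (\<Sum>\<gamma>\<in>Gam. smult [:ev2 g (fst \<gamma>) (snd \<gamma>):] (cg \<gamma>))"
      have tf: "degree g \<le> t" "dx g t" using less.prems(1) by (auto simp: tri_def g_def)
      have "degree g1 \<le> t" unfolding g1_def using tf(1) cg(1) t(4)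
        by (intro degree_diff_le degree_sum_le card_Gam(1)) (auto intro: order.trans[OF degree_smult_le] order.trans)
      moreover have "dx g1 t" unfolding g1_def using tf(2) cg(2) t(4)
        by (intro dx_diff dx_sum dx_mono[OF dx_smult[of _ 0]]) auto
      moreover have "ev2 g1 x y = 0" if G: "(x, y) \<in> Gam" for x y
      proof -
        have "(\<Sum>\<gamma>\<in>Gam. ev2 g (fst \<gamma>) (snd \<gamma>) * ev2 (cg \<gamma>) x y) = (\<Sum>\<gamma>\<in>Gam. if \<gamma> = (x, y) then ev2 g x y else 0)"
          using cg(3)[OF _ G] by (intro sum.cong) auto
        thus ?thesis using G card_Gam(1) by (simp add: g1_def)
      qed
      ultimately obtain \<alpha> \<beta> where ab: "g1 = \<alpha> * F1 + \<beta> * HN2" "degree \<beta> \<le> t - b" "dx \<beta> (t - a)"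
        using gam_ideal[of g1 t] t by blast
      \<comment> \<open>On the cover this equals \<beta> * HN * z^k, rewritten by HN * z^p = HN * z
        + U.\<close>
      define h where "h = monom (\<beta> * HN2) (k - p + 1) + monom (\<beta> * U2) (k - p)"
      have ht: "tri (f0 + h) t"
      proof -
        have "degree (\<beta> * HN2) \<le> t" "degree (\<beta> * U2) \<le> t"
          using degree_mult_le[of \<beta> HN2] degree_mult_le[of \<beta> U2] ab(2) dx_HN2 dx_U2 t by linarith+
        moreover have "dx (\<beta> * HN2) t" "dx (\<beta> * U2) t"
          using dx_mult[OF ab(3) dx_HN2(1)] dx_mult[OF ab(3) dx_U2(1)] t by auto
        moreover have "k \<le> t" "k - p + 1 \<le> t" using less.prems(3) K p2 by auto
        ultimately show ?thesis using less.prems(1) tf unfolding tri_def f0_def h_def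
          by (auto intro!: degree_add_le degree_diff_le dx_add dx_diff intro: order.trans[OF degree_monom_le])
      qed
      have "?Sp (f0 + h)"
      proof (rule less.IH[of k])
        show "k < K" "k \<le> t + 1" using K less.prems(3) by auto
        fix j assume "k \<le> j"
        thus "coeff (f0 + h) j = 0" using less.prems(2)[of j] K p2 by (auto simp: f0_def h_def g_def)
      qed (rule ht)
      moreover have "?Sp (\<Sum>\<gamma>\<in>Gam. smult [:[:ev2 g (fst \<gamma>) (snd \<gamma>):]:] (Bel (Inr (k, \<gamma>))))"
        using K less.prems(3) by (intro Sp_sum Sp_el) (auto simp: BI_def)
      ultimately have "?Sp ((f0 + h) + (\<Sum>\<gamma>\<in>Gam. smult [:[:ev2 g (fst \<gamma>) (snd \<gamma>):]:] (Bel (Inr (k, \<gamma>)))))"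
        by (rule Sp_add)
      thus ?thesis
      proof (rule Sp_eq)
        fix x y z assume X: "(x, y, z) \<in> X0"
        have "ev2 g x y = ev2 \<beta> x y * (poly H x * poly N y) + (\<Sum>\<gamma>\<in>Gam. ev2 g (fst \<gamma>) (snd \<gamma>) * ev2 (cg \<gamma>) x y)"
        proof -
          have "ev2 g1 x y = ev2 \<beta> x y * (poly H x * poly N y)" using X unfolding ab(1) by (simp add: X0_def)
          thus ?thesis by (simp add: g1_def algebra_simps)
        qed
        moreover have "poly H x * poly N y * z ^ k = poly H x * poly N y * z ^ (k - p + 1) + U x y * z ^ (k - p)"
        proof -
          have zk: "z ^ k = z ^ p * z ^ (k - p)" using K(2) by (simp flip: power_add)
          have "poly H x * poly N y * z ^ p = poly H x * poly N y * z + U x y"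
            using X by (auto simp: X0_def algebra_simps)
          hence "(poly H x * poly N y * z ^ p) * z ^ (k - p) = (poly H x * poly N y * z + U x y) * z ^ (k - p)" by simp
          thus ?thesis unfolding zk by (simp add: algebra_simps)
        qed
        moreover have "(B * (P * M) + S) * Z = B * (P * M * Z) + S * Z" for B P M S Z :: 'k
          by (simp add: algebra_simps)
        ultimately have "ev2 g x y * z ^ k = ev2 \<beta> x y * (poly H x * poly N y * z ^ (k - p + 1) + U x y * z ^ (k - p))
            + (\<Sum>\<gamma>\<in>Gam. ev2 g (fst \<gamma>) (snd \<gamma>) * ev2 (cg \<gamma>) x y) * z ^ k" by metis
        hence "ev2 g x y * z ^ k = ev3 h x y z + (\<Sum>\<gamma>\<in>Gam. ev2 g (fst \<gamma>) (snd \<gamma>) * ev2 (cg \<gamma>) x y) * z ^ k"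
          by (simp add: h_def algebra_simps)
        thus "ev3 f x y z = ev3 ((f0 + h) + (\<Sum>\<gamma>\<in>Gam. smult [:[:ev2 g (fst \<gamma>) (snd \<gamma>):]:] (Bel (Inr (k, \<gamma>))))) x y z"
          by (simp add: f0_def Bel_def sum_distrib_right sum_distrib_left algebra_simps)
      qed
    qed
  qed
  show ?thesis
  proof (rule main[OF f _ order.refl])
    fix k assume "t + 1 \<le> k"
    thus "coeff f k = 0" using f by (intro coeff_eq_0) (simp add: tri_def)
  qed
qed

end

section \<open>Forms and the Jacobian criterion\<close>

definition mnl :: "(nat \<Rightarrow>\<^sub>0 nat) \<Rightarrow> (nat \<Rightarrow> 'r::comm_ring_1) \<Rightarrow> 'r" where
  "mnl m xs = (\<Prod>i\<in>Poly_Mapping.keys m. xs i ^ Poly_Mapping.lookup m i)"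

text \<open>Coefficients are sent through \<phi>, so that a form can be evaluated at a vector of
  polynomials, that is, restricted to a parametrised curve.\<close>

definition gev :: "('k::comm_ring_1 \<Rightarrow> 'r::comm_ring_1) \<Rightarrow> ((nat \<Rightarrow>\<^sub>0 nat) \<Rightarrow>\<^sub>0 'k) \<Rightarrow> (nat \<Rightarrow> 'r) \<Rightarrow> 'r" where
  "gev \<phi> f xs = (\<Sum>m\<in>Poly_Mapping.keys f. \<phi> (Poly_Mapping.lookup f m) * mnl m xs)"

definition mdeg :: "(nat \<Rightarrow>\<^sub>0 nat) \<Rightarrow> nat" where
  "mdeg m = (\<Sum>i\<in>Poly_Mapping.keys m. Poly_Mapping.lookup m i)"

lemma mpoly_eval_gev: "mpoly_eval f x = gev (\<lambda>c. c) f x"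
  by (simp add: mpoly_eval_def gev_def mnl_def)

lemma mnl_superset:
  assumes "finite S" "Poly_Mapping.keys m \<subseteq> S" shows "mnl m xs = (\<Prod>i\<in>S. xs i ^ Poly_Mapping.lookup m i)"
  unfolding mnl_def using assms by (intro prod.mono_neutral_left) (auto simp: in_keys_iff)

lemma mdeg_superset:
  assumes "finite S" "Poly_Mapping.keys m \<subseteq> S" shows "mdeg m = (\<Sum>i\<in>S. Poly_Mapping.lookup m i)"
  unfolding mdeg_def using assms by (intro sum.mono_neutral_left) (auto simp: in_keys_iff)

lemma keys_add_nat: "Poly_Mapping.keys (m + n) = Poly_Mapping.keys m \<union> Poly_Mapping.keys (n :: nat \<Rightarrow>\<^sub>0 nat)"
  by (auto simp: in_keys_iff lookup_add)

lemma mnl_add: "mnl (m + n) xs = mnl m xs * mnl n xs"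
  using mnl_superset[of "Poly_Mapping.keys m \<union> Poly_Mapping.keys n" m xs]
    mnl_superset[of "Poly_Mapping.keys m \<union> Poly_Mapping.keys n" n xs]
    mnl_superset[of "Poly_Mapping.keys m \<union> Poly_Mapping.keys n" "m + n" xs]
  by (simp add: keys_add_nat lookup_add power_add prod.distrib)

lemma mdeg_add: "mdeg (m + n) = mdeg m + mdeg n"
  using mdeg_superset[of "Poly_Mapping.keys m \<union> Poly_Mapping.keys n" m]
    mdeg_superset[of "Poly_Mapping.keys m \<union> Poly_Mapping.keys n" n]
    mdeg_superset[of "Poly_Mapping.keys m \<union> Poly_Mapping.keys n" "m + n"]
  by (simp add: keys_add_nat lookup_add sum.distrib)

lemma mnl_0 [simp]: "mnl 0 xs = 1" and mdeg_0 [simp]: "mdeg 0 = 0"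
  by (simp_all add: mnl_def mdeg_def)

lemma mnl_single [simp]: "mnl (Poly_Mapping.single i n) xs = xs i ^ n"
  and mdeg_single [simp]: "mdeg (Poly_Mapping.single i n) = n"
  by (cases "n = 0"; simp add: mnl_def mdeg_def)+

lemma mnl_sum: "mnl (sum f A) xs = (\<Prod>i\<in>A. mnl (f i) xs)"
  by (induction A rule: infinite_finite_induct) (auto simp: mnl_add)

lemma mdeg_sum: "mdeg (sum f A) = (\<Sum>i\<in>A. mdeg (f i))"
  by (induction A rule: infinite_finite_induct) (auto simp: mdeg_add)

lemma mnl_scale: "mnl m (\<lambda>i. c * xs i) = c ^ mdeg m * mnl m xs"
  by (simp add: mnl_def mdeg_def power_mult_distrib prod.distrib power_sum)

lemma mpoly_sum_single:
  "f = (\<Sum>m\<in>Poly_Mapping.keys f. Poly_Mapping.single m (Poly_Mapping.lookup f m))"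
  by (rule poly_mapping_eqI) (auto simp: lookup_sum lookup_single when_def in_keys_iff)

context
  fixes \<phi> :: "'k::comm_ring_1 \<Rightarrow> 'r::comm_ring_1"
  assumes hom: "comm_ring_hom \<phi>"
begin

interpretation h: comm_ring_hom \<phi> by (rule hom)

lemma gev_superset:
  assumes "finite S" "Poly_Mapping.keys f \<subseteq> S"
  shows "gev \<phi> f xs = (\<Sum>m\<in>S. \<phi> (Poly_Mapping.lookup f m) * mnl m xs)"
  unfolding gev_def using assms by (intro sum.mono_neutral_left) (auto simp: in_keys_iff)

lemma gev_add: "gev \<phi> (f + g) xs = gev \<phi> f xs + gev \<phi> g xs"
proof -
  let ?S = "Poly_Mapping.keys f \<union> Poly_Mapping.keys g"
  have "Poly_Mapping.keys (f + g) \<subseteq> ?S" by (rule Poly_Mapping.keys_add)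
  thus ?thesis using gev_superset[of ?S f xs] gev_superset[of ?S g xs] gev_superset[of ?S "f + g" xs]
    by (simp add: lookup_add h.hom_add distrib_right sum.distrib)
qed

lemma gev_0: "gev \<phi> 0 xs = 0" by (simp add: gev_def)

lemma gev_single: "gev \<phi> (Poly_Mapping.single m c) xs = \<phi> c * mnl m xs"
  by (cases "c = 0") (auto simp: gev_def)

lemma gev_sum: "gev \<phi> (sum f A) xs = (\<Sum>i\<in>A. gev \<phi> (f i) xs)"
  by (induction A rule: infinite_finite_induct) (auto simp: gev_add gev_0)

lemma gev_mult: "gev \<phi> (f * g) xs = gev \<phi> f xs * gev \<phi> g xs"
proof -
  have "f * g = (\<Sum>m\<in>Poly_Mapping.keys f. \<Sum>n\<in>Poly_Mapping.keys g.
      Poly_Mapping.single (m + n) (Poly_Mapping.lookup f m * Poly_Mapping.lookup g n))"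
    by (subst mpoly_sum_single[of f], subst mpoly_sum_single[of g]) (simp add: sum_product mult_single)
  thus ?thesis
    by (simp add: gev_sum gev_single h.hom_mult mnl_add sum_product gev_def[of \<phi> f] gev_def[of \<phi> g] mult_ac)
qed

lemma gev_hom: "comm_ring_hom (\<lambda>f. gev \<phi> f xs)"
  by unfold_locales (auto simp: gev_add gev_mult gev_0 gev_single[of 0 1, simplified])

end

lemma gev_natural:
  assumes "comm_ring_hom h" shows "h (gev \<phi> f xs) = gev (\<lambda>c. h (\<phi> c)) f (\<lambda>i. h (xs i))"
proof -
  interpret comm_ring_hom h by (rule assms)
  show ?thesis by (simp add: gev_def mnl_def hom_sum hom_mult hom_prod hom_power)
qed

lemma id_hom: "comm_ring_hom (\<lambda>c::'k::comm_ring_1. c)" by unfold_locales auto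
lemma const_hom: "comm_ring_hom (\<lambda>c::'k::comm_ring_1. [:c:])" by unfold_locales (auto simp: one_pCons)

lemma mpoly_eval_add: "mpoly_eval (f + g) x = mpoly_eval f x + mpoly_eval g x"
  and mpoly_eval_mult: "mpoly_eval (f * g) x = mpoly_eval f x * mpoly_eval g x"
  and mpoly_eval_sum: "mpoly_eval (sum h A) x = (\<Sum>i\<in>A. mpoly_eval (h i) x)"
  and mpoly_eval_single: "mpoly_eval (Poly_Mapping.single m c) x = c * mnl m x"
  and mpoly_eval_hom: "comm_ring_hom (\<lambda>f. mpoly_eval f x)"
  unfolding mpoly_eval_gev
  by (rule gev_add[OF id_hom] gev_mult[OF id_hom] gev_sum[OF id_hom] gev_single[OF id_hom] gev_hom[OF id_hom])+

lemma mpoly_eval_0: "mpoly_eval 0 x = 0" by (simp add: mpoly_eval_def)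

lemma mpoly_eval_diff: "mpoly_eval (f - g) x = mpoly_eval f x - mpoly_eval g x"
proof -
  interpret comm_ring_hom "\<lambda>f. mpoly_eval f x" by (rule mpoly_eval_hom)
  show ?thesis by (rule hom_minus)
qed

lemma mpoly_eval_scale: "mpoly_eval (mpoly_scale c f) x = c * mpoly_eval f x"
  by (simp add: mpoly_scale_def mpoly_eval_mult mpoly_eval_single)

section \<open>Gradients and the chain rule\<close>

definition vars :: "((nat \<Rightarrow>\<^sub>0 nat) \<Rightarrow>\<^sub>0 'k::zero) \<Rightarrow> nat set" where
  "vars f = (\<Union>m\<in>Poly_Mapping.keys f. Poly_Mapping.keys m)"

lemma pderiv_mnl:
  assumes "Poly_Mapping.keys m \<subseteq> {..N}"
  shows "pderiv (mnl m xs) = (\<Sum>i\<le>N. of_nat (Poly_Mapping.lookup m i) * mnl (m - Poly_Mapping.single i 1) xs * pderiv (xs i))"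
proof -
  have "pderiv (mnl m xs) = (\<Sum>i\<le>N. (\<Prod>j\<in>{..N} - {i}. xs j ^ Poly_Mapping.lookup m j) * pderiv (xs i ^ Poly_Mapping.lookup m i))"
    unfolding mnl_superset[OF finite_atMost assms] by (subst pderiv_prod) auto
  also have "\<dots> = (\<Sum>i\<le>N. of_nat (Poly_Mapping.lookup m i) * mnl (m - Poly_Mapping.single i 1) xs * pderiv (xs i))"
  proof (intro sum.cong refl)
    fix i assume i: "i \<in> {..N}"
    have "Poly_Mapping.keys (m - Poly_Mapping.single i 1) \<subseteq> Poly_Mapping.keys m"
      by (auto simp: in_keys_iff lookup_minus)
    with assms have k: "Poly_Mapping.keys (m - Poly_Mapping.single i 1) \<subseteq> {..N}" by blast
    have "mnl (m - Poly_Mapping.single i 1) xs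
        = xs i ^ (Poly_Mapping.lookup m i - 1) * (\<Prod>j\<in>{..N} - {i}. xs j ^ Poly_Mapping.lookup m j)"
      unfolding mnl_superset[OF finite_atMost k] using i
      by (subst prod.remove[of _ i]) (auto simp: lookup_minus lookup_single when_def intro!: prod.cong)
    thus "(\<Prod>j\<in>{..N} - {i}. xs j ^ Poly_Mapping.lookup m j) * pderiv (xs i ^ Poly_Mapping.lookup m i)
      = of_nat (Poly_Mapping.lookup m i) * mnl (m - Poly_Mapping.single i 1) xs * pderiv (xs i)"
      by (simp add: pderiv_power of_nat_poly mult_ac)
  qed
  finally show ?thesis .
qed

lemma gev_pderiv:
  fixes f :: "'k::field mpoly"
  assumes "vars f \<subseteq> {..N}"
  shows "pderiv (gev (\<lambda>c. [:c:]) f xs) = (\<Sum>i\<le>N. gev (\<lambda>c. [:c:]) (mpoly_pderiv i f) xs * pderiv (xs i))"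
proof -
  have "pderiv (gev (\<lambda>c. [:c:]) f xs)
      = (\<Sum>m\<in>Poly_Mapping.keys f. smult (Poly_Mapping.lookup f m) (pderiv (mnl m xs)))"
    by (simp add: gev_def pderiv_sum pderiv_smult)
  also have "\<dots> = (\<Sum>m\<in>Poly_Mapping.keys f. \<Sum>i\<le>N. smult (Poly_Mapping.lookup f m)
      (of_nat (Poly_Mapping.lookup m i) * mnl (m - Poly_Mapping.single i 1) xs * pderiv (xs i)))"
    using assms by (intro sum.cong refl) (subst pderiv_mnl[of _ N], auto simp: vars_def smult_sum2)
  also have "\<dots> = (\<Sum>i\<le>N. \<Sum>m\<in>Poly_Mapping.keys f. smult (Poly_Mapping.lookup f m)
      (of_nat (Poly_Mapping.lookup m i) * mnl (m - Poly_Mapping.single i 1) xs * pderiv (xs i)))"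
    by (rule sum.swap)
  finally show ?thesis
    by (simp add: mpoly_pderiv_def gev_sum[OF const_hom] gev_single[OF const_hom] sum_distrib_left
        of_nat_poly mult_ac)
qed

definition gradient :: "'k::field mpoly \<Rightarrow> (nat \<Rightarrow> 'k) \<Rightarrow> nat \<Rightarrow> 'k" where
  "gradient f x = (\<lambda>i. mpoly_eval (mpoly_pderiv i f) x)"

lemma poly_gev: "poly (gev (\<lambda>c. [:c:]) f xs) t = mpoly_eval f (\<lambda>i. poly (xs i) t)"
  unfolding mpoly_eval_gev by (subst gev_natural[OF poly_hom]) simp

lemma chain_rule:
  assumes "vars f \<subseteq> {..N}"
  shows "poly (pderiv (gev (\<lambda>c. [:c:]) f xs)) t
    = (\<Sum>i\<le>N. gradient f (\<lambda>i. poly (xs i) t) i * poly (pderiv (xs i)) t)"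
  by (simp add: gev_pderiv[OF assms] poly_sum poly_gev gradient_def)

lemma gradient_outside: "vars f \<subseteq> {..N} \<Longrightarrow> i > N \<Longrightarrow> gradient f x i = 0"
proof -
  assume v: "vars f \<subseteq> {..N}" "i > N"
  have "Poly_Mapping.lookup m i = 0" if "m \<in> Poly_Mapping.keys f" for m
    using v that by (force simp: vars_def in_keys_iff)
  hence "mpoly_pderiv i f = 0" by (simp add: mpoly_pderiv_def)
  thus ?thesis by (simp add: gradient_def mpoly_eval_0)
qed

section \<open>Spaces of forms and some linear algebra\<close>

lemma forms_iff: "f \<in> forms k N d \<longleftrightarrow> vars f \<subseteq> {..N} \<and>
    (\<forall>m\<in>Poly_Mapping.keys f. Poly_Mapping.lookup f m \<in> k \<and> mdeg m = d)"
  by (auto simp: forms_def vars_def mdeg_def)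

lemma forms_0 [simp]: "0 \<in> forms k N d" by (simp add: forms_def)

lemma forms_add:
  assumes "\<And>x y. x \<in> k \<Longrightarrow> y \<in> k \<Longrightarrow> x + y \<in> k" "f \<in> forms k N d" "g \<in> forms k N d"
  shows "f + g \<in> forms k N d"
proof -
  have "Poly_Mapping.lookup (f + g) m \<in> k" if "m \<in> Poly_Mapping.keys (f + g)" for m
    using that assms Poly_Mapping.keys_add[of f g]
    by (cases "m \<in> Poly_Mapping.keys f"; cases "m \<in> Poly_Mapping.keys g")
      (auto simp: forms_iff lookup_add in_keys_iff)
  thus ?thesis using assms(2,3) Poly_Mapping.keys_add[of f g] by (fastforce simp: forms_def)
qed

lemma forms_sum:
  assumes "\<And>x y. x \<in> k \<Longrightarrow> y \<in> k \<Longrightarrow> x + y \<in> k" "\<And>i. i \<in> A \<Longrightarrow> f i \<in> forms k N d"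
  shows "sum f A \<in> forms k N d"
  using assms(2) by (induction A rule: infinite_finite_induct) (auto intro: forms_add assms(1))

lemma forms_single:
  "c \<in> k \<Longrightarrow> Poly_Mapping.keys m \<subseteq> {..N} \<Longrightarrow> mdeg m = d \<Longrightarrow> Poly_Mapping.single m c \<in> forms k N d"
  by (cases "c = 0") (auto simp: forms_iff vars_def)

lemma forms_mult:
  assumes k: "\<And>x y. x \<in> k \<Longrightarrow> y \<in> k \<Longrightarrow> x + y \<in> k" "\<And>x y. x \<in> k \<Longrightarrow> y \<in> k \<Longrightarrow> x * y \<in> k"
    and "f \<in> forms k N d" "g \<in> forms k N d'"
  shows "f * g \<in> forms k N (d + d')"
proof -
  have eq: "f * g = (\<Sum>m\<in>Poly_Mapping.keys f. \<Sum>n\<in>Poly_Mapping.keys g.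
      Poly_Mapping.single (m + n) (Poly_Mapping.lookup f m * Poly_Mapping.lookup g n))"
    by (subst mpoly_sum_single[of f], subst mpoly_sum_single[of g]) (simp add: sum_product mult_single)
  show ?thesis unfolding eq using assms(3,4)
    by (intro forms_sum k(1) forms_single k(2)) (auto simp: forms_def mdeg_add keys_add_nat mdeg_def[symmetric])
qed

lemma forms_mono: "k \<subseteq> k' \<Longrightarrow> forms k N d \<subseteq> forms k' N d" by (auto simp: forms_def)

lemma forms_scale: "f \<in> forms UNIV N d \<Longrightarrow> mpoly_scale c f \<in> forms UNIV N d"
  unfolding mpoly_scale_def
  using forms_mult[of UNIV "Poly_Mapping.single 0 c" N 0 f d] by (auto simp: forms_single)

lemma forms_diff: assumes "f \<in> forms UNIV N d" "g \<in> forms UNIV N d" shows "f - g \<in> forms UNIV N d"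
proof -
  have "f - g = f + mpoly_scale (-1) g"
    by (simp add: mpoly_scale_def single_uminus)
  moreover have "f + mpoly_scale (-1) g \<in> forms UNIV N d"
    by (rule forms_add[OF UNIV_I assms(1) forms_scale[OF assms(2)]])
  ultimately show ?thesis by (simp only:)
qed

lemma forms_vars: "f \<in> forms k N d \<Longrightarrow> vars f \<subseteq> {..N}" by (simp add: forms_iff)

lemma forms_homogeneous:
  assumes "f \<in> forms k N d" shows "mpoly_eval f (\<lambda>i. c * x i) = c ^ d * mpoly_eval f x"
proof -
  have "mpoly_eval f (\<lambda>i. c * x i) = (\<Sum>m\<in>Poly_Mapping.keys f. Poly_Mapping.lookup f m * (c ^ d * mnl m x))"
    unfolding mpoly_eval_gev gev_def using assms by (intro sum.cong) (auto simp: mnl_scale forms_iff)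
  also have "\<dots> = c ^ d * mpoly_eval f x"
    unfolding mpoly_eval_gev gev_def sum_distrib_left by (intro sum.cong) auto
  finally show ?thesis .
qed

lemma forms_subspace: "mpoly.subspace (forms UNIV N d :: 'k::field mpoly set)"
  by (rule mpoly.subspaceI) (auto simp: forms_add forms_scale)

lemma forms_finite_span:
  "\<exists>S. finite S \<and> (forms UNIV N d :: 'k::field mpoly set) \<subseteq> mpoly.span S"
proof -
  let ?M = "{m. Poly_Mapping.keys m \<subseteq> {..N} \<and> mdeg m = d}"
  have "inj_on (\<lambda>m. restrict (Poly_Mapping.lookup m) {..N}) ?M"
  proof (rule inj_onI)
    fix m n assume mn: "m \<in> ?M" "n \<in> ?M"
      "restrict (Poly_Mapping.lookup m) {..N} = restrict (Poly_Mapping.lookup n) {..N}"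
    show "m = n"
    proof (rule poly_mapping_eqI)
      fix i
      show "Poly_Mapping.lookup m i = Poly_Mapping.lookup n i"
      proof (cases "i \<le> N")
        case True thus ?thesis using fun_cong[OF mn(3), of i] by simp
      next
        case False
        hence "i \<notin> Poly_Mapping.keys m" "i \<notin> Poly_Mapping.keys n" using mn(1,2) by auto
        thus ?thesis by (simp add: in_keys_iff)
      qed
    qed
  qed
  moreover have "(\<lambda>m. restrict (Poly_Mapping.lookup m) {..N}) ` ?M \<subseteq> PiE {..N} (\<lambda>_. {..d})"
  proof clarify
    fix m assume m: "Poly_Mapping.keys m \<subseteq> {..N}" "d = mdeg m"
    have "Poly_Mapping.lookup m i \<le> mdeg m" if "i \<le> N" for i
      unfolding mdeg_superset[OF finite_atMost m(1)] using that by (intro member_le_sum) auto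
    thus "restrict (Poly_Mapping.lookup m) {..N} \<in> PiE {..N} (\<lambda>_. {..mdeg m})" by auto
  qed
  ultimately have fin: "finite ?M" by (meson finite_PiE finite_atMost inj_on_finite)
  have "f \<in> mpoly.span ((\<lambda>m. Poly_Mapping.single m 1) ` ?M)" if f: "f \<in> forms UNIV N d" for f :: "'k mpoly"
  proof -
    have "f = (\<Sum>m\<in>Poly_Mapping.keys f. mpoly_scale (Poly_Mapping.lookup f m) (Poly_Mapping.single m 1))"
      by (subst mpoly_sum_single[of f]) (simp add: mpoly_scale_def mult_single)
    also have "\<dots> \<in> mpoly.span ((\<lambda>m. Poly_Mapping.single m 1) ` ?M)"
      using f by (intro mpoly.span_sum mpoly.span_scale mpoly.span_base) (auto simp: forms_def mdeg_def)
    finally show ?thesis .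
  qed
  thus ?thesis using fin by (intro exI[of _ "(\<lambda>m. Poly_Mapping.single m 1) ` ?M"]) auto
qed

text \<open>A basis of W together with the t i is a basis of U. With U the forms of one degree and W
  those vanishing on the curve, the card of I is the value of the Hilbert function.\<close>

lemma (in vector_space) dim_complement:
  assumes U: "subspace U" and fin: "finite S" "U \<subseteq> span S" and W: "subspace W" "W \<subseteq> U" and I: "finite I"
    and t: "\<And>i. i \<in> I \<Longrightarrow> t i \<in> U"
    and indep: "\<And>l. (\<Sum>i\<in>I. scale (l i) (t i)) \<in> W \<Longrightarrow> \<forall>i\<in>I. l i = 0"
    and span: "\<And>u. u \<in> U \<Longrightarrow> \<exists>l. u - (\<Sum>i\<in>I. scale (l i) (t i)) \<in> W"
  shows "dim U = dim W + card I"
proof -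
  obtain B where B: "B \<subseteq> W" "independent B" "W \<subseteq> local.span B" "card B = dim W"
    using basis_exists[of W] by blast
  have "B \<subseteq> local.span S" using B(1) W(2) fin(2) by blast
  hence fB: "finite B" using independent_span_bound[OF fin(1) B(2)] by blast
  have spB: "local.span B = W" using span_minimal[OF B(1) W(1)] B(3) by blast
  have ti: "t i \<notin> W" if i: "i \<in> I" for i
  proof
    assume "t i \<in> W"
    hence "(\<Sum>j\<in>I. scale (if j = i then 1 else 0) (t j)) \<in> W"
      using i I by (subst sum.remove[OF I i]) (auto intro!: sum.neutral)
    from indep[OF this] show False using i by auto
  qed
  have inj: "inj_on t I"
  proof (rule inj_onI, rule ccontr)
    fix i j assume ij: "i \<in> I" "j \<in> I" "t i = t j" "i \<noteq> j"
    let ?l = "\<lambda>k. if k = i then 1 else if k = j then -1 else 0"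
    have "(\<Sum>k\<in>I. scale (?l k) (t k)) = t i + (scale (-1) (t j) + (\<Sum>k\<in>I - {i} - {j}. scale (?l k) (t k)))"
      using ij I by (subst sum.remove[OF I ij(1)], subst sum.remove[of _ j]) auto
    also have "(\<Sum>k\<in>I - {i} - {j}. scale (?l k) (t k)) = 0" by (intro sum.neutral) auto
    finally have "(\<Sum>k\<in>I. scale (?l k) (t k)) \<in> W" using ij(3) subspace_0[OF W(1)] by simp
    from indep[OF this] show False using ij by auto
  qed
  have disj: "B \<inter> t ` I = {}" using B(1) ti by blast
  have ind: "independent (B \<union> t ` I)"
  proof (rule independent_if_scalars_zero)
    show f: "finite (B \<union> t ` I)" using fB I by simp
    fix f x assume s: "(\<Sum>x\<in>B \<union> t ` I. scale (f x) x) = 0" and x: "x \<in> B \<union> t ` I"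
    have s': "(\<Sum>x\<in>B. scale (f x) x) + (\<Sum>i\<in>I. scale (f (t i)) (t i)) = 0"
      using s fB I disj by (simp add: sum.union_disjoint sum.reindex[OF inj])
    have "(\<Sum>x\<in>B. scale (f x) x) \<in> W" using B(1) W(1) by (intro subspace_sum subspace_scale) auto
    hence "- (\<Sum>x\<in>B. scale (f x) x) \<in> W" using W(1) subspace_neg by blast
    hence "(\<Sum>i\<in>I. scale (f (t i)) (t i)) \<in> W" using s' by (simp add: add_eq_0_iff)
    from indep[OF this] have z: "\<forall>i\<in>I. f (t i) = 0" .
    hence "(\<Sum>x\<in>B. scale (f x) x) = 0" using s' by simp
    hence "\<forall>x\<in>B. f x = 0" using B(2) fB unfolding independent_explicit_finite_subsets by blast
    thus "f x = 0" using x z by auto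
  qed
  have "U \<subseteq> local.span (B \<union> t ` I)"
  proof
    fix u assume u: "u \<in> U"
    obtain l where l: "u - (\<Sum>i\<in>I. scale (l i) (t i)) \<in> W" using span[OF u] by blast
    have "u - (\<Sum>i\<in>I. scale (l i) (t i)) \<in> local.span (B \<union> t ` I)"
      using l spB span_mono[of B "B \<union> t ` I"] by blast
    moreover have "(\<Sum>i\<in>I. scale (l i) (t i)) \<in> local.span (B \<union> t ` I)"
      by (intro span_sum span_scale span_base) auto
    ultimately show "u \<in> local.span (B \<union> t ` I)" by (metis diff_add_cancel span_add)
  qed
  moreover have "B \<union> t ` I \<subseteq> U" using B(1) W(2) t by blast
  ultimately have "dim U = card (B \<union> t ` I)" using ind dim_unique by blast
  also have "\<dots> = dim W + card I" using fB I disj B(4) by (simp add: card_Un_disjoint card_image inj)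
  finally show ?thesis .
qed

lemma underdetermined:
  fixes A :: "'j \<Rightarrow> 'i \<Rightarrow> 'k::field"
  assumes "finite J" "finite I" "card J < card I"
  shows "\<exists>l. (\<exists>i\<in>I. l i \<noteq> 0) \<and> (\<forall>j\<in>J. (\<Sum>i\<in>I. l i * A j i) = 0)"
  using assms
proof (induction J arbitrary: I A)
  case empty
  then obtain i where "i \<in> I" by fastforce
  thus ?case by (intro exI[of _ "\<lambda>_. 1"]) auto
next
  case (insert j J)
  show ?case
  proof (cases "\<exists>i0\<in>I. A j i0 \<noteq> 0")
    case False
    have "card J < card I" using insert by simp
    then obtain l where "\<exists>i\<in>I. l i \<noteq> 0" "\<forall>j\<in>J. (\<Sum>i\<in>I. l i * A j i) = 0"
      using insert.IH[OF insert.prems(1), of A] by blast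
    moreover have "(\<Sum>i\<in>I. l i * A j i) = 0" using False by (intro sum.neutral) auto
    ultimately show ?thesis by (intro exI[of _ l]) simp
  next
    case True
    then obtain i0 where i0: "i0 \<in> I" "A j i0 \<noteq> 0" by blast
    define A' where "A' j' i = A j' i - A j i / A j i0 * A j' i0" for j' i
    have "card J < card (I - {i0})" using insert i0 by simp
    then obtain l where l: "\<exists>i\<in>I - {i0}. l i \<noteq> 0" "\<forall>j\<in>J. (\<Sum>i\<in>I - {i0}. l i * A' j i) = 0"
      using insert.IH[of "I - {i0}" A'] insert.prems(1) by blast
    define l' where "l' = l(i0 := - (\<Sum>i\<in>I - {i0}. l i * A j i) / A j i0)"
    have s: "(\<Sum>i\<in>I. l' i * A j' i) = l' i0 * A j' i0 + (\<Sum>i\<in>I - {i0}. l i * A j' i)" for j'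
      using i0 insert.prems(1) by (subst sum.remove[of I i0]) (auto simp: l'_def intro!: sum.cong)
    have "(\<Sum>i\<in>I. l' i * A j' i) = 0" if "j' \<in> insert j J" for j'
    proof (cases "j' = j")
      case True
      thus ?thesis unfolding s using i0 by (simp add: l'_def)
    next
      case False
      hence "0 = (\<Sum>i\<in>I - {i0}. l i * A' j' i)" using l(2) that by auto
      also have "\<dots> = (\<Sum>i\<in>I - {i0}. l i * A j' i) - (\<Sum>i\<in>I - {i0}. l i * A j i) / A j i0 * A j' i0"
        by (simp add: A'_def right_diff_distrib sum_subtractf sum_distrib_right sum_divide_distrib mult.assoc)
      finally show ?thesis unfolding s by (simp add: l'_def)
    qed
    moreover have "\<exists>i\<in>I. l' i \<noteq> 0" using l(1) by (auto simp: l'_def)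
    ultimately show ?thesis by blast
  qed
qed

section \<open>Points and closed sets of projective space\<close>

definition cls :: "(nat \<Rightarrow> 'k::field) \<Rightarrow> 'k proj_point" where "cls x = {y. \<exists>c. c \<noteq> 0 \<and> y = (\<lambda>i. c * x i)}"

definition vecs :: "nat \<Rightarrow> (nat \<Rightarrow> 'k::field) set" where "vecs N = {x. (\<forall>i>N. x i = 0) \<and> (\<exists>i\<le>N. x i \<noteq> 0)}"

lemma proj_space_eq: "proj_space N = cls ` vecs N"
  by (auto simp: proj_space_def quotient_def cls_def vecs_def)

lemma cls_self: "x \<in> cls x" unfolding cls_def by (intro CollectI exI[of _ 1]) simp

lemma cls_scale: assumes "c \<noteq> 0" shows "cls (\<lambda>i. c * x i) = cls x"
proof -
  have 1: "(\<lambda>i. d * x i) \<in> cls (\<lambda>i. c * x i)" if "d \<noteq> 0" for d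
    using assms that unfolding cls_def by (intro CollectI exI[of _ "d / c"]) auto
  have 2: "(\<lambda>i. d * (c * x i)) \<in> cls x" if "d \<noteq> 0" for d
  proof -
    have "d * c \<noteq> 0" using assms that by simp
    moreover have "(\<lambda>i. d * (c * x i)) = (\<lambda>i. (d * c) * x i)" by (rule ext) (rule mult.assoc[symmetric])
    ultimately show ?thesis unfolding cls_def by (intro CollectI exI[of _ "d * c"]) (rule conjI)
  qed
  show ?thesis
  proof (intro equalityI subsetI)
    fix y assume "y \<in> cls (\<lambda>i. c * x i)"
    then obtain d where "d \<noteq> 0" "y = (\<lambda>i. d * (c * x i))" unfolding cls_def by blast
    thus "y \<in> cls x" using 2 by simp
  next
    fix y assume "y \<in> cls x"
    then obtain d where "d \<noteq> 0" "y = (\<lambda>i. d * x i)" unfolding cls_def by blast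
    thus "y \<in> cls (\<lambda>i. c * x i)" using 1 by simp
  qed
qed

lemma cls_eq: "y \<in> cls x \<Longrightarrow> cls y = cls x"
proof -
  assume "y \<in> cls x"
  then obtain c where c: "c \<noteq> 0" "y = (\<lambda>i. c * x i)" unfolding cls_def by blast
  show ?thesis unfolding c(2) by (rule cls_scale[OF c(1)])
qed

lemma proj_space_mem: "P \<in> proj_space N \<Longrightarrow> x \<in> P \<Longrightarrow> x \<in> vecs N \<and> P = cls x"
  unfolding proj_space_eq using cls_eq by (fastforce simp: cls_def vecs_def)

lemma form_cls: "f \<in> forms k N d \<Longrightarrow> y \<in> cls x \<Longrightarrow> mpoly_eval f y = 0 \<longleftrightarrow> mpoly_eval f x = 0"
  by (auto simp: cls_def forms_homogeneous)

lemma cls_in_zero_locus: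
  assumes "S \<subseteq> (\<Union>d. forms k N d)"
  shows "cls x \<in> zero_locus N S \<longleftrightarrow> cls x \<in> proj_space N \<and> (\<forall>f\<in>S. mpoly_eval f x = 0)"
  using assms form_cls cls_self unfolding zero_locus_def by blast

lemma closed_Un:
  assumes "closed_over UNIV N A" "closed_over UNIV N B" shows "closed_over UNIV N (A \<union> B)"
proof -
  obtain S T where S: "S \<subseteq> (\<Union>d. forms UNIV N d)" "A = zero_locus N S"
    and T: "T \<subseteq> (\<Union>d. forms UNIV N d)" "B = zero_locus N T" using assms by (auto simp: closed_over_def)
  define M where "M = {f * g | f g. f \<in> S \<and> g \<in> T}"
  have M: "M \<subseteq> (\<Union>d. forms UNIV N d)" unfolding M_def
  proof
    fix h assume "h \<in> {f * g |f g. f \<in> S \<and> g \<in> T}"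
    then obtain f g where h: "h = f * g" "f \<in> S" "g \<in> T" by blast
    then obtain d d' where d: "f \<in> forms UNIV N d" "g \<in> forms UNIV N d'" using S(1) T(1) by blast
    have "f * g \<in> forms UNIV N (d + d')" by (rule forms_mult[OF _ _ d]) auto
    thus "h \<in> (\<Union>d. forms UNIV N d)" unfolding h(1) by (rule UN_I[OF UNIV_I])
  qed
  have "cls x \<in> A \<union> B \<longleftrightarrow> cls x \<in> zero_locus N M" for x
  proof -
    have "(\<forall>h\<in>M. mpoly_eval h x = 0) \<longleftrightarrow> (\<forall>f\<in>S. \<forall>g\<in>T. mpoly_eval f x * mpoly_eval g x = 0)"
      unfolding M_def by (auto simp flip: mpoly_eval_mult)
    also have "\<dots> \<longleftrightarrow> (\<forall>f\<in>S. mpoly_eval f x = 0) \<or> (\<forall>g\<in>T. mpoly_eval g x = 0)"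
      unfolding mult_eq_0_iff by blast
    finally show ?thesis
      unfolding S(2) T(2) Un_iff cls_in_zero_locus[OF S(1)] cls_in_zero_locus[OF T(1)] cls_in_zero_locus[OF M]
      by blast
  qed
  moreover have "A \<union> B \<subseteq> proj_space N" "zero_locus N M \<subseteq> proj_space N"
    by (auto simp: S(2) T(2) zero_locus_def)
  ultimately have "A \<union> B = zero_locus N M" unfolding proj_space_eq by blast
  thus ?thesis using M by (auto simp: closed_over_def)
qed

lemma closed_empty: "closed_over UNIV N ({} :: 'k::field proj_point set)"
proof -
  have "Poly_Mapping.single 0 (1::'k) \<in> forms UNIV N 0" by (rule forms_single) auto
  hence "{Poly_Mapping.single 0 (1::'k)} \<subseteq> (\<Union>d. forms UNIV N d)" by auto
  moreover have "{} = zero_locus N {Poly_Mapping.single 0 (1::'k)}"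
  proof -
    have "P \<notin> zero_locus N {Poly_Mapping.single 0 (1::'k)}" for P
    proof
      assume P: "P \<in> zero_locus N {Poly_Mapping.single 0 (1::'k)}"
      then obtain x where "P = cls x" by (auto simp: zero_locus_def proj_space_eq)
      hence "x \<in> P" using cls_self by simp
      hence "mpoly_eval (Poly_Mapping.single 0 (1::'k)) x = 0" using P by (simp add: zero_locus_def)
      moreover have "mpoly_eval (Poly_Mapping.single 0 (1::'k)) x = 1"
        unfolding mpoly_eval_single by simp
      ultimately show False by simp
    qed
    thus ?thesis by blast
  qed
  ultimately show ?thesis unfolding closed_over_def by (intro exI conjI)
qed

text \<open>The forms \<open>l i j\<close> are the 2 by 2 minors of the matrix whose rows are x and
  the point in question.\<close>

lemma closed_single:
  fixes P :: "'k::field proj_point"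
  assumes "P \<in> proj_space N" shows "closed_over UNIV N {P}"
proof -
  obtain x where x: "x \<in> vecs N" "P = cls x" using assms by (auto simp: proj_space_eq)
  define l :: "nat \<Rightarrow> nat \<Rightarrow> 'k mpoly" where "l i j = Poly_Mapping.single (Poly_Mapping.single i 1) (x j) - Poly_Mapping.single (Poly_Mapping.single j 1) (x i)" for i j :: nat
  define S where "S = {l i j | i j. i \<le> N \<and> j \<le> N}"
  have S: "S \<subseteq> (\<Union>d. forms UNIV N d)"
    unfolding S_def l_def by (auto intro!: exI[of _ 1] forms_diff forms_single)
  have ev: "mpoly_eval (l i j) y = x j * y i - x i * y j" for i j y
    by (simp add: l_def mpoly_eval_diff mpoly_eval_single)
  have "cls y \<in> zero_locus N S \<longleftrightarrow> cls y = P" if y: "y \<in> vecs N" for y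
  proof -
    have yp: "cls y \<in> proj_space N" using y by (simp add: proj_space_eq)
    obtain i where i: "i \<le> N" "x i \<noteq> 0" using x by (auto simp: vecs_def)
    have "(\<forall>f\<in>S. mpoly_eval f y = 0) \<longleftrightarrow> (\<forall>i\<le>N. \<forall>j\<le>N. x j * y i = x i * y j)"
    proof
      assume *: "\<forall>f\<in>S. mpoly_eval f y = 0"
      show "\<forall>i\<le>N. \<forall>j\<le>N. x j * y i = x i * y j"
      proof (intro allI impI)
        fix i j assume "i \<le> N" "j \<le> N"
        hence "l i j \<in> S" unfolding S_def by blast
        hence "mpoly_eval (l i j) y = 0" using * by blast
        thus "x j * y i = x i * y j" by (simp add: ev)
      qed
    qed (auto simp: S_def ev)
    also have "\<dots> \<longleftrightarrow> cls y = cls x"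
    proof
      assume *: "\<forall>i\<le>N. \<forall>j\<le>N. x j * y i = x i * y j"
      have "y j = y i / x i * x j" for j
        using * i x y by (cases "j \<le> N") (auto simp: field_simps vecs_def)
      hence e: "y = (\<lambda>j. y i / x i * x j)" by blast
      moreover have "y i / x i \<noteq> 0"
      proof
        assume "y i / x i = 0"
        hence "y = (\<lambda>j. 0)" using e by (metis mult_zero_left)
        thus False using y by (simp add: vecs_def)
      qed
      ultimately show "cls y = cls x" by (metis cls_scale)
    next
      assume "cls y = cls x"
      hence "y \<in> cls x" using cls_self by metis
      thus "\<forall>i\<le>N. \<forall>j\<le>N. x j * y i = x i * y j" by (auto simp: cls_def)
    qed
    finally show ?thesis unfolding cls_in_zero_locus[OF S] using yp x(2) by simp
  qed
  hence "{P} = zero_locus N S"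
    using assms unfolding zero_locus_def proj_space_eq by blast
  thus ?thesis using S by (auto simp: closed_over_def)
qed

lemma closed_finite: "finite A \<Longrightarrow> A \<subseteq> proj_space N \<Longrightarrow> closed_over UNIV N A"
proof (induction A rule: finite_induct)
  case (insert P A)
  thus ?case using closed_Un[of N "{P}" A] closed_single[of P N] by simp
qed (rule closed_empty)

lemma closed_sub: "closed_over k N V \<Longrightarrow> V \<subseteq> proj_space N"
  by (auto simp: closed_over_def zero_locus_def)

lemma irreducible_single: "P \<in> proj_space N \<Longrightarrow> abs_irreducible N {P}"
  unfolding abs_irreducible_def using closed_single by blast

lemma irreducible_finite:
  assumes "abs_irreducible N V" "finite V" shows "\<exists>P. V = {P}"
proof -
  obtain P where P: "P \<in> V" using assms by (auto simp: abs_irreducible_def)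
  have sub: "V \<subseteq> proj_space N" using assms closed_sub by (auto simp: abs_irreducible_def)
  have "closed_over UNIV N {P}" "closed_over UNIV N (V - {P})"
    using P sub assms(2) closed_single closed_finite by (blast, blast intro: closed_finite)
  moreover have "V = {P} \<union> (V - {P})" using P by blast
  ultimately have "V = {P} \<or> V = V - {P}" using assms(1) unfolding abs_irreducible_def by blast
  thus ?thesis using P by blast
qed

text \<open>A proper closed subset lies in the zeros of some form that does not vanish on all of V,
  so it is finite. An infinite V is then not a union of two of them, and in a chain of three
  irreducible sets the middle one would be a single point, with nothing left for the first.\<close>

lemma curve_irreducible_dim:
  fixes V :: "'k::alg_closed_field proj_point set"
  assumes closed: "closed_over UNIV N V" and inf: "infinite V"
    and dich: "\<And>f d. f \<in> forms UNIV N d \<Longrightarrow> (\<exists>P\<in>V. \<exists>x\<in>P. mpoly_eval f x \<noteq> 0) \<Longrightarrow>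
       finite {P \<in> V. \<forall>x\<in>P. mpoly_eval f x = 0}"
  shows "abs_irreducible N V" "has_dimension N V 1"
proof -
  have fin: "finite A" if A: "closed_over UNIV N A" "A \<subseteq> V" "A \<noteq> V" for A
  proof -
    obtain S where S: "S \<subseteq> (\<Union>d. forms UNIV N d)" "A = zero_locus N S" using A(1) by (auto simp: closed_over_def)
    obtain P where P: "P \<in> V" "P \<notin> A" using A by blast
    hence "P \<in> proj_space N" using closed closed_sub by blast
    then obtain f x where f: "f \<in> S" "x \<in> P" "mpoly_eval f x \<noteq> 0"
      using P(2) unfolding S(2) zero_locus_def by blast
    obtain d where d: "f \<in> forms UNIV N d" using f(1) S(1) by blast
    have "finite {P \<in> V. \<forall>x\<in>P. mpoly_eval f x = 0}" using dich[OF d] f P by blast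
    moreover have "A \<subseteq> {P \<in> V. \<forall>x\<in>P. mpoly_eval f x = 0}" using A(2) f(1) by (auto simp: S(2) zero_locus_def)
    ultimately show ?thesis by (rule finite_subset[rotated])
  qed
  show irr: "abs_irreducible N V" unfolding abs_irreducible_def
  proof (intro conjI allI impI)
    show "V \<noteq> {}" using inf by auto
    fix A B assume AB: "closed_over UNIV N A \<and> closed_over UNIV N B \<and> V = A \<union> B"
    show "V = A \<or> V = B"
    proof (rule ccontr)
      assume "\<not> ?thesis"
      hence "finite A" "finite B" using fin AB by blast+
      thus False using AB inf by auto
    qed
  qed (rule closed)
  obtain P where P: "P \<in> V" using inf by fastforce
  have PV: "{P} \<subset> V" using P inf by (metis finite.emptyI finite.insertI empty_subsetI insert_subset psubsetI)
  have "irreducible_chain N V 1" unfolding irreducible_chain_def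
    by (rule exI[of _ "\<lambda>i. if i = 0 then {P} else V"])
      (use irr PV P irreducible_single closed_sub[OF closed] in auto)
  moreover have "\<not> irreducible_chain N V (Suc 1)"
  proof
    assume "irreducible_chain N V (Suc 1)"
    then obtain Z where Z: "\<And>i. i \<le> 2 \<Longrightarrow> abs_irreducible N (Z i)" "\<And>i. i \<le> 2 \<Longrightarrow> Z i \<subseteq> V"
      "\<And>i. i < 2 \<Longrightarrow> Z i \<subset> Z (Suc i)" unfolding irreducible_chain_def by (auto simp: numeral_2_eq_2)
    have Z12: "Z 1 \<subset> Z 2" and "Z 0 \<subset> Z 1" using Z(3)[of 1] Z(3)[of 0] by (auto simp: numeral_2_eq_2)
    have "finite (Z 1)" using fin[of "Z 1"] Z(1)[of 1] Z(2)[of 1] Z(2)[of 2] Z12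
      by (auto simp: abs_irreducible_def)
    then obtain Q where "Z 1 = {Q}" using irreducible_finite[OF Z(1)[of 1]] by auto
    hence "Z 0 = {}" using \<open>Z 0 \<subset> Z 1\<close> by auto
    thus False using Z(1)[of 0] by (simp add: abs_irreducible_def)
  qed
  ultimately show "has_dimension N V 1" by (simp add: has_dimension_def)
qed

section \<open>The rank of the Jacobian matrix in a limit\<close>

lemma forms_prod:
  assumes "finite A" "\<And>i. i \<in> A \<Longrightarrow> f i \<in> forms UNIV N (d i)"
  shows "prod f A \<in> forms UNIV N (sum d A)"
  using assms
proof (induction A rule: finite_induct)
  case empty
  have "Poly_Mapping.single 0 1 \<in> forms UNIV N 0" by (rule forms_single) auto
  thus ?case by simp
next
  case (insert i A)
  thus ?case by (simp add: forms_mult)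
qed

lemma forms_pderiv:
  assumes "f \<in> forms UNIV N d" shows "mpoly_pderiv i f \<in> forms UNIV N (d - 1)"
  unfolding mpoly_pderiv_def
proof (intro forms_sum)
  fix m assume m: "m \<in> Poly_Mapping.keys f"
  hence km: "Poly_Mapping.keys m \<subseteq> {..N}" "mdeg m = d" using assms by (auto simp: forms_iff vars_def)
  show "Poly_Mapping.single (m - Poly_Mapping.single i 1) (of_nat (Poly_Mapping.lookup m i) * Poly_Mapping.lookup f m)
      \<in> forms UNIV N (d - 1)"
  proof (cases "Poly_Mapping.lookup m i = 0")
    case False
    have "m = (m - Poly_Mapping.single i 1) + Poly_Mapping.single i 1"
      using False by (intro poly_mapping_eqI) (auto simp: lookup_add lookup_minus lookup_single when_def)
    hence "mdeg m = mdeg (m - Poly_Mapping.single i 1) + 1" by (metis mdeg_add mdeg_single)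
    moreover have "Poly_Mapping.keys (m - Poly_Mapping.single i 1) \<subseteq> Poly_Mapping.keys m"
      by (auto simp: in_keys_iff lookup_minus)
    ultimately show ?thesis using km by (intro forms_single) auto
  qed simp
qed auto

text \<open>Upper semicontinuity of the corank of the Jacobian matrix: bordered minors are again forms.\<close>
lemma jacobian_rank_le:
  fixes V :: "'k::field proj_point set" and S :: "(nat \<Rightarrow> 'k) set"
  assumes ext: "\<And>f d x P. f \<in> forms UNIV N d \<Longrightarrow> (\<And>y. y \<in> S \<Longrightarrow> mpoly_eval f y = 0) \<Longrightarrow> P \<in> V \<Longrightarrow> x \<in> P \<Longrightarrow> mpoly_eval f x = 0"
    and tan: "\<And>y. y \<in> S \<Longrightarrow> \<exists>v w. (\<forall>s t. (\<forall>i\<le>N. s * v i + t * w i = 0) \<longrightarrow> s = 0 \<and> t = 0) \<and>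
       (\<forall>k<N. (\<Sum>i\<le>N. gradient (f k) y i * v i) = 0 \<and> (\<Sum>i\<le>N. gradient (f k) y i * w i) = 0)"
    and f: "\<And>k. k < N \<Longrightarrow> f k \<in> forms UNIV N (d k)" and x: "P \<in> V" "x \<in> P"
  shows "\<exists>l. (\<exists>k<N. l k \<noteq> 0) \<and> (\<forall>i\<le>N. (\<Sum>k<N. l k * gradient (f k) x i) = 0)"
proof (rule ccontr)
  assume neg: "\<not> ?thesis"
  \<comment> \<open>The N gradients are completed to a square matrix by an arbitrary constant row c,
    so that one determinant, a form, records their rank.\<close>
  define A where "A c = mat (Suc N) (Suc N) (\<lambda>(i, j). if i < N then mpoly_pderiv j (f i) else Poly_Mapping.single 0 (c j))"
    for c :: "nat \<Rightarrow> 'k"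
  define M where "M c y = mat (Suc N) (Suc N) (\<lambda>(i, j). if i < N then gradient (f i) y j else c j)" for c :: "nat \<Rightarrow> 'k" and y
  have ev: "mpoly_eval (det (A c)) y = det (M c y)" for c y
  proof -
    interpret comm_ring_hom "\<lambda>g. mpoly_eval g y" by (rule mpoly_eval_hom)
    have "map_mat (\<lambda>g. mpoly_eval g y) (A c) = M c y"
      by (rule eq_matI) (auto simp: A_def M_def gradient_def mpoly_eval_single)
    thus ?thesis by (metis hom_det)
  qed
  have form: "\<exists>n. det (A c) \<in> forms UNIV N n" for c
  proof -
    have "det (A c) = (\<Sum>\<pi> | \<pi> permutes {0..<Suc N}. signof \<pi> * (\<Prod>i = 0..<Suc N. A c $$ (i, \<pi> i)))"
      by (rule det_def') (simp add: A_def)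
    also have "\<dots> \<in> forms UNIV N (0 + (\<Sum>i = 0..<Suc N. if i < N then d i - 1 else 0))"
    proof (intro forms_sum forms_mult forms_prod)
      fix \<pi> assume \<pi>: "\<pi> \<in> {\<pi>. \<pi> permutes {0..<Suc N}}"
      have "signof \<pi> = Poly_Mapping.single 0 (signof \<pi> :: 'k)"
        by (simp add: sign_def single_uminus)
      thus "(signof \<pi> :: 'k mpoly) \<in> forms UNIV N 0" by (metis forms_single UNIV_I empty_subsetI keys_zero mdeg_0)
      fix i assume i: "i \<in> {0..<Suc N}"
      hence "\<pi> i < Suc N" using \<pi> permutes_in_image[of \<pi> "{0..<Suc N}" i] by auto
      thus "A c $$ (i, \<pi> i) \<in> forms UNIV N (if i < N then d i - 1 else 0)"
        using i f forms_pderiv[OF f, of i "\<pi> i"] by (auto simp: A_def intro!: forms_single)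
    qed auto
    finally show ?thesis by blast
  qed
  have "det (M c y) = 0" if y: "y \<in> S" for c y
  proof -
    obtain v w where vw: "\<And>s t. (\<forall>i\<le>N. s * v i + t * w i = 0) \<Longrightarrow> s = 0 \<and> t = 0"
      "\<And>k. k < N \<Longrightarrow> (\<Sum>i\<le>N. gradient (f k) y i * v i) = 0" "\<And>k. k < N \<Longrightarrow> (\<Sum>i\<le>N. gradient (f k) y i * w i) = 0"
      using tan[OF y] by blast
    \<comment> \<open>The gradients at y kill a space of dimension two, and some nonzero vector of
      it is killed by the row c as well; hence the determinant vanishes on S.\<close>
    obtain s t where st: "(s, t) \<noteq> (0, 0)" "s * (\<Sum>i\<le>N. c i * v i) + t * (\<Sum>i\<le>N. c i * w i) = 0"
      by (cases "(\<Sum>i\<le>N. c i * v i) = 0"; cases "(\<Sum>i\<le>N. c i * w i) = 0")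
        (auto intro: that[of 1 0] that[of 0 1] that[of "(\<Sum>i\<le>N. c i * w i)" "- (\<Sum>i\<le>N. c i * v i)"])
    define z where "z = vec (Suc N) (\<lambda>i. s * v i + t * w i)"
    have z0: "z \<noteq> 0\<^sub>v (Suc N)"
    proof
      assume "z = 0\<^sub>v (Suc N)"
      hence "z $ i = 0" if "i \<le> N" for i using that by simp
      hence "\<forall>i\<le>N. s * v i + t * w i = 0" by (simp add: z_def)
      from vw(1)[OF this] show False using st(1) by auto
    qed
    have scal: "(\<Sum>i\<le>N. g i * (s * v i + t * w i)) = s * (\<Sum>i\<le>N. g i * v i) + t * (\<Sum>i\<le>N. g i * w i)" for g :: "nat \<Rightarrow> 'k"
      by (simp add: sum_distrib_left distrib_left sum.distrib mult_ac)
    have "M c y *\<^sub>v z = 0\<^sub>v (Suc N)"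
    proof (rule eq_vecI)
      fix i assume i: "i < dim_vec (0\<^sub>v (Suc N) :: 'k vec)"
      have "(M c y *\<^sub>v z) $ i = (\<Sum>j\<in>{0..<Suc N}. (if i < N then gradient (f i) y j else c j) * (s * v j + t * w j))"
        using i by (simp add: M_def z_def scalar_prod_def)
      also have "{0..<Suc N} = {..N}" by auto
      also have "(\<Sum>j\<le>N. (if i < N then gradient (f i) y j else c j) * (s * v j + t * w j)) = 0"
        using st(2) vw(2,3) by (cases "i < N") (simp_all add: scal)
      finally show "(M c y *\<^sub>v z) $ i = 0\<^sub>v (Suc N) $ i" using i by simp
    qed (simp add: M_def)
    thus ?thesis using z0 det_0_iff_vec_prod_zero_field[of "M c y" "Suc N"]
      by (auto simp: M_def z_def intro!: exI[of _ z])
  qed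
  hence det0: "det (M c x) = 0" for c
    using form[of c] ext[OF _ _ x, of "det (A c)"] by (metis ev)
  \<comment> \<open>If the gradients at x were independent, a singular bordered matrix would put its
    last row into their span. With unit vectors as last rows, N + 1 independent vectors would lie in
    the span of N.\<close>
  have "\<exists>g. \<forall>i\<le>N. (\<Sum>k<N. g k * gradient (f k) x i) = (if i = j then 1 else 0)" if j: "j \<le> N" for j
  proof -
    let ?c = "\<lambda>i. if i = j then 1 else 0 :: 'k"
    have Mc: "M ?c x \<in> carrier_mat (Suc N) (Suc N)" by (simp add: M_def)
    have "det (transpose_mat (M ?c x)) = 0" using det0 det_transpose[OF Mc] by simp
    then obtain l where l: "l \<in> carrier_vec (Suc N)" "l \<noteq> 0\<^sub>v (Suc N)" "transpose_mat (M ?c x) *\<^sub>v l = 0\<^sub>v (Suc N)"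
      using det_0_iff_vec_prod_zero_field[of "transpose_mat (M ?c x)" "Suc N"] Mc by auto
    have eq: "(\<Sum>k<N. l $ k * gradient (f k) x i) + l $ N * ?c i = 0" if i: "i \<le> N" for i
    proof -
      have "0 = (transpose_mat (M ?c x) *\<^sub>v l) $ i" using l(3) i by simp
      also have "\<dots> = (\<Sum>k\<in>{0..<Suc N}. (if k < N then gradient (f k) x i else ?c i) * l $ k)"
        using i l(1) by (simp add: M_def scalar_prod_def)
      also have "\<dots> = (\<Sum>k<N. l $ k * gradient (f k) x i) + l $ N * ?c i"
        by (simp add: atLeast0LessThan mult.commute)
      finally show ?thesis by simp
    qed
    have "l $ N \<noteq> 0"
    proof
      assume N0: "l $ N = 0"
      hence "\<forall>i\<le>N. (\<Sum>k<N. l $ k * gradient (f k) x i) = 0" using eq by simp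
      hence "\<forall>k<N. l $ k = 0" using neg by blast
      hence "l = 0\<^sub>v (Suc N)" using N0 l(1) by (intro eq_vecI) (auto simp: less_Suc_eq)
      thus False using l(2) by simp
    qed
    have "(\<Sum>k<N. (- l $ k / l $ N) * gradient (f k) x i) = ?c i" if "i \<le> N" for i
    proof -
      have "(\<Sum>k<N. (- l $ k / l $ N) * gradient (f k) x i) = - (\<Sum>k<N. l $ k * gradient (f k) x i) / l $ N"
        by (simp add: sum_negf sum_divide_distrib)
      also have "(\<Sum>k<N. l $ k * gradient (f k) x i) = - (l $ N * ?c i)" using eq[OF that] by (simp add: add_eq_0_iff2)
      finally show ?thesis using \<open>l $ N \<noteq> 0\<close> by simp
    qed
    thus ?thesis by (intro exI[of _ "\<lambda>k. - l $ k / l $ N"]) blast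
  qed
  then obtain g where g: "\<And>j i. j \<le> N \<Longrightarrow> i \<le> N \<Longrightarrow> (\<Sum>k<N. g j k * gradient (f k) x i) = (if i = j then 1 else 0)"
    by metis
  obtain l where l: "\<exists>j\<in>{..N}. l j \<noteq> 0" "\<forall>k\<in>{..<N}. (\<Sum>j\<in>{..N}. l j * g j k) = 0"
    using underdetermined[of "{..<N}" "{..N}" "\<lambda>k j. g j k"] by auto
  have "l i = 0" if "i \<le> N" for i
  proof -
    have "l i = (\<Sum>j\<le>N. if j = i then l j else 0)" using that by simp
    also have "\<dots> = (\<Sum>j\<le>N. l j * (if i = j then 1 else 0))" by (rule sum.cong) auto
    also have "\<dots> = (\<Sum>j\<le>N. l j * (\<Sum>k<N. g j k * gradient (f k) x i))"
      using g that by (intro sum.cong) auto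
    also have "\<dots> = (\<Sum>k<N. (\<Sum>j\<le>N. l j * g j k) * gradient (f k) x i)"
      unfolding sum_distrib_left sum_distrib_right by (subst sum.swap) (simp add: mult_ac)
    also have "\<dots> = 0" using l(2) by simp
    finally show ?thesis .
  qed
  thus False using l(1) by auto
qed

section \<open>The Segre embedding\<close>

text \<open>The Segre embedding of the triple product of the projective line: the binary digits of
  an index select a coordinate in each of the three factors.\<close>

definition sel :: "bool \<Rightarrow> 'r \<times> 'r \<Rightarrow> 'r" where "sel s P = (if s then fst P else snd P)"

definition ix :: "bool \<Rightarrow> bool \<Rightarrow> bool \<Rightarrow> nat" where "ix s1 s2 s3 = 4 * of_bool s1 + 2 * of_bool s2 + of_bool s3"

definition b1 :: "nat \<Rightarrow> bool" where "b1 i \<longleftrightarrow> i \<ge> 4"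
definition b2 :: "nat \<Rightarrow> bool" where "b2 i \<longleftrightarrow> odd (i div 2)"
definition b3 :: "nat \<Rightarrow> bool" where "b3 i \<longleftrightarrow> odd i"

lemma b_ix [simp]: "b1 (ix s1 s2 s3) = s1" "b2 (ix s1 s2 s3) = s2" "b3 (ix s1 s2 s3) = s3"
  by (cases s1; cases s2; cases s3; simp add: ix_def b1_def b2_def b3_def)+

lemma ix_le [simp]: "ix s1 s2 s3 \<le> 7" by (simp add: ix_def)

lemma ix_inj [simp]: "ix s1 s2 s3 = ix t1 t2 t3 \<longleftrightarrow> s1 = t1 \<and> s2 = t2 \<and> s3 = t3"
  by (cases s1; cases s2; cases s3; cases t1; cases t2; cases t3; simp add: ix_def)

lemma ix_b: assumes "i \<le> 7" shows "ix (b1 i) (b2 i) (b3 i) = i"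
proof -
  have "i \<in> {0, 1, 2, 3, 4, 5, 6, 7}" using assms by auto
  thus ?thesis by (auto simp: ix_def b1_def b2_def b3_def)
qed

lemma ex_ix: "i \<le> 7 \<Longrightarrow> \<exists>s1 s2 s3. i = ix s1 s2 s3" using ix_b by metis

definition psi :: "'r::comm_ring_1 \<times> 'r \<Rightarrow> 'r \<times> 'r \<Rightarrow> 'r \<times> 'r \<Rightarrow> nat \<Rightarrow> 'r" where
  "psi P Q R i = (if i \<le> 7 then sel (b1 i) P * sel (b2 i) Q * sel (b3 i) R else 0)"

lemma psi_ix [simp]: "psi P Q R (ix s1 s2 s3) = sel s1 P * sel s2 Q * sel s3 R" by (simp add: psi_def)

text \<open>A monomial of degree s in the Segre coordinates that pulls back to the powers i, j, k of
  the three first coordinates: the r-th factor takes the first coordinate of a line exactly if r is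
  below the exponent for that line.\<close>

definition mmx :: "nat \<Rightarrow> nat \<Rightarrow> nat \<Rightarrow> nat \<Rightarrow> nat \<Rightarrow>\<^sub>0 nat" where
  "mmx s i j k = (\<Sum>r<s. Poly_Mapping.single (ix (r < i) (r < j) (r < k)) 1)"

lemma prod_sel: "i \<le> s \<Longrightarrow> (\<Prod>r<s. sel (r < i) P) = fst P ^ i * snd P ^ (s - i)"
  for P :: "'r::comm_ring_1 \<times> 'r"
proof (induction s)
  case (Suc s)
  show ?case
  proof (cases "i = Suc s")
    case True
    have "(\<Prod>r<Suc s. sel (r < i) P) = (\<Prod>r<Suc s. fst P)" using True by (intro prod.cong) (auto simp: sel_def)
    thus ?thesis using True by simp
  next
    case False
    thus ?thesis using Suc by (simp add: sel_def Suc_diff_le mult_ac)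
  qed
qed simp

lemma mnl_mmx:
  assumes "i \<le> s" "j \<le> s" "k \<le> s"
  shows "mnl (mmx s i j k) (psi P Q R) =
    fst P ^ i * snd P ^ (s - i) * (fst Q ^ j * snd Q ^ (s - j)) * (fst R ^ k * snd R ^ (s - k))"
  using assms by (simp add: mmx_def mnl_sum prod.distrib prod_sel)

lemma mdeg_mmx: "mdeg (mmx s i j k) = s" by (simp add: mmx_def mdeg_sum)

lemma keys_mmx: "Poly_Mapping.keys (mmx s i j k) \<subseteq> {..7}"
proof -
  have "Poly_Mapping.keys (mmx s i j k) \<subseteq> (\<Union>r\<in>{..<s}. Poly_Mapping.keys (Poly_Mapping.single (ix (r < i) (r < j) (r < k)) (1::nat)))"
    unfolding mmx_def by (rule Poly_Mapping.keys_sum)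
  thus ?thesis by (auto split: if_splits)
qed

text \<open>Composed with the Segre embedding, a form of degree s becomes a function of tridegree (s, s, s).\<close>

definition hform :: "nat \<Rightarrow> 'k::field poly poly poly \<Rightarrow> 'k mpoly" where
  "hform s f = (\<Sum>i\<le>s. \<Sum>j\<le>s. \<Sum>k\<le>s. Poly_Mapping.single (mmx s i j k) (coeff (coeff (coeff f k) j) i))"

text \<open>The polynomial f homogenised to tridegree (l, m, n), evaluated at three pairs of
  homogeneous coordinates.\<close>

definition th :: "nat \<Rightarrow> nat \<Rightarrow> nat \<Rightarrow> 'k::field poly poly poly \<Rightarrow> 'k \<times> 'k \<Rightarrow> 'k \<times> 'k \<Rightarrow> 'k \<times> 'k \<Rightarrow> 'k" where
  "th l m n f P Q R = (\<Sum>i\<le>l. \<Sum>j\<le>m. \<Sum>k\<le>n. coeff (coeff (coeff f k) j) i *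
     (fst P ^ i * snd P ^ (l - i) * (fst Q ^ j * snd Q ^ (m - j)) * (fst R ^ k * snd R ^ (n - k))))"

definition tdeg :: "'k::zero poly poly poly \<Rightarrow> nat \<Rightarrow> nat \<Rightarrow> nat \<Rightarrow> bool" where
  "tdeg f l m n \<longleftrightarrow> degree f \<le> n \<and> (\<forall>k. degree (coeff f k) \<le> m \<and> dx (coeff f k) l)"

lemma hform_forms:
  assumes "\<And>i j k. coeff (coeff (coeff f k) j) i \<in> K" "\<And>x y. x \<in> K \<Longrightarrow> y \<in> K \<Longrightarrow> x + y \<in> K"
  shows "hform s f \<in> forms K 7 s"
  unfolding hform_def using assms by (intro forms_sum forms_single keys_mmx mdeg_mmx) auto

lemma hform_psi: "mpoly_eval (hform s f) (psi P Q R) = th s s s f P Q R"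
  by (simp add: hform_def th_def mpoly_eval_sum mpoly_eval_single mnl_mmx)

lemma poly_bound: "degree g \<le> l \<Longrightarrow> poly g x = (\<Sum>i\<le>l. coeff g i * x ^ i)" for g :: "'k::comm_ring_1 poly"
  unfolding poly_altdef by (rule sum.mono_neutral_left) (auto simp: coeff_eq_0)

lemma th_affine:
  assumes "tdeg f l m n" shows "th l m n f (x, 1) (y, 1) (z, 1) = ev3 f x y z"
proof -
  have h: "poly g x = (\<Sum>i\<le>l. coeff g i * x ^ i)" if "degree g \<le> l" for g :: "'a poly"
    using that by (rule poly_bound)
  have 2: "ev2 g x y = (\<Sum>j\<le>m. (\<Sum>i\<le>l. coeff (coeff g j) i * x ^ i) * y ^ j)"
    if g: "degree g \<le> m" "dx g l" for g :: "'a poly poly"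
  proof -
    have "g = (\<Sum>j\<le>m. monom (coeff g j) j)" by (rule poly_as_sum_of_monoms'[symmetric, OF g(1)])
    hence "ev2 g x y = ev2 (\<Sum>j\<le>m. monom (coeff g j) j) x y" by (rule arg_cong)
    also have "\<dots> = (\<Sum>j\<le>m. poly (coeff g j) x * y ^ j)" by simp
    finally show ?thesis using h g(2) by (simp add: dx_def)
  qed
  have "f = (\<Sum>k\<le>n. monom (coeff f k) k)"
    by (rule poly_as_sum_of_monoms'[symmetric]) (use assms in \<open>simp add: tdeg_def\<close>)
  hence "ev3 f x y z = ev3 (\<Sum>k\<le>n. monom (coeff f k) k) x y z" by (rule arg_cong)
  also have "\<dots> = (\<Sum>k\<le>n. ev2 (coeff f k) x y * z ^ k)" by simp
  also have "\<dots> = (\<Sum>k\<le>n. (\<Sum>j\<le>m. (\<Sum>i\<le>l. coeff (coeff (coeff f k) j) i * x ^ i) * y ^ j) * z ^ k)"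
    using 2 assms by (simp add: tdeg_def)
  also have "\<dots> = (\<Sum>k\<le>n. \<Sum>j\<le>m. \<Sum>i\<le>l. coeff (coeff (coeff f k) j) i * (x ^ i * y ^ j * z ^ k))"
    by (simp add: sum_distrib_right mult.assoc)
  also have "\<dots> = (\<Sum>j\<le>m. \<Sum>k\<le>n. \<Sum>i\<le>l. coeff (coeff (coeff f k) j) i * (x ^ i * y ^ j * z ^ k))"
    by (rule sum.swap)
  also have "\<dots> = (\<Sum>j\<le>m. \<Sum>i\<le>l. \<Sum>k\<le>n. coeff (coeff (coeff f k) j) i * (x ^ i * y ^ j * z ^ k))"
    by (rule sum.cong[OF refl], rule sum.swap)
  also have "\<dots> = (\<Sum>i\<le>l. \<Sum>j\<le>m. \<Sum>k\<le>n. coeff (coeff (coeff f k) j) i * (x ^ i * y ^ j * z ^ k))"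
    by (rule sum.swap)
  finally show ?thesis by (simp add: th_def)
qed

text \<open>One representative for each point of the projective line, with pivot coordinate
  1.\<close>

definition nrm :: "'k::field \<times> 'k \<Rightarrow> bool" where "nrm P \<longleftrightarrow> snd P = 1 \<or> P = (1, 0)"

definition sh :: "nat \<Rightarrow> nat \<Rightarrow> nat \<Rightarrow> 'k::field poly poly poly \<Rightarrow> 'k poly poly poly" where
  "sh \<alpha> \<beta> \<gamma> f = monom (monom (monom 1 \<alpha>) \<beta>) \<gamma> * f"

lemma coeff_sh: "coeff (coeff (coeff (sh \<alpha> \<beta> \<gamma> f) k) j) i =
   (if \<alpha> \<le> i \<and> \<beta> \<le> j \<and> \<gamma> \<le> k then coeff (coeff (coeff f (k - \<gamma>)) (j - \<beta>)) (i - \<alpha>) else 0)"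
  by (simp add: sh_def coeff_monom_mult)

lemma sum_shift: "\<alpha> \<le> s \<Longrightarrow> (\<Sum>i\<le>s. if \<alpha> \<le> i then g (i - \<alpha>) else 0) = (\<Sum>i\<le>s - \<alpha>. g i)"
  for g :: "nat \<Rightarrow> 'k::comm_monoid_add"
proof -
  assume "\<alpha> \<le> s"
  have "(\<Sum>i\<le>s. if \<alpha> \<le> i then g (i - \<alpha>) else 0) = (\<Sum>i\<in>{\<alpha>..s}. g (i - \<alpha>))"
    by (rule sum.mono_neutral_cong_right) auto
  also have "\<dots> = (\<Sum>i\<le>s - \<alpha>. g i)"
    by (rule sum.reindex_bij_witness[of _ "\<lambda>i. i + \<alpha>" "\<lambda>i. i - \<alpha>"]) (use \<open>\<alpha> \<le> s\<close> in auto)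
  finally show ?thesis .
qed

text \<open>The coordinate that a normalised point has equal to 1 fills up the missing degree.\<close>
definition cor :: "nat \<Rightarrow> nat \<Rightarrow> 'k::field \<times> 'k \<Rightarrow> nat" where "cor s l P = (if snd P = 1 then 0 else s - l)"

lemma cor_pow:
  assumes "nrm P" "l \<le> s" "i \<le> l" "snd P = snd P'" "snd P \<noteq> 1 \<Longrightarrow> P' = P"
  shows "fst P' ^ (i + cor s l P) * snd P' ^ (s - (i + cor s l P)) = fst P' ^ i * snd P' ^ (l - i)"
  using assms by (auto simp: nrm_def cor_def power_0_left)

lemma th_sum_aux:
  fixes c :: "nat \<Rightarrow> 'k::comm_ring_1"
  assumes "\<alpha> + l \<le> s" "\<And>i. i > l \<Longrightarrow> c i = 0" "\<And>i. i \<le> l \<Longrightarrow> XX (i + \<alpha>) = Y i"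
  shows "(\<Sum>i\<le>s. if \<alpha> \<le> i then c (i - \<alpha>) * XX i else 0) = (\<Sum>i\<le>l. c i * Y i)"
proof -
  have "(\<Sum>i\<le>s. if \<alpha> \<le> i then c (i - \<alpha>) * XX i else 0) = (\<Sum>i\<le>s. if \<alpha> \<le> i then c (i - \<alpha>) * XX (i - \<alpha> + \<alpha>) else 0)"
    by (rule sum.cong) auto
  also have "\<dots> = (\<Sum>i\<le>s - \<alpha>. c i * XX (i + \<alpha>))" using assms(1) by (intro sum_shift) auto
  also have "\<dots> = (\<Sum>i\<le>l. c i * XX (i + \<alpha>))"
    using assms(1,2) by (intro sum.mono_neutral_right) auto
  finally show ?thesis using assms(3) by simp
qed

text \<open>Displacements inside the chart of P: a finite point may move along the line, the point
  at infinity stays. Points of the curve have at most one infinite coordinate, so two directions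
  always remain.\<close>

definition moves :: "'k::field \<times> 'k \<Rightarrow> 'k \<times> 'k \<Rightarrow> bool" where
  "moves P P' \<longleftrightarrow> nrm P \<and> snd P = snd P' \<and> (snd P \<noteq> 1 \<longrightarrow> P' = P)"

lemma moves_pow:
  assumes "moves P P'" "l \<le> s" "i \<le> l"
  shows "fst P' ^ (i + cor s l P) * snd P' ^ (s - (i + cor s l P)) = fst P' ^ i * snd P' ^ (l - i)"
proof (rule cor_pow)
  show "nrm P" "snd P = snd P'" "snd P \<noteq> 1 \<Longrightarrow> P' = P" using assms(1) unfolding moves_def by blast+
qed (rule assms)+

lemma th_if_sum:
  fixes g :: "'i \<Rightarrow> 'j \<Rightarrow> 'l \<Rightarrow> 'k::comm_ring_1"
  shows "(\<Sum>i\<in>I. \<Sum>j\<in>J. \<Sum>k\<in>L. (if A i \<and> A' j \<and> A'' k then g i j k else 0) * (x i * y j * z k)) =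
    (\<Sum>i\<in>I. if A i then (\<Sum>j\<in>J. if A' j then (\<Sum>k\<in>L. if A'' k then g i j k * z k else 0) * y j else 0) * x i else 0)"
proof -
  have k: "(\<Sum>k\<in>L. (if A i \<and> A' j \<and> A'' k then g i j k else 0) * (x i * y j * z k)) =
      (if A i then (if A' j then (\<Sum>k\<in>L. if A'' k then g i j k * z k else 0) * y j else 0) * x i else 0)" for i j
  proof (cases "A i \<and> A' j")
    case True
    have "(\<Sum>k\<in>L. (if A'' k then g i j k else 0) * (x i * y j * z k)) = (\<Sum>k\<in>L. (if A'' k then g i j k * z k else 0) * y j * x i)"
      by (rule sum.cong) (auto simp: mult_ac)
    thus ?thesis using True by (simp add: sum_distrib_right)
  qed auto
  have j: "(\<Sum>j\<in>J. if A i then (if A' j then h j * y j else 0) * x i else 0) =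
      (if A i then (\<Sum>j\<in>J. if A' j then h j * y j else 0) * x i else 0)" for i and h :: "'j \<Rightarrow> 'k"
    by (simp add: sum_distrib_right)
  show ?thesis unfolding k j ..
qed

text \<open>A form on the Segre variety has the same degree in all three factors. The missing
  degrees are supplied by powers of the coordinate that equals 1 at the point and at its
  displacements, so that the local equation is not multiplied by anything vanishing there.\<close>

lemma th_sh:
  assumes f: "tdeg f l m n" "l \<le> s" "m \<le> s" "n \<le> s" and mv: "moves P P'" "moves Q Q'" "moves R R'"
  shows "th s s s (sh (cor s l P) (cor s m Q) (cor s n R) f) P' Q' R' = th l m n f P' Q' R'"
proof -
  let ?a = "cor s l P" and ?b = "cor s m Q" and ?c = "cor s n R"
  define XX where "XX i = fst P' ^ i * snd P' ^ (s - i)" for i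
  define Y where "Y i = fst Q' ^ i * snd Q' ^ (s - i)" for i
  define Z where "Z i = fst R' ^ i * snd R' ^ (s - i)" for i
  define XX' where "XX' i = fst P' ^ i * snd P' ^ (l - i)" for i
  define Y' where "Y' i = fst Q' ^ i * snd Q' ^ (m - i)" for i
  define Z' where "Z' i = fst R' ^ i * snd R' ^ (n - i)" for i
  have XX: "XX (i + ?a) = XX' i" if "i \<le> l" for i unfolding XX_def XX'_def
    by (rule moves_pow[OF mv(1) f(2) that])
  have Y: "Y (i + ?b) = Y' i" if "i \<le> m" for i unfolding Y_def Y'_def
    by (rule moves_pow[OF mv(2) f(3) that])
  have Z: "Z (i + ?c) = Z' i" if "i \<le> n" for i unfolding Z_def Z'_def
    by (rule moves_pow[OF mv(3) f(4) that])
  have le: "?a + l \<le> s" "?b + m \<le> s" "?c + n \<le> s" using f by (auto simp: cor_def)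
  let ?f = "\<lambda>i j k. coeff (coeff (coeff f k) j) i"
  have z: "?f i j k = 0" if "i > l \<or> j > m \<or> k > n" for i j k
  proof -
    have "degree (coeff (coeff f k) j) \<le> l" "degree (coeff f k) \<le> m" "degree f \<le> n"
      using f(1) by (auto simp: tdeg_def dx_def)
    thus ?thesis using that by (auto simp: coeff_eq_0)
  qed
  have k3: "(\<Sum>k\<le>s. if ?c \<le> k then ?f i j (k - ?c) * Z k else 0) = (\<Sum>k\<le>n. ?f i j k * Z' k)" for i j
    by (rule th_sum_aux[where XX = Z and Y = Z' and c = "\<lambda>k. ?f i j k"]) (use le Z z in auto)
  have k2: "(\<Sum>j\<le>s. if ?b \<le> j then (\<Sum>k\<le>n. ?f i (j - ?b) k * Z' k) * Y j else 0) =
     (\<Sum>j\<le>m. (\<Sum>k\<le>n. ?f i j k * Z' k) * Y' j)" for i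
    by (rule th_sum_aux[where XX = Y and Y = Y' and c = "\<lambda>j. \<Sum>k\<le>n. ?f i j k * Z' k"]) (use le Y z in auto)
  have k1: "(\<Sum>i\<le>s. if ?a \<le> i then (\<Sum>j\<le>m. (\<Sum>k\<le>n. ?f (i - ?a) j k * Z' k) * Y' j) * XX i else 0) =
     (\<Sum>i\<le>l. (\<Sum>j\<le>m. (\<Sum>k\<le>n. ?f i j k * Z' k) * Y' j) * XX' i)"
    by (rule th_sum_aux[where XX = XX and Y = XX' and c = "\<lambda>i. \<Sum>j\<le>m. (\<Sum>k\<le>n. ?f i j k * Z' k) * Y' j"])
      (use le XX z in auto)
  have "th s s s (sh ?a ?b ?c f) P' Q' R' = (\<Sum>i\<le>s. \<Sum>j\<le>s. \<Sum>k\<le>s.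
      (if ?a \<le> i \<and> ?b \<le> j \<and> ?c \<le> k then ?f (i - ?a) (j - ?b) (k - ?c) else 0) * (XX i * Y j * Z k))"
    unfolding th_def coeff_sh XX_def Y_def Z_def ..
  also have "\<dots> = (\<Sum>i\<le>s. if ?a \<le> i then (\<Sum>j\<le>s. if ?b \<le> j then
      (\<Sum>k\<le>s. if ?c \<le> k then ?f (i - ?a) (j - ?b) (k - ?c) * Z k else 0) * Y j else 0) * XX i else 0)"
    unfolding th_if_sum ..
  also have "\<dots> = (\<Sum>i\<le>s. if ?a \<le> i then (\<Sum>j\<le>s. if ?b \<le> j then
      (\<Sum>k\<le>n. ?f (i - ?a) (j - ?b) k * Z' k) * Y j else 0) * XX i else 0)"
    unfolding k3 ..
  also have "\<dots> = (\<Sum>i\<le>s. if ?a \<le> i then (\<Sum>j\<le>m. (\<Sum>k\<le>n. ?f (i - ?a) j k * Z' k) * Y' j) * XX i else 0)"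
    unfolding k2 ..
  also have "\<dots> = (\<Sum>i\<le>l. (\<Sum>j\<le>m. (\<Sum>k\<le>n. ?f i j k * Z' k) * Y' j) * XX' i)"
    unfolding k1 ..
  also have "\<dots> = th l m n f P' Q' R'"
    unfolding th_def XX'_def Y'_def Z'_def by (simp add: sum_distrib_right sum_distrib_left mult_ac)
  finally show ?thesis .
qed

lemma sh_tdeg:
  assumes "tdeg f l m n" "l \<le> s" "m \<le> s" "n \<le> s"
  shows "tdeg (sh (cor s l P) (cor s m Q) (cor s n R) f) s s s"
proof -
  let ?g = "sh (cor s l P) (cor s m Q) (cor s n R) f"
  have z: "coeff (coeff (coeff ?g k) j) i = 0" if "i > s \<or> j > s \<or> k > s" for i j k
  proof -
    have "degree (coeff (coeff f k) j) \<le> l" "degree (coeff f k) \<le> m" "degree f \<le> n" for k j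
      using assms(1) by (auto simp: tdeg_def dx_def)
    note d = this
    have "coeff (coeff (coeff f k) j) i = 0" if "i > l \<or> j > m \<or> k > n" for i j k
      using that d(1)[of k j] d(2)[of k] d(3) by (auto simp: coeff_eq_0)
    note * = this
    have "i - cor s l P > l" if "i > s" using that assms(2) by (auto simp: cor_def)
    moreover have "j - cor s m Q > m" if "j > s" using that assms(3) by (auto simp: cor_def)
    moreover have "k - cor s n R > n" if "k > s" using that assms(4) by (auto simp: cor_def)
    ultimately show ?thesis using that unfolding coeff_sh by (auto intro!: *)
  qed
  have "degree ?g \<le> s" by (rule degree_le) (use z in \<open>auto intro!: poly_eqI\<close>)
  moreover have "degree (coeff ?g k) \<le> s" for k by (rule degree_le) (use z in \<open>auto intro!: poly_eqI\<close>)
  moreover have "dx (coeff ?g k) s" for k unfolding dx_def by (intro allI degree_le) (use z in auto)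
  ultimately show ?thesis by (auto simp: tdeg_def)
qed

lemma ev3_sh [simp]: "ev3 (sh \<alpha> \<beta> \<gamma> f) x y z = x ^ \<alpha> * y ^ \<beta> * z ^ \<gamma> * ev3 f x y z"
  by (simp add: sh_def poly_monom)

text \<open>Restriction to the affine chart: the three digits of a coordinate tell which of x, y, z
  it contributes.\<close>

definition dehom :: "'k::field mpoly \<Rightarrow> 'k poly poly poly" where
  "dehom f = (\<Sum>m\<in>Poly_Mapping.keys f. monom (monom (monom (Poly_Mapping.lookup f m)
     (\<Sum>i\<in>Poly_Mapping.keys m. of_bool (b1 i) * Poly_Mapping.lookup m i))
     (\<Sum>i\<in>Poly_Mapping.keys m. of_bool (b2 i) * Poly_Mapping.lookup m i))
     (\<Sum>i\<in>Poly_Mapping.keys m. of_bool (b3 i) * Poly_Mapping.lookup m i))"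

lemma ev3_dehom:
  assumes "f \<in> forms k 7 t" shows "ev3 (dehom f) x y z = mpoly_eval f (psi (x, 1) (y, 1) (z, 1))"
proof -
  have "mnl m (psi (x, 1) (y, 1) (z, 1)) =
      x ^ (\<Sum>i\<in>Poly_Mapping.keys m. of_bool (b1 i) * Poly_Mapping.lookup m i)
      * y ^ (\<Sum>i\<in>Poly_Mapping.keys m. of_bool (b2 i) * Poly_Mapping.lookup m i)
      * z ^ (\<Sum>i\<in>Poly_Mapping.keys m. of_bool (b3 i) * Poly_Mapping.lookup m i)"
    if m: "m \<in> Poly_Mapping.keys f" for m
  proof -
    have "i \<le> 7" if "i \<in> Poly_Mapping.keys m" for i using assms m that by (auto simp: forms_def)
    hence "mnl m (psi (x, 1) (y, 1) (z, 1)) = (\<Prod>i\<in>Poly_Mapping.keys m.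
       x ^ (of_bool (b1 i) * Poly_Mapping.lookup m i) * y ^ (of_bool (b2 i) * Poly_Mapping.lookup m i)
        * z ^ (of_bool (b3 i) * Poly_Mapping.lookup m i))"
      unfolding mnl_def by (intro prod.cong) (auto simp: psi_def sel_def power_mult_distrib)
    thus ?thesis by (simp only: prod.distrib power_sum)
  qed
  thus ?thesis unfolding mpoly_eval_gev gev_def dehom_def by (simp add: poly_monom mult.assoc)
qed

lemma tdeg_0: "tdeg 0 l m n" by (simp add: tdeg_def)

lemma tdeg_add: "tdeg f l m n \<Longrightarrow> tdeg g l m n \<Longrightarrow> tdeg (f + g) l m n"
  by (auto simp: tdeg_def intro: degree_add_le dx_add)

lemma tdeg_dehom: assumes "f \<in> forms k 7 t" shows "tdeg (dehom f) t t t"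
proof -
  have S: "tdeg (sum h A) t t t" if "\<And>i. i \<in> A \<Longrightarrow> tdeg (h i) t t t" for h :: "(nat \<Rightarrow>\<^sub>0 nat) \<Rightarrow> 'a poly poly poly" and A
    using that by (induction A rule: infinite_finite_induct) (auto simp: tdeg_0 tdeg_add)
  have M: "tdeg (monom (monom (monom c i) j) k) t t t" if "i \<le> t" "j \<le> t" "k \<le> t" for c :: 'a and i j k
    using that unfolding tdeg_def dx_def
    by (auto simp: degree_monom_eq intro: order.trans[OF degree_monom_le])
  have le: "(\<Sum>i\<in>Poly_Mapping.keys m. of_bool (B i) * Poly_Mapping.lookup m i) \<le> t"
    if "m \<in> Poly_Mapping.keys f" for m B
  proof -
    have "(\<Sum>i\<in>Poly_Mapping.keys m. of_bool (B i) * Poly_Mapping.lookup m i) \<le> mdeg m"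
      unfolding mdeg_def by (intro sum_mono) auto
    thus ?thesis using assms that by (simp add: forms_iff)
  qed
  show ?thesis unfolding dehom_def by (intro S M le)
qed

definition quad :: "nat \<Rightarrow> nat \<Rightarrow> nat \<Rightarrow> nat \<Rightarrow> 'k::field mpoly" where
  "quad i j k l = Poly_Mapping.single (Poly_Mapping.single i 1 + Poly_Mapping.single j 1) 1
     + Poly_Mapping.single (Poly_Mapping.single k 1 + Poly_Mapping.single l 1) (-1)"

lemma eval_quad [simp]: "mpoly_eval (quad i j k l) x = x i * x j - x k * x l"
  by (simp add: quad_def mpoly_eval_add mpoly_eval_single mnl_add)

lemma forms_quad:
  assumes "i \<le> N" "j \<le> N" "k \<le> N" "l \<le> N" "1 \<in> K" "-1 \<in> K" "\<And>x y. x \<in> K \<Longrightarrow> y \<in> K \<Longrightarrow> x + y \<in> K"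
  shows "quad i j k l \<in> forms K N 2"
  unfolding quad_def using assms
  by (intro forms_add forms_single) (auto simp: keys_add_nat mdeg_add split: if_splits)

text \<open>Two indices exchange their first, or their second, digit. Exchanging the third digit
  amounts to exchanging both of the others.\<close>

definition segre_quads :: "'k::field mpoly set" where
  "segre_quads = {quad (ix s1 s2 s3) (ix t1 t2 t3) (ix t1 s2 s3) (ix s1 t2 t3) | s1 s2 s3 t1 t2 t3. True} \<union>
     {quad (ix s1 s2 s3) (ix t1 t2 t3) (ix s1 t2 s3) (ix t1 s2 t3) | s1 s2 s3 t1 t2 t3. True}"

lemma segre_quads_psi: "f \<in> segre_quads \<Longrightarrow> mpoly_eval f (\<lambda>i. c * psi P Q R i) = 0"
  by (auto simp: segre_quads_def)

lemma segre_quads_forms: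
  assumes "1 \<in> K" "-1 \<in> K" "\<And>x y. x \<in> K \<Longrightarrow> y \<in> K \<Longrightarrow> x + y \<in> K"
  shows "segre_quads \<subseteq> forms K 7 2"
  unfolding segre_quads_def using assms by (auto intro!: forms_quad)

lemma normalise:
  fixes P :: "'k::field \<times> 'k"
  assumes "fst P \<noteq> 0 \<or> snd P \<noteq> 0"
  shows "\<exists>c P'. c \<noteq> 0 \<and> nrm P' \<and> (\<forall>s. sel s P = c * sel s P')"
proof (cases "snd P = 0")
  case True
  thus ?thesis using assms by (intro exI[of _ "fst P"] exI[of _ "(1, 0)"]) (auto simp: nrm_def sel_def)
next
  case False
  thus ?thesis by (intro exI[of _ "snd P"] exI[of _ "(fst P / snd P, 1)"]) (auto simp: nrm_def sel_def)
qed

text \<open>Through a nonzero coordinate run three pairs of coordinates in which one digit varies;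
  these pairs are the three factors. The exchange relations recover every coordinate from them, up
  to the square of the pivot.\<close>

lemma segre_decompose:
  fixes x :: "nat \<Rightarrow> 'k::field"
  assumes x: "x \<in> vecs 7" and q: "\<And>f. f \<in> segre_quads \<Longrightarrow> mpoly_eval f x = 0"
  shows "\<exists>c P Q R. c \<noteq> 0 \<and> nrm P \<and> nrm Q \<and> nrm R \<and> x = (\<lambda>i. c * psi P Q R i)"
proof -
  have q1: "x (ix s1 s2 s3) * x (ix t1 t2 t3) = x (ix t1 s2 s3) * x (ix s1 t2 t3)" for s1 s2 s3 t1 t2 t3
  proof -
    have "quad (ix s1 s2 s3) (ix t1 t2 t3) (ix t1 s2 s3) (ix s1 t2 t3) \<in> segre_quads"
      unfolding segre_quads_def by blast
    from q[OF this] show ?thesis by simp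
  qed
  have q2: "x (ix s1 s2 s3) * x (ix t1 t2 t3) = x (ix s1 t2 s3) * x (ix t1 s2 t3)" for s1 s2 s3 t1 t2 t3
  proof -
    have "quad (ix s1 s2 s3) (ix t1 t2 t3) (ix s1 t2 s3) (ix t1 s2 t3) \<in> segre_quads"
      unfolding segre_quads_def by blast
    from q[OF this] show ?thesis by simp
  qed
  obtain i where i: "i \<le> 7" "x i \<noteq> 0" using x by (auto simp: vecs_def)
  obtain r1 r2 r3 where "i = ix r1 r2 r3" using ex_ix[OF i(1)] by blast
  hence nz: "x (ix r1 r2 r3) \<noteq> 0" using i by simp
  define P where "P = (x (ix True r2 r3), x (ix False r2 r3))"
  define Q where "Q = (x (ix r1 True r3), x (ix r1 False r3))"
  define R where "R = (x (ix r1 r2 True), x (ix r1 r2 False))"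
  have P: "sel s P = x (ix s r2 r3)" and Q: "sel s Q = x (ix r1 s r3)" and R: "sel s R = x (ix r1 r2 s)" for s
    by (cases s; simp add: P_def Q_def R_def sel_def)+
  have nzs: "fst A \<noteq> 0 \<or> snd A \<noteq> 0" if "sel s A \<noteq> 0" for A :: "'k \<times> 'k" and s
    using that by (auto simp: sel_def split: if_splits)
  obtain c1 P' where P': "c1 \<noteq> 0" "nrm P'" "\<And>s. sel s P = c1 * sel s P'" using normalise[of P] nzs[of r1 P] nz P by auto
  obtain c2 Q' where Q': "c2 \<noteq> 0" "nrm Q'" "\<And>s. sel s Q = c2 * sel s Q'" using normalise[of Q] nzs[of r2 Q] nz Q by auto
  obtain c3 R' where R': "c3 \<noteq> 0" "nrm R'" "\<And>s. sel s R = c3 * sel s R'" using normalise[of R] nzs[of r3 R] nz R by auto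
  let ?n = "x (ix r1 r2 r3)"
  have eq: "x j = c1 * c2 * c3 / ?n ^ 2 * psi P' Q' R' j" for j
  proof (cases "j \<le> 7")
    case False
    thus ?thesis using x by (simp add: vecs_def psi_def)
  next
    case True
    then obtain s1 s2 s3 where j: "j = ix s1 s2 s3" using ex_ix by blast
    have "c1 * c2 * c3 * psi P' Q' R' j = sel s1 P * sel s2 Q * sel s3 R"
      by (simp add: j P'(3) Q'(3) R'(3) mult_ac)
    also have "\<dots> = x (ix s1 r2 r3) * x (ix r1 s2 r3) * x (ix r1 r2 s3)" by (simp add: P Q R)
    also have "x (ix s1 r2 r3) * x (ix r1 s2 r3) = ?n * x (ix s1 s2 r3)" by (rule q1)
    also have "?n * x (ix s1 s2 r3) * x (ix r1 r2 s3) = ?n * (x (ix r1 s2 r3) * x (ix s1 r2 s3))"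
      unfolding mult.assoc using q1[of s1 s2 r3 r1 r2 s3] by simp
    also have "x (ix r1 s2 r3) * x (ix s1 r2 s3) = ?n * x (ix s1 s2 s3)" by (rule q2)
    finally show ?thesis using nz by (simp add: j power2_eq_square field_simps)
  qed
  show ?thesis
    by (rule exI[of _ "c1 * c2 * c3 / ?n ^ 2"], rule exI[of _ P'], rule exI[of _ Q'], rule exI[of _ R'])
      (intro conjI ext eq P'(2) Q'(2) R'(2), use P'(1) Q'(1) R'(1) nz in simp)
qed

section \<open>Tangent vectors of the Segre variety and lower bounds for the rank\<close>

definition pair :: "(nat \<Rightarrow> 'k::comm_ring_1) \<Rightarrow> (nat \<Rightarrow> 'k) \<Rightarrow> 'k" where "pair g d = (\<Sum>i\<le>7. g i * d i)"

lemma triangular_independent: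
  fixes g d :: "nat \<Rightarrow> nat \<Rightarrow> 'k::field"
  assumes low: "\<And>i j. i < j \<Longrightarrow> j < n \<Longrightarrow> pair (g i) (d j) = 0" and diag: "\<And>i. i < n \<Longrightarrow> pair (g i) (d i) \<noteq> 0"
  shows "inj_on g {..<n}" "coord.independent (g ` {..<n})"
proof -
  have main: "l i = 0" if l: "\<And>k. (\<Sum>i<n. l i * g i k) = 0" and i: "i < n" for l i
  proof (rule ccontr)
    assume "l i \<noteq> 0"
    define j where "j = Max {i. i < n \<and> l i \<noteq> 0}"
    have fin: "finite {i. i < n \<and> l i \<noteq> 0}" by auto
    have "j \<in> {i. i < n \<and> l i \<noteq> 0}" unfolding j_def using i \<open>l i \<noteq> 0\<close> by (intro Max_in fin) auto
    hence j: "j < n" "l j \<noteq> 0" by auto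
    have above: "l k = 0" if "j < k" "k < n" for k
      using Max_ge[OF fin, of k] that unfolding j_def by fastforce
    have "0 = pair (\<lambda>k. \<Sum>i<n. l i * g i k) (d j)" by (simp add: l pair_def)
    also have "\<dots> = (\<Sum>i<n. l i * pair (g i) (d j))"
      unfolding pair_def sum_distrib_left sum_distrib_right by (subst sum.swap) (simp add: mult_ac)
    also have "\<dots> = (\<Sum>i\<in>{j}. l i * pair (g i) (d j))"
    proof (intro sum.mono_neutral_right ballI)
      fix i assume "i \<in> {..<n} - {j}"
      thus "l i * pair (g i) (d j) = 0" using low[of i j] above[of i] j(1) by (cases "i < j") auto
    qed (use j in auto)
    finally show False using diag[OF j(1)] j(2) by simp
  qed
  show inj: "inj_on g {..<n}"
  proof (rule inj_onI, rule ccontr)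
    fix i j assume ij: "i \<in> {..<n}" "j \<in> {..<n}" "g i = g j" "i \<noteq> j"
    define l where "l = (\<lambda>k. if k = i then 1 else if k = j then -1 else (0::'k))"
    have "(\<Sum>m<n. l m * g m k) = (\<Sum>m\<in>{i, j}. l m * g m k)" for k
      using ij by (intro sum.mono_neutral_right) (auto simp: l_def)
    hence "(\<Sum>m<n. l m * g m k) = 0" for k using ij by (simp add: l_def)
    from main[OF this, of i] ij show False by (simp add: l_def)
  qed
  show "coord.independent (g ` {..<n})"
  proof (rule coord.independent_if_scalars_zero)
    fix f x assume f: "(\<Sum>x\<in>g ` {..<n}. (\<lambda>i. f x * x i)) = 0" and x: "x \<in> g ` {..<n}"
    obtain i where i: "i < n" "x = g i" using x by auto
    have "(\<Sum>i<n. f (g i) * g i k) = 0" for k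
    proof -
      have "(\<Sum>x\<in>g ` {..<n}. (\<lambda>i. f x * x i)) k = 0" using f by simp
      moreover have "(\<Sum>x\<in>A. (\<lambda>i. f x * x i)) k = (\<Sum>x\<in>A. f x * x k)" for A
        by (induction A rule: infinite_finite_induct) auto
      ultimately have "(\<Sum>x\<in>g ` {..<n}. f x * x k) = 0" by simp
      thus ?thesis unfolding sum.reindex[OF inj] by simp
    qed
    from main[OF this i(1)] show "f x = 0" using i(2) by simp
  qed auto
qed

lemma poly_eqI_inf: "infinite (UNIV :: 'k set) \<Longrightarrow> (\<And>t. poly f t = poly g t) \<Longrightarrow> f = (g :: 'k::field poly)"
proof (rule ccontr)
  assume inf: "infinite (UNIV :: 'k set)" and e: "\<And>t. poly f t = poly g t" and "f \<noteq> g"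
  hence "finite {t. poly (f - g) t = 0}" by (intro poly_roots_finite) auto
  moreover have "{t. poly (f - g) t = 0} = UNIV" using e by auto
  ultimately show False using inf by simp
qed

text \<open>Gradients are never expanded: over an infinite field the values of f along a
  parametrised curve determine the restriction as a polynomial, and its derivative is the pairing
  with the tangent vector.\<close>

lemma grad_along:
  fixes f :: "'k::field mpoly"
  assumes inf: "infinite (UNIV :: 'k set)" and f: "f \<in> forms UNIV 7 d"
    and g: "\<And>t. mpoly_eval f (\<lambda>i. poly (xs i) t) = poly g t"
  shows "pair (gradient f (\<lambda>i. poly (xs i) t)) (\<lambda>i. poly (pderiv (xs i)) t) = poly (pderiv g) t"
proof -
  have "gev (\<lambda>c. [:c:]) f xs = g" by (rule poly_eqI_inf[OF inf]) (simp add: poly_gev g)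
  thus ?thesis using chain_rule[OF forms_vars[OF f], of xs t] by (simp add: pair_def)
qed

text \<open>The Segre image, scaled by c, of the line through (P, Q, R) with direction w in the
  first coordinates.\<close>

definition mcurve :: "'k::field \<Rightarrow> 'k \<times> 'k \<Rightarrow> 'k \<times> 'k \<Rightarrow> 'k \<times> 'k \<Rightarrow> 'k \<times> 'k \<times> 'k \<Rightarrow> nat \<Rightarrow> 'k poly" where
  "mcurve c P Q R w i = smult c (psi ([:fst P, fst w:], [:snd P:]) ([:fst Q, fst (snd w):], [:snd Q:])
     ([:fst R, snd (snd w):], [:snd R:]) i)"

lemma poly_mcurve: "poly (mcurve c P Q R w i) t =
    c * psi (fst P + t * fst w, snd P) (fst Q + t * fst (snd w), snd Q) (fst R + t * snd (snd w), snd R) i"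
  by (simp add: mcurve_def psi_def sel_def)

definition tg :: "'k::field \<Rightarrow> 'k \<times> 'k \<Rightarrow> 'k \<times> 'k \<Rightarrow> 'k \<times> 'k \<Rightarrow> 'k \<times> 'k \<times> 'k \<Rightarrow> nat \<Rightarrow> 'k" where
  "tg c P Q R w i = poly (pderiv (mcurve c P Q R w i)) 0"

lemma grad_tg:
  fixes f :: "'k::field mpoly"
  assumes inf: "infinite (UNIV :: 'k set)" and f: "f \<in> forms UNIV 7 d"
    and g: "\<And>t. mpoly_eval f (\<lambda>i. c * psi (fst P + t * fst w, snd P) (fst Q + t * fst (snd w), snd Q) (fst R + t * snd (snd w), snd R) i) = poly g t"
  shows "pair (gradient f (\<lambda>i. c * psi P Q R i)) (tg c P Q R w) = poly (pderiv g) 0"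
  using grad_along[OF inf f, of "mcurve c P Q R w" g 0] g unfolding tg_def[abs_def] by (simp add: poly_mcurve)

lemma quad_tg:
  assumes inf: "infinite (UNIV :: 'k::field set)" and f: "f \<in> segre_quads"
  shows "pair (gradient f (\<lambda>i. c * psi P Q R i)) (tg c P Q R w) = (0::'k)"
proof -
  have "f \<in> forms UNIV 7 2" using segre_quads_forms[of UNIV] f by blast
  from grad_tg[OF inf this, of c P w Q R 0] show ?thesis using segre_quads_psi[OF f] by simp
qed

definition unitv :: "nat \<Rightarrow> nat \<Rightarrow> 'k::field" where "unitv m i = (if i = m then 1 else 0)"

lemma quad_unitv:
  assumes inf: "infinite (UNIV :: 'k::field set)" and "i \<le> 7" "j \<le> 7" "k \<le> 7" "l \<le> 7"
  shows "pair (gradient (quad i j k l) x) (unitv m) =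
    (x i * unitv m j + unitv m i * x j - x k * unitv m l - unitv m k * x l :: 'k)"
proof -
  let ?xs = "\<lambda>i. [:x i, unitv m i:]"
  have "quad i j k l \<in> forms UNIV 7 2" using assms by (intro forms_quad) auto
  hence "pair (gradient (quad i j k l) (\<lambda>i. poly (?xs i) 0)) (\<lambda>i. poly (pderiv (?xs i)) 0)
      = poly (pderiv (?xs i * ?xs j - ?xs k * ?xs l)) 0"
    by (rule grad_along[OF inf]) (simp add: algebra_simps)
  thus ?thesis by (simp add: pderiv_mult pderiv_diff pderiv_pCons)
qed

lemma nrm_pivot: "nrm P \<Longrightarrow> sel (snd P = 0) P = 1" by (auto simp: nrm_def sel_def)

text \<open>The pairings form a triangular matrix. The four coordinates that differ from the pivot
  in at least two digits detect four quadrics, each with derivative c. All quadrics annihilate the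
  tangent vectors of the Segre threefold, so v and w detect f and g independently of them, which
  makes six.\<close>

lemma segre_rank:
  fixes f g :: "'k::field mpoly"
  assumes inf: "infinite (UNIV :: 'k set)" and c: "c \<noteq> 0" and n: "nrm P" "nrm Q" "nrm R"
    and x_def: "x = (\<lambda>i. c * psi P Q R i)"
    and S: "\<And>f. f \<in> segre_quads \<Longrightarrow> gradient f x \<in> S" "gradient f x \<in> S" "gradient g x \<in> S"
    and fg: "pair (gradient f x) (tg c P Q R v) \<noteq> 0" "pair (gradient f x) (tg c P Q R w) = 0"
      "pair (gradient g x) (tg c P Q R w) \<noteq> 0"
  shows "\<exists>T\<subseteq>S. finite T \<and> coord.independent T \<and> card T = 6"
proof -
  define s1 s2 s3 where "s1 = (snd P = 0)" and "s2 = (snd Q = 0)" and "s3 = (snd R = 0)"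
  have xb: "x (ix s1 s2 s3) = c" unfolding x_def s1_def s2_def s3_def using n by (simp add: nrm_pivot)
  let ?b = "ix s1 s2 s3" and ?k0 = "ix (\<not> s1) (\<not> s2) s3" and ?k1 = "ix (\<not> s1) s2 (\<not> s3)"
    and ?k2 = "ix s1 (\<not> s2) (\<not> s3)" and ?k3 = "ix (\<not> s1) (\<not> s2) (\<not> s3)"
    and ?n1 = "ix (\<not> s1) s2 s3" and ?n2 = "ix s1 (\<not> s2) s3" and ?n3 = "ix s1 s2 (\<not> s3)"
  define q0 :: "'k mpoly" where "q0 = quad ?b ?k0 ?n1 ?n2"
  define q1 :: "'k mpoly" where "q1 = quad ?b ?k1 ?n1 ?n3"
  define q2 :: "'k mpoly" where "q2 = quad ?b ?k2 ?n2 ?n3"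
  define q3 :: "'k mpoly" where "q3 = quad ?b ?k3 ?n1 ?k2"
  have sq: "q0 \<in> segre_quads" "q1 \<in> segre_quads" "q2 \<in> segre_quads" "q3 \<in> segre_quads"
    unfolding segre_quads_def q0_def q1_def q2_def q3_def by blast+
  have tq: "pair (gradient h x) (tg c P Q R y) = 0" if "h \<in> segre_quads" for h y
    unfolding x_def by (rule quad_tg[OF inf that])
  define gs where "gs = (\<lambda>i. [gradient q0 x, gradient q1 x, gradient q2 x, gradient q3 x, gradient f x, gradient g x] ! i)"
  define ds where "ds = (\<lambda>i. [unitv ?k0, unitv ?k1, unitv ?k2, unitv ?k3, tg c P Q R v, tg c P Q R w] ! i)"
  have gsv: "gs 0 = gradient q0 x" "gs (Suc 0) = gradient q1 x" "gs 2 = gradient q2 x" "gs 3 = gradient q3 x"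
      "gs 4 = gradient f x" "gs 5 = gradient g x"
    and dsv: "ds 0 = unitv ?k0" "ds (Suc 0) = unitv ?k1" "ds 2 = unitv ?k2" "ds 3 = unitv ?k3"
      "ds 4 = tg c P Q R v" "ds 5 = tg c P Q R w"
    by (simp_all add: gs_def ds_def)
  have six: "i < 6 \<Longrightarrow> i = 0 \<or> i = 1 \<or> i = 2 \<or> i = 3 \<or> i = 4 \<or> i = (5::nat)" for i by auto
  have low: "pair (gs i) (ds j) = 0" if "i < j" "j < 6" for i j
    using six[OF less_trans[OF that]] six[OF that(2)] that
    by (elim disjE) (simp_all add: gsv dsv tq sq fg q0_def q1_def q2_def q3_def quad_unitv[OF inf]
       tq[OF sq(1), unfolded q0_def] tq[OF sq(2), unfolded q1_def] tq[OF sq(3), unfolded q2_def] tq[OF sq(4), unfolded q3_def],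
       simp_all add: unitv_def)
  have diag: "pair (gs i) (ds i) \<noteq> 0" if "i < 6" for i
    using six[OF that] c xb
    by (elim disjE) (simp_all add: gsv dsv fg q0_def q1_def q2_def q3_def quad_unitv[OF inf], simp_all add: unitv_def)
  have "gs ` {..<6} \<subseteq> S" using six S sq gsv by fastforce
  moreover have "inj_on gs {..<6}" "coord.independent (gs ` {..<6})"
    using triangular_independent[where g = gs and d = ds and n = 6] low diag by blast+
  ultimately show ?thesis by (intro exI[of _ "gs ` {..<6}"]) (auto simp: card_image)
qed

lemma (in vector_space) dim_eqI:
  assumes T: "T \<subseteq> S" "finite T" "independent T" "card T = n"
    and up: "\<And>B. B \<subseteq> S \<Longrightarrow> finite B \<Longrightarrow> card B = Suc n \<Longrightarrow> \<not> independent B"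
  shows "dim S = n"
proof -
  obtain B where B: "B \<subseteq> S" "independent B" "S \<subseteq> local.span B" "card B = dim S" using basis_exists[of S] by blast
  have small: "finite B \<and> card B \<le> n"
  proof (rule ccontr)
    assume "\<not> ?thesis"
    hence "\<exists>B'\<subseteq>B. finite B' \<and> card B' = Suc n"
      by (metis infinite_arbitrarily_large not_less_eq_eq obtain_subset_with_card_n finite_subset)
    then obtain B' where B': "B' \<subseteq> B" "finite B'" "card B' = Suc n" by blast
    thus False using up[of B'] B(1) independent_mono[OF B(2) B'(1)] by blast
  qed
  have "T \<subseteq> local.span B" using T(1) B(3) by blast
  hence "card T \<le> card B" using independent_span_bound[of B T] small T(3) by blast
  thus ?thesis using small T(4) B(4) by simp
qed

lemma cls_psi_inj:
  assumes "cls (psi (x, 1) (y, 1) (z, 1)) = cls (psi (x', 1) (y', 1) (z', 1 :: 'k::field))"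
  shows "x = x' \<and> y = y' \<and> z = z'"
proof -
  have "psi (x, 1) (y, 1) (z, 1) \<in> cls (psi (x', 1) (y', 1) (z', 1))" using assms cls_self by blast
  then obtain c where c: "psi (x, 1) (y, 1) (z, 1) = (\<lambda>i. c * psi (x', 1) (y', 1) (z', 1) i)" by (auto simp: cls_def)
  have *: "sel s1 (x, 1) * sel s2 (y, 1) * sel s3 (z, 1) = c * (sel s1 (x', 1) * sel s2 (y', 1) * sel s3 (z', 1))" for s1 s2 s3
    using fun_cong[OF c, of "ix s1 s2 s3"] by simp
  show ?thesis using *[of False False False] *[of True False False] *[of False True False] *[of False False True]
    by (simp add: sel_def)
qed

lemma psi_vecs: assumes "nrm P" "nrm Q" "nrm R" "c \<noteq> 0" shows "(\<lambda>i. c * psi P Q R i) \<in> vecs 7"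
proof -
  have "psi P Q R (ix (snd P = 0) (snd Q = 0) (snd R = 0)) = 1" using assms by (simp add: nrm_pivot)
  thus ?thesis using assms(4) unfolding vecs_def
    by (auto simp: psi_def[of P Q R] intro!: exI[of _ "ix (snd P = 0) (snd Q = 0) (snd R = 0)"])
qed

section \<open>The projective curve\<close>

definition th2 :: "nat \<Rightarrow> nat \<Rightarrow> 'k::field poly poly \<Rightarrow> 'k \<times> 'k \<Rightarrow> 'k \<times> 'k \<Rightarrow> 'k" where
  "th2 l m g P Q = (\<Sum>i\<le>l. \<Sum>j\<le>m. coeff (coeff g j) i *
     (fst P ^ i * snd P ^ (l - i) * (fst Q ^ j * snd Q ^ (m - j))))"

lemma th_th2: "th l m n f P Q R = (\<Sum>k\<le>n. th2 l m (coeff f k) P Q * (fst R ^ k * snd R ^ (n - k)))"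
proof -
  have "th l m n f P Q R = (\<Sum>i\<le>l. \<Sum>k\<le>n. \<Sum>j\<le>m. coeff (coeff (coeff f k) j) i *
     (fst P ^ i * snd P ^ (l - i) * (fst Q ^ j * snd Q ^ (m - j)) * (fst R ^ k * snd R ^ (n - k))))"
    unfolding th_def by (rule sum.cong[OF refl], rule sum.swap)
  also have "\<dots> = (\<Sum>k\<le>n. \<Sum>i\<le>l. \<Sum>j\<le>m. coeff (coeff (coeff f k) j) i *
     (fst P ^ i * snd P ^ (l - i) * (fst Q ^ j * snd Q ^ (m - j)) * (fst R ^ k * snd R ^ (n - k))))"
    by (rule sum.swap)
  finally show ?thesis by (simp add: th2_def sum_distrib_right mult.assoc)
qed

lemma th2_simps [simp]: "th2 l m 0 P Q = 0" "th2 l m (- g) P Q = - th2 l m g P Q"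
  "th2 l m (g - h) P Q = th2 l m g P Q - th2 l m h P Q"
  by (simp_all add: th2_def sum_negf sum_subtractf left_diff_distrib)

lemma th2_affine: assumes "degree g \<le> m" "dx g l" shows "th2 l m g (x, 1) (y, 1) = ev2 g x y"
proof -
  have "tdeg [:g:] l m 0" using assms by (auto simp: tdeg_def coeff_pCons split: nat.split)
  from th_affine[OF this, of x y 0] show ?thesis by (simp add: th_th2)
qed

definition hom1 :: "nat \<Rightarrow> 'k::field poly \<Rightarrow> 'k \<times> 'k \<Rightarrow> 'k" where
  "hom1 l h P = (\<Sum>i\<le>l. coeff h i * (fst P ^ i * snd P ^ (l - i)))"

lemma hom1_affine: "degree h \<le> l \<Longrightarrow> hom1 l h (x, 1) = poly h x"
  by (simp add: hom1_def poly_bound)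

lemma hom1_infinity: "hom1 l h (1, 0) = coeff h l" for h :: "'k::field poly"
proof -
  have "hom1 l h (1, 0) = (\<Sum>i\<in>{l}. coeff h i * (fst (1, 0 :: 'k) ^ i * snd (1 :: 'k, 0) ^ (l - i)))"
    unfolding hom1_def by (rule sum.mono_neutral_right) auto
  thus ?thesis by simp
qed

lemma th2_prod: "th2 l m (smult h (lift g)) P Q = hom1 l h P * hom1 m g Q"
  unfolding th2_def hom1_def sum_product
  by (intro sum.cong refl) (simp add: coeff_map_poly mult_ac)

lemma th2_const: "th2 l m [:h:] P Q = hom1 l h P * snd Q ^ m"
proof -
  have "th2 l m [:h:] P Q = (\<Sum>i\<le>l. \<Sum>j\<in>{0}. coeff (coeff [:h:] j) i *
     (fst P ^ i * snd P ^ (l - i) * (fst Q ^ j * snd Q ^ (m - j))))"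
    unfolding th2_def by (rule sum.cong[OF refl], rule sum.mono_neutral_right) (auto simp: coeff_pCons split: nat.split)
  thus ?thesis by (simp add: hom1_def sum_distrib_right mult.assoc)
qed

locale curve_fq = curve E G B H N u p D e a b + fq_closure q c ty
  for E G B H N :: "'k::alg_closed_field poly" and u p D e a b q c and ty :: "'k itself" +
  assumes rational: "fqpoly E" "fqpoly G" "fqpoly B" "fqpoly H" "fqpoly N" "\<And>i j. u i j \<in> Fq q"
begin

definition ap :: "'k \<Rightarrow> 'k \<Rightarrow> 'k \<Rightarrow> nat \<Rightarrow> 'k" where "ap x y z = psi (x, 1) (y, 1) (z, 1)"

definition SV :: "'k mpoly set" where
  "SV = {f \<in> (\<Union>d. forms (Fq q) 7 d). \<forall>x y z. (x, y, z) \<in> X0 \<longrightarrow> mpoly_eval f (ap x y z) = 0}"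

text \<open>The closure of the affine curve is cut out by all forms over the small field vanishing on it; by
  Galois descent every form over K vanishing on X0 vanishes on V.\<close>
definition V :: "'k proj_point set" where "V = zero_locus 7 SV"

lemma Fq_closed: "(0::'k) \<in> Fq q" "(1::'k) \<in> Fq q" "-1 \<in> (Fq q :: 'k set)"
   "x \<in> Fq q \<Longrightarrow> y \<in> Fq q \<Longrightarrow> x + y \<in> (Fq q :: 'k set)"
  using FF_0[of 1] FF_1[of 1] FF_minus[of 1 1] FF_add[of x 1 y] by simp_all

lemma U_frob: "U (x ^ q) (y ^ q) = U x y ^ q"
proof -
  have fq: "u i j ^ q = u i j" for i j using rational(6)[of i j] by (simp add: Fq_def)
  have "U x y ^ q = (\<Sum>i\<le>a. (\<Sum>j\<le>b. u i j * x ^ i * y ^ j) ^ q)"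
    unfolding U_def using fr_sum[of _ _ 1] by simp
  also have "\<dots> = (\<Sum>i\<le>a. \<Sum>j\<le>b. (u i j * x ^ i * y ^ j) ^ q)"
    by (rule sum.cong[OF refl]) (use fr_sum[of _ _ 1] in simp)
  also have "\<dots> = U (x ^ q) (y ^ q)"
    unfolding U_def by (simp add: power_mult_distrib fq power_mult[symmetric] mult.commute)
  finally show ?thesis ..
qed

lemma X0_frob: "(x ^ q, y ^ q, z ^ q) \<in> X0 \<longleftrightarrow> (x, y, z) \<in> X0"
proof -
  have pf: "poly f (x ^ q) = poly f x ^ q" if "fqpoly f" for f x using poly_fr[OF that, of x 1] by simp
  have inj: "x ^ q = y ^ q \<longleftrightarrow> x = y" for x y :: 'k using fr_inj[of x 1 y] by auto
  have d: "(z ^ q) ^ p - z ^ q = (z ^ p - z) ^ q"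
    using fr_diff[of "z ^ p" z 1] by (simp add: power_mult[symmetric] mult.commute)
  have "poly E (x ^ q) * poly B (y ^ q) = poly G (x ^ q) \<longleftrightarrow> poly E x * poly B y = poly G x"
    unfolding pf[OF rational(1)] pf[OF rational(2)] pf[OF rational(3)] power_mult_distrib[symmetric] inj ..
  moreover have "poly H (x ^ q) * poly N (y ^ q) * ((z ^ q) ^ p - z ^ q) = U (x ^ q) (y ^ q)
      \<longleftrightarrow> poly H x * poly N y * (z ^ p - z) = U x y"
    unfolding pf[OF rational(4)] pf[OF rational(5)] U_frob d power_mult_distrib[symmetric] inj ..
  ultimately show ?thesis by (simp add: X0_def)
qed

lemma frob_surj: "\<exists>y::'k. y ^ q = x"
proof -
  obtain k where k: "k \<ge> 1" "x ^ (q ^ k) = x" using algebraic by blast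
  have "(x ^ (q ^ (k - 1))) ^ q = x ^ (q ^ Suc (k - 1))" by (simp add: power_mult[symmetric] mult.commute)
  thus ?thesis using k by (intro exI[of _ "x ^ (q ^ (k - 1))"]) simp
qed

lemma mnl_power: "mnl m (\<lambda>i. xs i ^ n) = mnl m xs ^ n"
  by (simp add: mnl_def prod_power_distrib power_mult[symmetric] mult.commute)

text \<open>\<open>descent\<close> is applied to the coefficients of f, with the monomials of f as
  index set and W the vectors of their values on the affine curve. W is Frobenius stable because the
  equations lie over the small field, so a form over K not vanishing at x would give one over the
  small field, contrary to the definition of V.\<close>

lemma form_ext:
  assumes f: "f \<in> forms UNIV 7 d" and van: "\<And>x y z. (x, y, z) \<in> X0 \<Longrightarrow> mpoly_eval f (ap x y z) = 0"
    and P: "P \<in> V" "x \<in> P"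
  shows "mpoly_eval f x = 0"
proof (rule ccontr)
  assume nz: "mpoly_eval f x \<noteq> 0"
  define W where "W = {\<lambda>m. mnl m (ap x y z) | x y z. (x, y, z) \<in> X0}"
  have st: "\<exists>w'\<in>W. \<forall>m\<in>Poly_Mapping.keys f. w m = w' m ^ q" if "w \<in> W" for w
  proof -
    obtain x y z where xyz: "(x, y, z) \<in> X0" "w = (\<lambda>m. mnl m (ap x y z))" using \<open>w \<in> W\<close> unfolding W_def by blast
    obtain x' y' z' where r: "x' ^ q = x" "y' ^ q = y" "z' ^ q = z" using frob_surj by metis
    have "ap x y z = (\<lambda>i. ap x' y' z' i ^ q)"
      using q_pos by (auto simp: ap_def psi_def sel_def r[symmetric] power_mult_distrib fun_eq_iff)
    hence "w m = mnl m (ap x' y' z') ^ q" for m unfolding xyz(2) by (simp add: mnl_power)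
    moreover have "(x', y', z') \<in> X0" using xyz(1) X0_frob[of x' y' z'] r by simp
    moreover from this have "(\<lambda>m. mnl m (ap x' y' z')) \<in> W" unfolding W_def by blast
    ultimately show ?thesis by (intro bexI[of _ "\<lambda>m. mnl m (ap x' y' z')"] ballI)
  qed
  have ev: "mpoly_eval f y = (\<Sum>m\<in>Poly_Mapping.keys f. Poly_Mapping.lookup f m * mnl m y)" for y
    by (simp add: mpoly_eval_gev gev_def)
  have "\<exists>b. (\<forall>i\<in>Poly_Mapping.keys f. b i \<in> Fq q) \<and> (\<forall>w\<in>W. (\<Sum>i\<in>Poly_Mapping.keys f. b i * w i) = 0) \<and>
      (\<Sum>i\<in>Poly_Mapping.keys f. b i * mnl i x) \<noteq> 0"
    by (rule descent[where a = "Poly_Mapping.lookup f"]) (use st nz van in \<open>auto simp: W_def ev\<close>)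
  then obtain \<beta> where \<beta>: "\<And>i. i \<in> Poly_Mapping.keys f \<Longrightarrow> \<beta> i \<in> Fq q"
    "\<And>w. w \<in> W \<Longrightarrow> (\<Sum>i\<in>Poly_Mapping.keys f. \<beta> i * w i) = 0"
    "(\<Sum>i\<in>Poly_Mapping.keys f. \<beta> i * mnl i x) \<noteq> 0" by blast
  define g where "g = (\<Sum>m\<in>Poly_Mapping.keys f. Poly_Mapping.single m (\<beta> m))"
  have evg: "mpoly_eval g y = (\<Sum>m\<in>Poly_Mapping.keys f. \<beta> m * mnl m y)" for y
    by (simp add: g_def mpoly_eval_sum mpoly_eval_single)
  have "g \<in> forms (Fq q) 7 d" unfolding g_def
    using f \<beta>(1) Fq_closed(4) by (intro forms_sum forms_single) (auto simp: forms_def mdeg_def)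
  moreover have "mpoly_eval g (ap x y z) = 0" if "(x, y, z) \<in> X0" for x y z
    unfolding evg by (rule \<beta>(2)) (use that in \<open>auto simp: W_def\<close>)
  ultimately have "g \<in> SV" unfolding SV_def by blast
  hence "mpoly_eval g x = 0" using P by (auto simp: V_def zero_locus_def)
  thus False using \<beta>(3) by (simp add: evg)
qed

lemma SV_forms: "SV \<subseteq> (\<Union>d. forms (Fq q) 7 d)" by (auto simp: SV_def)

lemma V_closed: "closed_over (Fq q) 7 V" "closed_over UNIV 7 V"
proof -
  show "closed_over (Fq q) 7 V" unfolding closed_over_def V_def
    by (intro exI[of _ SV] conjI SV_forms refl)
  have "(\<Union>d. forms (Fq q) 7 d) \<subseteq> (\<Union>d. forms UNIV 7 d :: 'k mpoly set)"
    by (intro UN_mono forms_mono) auto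
  hence "SV \<subseteq> (\<Union>d. forms UNIV 7 d)" by (rule subset_trans[OF SV_forms])
  thus "closed_over UNIV 7 V" unfolding closed_over_def V_def by (intro exI[of _ SV] conjI refl)
qed

lemma V_sub: "V \<subseteq> proj_space 7" using closed_sub[OF V_closed(2)] .

lemma cls_ap: assumes "(x, y, z) \<in> X0" shows "cls (ap x y z) \<in> V" "ap x y z \<in> cls (ap x y z)"
proof -
  have "ap x y z \<in> vecs 7" using psi_vecs[of "(x, 1)" "(y, 1)" "(z, 1)" 1] by (simp add: nrm_def ap_def)
  hence "cls (ap x y z) \<in> proj_space 7" unfolding proj_space_eq by (rule imageI)
  moreover have "\<forall>f\<in>SV. mpoly_eval f (ap x y z) = 0" using assms unfolding SV_def by blast
  ultimately show "cls (ap x y z) \<in> V" unfolding V_def cls_in_zero_locus[OF SV_forms] by (rule conjI)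
qed (rule cls_self)

lemma quads_SV: "segre_quads \<subseteq> SV"
proof -
  have "segre_quads \<subseteq> (forms (Fq q) 7 2 :: 'k mpoly set)" by (rule segre_quads_forms) (auto intro: Fq_closed)
  moreover have "mpoly_eval f (ap x y z) = 0" if "f \<in> segre_quads" for f and x y z :: 'k
    using segre_quads_psi[OF that, of 1] by (simp add: ap_def)
  ultimately show ?thesis unfolding SV_def by (intro subsetI CollectI conjI UN_I[OF UNIV_I] allI impI) auto
qed

lemma V_decompose:
  assumes "P0 \<in> V" "x \<in> P0"
  shows "\<exists>c P Q R. c \<noteq> 0 \<and> nrm P \<and> nrm Q \<and> nrm R \<and> x = (\<lambda>i. c * psi P Q R i)"
proof (rule segre_decompose)
  show "x \<in> vecs 7" using proj_space_mem[of P0 7 x] assms V_sub by blast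
  show "mpoly_eval f x = 0" if "f \<in> segre_quads" for f
    using that quads_SV assms by (auto simp: V_def zero_locus_def)
qed

text \<open>The chart of (P, Q, R) decides how the local equation is raised to a form of equal
  degrees. The form depends on the point, and near it restricts to the local equation up to a power
  of the scaling.\<close>

lemma local_form:
  assumes f: "tdeg f l m n" and van: "\<And>x y z. (x, y, z) \<in> X0 \<Longrightarrow> ev3 f x y z = 0"
    and n: "nrm P" "nrm Q" "nrm R"
  shows "\<exists>F s. F \<in> vanishing_forms 7 V s \<and> (\<forall>c P' Q' R'. moves P P' \<longrightarrow> moves Q Q' \<longrightarrow> moves R R' \<longrightarrow>
     mpoly_eval F (\<lambda>i. c * psi P' Q' R' i) = c ^ s * th l m n f P' Q' R')"
proof -
  define s where "s = max l (max m n)"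
  have s: "l \<le> s" "m \<le> s" "n \<le> s" by (auto simp: s_def)
  define F where "F = hform s (sh (cor s l P) (cor s m Q) (cor s n R) f)"
  have F: "F \<in> forms UNIV 7 s" unfolding F_def by (rule hform_forms) auto
  have "mpoly_eval F (ap x y z) = 0" if "(x, y, z) \<in> X0" for x y z
    unfolding F_def ap_def hform_psi th_affine[OF sh_tdeg[OF f s]] using van[OF that] by simp
  hence "F \<in> vanishing_forms 7 V s" unfolding vanishing_forms_def using F form_ext[OF F] by blast
  moreover have "mpoly_eval F (\<lambda>i. k * psi P' Q' R' i) = k ^ s * th l m n f P' Q' R'"
    if "moves P P'" "moves Q Q'" "moves R R'" for k P' Q' R'
    unfolding forms_homogeneous[OF F] by (simp add: F_def hform_psi th_sh[OF f s that])
  ultimately show ?thesis by blast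
qed

lemma moves_refl: "nrm P \<Longrightarrow> moves P P" by (simp add: moves_def)

lemma th_vanish:
  assumes f: "tdeg f l m n" and van: "\<And>x y z. (x, y, z) \<in> X0 \<Longrightarrow> ev3 f x y z = 0"
    and n: "nrm P" "nrm Q" "nrm R" and c: "k \<noteq> 0" "P0 \<in> V" "(\<lambda>i. k * psi P Q R i) \<in> P0"
  shows "th l m n f P Q R = 0"
proof -
  obtain F s where F: "F \<in> vanishing_forms 7 V s"
    "mpoly_eval F (\<lambda>i. k * psi P Q R i) = k ^ s * th l m n f P Q R"
    using local_form[OF f van n] moves_refl n by metis
  have "mpoly_eval F (\<lambda>i. k * psi P Q R i) = 0" using F(1) c(2,3) by (auto simp: vanishing_forms_def)
  thus ?thesis using F(2) c(1) by simp
qed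

lemma tdeg_F1: "tdeg [:F1:] D e 0" using dx_F1 deg_F1
  by (auto simp: tdeg_def coeff_pCons split: nat.split)

lemma tdeg_F2: "tdeg F2 a b p"
  using deg_F2 dx_HN2 dx_U2 by (auto simp: tdeg_def coeff_F2 dx_def)

lemma th_F1: "th D e 0 [:F1:] P Q R = hom1 D E P * hom1 e B Q - hom1 D G P * snd Q ^ e"
  by (simp add: th_th2 F1_def th2_prod th2_const)

lemma th_F2: "th a b p F2 P Q R =
  hom1 a H P * hom1 b N Q * (fst R ^ p - fst R * snd R ^ (p - 1)) - th2 a b U2 P Q * snd R ^ p"
proof -
  have "th a b p F2 P Q R = (\<Sum>k\<in>{0, 1, p}. th2 a b (coeff F2 k) P Q * (fst R ^ k * snd R ^ (p - k)))"
    unfolding th_th2 using p2 by (intro sum.mono_neutral_right) (auto simp: coeff_F2)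
  also have "\<dots> = th2 a b HN2 P Q * (fst R ^ p - fst R * snd R ^ (p - 1)) - th2 a b U2 P Q * snd R ^ p"
    using p2 by (simp add: coeff_F2 algebra_simps)
  finally show ?thesis by (simp add: HN2_def th2_prod)
qed

lemma nrm_cases: assumes "nrm P" obtains x where "P = (x, 1)" | "P = (1, 0)"
  using assms by (cases P) (auto simp: nrm_def)

lemma lc_nz: "coeff E D \<noteq> 0" "coeff H a \<noteq> 0" "coeff N b \<noteq> 0" "coeff B e = 1" "coeff G D = 0"
  using degE degH degN degB monicB degG by (auto simp: coeff_eq_0)

text \<open>Here z is finite while P or Q may be infinite: the point (P, Q) lies off the branch
  locus and z solves the homogenised equation of the cover.\<close>

definition infinite_case :: "'k \<times> 'k \<Rightarrow> 'k \<times> 'k \<Rightarrow> 'k \<Rightarrow> bool" where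
  "infinite_case P Q z \<longleftrightarrow> hom1 a H P * hom1 b N Q \<noteq> 0 \<and>
     hom1 a H P * hom1 b N Q * (z ^ p - z) = th2 a b U2 P Q"

text \<open>The two homogenised equations are read off at the values 1 and 0. As G has degree below
  D, an infinite x leaves B(y) = 0, and an infinite y leaves E(x) = 0; both at once would contradict
  the leading coefficients of E and B. Where HN is nonzero, the coefficient of z^p excludes an
  infinite z; where HN vanishes, \<open>Unz\<close> excludes a finite one.\<close>

lemma V_cases:
  assumes "P0 \<in> V" "x0 \<in> P0"
  obtains k P Q R where "k \<noteq> 0" "nrm P" "nrm Q" "nrm R" "x0 = (\<lambda>i. k * psi P Q R i)"
    "(\<exists>x y z. P = (x, 1) \<and> Q = (y, 1) \<and> R = (z, 1) \<and> (x, y, z) \<in> X0 \<and> infinite_case P Q z) \<or>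
     (\<exists>x y. P = (x, 1) \<and> Q = (y, 1) \<and> R = (1, 0) \<and> (x, y) \<in> Gam) \<or>
     (\<exists>y z. P = (1, 0) \<and> Q = (y, 1) \<and> R = (z, 1) \<and> poly B y = 0 \<and> infinite_case P Q z) \<or>
     (\<exists>x z. P = (x, 1) \<and> Q = (1, 0) \<and> R = (z, 1) \<and> poly E x = 0 \<and> infinite_case P Q z)"
proof -
  obtain c P Q R where d: "c \<noteq> 0" "nrm P" "nrm Q" "nrm R" "x0 = (\<lambda>i. c * psi P Q R i)"
    using V_decompose[OF assms] by blast
  have e1: "th D e 0 [:F1:] P Q R = 0"
    by (rule th_vanish[OF tdeg_F1 _ d(2-4) d(1) assms(1)]) (use assms(2) d(5) in \<open>auto simp: X0_iff X1_iff simp del: ev2_F1\<close>)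
  have e2: "th a b p F2 P Q R = 0"
    by (rule th_vanish[OF tdeg_F2 _ d(2-4) d(1) assms(1)]) (use assms(2) d(5) in \<open>auto simp: X0_iff simp del: ev3_F2\<close>)
  note h = hom1_affine[of E D] hom1_affine[of G D] hom1_affine[of B e] hom1_affine[of H a] hom1_affine[of N b] hom1_infinity[where 'k = 'k]
  have dg: "degree E \<le> D" "degree G \<le> D" "degree B \<le> e" "degree H \<le> a" "degree N \<le> b"
    using degE degG degB degH degN by auto
  have ic: "infinite_case P Q z" if "R = (z, 1)" "hom1 a H P * hom1 b N Q \<noteq> 0" for z
    using e2 that unfolding th_F2 infinite_case_def by (simp add: algebra_simps)
  have Rf: "\<exists>z. R = (z, 1)" if "hom1 a H P * hom1 b N Q \<noteq> 0"
    using d(4) that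
  proof (cases rule: nrm_cases)
    case 2
    thus ?thesis using e2 that p2 unfolding th_F2 by (simp add: power_0_left)
  qed auto
  have u2: "th2 a b U2 (x, 1) (y, 1) = U x y" for x y
    using th2_affine[OF dx_U2(2) dx_U2(1)] by simp
  show ?thesis
  proof (rule that[OF d])
    show "(\<exists>x y z. P = (x, 1) \<and> Q = (y, 1) \<and> R = (z, 1) \<and> (x, y, z) \<in> X0 \<and> infinite_case P Q z) \<or>
     (\<exists>x y. P = (x, 1) \<and> Q = (y, 1) \<and> R = (1, 0) \<and> (x, y) \<in> Gam) \<or>
     (\<exists>y z. P = (1, 0) \<and> Q = (y, 1) \<and> R = (z, 1) \<and> poly B y = 0 \<and> infinite_case P Q z) \<or>
     (\<exists>x z. P = (x, 1) \<and> Q = (1, 0) \<and> R = (z, 1) \<and> poly E x = 0 \<and> infinite_case P Q z)"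
      using d(2)
    proof (cases rule: nrm_cases)
      case (1 x)
      show ?thesis using d(3)
      proof (cases rule: nrm_cases)
        case y: (1 y)
        have x1: "(x, y) \<in> X1" using e1 1 y dg h unfolding th_F1 by (simp add: X1_def)
        show ?thesis using d(4)
        proof (cases rule: nrm_cases)
          case z: (1 z)
          have x0: "(x, y, z) \<in> X0" using e2 x1 dg h(4,5) unfolding X0_iff th_F2 1 y z u2 by simp
          have "hom1 a H P * hom1 b N Q \<noteq> 0" using X0_HN[OF x0] dg h(4,5) unfolding 1 y by simp
          thus ?thesis using x0 1 y z ic by blast
        next
          case 2
          have "(x, y) \<in> Gam" using e2 x1 dg h(4,5) p2 unfolding Gam_iff th_F2 1 y 2 by (simp add: power_0_left)
          thus ?thesis using 1 y 2 by blast
        qed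
      next
        case 2
        have Ex: "poly E x = 0" using e1 dg h lc_nz curve.e1[OF curve_axioms] unfolding th_F1 1 2
          by (simp add: power_0_left)
        hence "hom1 a H P * hom1 b N Q \<noteq> 0" using HE[of x] dg h(4,6) lc_nz unfolding 1 2 by auto
        thus ?thesis using Rf ic Ex 1 2 by blast
      qed
    next
      case 2
      show ?thesis using d(3)
      proof (cases rule: nrm_cases)
        case y: (1 y)
        have By: "poly B y = 0" using e1 dg h lc_nz unfolding th_F1 2 y by simp
        hence "hom1 a H P * hom1 b N Q \<noteq> 0" using NB[of y] dg h(5,6) lc_nz unfolding 2 y by auto
        thus ?thesis using Rf ic By 2 y by blast
      next
        case q: 2
        have False using e1 h lc_nz unfolding th_F1 2 q by simp
        thus ?thesis ..
      qed
    qed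
  qed
qed

lemma finite_AS: assumes "\<alpha> \<noteq> (0::'k)" shows "finite {z. \<alpha> * (z ^ p - z) = \<beta>}"
proof -
  define g where "g = monom \<alpha> p - monom \<alpha> 1 - [:\<beta>:]"
  have "coeff g p = \<alpha>" using p2 by (simp add: g_def coeff_pCons split: nat.split)
  hence "g \<noteq> 0" using assms by auto
  hence "finite {z. poly g z = 0}" by (rule poly_roots_finite)
  moreover have "poly g z = \<alpha> * (z ^ p - z) - \<beta>" for z by (simp add: g_def poly_monom algebra_simps)
  ultimately show ?thesis by simp
qed

lemma finite_infinite_case: "finite {z. infinite_case P Q z}"
proof (cases "hom1 a H P * hom1 b N Q = 0")
  case True
  thus ?thesis by (simp add: infinite_case_def)
next
  case False
  show ?thesis by (rule finite_subset[OF _ finite_AS[OF False]]) (auto simp: infinite_case_def)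
qed

text \<open>Each of the other cases has finitely many base points and finitely many z above
  each.\<close>

lemma V_finite_rest: "finite (V - {cls (ap x y z) | x y z. (x, y, z) \<in> X0})"
proof -
  define A where "A = (\<lambda>(x, y). cls (psi (x, 1) (y, 1) (1, 0))) ` Gam"
  define A' where "A' = (\<lambda>(y, z). cls (psi (1, 0) (y, 1) (z, 1))) ` (SIGMA y:{y. poly B y = 0}. {z. infinite_case (1, 0) (y, 1) z})"
  define A'' where "A'' = (\<lambda>(x, z). cls (psi (x, 1) (1, 0) (z, 1))) ` (SIGMA x:{x. poly E x = 0}. {z. infinite_case (x, 1) (1, 0) z})"
  have "finite (A \<union> A' \<union> A'')" unfolding A_def A'_def A''_def
    by (intro finite_UnI finite_imageI finite_SigmaI finite_infinite_case card_Gam poly_roots_finite nz)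
  moreover have "V - {cls (ap x y z) | x y z. (x, y, z) \<in> X0} \<subseteq> A \<union> A' \<union> A''"
  proof
    fix P0 assume P0: "P0 \<in> V - {cls (ap x y z) | x y z. (x, y, z) \<in> X0}"
    hence "P0 \<in> proj_space 7" using V_sub by blast
    then obtain x0 where x0: "P0 = cls x0" unfolding proj_space_eq by (elim imageE)
    hence "x0 \<in> P0" by (simp add: cls_self)
    have P0V: "P0 \<in> V" using P0 by blast
    obtain k P Q R where d: "k \<noteq> 0" "nrm P" "nrm Q" "nrm R" "x0 = (\<lambda>i. k * psi P Q R i)"
      "(\<exists>x y z. P = (x, 1) \<and> Q = (y, 1) \<and> R = (z, 1) \<and> (x, y, z) \<in> X0 \<and> infinite_case P Q z) \<or>
     (\<exists>x y. P = (x, 1) \<and> Q = (y, 1) \<and> R = (1, 0) \<and> (x, y) \<in> Gam) \<or>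
     (\<exists>y z. P = (1, 0) \<and> Q = (y, 1) \<and> R = (z, 1) \<and> poly B y = 0 \<and> infinite_case P Q z) \<or>
     (\<exists>x z. P = (x, 1) \<and> Q = (1, 0) \<and> R = (z, 1) \<and> poly E x = 0 \<and> infinite_case P Q z)"
      by (rule V_cases[OF P0V \<open>x0 \<in> P0\<close>])
    have c0: "P0 = cls (psi P Q R)" unfolding x0 d(5) by (rule cls_scale[OF d(1)])
    from d(6) show "P0 \<in> A \<union> A' \<union> A''"
    proof (elim disjE exE conjE)
      fix x y z assume "P = (x, 1)" "Q = (y, 1)" "R = (z, 1)" "(x, y, z) \<in> X0"
      thus ?thesis using P0 c0 by (auto simp: ap_def)
    next
      fix x y assume "P = (x, 1)" "Q = (y, 1)" "R = (1, 0)" "(x, y) \<in> Gam"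
      thus ?thesis unfolding c0 A_def by (intro UnI1 image_eqI[of _ _ "(x, y)"]) auto
    next
      fix y z assume "P = (1, 0)" "Q = (y, 1)" "R = (z, 1)" "poly B y = 0" "infinite_case P Q z"
      thus ?thesis unfolding c0 A'_def by (intro UnI1[OF UnI2] image_eqI[of _ _ "(y, z)"]) auto
    next
      fix x z assume "P = (x, 1)" "Q = (1, 0)" "R = (z, 1)" "poly E x = 0" "infinite_case P Q z"
      thus ?thesis unfolding c0 A''_def by (intro UnI2 image_eqI[of _ _ "(x, z)"]) auto
    qed
  qed
  ultimately show ?thesis by (rule finite_subset[rotated])
qed

text \<open>A form with infinitely many zeros on V has infinitely many on the affine curve, since V
  has few other points. Then \<open>vanish2\<close> makes it vanish on the affine curve and
  \<open>form_ext\<close> on V.\<close>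

lemma V_irreducible: "abs_irreducible 7 V" "has_dimension 7 V 1"
proof -
  have inj: "inj_on (\<lambda>(x, y, z). cls (ap x y z)) X0"
    by (rule inj_onI) (auto simp: ap_def dest: cls_psi_inj)
  have inf: "infinite V"
  proof
    assume "finite V"
    moreover have "(\<lambda>(x, y, z). cls (ap x y z)) ` X0 \<subseteq> V" using cls_ap(1) by auto
    ultimately have "finite X0" using inj inj_on_finite by blast
    thus False using infinite_X0 by simp
  qed
  have dich: "finite {P \<in> V. \<forall>x\<in>P. mpoly_eval f x = 0}"
    if f: "f \<in> forms UNIV 7 d" and nz: "\<exists>P\<in>V. \<exists>x\<in>P. mpoly_eval f x \<noteq> 0" for f d
  proof -
    define Z where "Z = {(x, y, z) \<in> X0. ev3 (dehom f) x y z = 0}"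
    have evd: "ev3 (dehom f) x y z = mpoly_eval f (ap x y z)" for x y z
      using ev3_dehom[OF f] by (simp add: ap_def)
    have "finite Z"
    proof (rule ccontr)
      assume inf: "infinite Z"
      have "mpoly_eval f (ap x y z) = 0" if "(x, y, z) \<in> X0" for x y z
        using vanish2[OF inf, of "dehom f"] that evd by (auto simp: Z_def)
      thus False using form_ext[OF f] nz by blast
    qed
    hence "finite ((\<lambda>(x, y, z). cls (ap x y z)) ` Z \<union> (V - {cls (ap x y z) | x y z. (x, y, z) \<in> X0}))"
      using V_finite_rest by blast
    moreover have "{P \<in> V. \<forall>x\<in>P. mpoly_eval f x = 0} \<subseteq>
      (\<lambda>(x, y, z). cls (ap x y z)) ` Z \<union> (V - {cls (ap x y z) | x y z. (x, y, z) \<in> X0})"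
    proof
      fix P assume P: "P \<in> {P \<in> V. \<forall>x\<in>P. mpoly_eval f x = 0}"
      show "P \<in> (\<lambda>(x, y, z). cls (ap x y z)) ` Z \<union> (V - {cls (ap x y z) | x y z. (x, y, z) \<in> X0})"
      proof (cases "\<exists>x y z. (x, y, z) \<in> X0 \<and> P = cls (ap x y z)")
        case True
        then obtain x y z where xyz: "(x, y, z) \<in> X0" "P = cls (ap x y z)" by blast
        hence "(x, y, z) \<in> Z" using P cls_self[of "ap x y z"] evd by (auto simp: Z_def)
        thus ?thesis using xyz(2) by (intro UnI1 image_eqI[of _ _ "(x, y, z)"]) auto
      next
        case False
        thus ?thesis using P by blast
      qed
    qed
    ultimately show ?thesis by (rule finite_subset[rotated])
  qed
  show "abs_irreducible 7 V" by (rule curve_irreducible_dim(1)[OF V_closed(2) inf]) (rule dich)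
  show "has_dimension 7 V 1" by (rule curve_irreducible_dim(2)[OF V_closed(2) inf]) (rule dich)
qed

end

section \<open>Smoothness\<close>

lemma ex_line1: "\<exists>g. \<forall>t. poly h (x + t * w) = poly g (t::'k::field)"
  by (intro exI[of _ "pcompose h [:x, w:]"]) (simp add: poly_pcompose)

lemma ex_line2: "\<exists>g. \<forall>t. ev2 f (x + t * v) (y + t * w) = poly g (t::'k::field)"
proof (induction f)
  case (pCons h f)
  obtain g where "\<forall>t. ev2 f (x + t * v) (y + t * w) = poly g t" using pCons by blast
  moreover obtain g' where "\<forall>t. poly h (x + t * v) = poly g' t" using ex_line1 by blast
  ultimately show ?case by (intro exI[of _ "g' + [:y, w:] * g"]) (simp add: algebra_simps)
qed (auto intro: exI[of _ 0])

lemma ex_line3: "\<exists>g. \<forall>t. ev3 f (x + t * v) (y + t * w) (z + t * r) = poly g (t::'k::field)"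
proof (induction f)
  case (pCons h f)
  obtain g where "\<forall>t. ev3 f (x + t * v) (y + t * w) (z + t * r) = poly g t" using pCons by blast
  moreover obtain g' where "\<forall>t. ev2 h (x + t * v) (y + t * w) = poly g' t" using ex_line2 by blast
  ultimately show ?case by (intro exI[of _ "g' + [:z, r:] * g"]) (simp add: algebra_simps)
qed (auto intro: exI[of _ 0])

context curve_fq begin

definition lin :: "'k \<Rightarrow> 'k \<Rightarrow> 'k poly" where "lin x w = [:x, w:]"

lemma poly_lin [simp]: "poly (lin x w) t = x + t * w" by (simp add: lin_def)
lemma pderiv_lin [simp]: "pderiv (lin x w) = [:w:]" by (simp add: lin_def pderiv_pCons)

lemma pderiv_frob: "pderiv (lin x w ^ p) = 0"
  using p_def by (simp add: pderiv_power of_nat_CHAR)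

text \<open>A tangent vector of the plane curve lifts, since the derivative of F2 with respect to z is the
  unit -HN.\<close>
lemma tangent:
  assumes X: "(x, y, z) \<in> X0"
  shows "\<exists>v w. (\<forall>s t. (\<forall>i\<le>7. s * v i + t * w i = 0) \<longrightarrow> s = 0 \<and> t = 0) \<and>
    (\<forall>f d. f \<in> vanishing_forms 7 V d \<longrightarrow> pair (gradient f (ap x y z)) v = 0 \<and> pair (gradient f (ap x y z)) w = 0)"
proof -
  define wx where "wx = - (poly E x * poly (pderiv B) y)"
  define wy where "wy = poly (pderiv E) x * poly B y - poly (pderiv G) x"
  have xy: "poly E x * poly B y = poly G x" and F20: "poly H x * poly N y * (z ^ p - z) = U x y" using X by (auto simp: X0_def)
  have wnz: "wx \<noteq> 0 \<or> wy \<noteq> 0" using smooth1[OF xy] by (auto simp: wx_def wy_def)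
  define F1l where "F1l = pcompose E (lin x wx) * pcompose B (lin y wy) - pcompose G (lin x wx)"
  have F1l: "poly F1l t = ev2 F1 (x + t * wx) (y + t * wy)" for t by (simp add: F1l_def poly_pcompose)
  have F1l0: "poly F1l 0 = 0" "poly (pderiv F1l) 0 = 0"
    using xy by (simp_all add: F1l_def poly_pcompose pderiv_mult pderiv_diff pderiv_pcompose wx_def wy_def algebra_simps)
  obtain Ul where Ul: "\<And>t. ev2 U2 (x + t * wx) (y + t * wy) = poly Ul t" using ex_line2 by metis
  define HNl where "HNl = pcompose H (lin x wx) * pcompose N (lin y wy)"
  have HN0: "poly HNl 0 \<noteq> 0" using X0_HN[OF X] by (simp add: HNl_def poly_pcompose)
  define wz where "wz = (poly (pderiv HNl) 0 * (z ^ p - z) - poly (pderiv Ul) 0) / poly HNl 0"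
  define F2l where "F2l = HNl * (lin z wz ^ p - lin z wz) - Ul"
  have F2l: "poly F2l t = ev3 F2 (x + t * wx) (y + t * wy) (z + t * wz)" for t
    using Ul[of t] by (simp add: F2l_def HNl_def poly_pcompose)
  have "poly F2l 0 = 0" using F2l[of 0] F20 by simp
  moreover have "poly (pderiv F2l) 0 = 0"
  proof -
    have "pderiv F2l = pderiv HNl * (lin z wz ^ p - lin z wz) - HNl * [:wz:] - pderiv Ul"
      by (simp add: F2l_def pderiv_mult pderiv_diff pderiv_frob)
    hence "poly (pderiv F2l) 0 = poly (pderiv HNl) 0 * (z ^ p - z) - poly HNl 0 * wz - poly (pderiv Ul) 0" by simp
    thus ?thesis using HN0 by (simp add: wz_def)
  qed
  ultimately have F2l0: "poly F2l 0 = 0" "poly (pderiv F2l) 0 = 0" by blast+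
  define w where "w = tg 1 (x, 1) (y, 1) (z, 1) (wx, wy, wz)"
  have app: "(\<lambda>i. 1 * psi (x, 1) (y, 1) (z, 1) i) = ap x y z" by (simp add: ap_def)
  \<comment> \<open>Two vectors annihilated by all gradients: the position vector, by Euler's
    relation for forms vanishing at the point, and w, because f is a combination of F1 and F2 on the
    affine chart and both vanish to second order along the line with direction w.\<close>
  have ortho: "pair (gradient f (ap x y z)) (ap x y z) = 0 \<and> pair (gradient f (ap x y z)) w = 0"
    if f: "f \<in> vanishing_forms 7 V d" for f d
  proof
    have ff: "f \<in> forms UNIV 7 d" using f by (simp add: vanishing_forms_def)
    have f0: "mpoly_eval f (ap x y z) = 0" if "(x, y, z) \<in> X0" for x y z
      using f cls_ap[OF that] by (auto simp: vanishing_forms_def)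
    have "pair (gradient f (\<lambda>i. poly [:0, ap x y z i:] 1)) (\<lambda>i. poly (pderiv [:0, ap x y z i:]) 1) = poly (pderiv 0) 1"
      by (rule grad_along[OF infinite_K ff])
        (use forms_homogeneous[OF ff, of _ "ap x y z"] f0[OF X] in simp)
    thus "pair (gradient f (ap x y z)) (ap x y z) = 0" by (simp add: pderiv_pCons)
    have evd: "ev3 (dehom f) x y z = mpoly_eval f (ap x y z)" for x y z
      using ev3_dehom[OF ff] by (simp add: ap_def)
    obtain v k where vk: "dehom f - v * F2 = [:F1:] * k"
      using ideal2[OF infinite_X0 order.refl, of "dehom f"] evd f0 by (metis dvdE)
    obtain vl where vl: "\<And>t. ev3 v (x + t * wx) (y + t * wy) (z + t * wz) = poly vl t" using ex_line3 by metis
    obtain kl where kl: "\<And>t. ev3 k (x + t * wx) (y + t * wy) (z + t * wz) = poly kl t" using ex_line3 by metis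
    have eq: "dehom f = v * F2 + [:F1:] * k" using vk by (simp add: algebra_simps)
    have "pair (gradient f (\<lambda>i. 1 * psi (x, 1) (y, 1) (z, 1) i)) w = poly (pderiv (vl * F2l + F1l * kl)) 0"
      unfolding w_def
    proof (rule grad_tg[OF infinite_K ff])
      fix t
      have "mpoly_eval f (ap (x + t * wx) (y + t * wy) (z + t * wz)) = poly (vl * F2l + F1l * kl) t"
        unfolding evd[symmetric] eq by (simp add: vl kl F1l F2l del: ev2_F1 ev3_F2)
      thus "mpoly_eval f (\<lambda>i. 1 * psi (fst (x, 1) + t * fst (wx, wy, wz), snd (x, 1)) (fst (y, 1) + t * fst (snd (wx, wy, wz)), snd (y, 1))
          (fst (z, 1) + t * snd (snd (wx, wy, wz)), snd (z, 1)) i) = poly (vl * F2l + F1l * kl) t"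
        by (simp add: ap_def)
    qed
    thus "pair (gradient f (ap x y z)) w = 0" unfolding app using F1l0 F2l0 by (simp add: pderiv_mult pderiv_add)
  qed
  have indep: "s = 0 \<and> t = 0" if st: "\<forall>i\<le>7. s * ap x y z i + t * w i = 0" for s t
  proof -
    have st': "s * ap x y z (ix s1 s2 s3) + t * w (ix s1 s2 s3) = 0" for s1 s2 s3 using st by simp
    have s0: "s = 0" using st'[of False False False]
      by (simp add: ap_def w_def tg_def mcurve_def sel_def pderiv_pCons one_pCons)
    moreover have "t * wx = 0" using st'[of True False False] s0
      by (simp add: ap_def w_def tg_def mcurve_def sel_def pderiv_pCons one_pCons)
    moreover have "t * wy = 0" using st'[of False True False] s0
      by (simp add: ap_def w_def tg_def mcurve_def sel_def pderiv_pCons one_pCons)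
    ultimately show ?thesis using wnz by auto
  qed
  show ?thesis by (rule exI[of _ "ap x y z"], rule exI[of _ w]) (use ortho indep in blast)
qed

lemma quads_vanishing: "segre_quads \<subseteq> vanishing_forms 7 V 2"
proof -
  have "segre_quads \<subseteq> (forms UNIV 7 2 :: 'k mpoly set)" by (rule segre_quads_forms) auto
  moreover have "mpoly_eval f x = 0" if "f \<in> segre_quads" "P \<in> V" "x \<in> P" for f P x
    using that quads_SV by (auto simp: V_def zero_locus_def)
  ultimately show ?thesis unfolding vanishing_forms_def by (intro subsetI CollectI conjI ballI) auto
qed

text \<open>To first order F is r times the local equation f along all lines that move finite
  coordinates only.\<close>

definition lgrad :: "'k \<Rightarrow> 'k \<times> 'k \<Rightarrow> 'k \<times> 'k \<Rightarrow> 'k \<times> 'k \<Rightarrow> ('k \<times> 'k \<Rightarrow> 'k \<times> 'k \<Rightarrow> 'k \<times> 'k \<Rightarrow> 'k) \<Rightarrow> 'k mpoly \<Rightarrow> 'k \<Rightarrow> bool" where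
  "lgrad k P Q R f F r \<longleftrightarrow> (\<forall>w g.
     (snd P \<noteq> 1 \<longrightarrow> fst w = 0) \<longrightarrow> (snd Q \<noteq> 1 \<longrightarrow> fst (snd w) = 0) \<longrightarrow> (snd R \<noteq> 1 \<longrightarrow> snd (snd w) = 0) \<longrightarrow>
     (\<forall>t. f (fst P + t * fst w, snd P) (fst Q + t * fst (snd w), snd Q) (fst R + t * snd (snd w), snd R) = poly g t) \<longrightarrow>
     pair (gradient F (\<lambda>i. k * psi P Q R i)) (tg k P Q R w) = r * poly (pderiv g) 0)"

lemma local_gradient:
  assumes f: "tdeg f l m n" and van: "\<And>x y z. (x, y, z) \<in> X0 \<Longrightarrow> ev3 f x y z = 0"
    and n: "nrm P" "nrm Q" "nrm R" and k: "k \<noteq> 0"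
  shows "\<exists>F s r. F \<in> vanishing_forms 7 V s \<and> r \<noteq> 0 \<and> lgrad k P Q R (th l m n f) F r"
proof -
  obtain F s where F: "F \<in> vanishing_forms 7 V s" "\<And>c P' Q' R'. moves P P' \<Longrightarrow> moves Q Q' \<Longrightarrow> moves R R' \<Longrightarrow>
     mpoly_eval F (\<lambda>i. c * psi P' Q' R' i) = c ^ s * th l m n f P' Q' R'"
    using local_form[OF f van n] by metis
  have ff: "F \<in> forms UNIV 7 s" using F(1) by (simp add: vanishing_forms_def)
  have "pair (gradient F (\<lambda>i. k * psi P Q R i)) (tg k P Q R w) = k ^ s * poly (pderiv g) 0"
    if w: "snd P \<noteq> 1 \<longrightarrow> fst w = 0" "snd Q \<noteq> 1 \<longrightarrow> fst (snd w) = 0" "snd R \<noteq> 1 \<longrightarrow> snd (snd w) = 0"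
      and g: "\<forall>t. th l m n f (fst P + t * fst w, snd P) (fst Q + t * fst (snd w), snd Q) (fst R + t * snd (snd w), snd R) = poly g t"
    for w g
  proof -
    have "pair (gradient F (\<lambda>i. k * psi P Q R i)) (tg k P Q R w) = poly (pderiv (smult (k ^ s) g)) 0"
    proof (rule grad_tg[OF infinite_K ff])
      fix t
      have "moves P (fst P + t * fst w, snd P)" "moves Q (fst Q + t * fst (snd w), snd Q)" "moves R (fst R + t * snd (snd w), snd R)"
        using n w by (auto simp: moves_def)
      from F(2)[OF this, of k] show "mpoly_eval F (\<lambda>i. k * psi (fst P + t * fst w, snd P) (fst Q + t * fst (snd w), snd Q)
          (fst R + t * snd (snd w), snd R) i) = poly (smult (k ^ s) g) t" using g by simp
    qed
    thus ?thesis by (simp add: pderiv_smult)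
  qed
  hence "lgrad k P Q R (th l m n f) F (k ^ s)" unfolding lgrad_def by blast
  thus ?thesis using F(1) k by (intro exI[of _ F] exI[of _ s] exI[of _ "k ^ s"]) auto
qed

text \<open>In each case of \<open>V_cases\<close> two directions inside the chart give F1 and F2 a
  triangular Jacobian. Off the branch locus the direction of z does not change F1 and gives F2 the
  derivative - HN, so F1 needs any direction at all. At a branch point z is infinite and F2
  restricts to HN, which has a simple zero in x or in y; F1 is then detected by the other of the
  two, by \<open>HB\<close> or \<open>NE\<close>.\<close>

lemma rank_ge:
  assumes "P0 \<in> V" "x0 \<in> P0"
  shows "\<exists>T \<subseteq> {gradient f x0 | f. f \<in> (\<Union>d. vanishing_forms 7 V d)}. finite T \<and> coord.independent T \<and> card T = 6"
proof -
  obtain k P Q R where d: "k \<noteq> 0" "nrm P" "nrm Q" "nrm R" "x0 = (\<lambda>i. k * psi P Q R i)"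
    and cs: "(\<exists>x y z. P = (x, 1) \<and> Q = (y, 1) \<and> R = (z, 1) \<and> (x, y, z) \<in> X0 \<and> infinite_case P Q z) \<or>
     (\<exists>x y. P = (x, 1) \<and> Q = (y, 1) \<and> R = (1, 0) \<and> (x, y) \<in> Gam) \<or>
     (\<exists>y z. P = (1, 0) \<and> Q = (y, 1) \<and> R = (z, 1) \<and> poly B y = 0 \<and> infinite_case P Q z) \<or>
     (\<exists>x z. P = (x, 1) \<and> Q = (1, 0) \<and> R = (z, 1) \<and> poly E x = 0 \<and> infinite_case P Q z)"
    by (rule V_cases[OF assms])
  let ?S = "{gradient f x0 | f. f \<in> (\<Union>d. vanishing_forms 7 V d)}"
  have v1: "ev3 [:F1:] x y z = 0" if "(x, y, z) \<in> X0" for x y z using that by (auto simp: X0_def)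
  obtain f1 d1 r1 where f1': "f1 \<in> vanishing_forms 7 V d1" "r1 \<noteq> 0" "lgrad k P Q R (th D e 0 [:F1:]) f1 r1"
    using local_gradient[OF tdeg_F1 v1 d(2-4) d(1)] by metis
  have f13: "pair (gradient f1 x0) (tg k P Q R w) = r1 * poly (pderiv g) 0"
    if "snd P \<noteq> 1 \<longrightarrow> fst w = 0" "snd Q \<noteq> 1 \<longrightarrow> fst (snd w) = 0" "snd R \<noteq> 1 \<longrightarrow> snd (snd w) = 0"
     "\<forall>t. th D e 0 [:F1:] (fst P + t * fst w, snd P) (fst Q + t * fst (snd w), snd Q) (fst R + t * snd (snd w), snd R) = poly g t" for w g
    using f1'(3)[unfolded lgrad_def, rule_format, of w g] that unfolding d(5) by blast
  note f1 = f1'(1,2) f13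
  have v2: "ev3 F2 x y z = 0" if "(x, y, z) \<in> X0" for x y z using that by (auto simp: X0_def)
  obtain f2 d2 r2 where f2': "f2 \<in> vanishing_forms 7 V d2" "r2 \<noteq> 0" "lgrad k P Q R (th a b p F2) f2 r2"
    using local_gradient[OF tdeg_F2 v2 d(2-4) d(1)] by metis
  have f23: "pair (gradient f2 x0) (tg k P Q R w) = r2 * poly (pderiv g) 0"
    if "snd P \<noteq> 1 \<longrightarrow> fst w = 0" "snd Q \<noteq> 1 \<longrightarrow> fst (snd w) = 0" "snd R \<noteq> 1 \<longrightarrow> snd (snd w) = 0"
     "\<forall>t. th a b p F2 (fst P + t * fst w, snd P) (fst Q + t * fst (snd w), snd Q) (fst R + t * snd (snd w), snd R) = poly g t" for w g
    using f2'(3)[unfolded lgrad_def, rule_format, of w g] that unfolding d(5) by blast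
  note f2 = f2'(1,2) f23
  have mem: "gradient f x0 \<in> ?S" if "f \<in> vanishing_forms 7 V s" for f s
    by (rule CollectI, rule exI[of _ f], rule conjI[OF refl UN_I[where B = "vanishing_forms 7 V", OF UNIV_I that]])
  have q: "gradient f x0 \<in> ?S" if "f \<in> segre_quads" for f
    using that quads_vanishing by (intro mem[of f 2]) auto
  have conclude: ?thesis if "f \<in> vanishing_forms 7 V s" "g \<in> vanishing_forms 7 V s'"
    "pair (gradient f x0) (tg k P Q R v) \<noteq> 0" "pair (gradient f x0) (tg k P Q R w) = 0" "pair (gradient g x0) (tg k P Q R w) \<noteq> 0"
    for f g s s' v w
    by (rule segre_rank[OF infinite_K d q mem[OF that(1)] mem[OF that(2)] that(3-5)])
  have dg: "degree E \<le> D" "degree G \<le> D" "degree B \<le> e" "degree H \<le> a" "degree N \<le> b"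
    using degE degG degB degH degN by auto
  note h = hom1_affine[OF dg(1)] hom1_affine[OF dg(2)] hom1_affine[OF dg(3)] hom1_affine[OF dg(4)] hom1_affine[OF dg(5)]
    hom1_infinity[where 'k = 'k]
  have dx: "pair (gradient f1 x0) (tg k P Q R (1, 0, 0)) = r1 * (poly (pderiv E) x * hom1 e B Q - poly (pderiv G) x * snd Q ^ e)"
    if "P = (x, 1)" for x
  proof -
    have "pair (gradient f1 x0) (tg k P Q R (1, 0, 0)) =
        r1 * poly (pderiv (smult (hom1 e B Q) (pcompose E (lin x 1)) - smult (snd Q ^ e) (pcompose G (lin x 1)))) 0"
      by (rule f1(3)) (simp_all add: that th_F1 h poly_pcompose)
    thus ?thesis by (simp add: pderiv_diff pderiv_smult pderiv_pcompose poly_pcompose mult_ac)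
  qed
  have dy: "pair (gradient f1 x0) (tg k P Q R (0, 1, 0)) = r1 * (hom1 D E P * poly (pderiv B) y)"
    if "Q = (y, 1)" for y
  proof -
    have "pair (gradient f1 x0) (tg k P Q R (0, 1, 0)) =
        r1 * poly (pderiv (smult (hom1 D E P) (pcompose B (lin y 1)) - [:hom1 D G P:])) 0"
      by (rule f1(3)) (simp_all add: that th_F1 h poly_pcompose)
    thus ?thesis by (simp add: pderiv_diff pderiv_smult pderiv_pcompose poly_pcompose)
  qed
  have F1z: ?thesis if R: "R = (z, 1)" and ic: "infinite_case P Q z"
      and v: "pair (gradient f1 x0) (tg k P Q R v) \<noteq> 0" for z v
  proof (rule conclude[OF f1(1) f2(1) v])
    have "pair (gradient f1 x0) (tg k P Q R (0, 0, 1)) = r1 * poly (pderiv [:th D e 0 [:F1:] P Q R:]) 0"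
      by (rule f1(3)) (simp_all add: R th_F1)
    thus "pair (gradient f1 x0) (tg k P Q R (0, 0, 1)) = 0" by (simp add: pderiv_pCons)
    let ?\<alpha> = "hom1 a H P * hom1 b N Q"
    have "pair (gradient f2 x0) (tg k P Q R (0, 0, 1)) = r2 * poly (pderiv (smult ?\<alpha> (lin z 1 ^ p - lin z 1) - [:th2 a b U2 P Q:])) 0"
      by (rule f2(3)) (simp_all add: R th_F2)
    also have "\<dots> = - r2 * ?\<alpha>" by (simp add: pderiv_diff pderiv_smult pderiv_frob)
    finally show "pair (gradient f2 x0) (tg k P Q R (0, 0, 1)) \<noteq> 0" using f2(2) ic by (simp add: infinite_case_def)
  qed
  from cs show ?thesis
  proof (elim disjE exE conjE)
    fix x y z assume c: "P = (x, 1)" "Q = (y, 1)" "R = (z, 1)" "(x, y, z) \<in> X0" "infinite_case P Q z"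
    have xy: "poly E x * poly B y = poly G x" using c(4) by (simp add: X0_def)
    from smooth1[OF xy] show ?thesis
    proof
      assume "poly E x * poly (pderiv B) y \<noteq> 0"
      thus ?thesis using dy[OF c(2)] f1(2) h(1) c(1) by (intro F1z[OF c(3,5), of "(0, 1, 0)"]) auto
    next
      assume "poly (pderiv E) x * poly B y \<noteq> poly (pderiv G) x"
      thus ?thesis using dx[OF c(1)] f1(2) h(3) c(2) by (intro F1z[OF c(3,5), of "(1, 0, 0)"]) auto
    qed
  next
    fix y z assume c: "P = (1, 0)" "Q = (y, 1)" "R = (z, 1)" "poly B y = 0" "infinite_case P Q z"
    have "pair (gradient f1 x0) (tg k P Q R (0, 1, 0)) \<noteq> 0"
      using dy[OF c(2)] f1(2) h(6) c(1) lc_nz sepB[OF c(4)] by simp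
    thus ?thesis by (rule F1z[OF c(3,5)])
  next
    fix x z assume c: "P = (x, 1)" "Q = (1, 0)" "R = (z, 1)" "poly E x = 0" "infinite_case P Q z"
    have "pair (gradient f1 x0) (tg k P Q R (1, 0, 0)) \<noteq> 0"
      using dx[OF c(1)] f1(2) h(6) c(2) lc_nz sepE[OF c(4)] curve.e1[OF curve_axioms] by (simp add: power_0_left)
    thus ?thesis by (rule F1z[OF c(3,5)])
  next
    fix x y assume c: "P = (x, 1)" "Q = (y, 1)" "R = (1, 0)" "(x, y) \<in> Gam"
    have xy: "poly E x * poly B y = poly G x" and X: "(x, y) \<in> X1" using c(4) by (auto simp: Gam_def X1_def)
    have dx2: "pair (gradient f2 x0) (tg k P Q R (1, 0, 0)) = r2 * (poly (pderiv H) x * poly N y)"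
    proof -
      have "pair (gradient f2 x0) (tg k P Q R (1, 0, 0)) = r2 * poly (pderiv (smult (poly N y) (pcompose H (lin x 1)))) 0"
        by (rule f2(3)) (use p2 in \<open>simp_all add: c th_F2 h poly_pcompose power_0_left\<close>)
      thus ?thesis by (simp add: pderiv_smult pderiv_pcompose poly_pcompose mult_ac)
    qed
    have dy2: "pair (gradient f2 x0) (tg k P Q R (0, 1, 0)) = r2 * (poly H x * poly (pderiv N) y)"
    proof -
      have "pair (gradient f2 x0) (tg k P Q R (0, 1, 0)) = r2 * poly (pderiv (smult (poly H x) (pcompose N (lin y 1)))) 0"
        by (rule f2(3)) (use p2 in \<open>simp_all add: c th_F2 h poly_pcompose power_0_left\<close>)
      thus ?thesis by (simp add: pderiv_smult pderiv_pcompose poly_pcompose)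
    qed
    show ?thesis
    proof (cases "poly H x = 0")
      case True
      show ?thesis
      proof (rule conclude[OF f2(1) f1(1)])
        show "pair (gradient f2 x0) (tg k P Q R (1, 0, 0)) \<noteq> 0" using dx2 sepH[OF True] HN[OF True xy] f2(2) by simp
        show "pair (gradient f2 x0) (tg k P Q R (0, 1, 0)) = 0" using dy2 True by simp
        show "pair (gradient f1 x0) (tg k P Q R (0, 1, 0)) \<noteq> 0"
          using dy[OF c(2)] f1(2) h(1) c(1) X1_E[OF X] HB[OF True xy] by simp
      qed
    next
      case False
      hence N0: "poly N y = 0" using c(4) by (auto simp: Gam_def)
      show ?thesis
      proof (rule conclude[OF f2(1) f1(1)])
        show "pair (gradient f2 x0) (tg k P Q R (0, 1, 0)) \<noteq> 0" using dy2 sepN[OF N0] False f2(2) by simp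
        show "pair (gradient f2 x0) (tg k P Q R (1, 0, 0)) = 0" using dx2 N0 by simp
        show "pair (gradient f1 x0) (tg k P Q R (1, 0, 0)) \<noteq> 0"
          using dx[OF c(1)] f1(2) h(3) c(2) NE[OF N0 xy] by simp
      qed
    qed
  qed
qed

text \<open>\<open>tangent\<close> provides a kernel of dimension two at the affine points, and
  \<open>jacobian_rank_le\<close> carries the resulting dependence over to all points of V.\<close>

lemma rank_le:
  assumes P0: "P0 \<in> V" "x0 \<in> P0"
    and A: "A \<subseteq> {gradient f x0 | f. f \<in> (\<Union>d. vanishing_forms 7 V d)}" "finite A" "card A = 7"
  shows "\<not> coord.independent A"
proof
  assume ind: "coord.independent A"
  obtain h where h: "bij_betw h {..<7::nat} A" using ex_bij_betw_nat_finite[OF A(2)] A(3) by (auto simp: atLeast0LessThan)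
  have "\<exists>f d. f \<in> vanishing_forms 7 V d \<and> h k = gradient f x0" if "k < 7" for k
  proof -
    have "h k \<in> A" using that bij_betwE[OF h] by simp
    hence "h k \<in> {gradient f x0 | f. f \<in> (\<Union>d. vanishing_forms 7 V d)}" using A(1) by (rule subsetD[rotated])
    thus ?thesis unfolding mem_Collect_eq UN_iff by metis
  qed
  then obtain f d where f: "\<And>k. k < 7 \<Longrightarrow> f k \<in> vanishing_forms 7 V (d k)" "\<And>k. k < 7 \<Longrightarrow> h k = gradient (f k) x0"
    by metis
  have ff: "f k \<in> forms UNIV 7 (d k)" if "k < 7" for k using f(1)[OF that] by (simp add: vanishing_forms_def)
  let ?S = "{ap x y z | x y z. (x, y, z) \<in> X0}"
  have "\<exists>l. (\<exists>k<7. l k \<noteq> 0) \<and> (\<forall>i\<le>7. (\<Sum>k<7. l k * gradient (f k) x0 i) = 0)"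
  proof (rule jacobian_rank_le[where S = ?S and V = V])
    show "mpoly_eval g x = 0" if "g \<in> forms UNIV 7 d" "\<And>y. y \<in> ?S \<Longrightarrow> mpoly_eval g y = 0" "P \<in> V" "x \<in> P" for g d x P
      by (rule form_ext[OF that(1) _ that(3,4)]) (use that(2) in blast)
    fix y assume "y \<in> ?S"
    then obtain x' y' z' where s: "y = ap x' y' z'" "(x', y', z') \<in> X0" by blast
    obtain v w where vw: "\<forall>s t. (\<forall>i\<le>7. s * v i + t * w i = 0) \<longrightarrow> s = 0 \<and> t = 0"
      "\<And>f d. f \<in> vanishing_forms 7 V d \<Longrightarrow> pair (gradient f y) v = 0 \<and> pair (gradient f y) w = 0"
      using tangent[OF s(2)] unfolding s(1) by blast
    show "\<exists>v w. (\<forall>s t. (\<forall>i\<le>7. s * v i + t * w i = 0) \<longrightarrow> s = 0 \<and> t = 0) \<and>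
       (\<forall>k<7. (\<Sum>i\<le>7. gradient (f k) y i * v i) = 0 \<and> (\<Sum>i\<le>7. gradient (f k) y i * w i) = 0)"
      using vw(1) vw(2)[OF f(1)] unfolding pair_def by blast
  qed (use ff P0 in auto)
  then obtain l where l: "\<exists>k<7. l k \<noteq> 0" "\<And>i. i \<le> 7 \<Longrightarrow> (\<Sum>k<7. l k * gradient (f k) x0 i) = 0" by blast
  have z: "(\<Sum>k<7. l k * gradient (f k) x0 i) = 0" for i
  proof (cases "i \<le> 7")
    case False
    hence "gradient (f k) x0 i = 0" if "k < 7" for k using gradient_outside[OF forms_vars[OF ff[OF that]]] by simp
    thus ?thesis by simp
  qed (rule l(2))
  define l' where "l' v = l (the_inv_into {..<7} h v)" for v
  have l'h: "l' (h k) = l k" if "k < 7" for k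
    using that h by (simp add: l'_def the_inv_into_f_f bij_betw_def)
  have "(\<Sum>v\<in>A. (\<lambda>i. l' v * v i)) i = 0" for i
  proof -
    have "(\<Sum>v\<in>A'. (\<lambda>i. l' v * v i)) i = (\<Sum>v\<in>A'. l' v * v i)" for A'
      by (induction A' rule: infinite_finite_induct) auto
    also have "(\<Sum>v\<in>A. l' v * v i) = (\<Sum>k<7. l' (h k) * h k i)"
      by (rule sum.reindex_bij_betw[OF h, symmetric])
    also have "\<dots> = (\<Sum>k<7. l k * gradient (f k) x0 i)" using l'h f(2) by (intro sum.cong) auto
    finally show ?thesis using z by simp
  qed
  hence s0: "(\<Sum>v\<in>A. (\<lambda>i. l' v * v i)) = 0" by (simp add: fun_eq_iff)
  obtain k where k: "k < 7" "l k \<noteq> 0" using l(1) by blast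
  have "h k \<in> A" using h k(1) by (auto simp: bij_betw_def)
  from coord.independentD[OF ind A(2) order.refl s0 this] show False using l'h[OF k(1)] k(2) by simp
qed

lemma V_smooth: "smooth_of_dim 7 V 1"
  unfolding smooth_of_dim_def
proof (intro ballI)
  fix P0 x0 assume P0: "P0 \<in> V" "x0 \<in> P0"
  obtain T where T: "T \<subseteq> {gradient f x0 | f. f \<in> (\<Union>d. vanishing_forms 7 V d)}" "finite T" "coord.independent T" "card T = 6"
    using rank_ge[OF P0] by blast
  have "coord.dim {gradient f x0 | f. f \<in> (\<Union>d. vanishing_forms 7 V d)} = 6"
    by (rule coord.dim_eqI[OF T]) (use rank_le[OF P0] in auto)
  thus "coord.dim {\<lambda>i. mpoly_eval (mpoly_pderiv i f) x0 |f. f \<in> (\<Union>d. vanishing_forms 7 V d)} + 1 = 7"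
    by (simp add: gradient_def)
qed

lemma V_curve: "smooth_proj_abs_irreducible_curve q 7 V"
  unfolding smooth_proj_abs_irreducible_curve_def using V_closed V_irreducible V_smooth by blast

section \<open>Hilbert function and genus\<close>

lemma tdeg_tri: "tdeg f t t t \<longleftrightarrow> tri f t" by (simp add: tdeg_def tri_def)

lemma vanishing_subspace: "mpoly.subspace (vanishing_forms 7 V t)"
  by (rule mpoly.subspaceI)
    (auto simp: vanishing_forms_def forms_add forms_scale mpoly_eval_0 mpoly_eval_add mpoly_eval_scale)

lemma vanishing_iff:
  assumes "f \<in> forms UNIV 7 t"
  shows "f \<in> vanishing_forms 7 V t \<longleftrightarrow> (\<forall>x y z. (x, y, z) \<in> X0 \<longrightarrow> mpoly_eval f (ap x y z) = 0)"
proof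
  assume "f \<in> vanishing_forms 7 V t"
  hence f: "\<And>P x. P \<in> V \<Longrightarrow> x \<in> P \<Longrightarrow> mpoly_eval f x = 0" by (simp add: vanishing_forms_def)
  show "\<forall>x y z. (x, y, z) \<in> X0 \<longrightarrow> mpoly_eval f (ap x y z) = 0"
    by (intro allI impI f[OF cls_ap])
next
  assume "\<forall>x y z. (x, y, z) \<in> X0 \<longrightarrow> mpoly_eval f (ap x y z) = 0"
  hence "mpoly_eval f x = 0" if "P \<in> V" "x \<in> P" for P x using form_ext[OF assms _ that] by simp
  thus "f \<in> vanishing_forms 7 V t" using assms by (simp add: vanishing_forms_def)
qed

text \<open>Forms of degree t restrict to functions of tridegree (t, t, t), and \<open>hform\<close>
  lifts the basis \<open>Bel\<close> back to forms. The lifts span a complement of the vanishing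
  forms.\<close>

lemma hilbert_function_V:
  assumes t: "D + a \<le> t" "b + e \<le> t" "p \<le> t" "card Gam \<le> t"
  shows "hilbert_function 7 V t = card (BI t)"
proof -
  have De: "D \<le> t" "e \<le> t" using t by auto
  obtain S where S: "finite S" "(forms UNIV 7 t :: 'k mpoly set) \<subseteq> mpoly.span S" using forms_finite_span by blast
  let ?T = "\<lambda>s. hform t (Bel s)"
  have hf: "?T s \<in> forms UNIV 7 t" for s by (rule hform_forms) auto
  have ev: "mpoly_eval (?T s) (ap x y z) = ev3 (Bel s) x y z" if "s \<in> BI t" for s x y z
    unfolding ap_def hform_psi by (rule th_affine) (use tri_Bel[OF t(4,3) De that] in \<open>simp add: tdeg_tri\<close>)
  have evs: "mpoly_eval (\<Sum>s\<in>BI t. mpoly_scale (l s) (?T s)) (ap x y z) = (\<Sum>s\<in>BI t. l s * ev3 (Bel s) x y z)" for l x y z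
    unfolding mpoly_eval_sum by (intro sum.cong) (auto simp: mpoly_eval_scale ev)
  have sf: "(\<Sum>s\<in>BI t. mpoly_scale (l s) (?T s)) \<in> forms UNIV 7 t" for l
    by (intro forms_sum forms_scale hf) auto
  have "mpoly.dim (forms UNIV 7 t :: 'k mpoly set) = mpoly.dim (vanishing_forms 7 V t) + card (BI t)"
  proof (rule mpoly.dim_complement[OF forms_subspace S vanishing_subspace _ card_BI(1)[OF De t(3)]])
    show "vanishing_forms 7 V t \<subseteq> forms UNIV 7 t" by (auto simp: vanishing_forms_def)
    show "?T s \<in> forms UNIV 7 t" for s by (rule hf)
    fix l assume "(\<Sum>s\<in>BI t. mpoly_scale (l s) (?T s)) \<in> vanishing_forms 7 V t"
    hence "\<And>x y z. (x, y, z) \<in> X0 \<Longrightarrow> (\<Sum>s\<in>BI t. l s * ev3 (Bel s) x y z) = 0"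
      unfolding vanishing_iff[OF sf] evs by blast
    thus "\<forall>s\<in>BI t. l s = 0" using Bel_indep by blast
  next
    fix f :: "'k mpoly" assume f: "f \<in> forms UNIV 7 t"
    obtain l where l: "\<forall>x y z. (x, y, z) \<in> X0 \<longrightarrow> ev3 (dehom f) x y z = (\<Sum>s\<in>BI t. l s * ev3 (Bel s) x y z)"
      using Bel_span[OF t, of "dehom f"] tdeg_dehom[OF f] by (auto simp: tdeg_tri)
    have "f - (\<Sum>s\<in>BI t. mpoly_scale (l s) (?T s)) \<in> vanishing_forms 7 V t"
      unfolding vanishing_iff[OF forms_diff[OF f sf]] mpoly_eval_diff evs
      using l ev3_dehom[OF f] by (simp add: ap_def)
    thus "\<exists>l. f - (\<Sum>s\<in>BI t. mpoly_scale (l s) (?T s)) \<in> vanishing_forms 7 V t" by blast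
  qed
  thus ?thesis by (simp add: hilbert_function_def)
qed

text \<open>For large t the Hilbert function is linear in t, and the genus is 1 minus its constant
  term. The outcome agrees with Riemann-Hurwitz: (e - 1) * (D - 1) is the genus of a smooth curve of
  bidegree (D, e), and each of the D * b + e * a branch points contributes 2 * (p - 1) to the
  different.\<close>

lemma V_genus: "has_genus 7 V (p * ((e - 1) * (D - 1)) + (p - 1) * (D * b + e * a - 1))"
proof -
  let ?g = "D * b + e * a"
  define P :: "rat poly" where "P = [: of_nat p * (of_nat e + of_nat D * (1 - of_nat e)) + (1 - of_nat p) * of_nat ?g,
     of_nat p * (of_nat e + of_nat D) + of_nat ?g :]"
  have "poly P (of_nat t) = of_nat (hilbert_function 7 V t)"
    if t: "D + a + b + e + p + card Gam \<le> t" for t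
  proof -
    have h: "hilbert_function 7 V t = p * ((t + 1) * e + D * (t + 1 - e)) + (t + 1 - p) * ?g"
      using hilbert_function_V[of t] card_BI(2)[of t] t by simp
    have "(of_nat (t + 1 - e) :: rat) = of_nat t + 1 - of_nat e" "(of_nat (t + 1 - p) :: rat) = of_nat t + 1 - of_nat p"
      using t by (simp_all add: of_nat_diff)
    thus ?thesis unfolding h of_nat_add of_nat_mult by (simp add: P_def algebra_simps)
  qed
  hence "\<forall>\<^sub>F t in sequentially. poly P (of_nat t) = of_nat (hilbert_function 7 V t)"
    unfolding eventually_sequentially by blast
  moreover have "of_nat (p * ((e - 1) * (D - 1)) + (p - 1) * (?g - 1)) = 1 - poly P 0"
  proof -
    have g1: "?g \<ge> 1" using D1 b1 by (simp add: Suc_leI)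
    have "(of_nat (e - 1) :: rat) = of_nat e - 1" "(of_nat (D - 1) :: rat) = of_nat D - 1" "(of_nat (p - 1) :: rat) = of_nat p - 1"
      "(of_nat (?g - 1) :: rat) = of_nat ?g - 1"
      using curve.e1[OF curve_axioms] D1 p2 g1 by (simp_all only: of_nat_diff of_nat_1)
    note e = this
    show ?thesis unfolding P_def of_nat_add[where 'a = rat] of_nat_mult[where 'a = rat] e by (simp add: algebra_simps)
  qed
  ultimately show ?thesis unfolding has_genus_def by blast
qed

end

section \<open>Prescribed values over a finite field\<close>

context fq_closure begin

definition FP :: "nat \<Rightarrow> 'k poly set" where "FP n = {f. fqpoly f \<and> (\<forall>i\<ge>n. coeff f i = 0)}"

lemma FP_degree: "f \<in> FP n \<Longrightarrow> f \<noteq> 0 \<Longrightarrow> degree f < n"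
  by (auto simp: FP_def not_le[symmetric])

lemma FP_diff: "f \<in> FP n \<Longrightarrow> g \<in> FP n \<Longrightarrow> f - g \<in> FP n"
  by (auto simp: FP_def fqpoly_diff)

lemma card_FP: "finite (FP n)" "card (FP n) = q ^ n"
proof -
  let ?F = "\<lambda>f::'k poly. restrict (coeff f) {..<n}"
  have "bij_betw ?F (FP n) (PiE {..<n} (\<lambda>_. Fq q))"
  proof (rule bij_betw_imageI)
    show "inj_on ?F (FP n)"
    proof (rule inj_onI, rule poly_eqI)
      fix f g i assume fg: "f \<in> FP n" "g \<in> FP n" "?F f = ?F g"
      show "coeff f i = coeff g i"
      proof (cases "i < n")
        case True
        thus ?thesis using fun_cong[OF fg(3), of i] by simp
      qed (use fg(1,2) in \<open>simp add: FP_def\<close>)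
    qed
    show "?F ` FP n = PiE {..<n} (\<lambda>_. Fq q)"
    proof (intro equalityI subsetI)
      fix g assume "g \<in> ?F ` FP n" thus "g \<in> PiE {..<n} (\<lambda>_. Fq q)" by (auto simp: FP_def fqpoly_def PiE_def extensional_def)
    next
      fix g :: "nat \<Rightarrow> 'k" assume g: "g \<in> PiE {..<n} (\<lambda>_. Fq q)"
      define f where "f = (\<Sum>i<n. monom (g i) i)"
      have cf: "coeff f i = (if i < n then g i else 0)" for i by (simp add: f_def coeff_sum)
      have "f \<in> FP n" unfolding FP_def fqpoly_def using g FF_0[of 1] by (auto simp: cf)
      moreover have "g = ?F f" using g by (intro ext) (auto simp: cf PiE_def extensional_def)
      ultimately show "g \<in> ?F ` FP n" by blast
    qed
  qed
  moreover have "finite (Fq q :: 'k set)" "card (Fq q :: 'k set) = q" using card_FF[of 1] by simp_all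
  ultimately show "finite (FP n)" "card (FP n) = q ^ n"
    by (auto simp: bij_betw_finite bij_betw_same_card card_PiE intro!: finite_PiE)
qed

lemma exact_deg_inj:
  assumes "exact_deg m x" "f \<in> FP m" "g \<in> FP m" "poly f x = poly g x" shows "f = g"
proof (rule ccontr)
  assume "f \<noteq> g"
  hence nz: "f - g \<noteq> 0" and m: "f - g \<in> FP m" using FP_diff assms by auto
  have "poly (f - g) x \<noteq> 0" using m by (intro exact_deg_no_root[OF assms(1) _ nz FP_degree[OF m nz]]) (simp add: FP_def)
  thus False using assms(4) by simp
qed

text \<open>Two members with the same coefficients from index m on differ by a polynomial of degree
  below m that vanishes at x, hence by 0; so the top n - m coefficients determine a member.\<close>

lemma card_fiber:
  assumes "exact_deg m x" "m \<le> n" shows "card {f \<in> FP n. poly f x = v} \<le> q ^ (n - m)"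
proof -
  let ?A = "{f \<in> FP n. poly f x = v}"
  have "inj_on (poly_shift m) ?A"
  proof (rule inj_onI)
    fix f g assume fg: "f \<in> ?A" "g \<in> ?A" "poly_shift m f = poly_shift m g"
    have top: "coeff f i = coeff g i" if "i \<ge> m" for i
      using arg_cong[OF fg(3), of "\<lambda>h. coeff h (i - m)"] that by (simp add: coeff_poly_shift)
    have "f - g \<in> FP m" unfolding FP_def using fg(1,2) top by (auto simp: FP_def fqpoly_diff)
    moreover have "0 \<in> FP m" by (simp add: FP_def fqpoly_0)
    ultimately have "f - g = 0" using exact_deg_inj[OF assms(1), of "f - g" 0] fg by simp
    thus "f = g" by simp
  qed
  moreover have "poly_shift m ` ?A \<subseteq> FP (n - m)" using assms(2)
    by (auto simp: FP_def fqpoly_def coeff_poly_shift)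
  ultimately have "card ?A \<le> card (FP (n - m))" by (rule card_inj_on_le[OF _ _ card_FP(1)])
  thus ?thesis by (simp add: card_FP)
qed

lemma exact_deg_ex: "\<exists>m. exact_deg m (x::'k)"
proof -
  let ?P = "\<lambda>m. m \<ge> 1 \<and> x \<in> FF m"
  have "\<exists>m. ?P m" using algebraic[of x] by (auto simp: FF_iff)
  then obtain m where m: "?P m" "\<And>k. k < m \<Longrightarrow> \<not> ?P k" using exists_least_iff[of ?P] by metis
  hence "exact_deg m x" unfolding exact_deg_def by simp
  thus ?thesis ..
qed

lemma exact_deg_iff: assumes "exact_deg m x" shows "x \<in> FF d \<longleftrightarrow> m dvd d"
proof
  show "x \<in> FF d \<Longrightarrow> m dvd d" by (rule exact_deg_dvd[OF assms])
  show "m dvd d \<Longrightarrow> x \<in> FF d" using assms unfolding exact_deg_def by (intro FF_dvd[of x m d]) auto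
qed

lemma exact_deg_unique: "exact_deg m x \<Longrightarrow> exact_deg d x \<Longrightarrow> m = d"
  using exact_deg_dvd[of m x d] exact_deg_dvd[of d x m] by (auto simp: exact_deg_def dvd_antisym)

text \<open>The image of the Artin-Schreier map on the field of degree m; a value outside it has no
  preimage in that field.\<close>

definition AS :: "nat \<Rightarrow> 'k set" where "AS m = (\<lambda>z. z ^ CHAR('k) - z) ` FF m"

lemma AS_frob: assumes "m \<ge> 1" shows "x ^ q \<in> AS m \<longleftrightarrow> x \<in> AS m"
proof -
  let ?p = "CHAR('k)"
  have d: "(z ^ q) ^ ?p - z ^ q = (z ^ ?p - z) ^ q" for z :: 'k
    using fr_diff[of "z ^ ?p" z 1] by (simp add: power_mult[symmetric] mult.commute)
  have iter: "z ^ (q ^ k) \<in> AS m" if "z \<in> AS m" for z k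
  proof (induction k)
    case (Suc k)
    then obtain t where t: "t \<in> FF m" "z ^ (q ^ k) = t ^ ?p - t" by (auto simp: AS_def)
    have "z ^ (q ^ Suc k) = (z ^ (q ^ k)) ^ q" by (simp add: power_mult[symmetric] mult.commute)
    also have "\<dots> = (t ^ q) ^ ?p - t ^ q" unfolding t(2) d ..
    finally show ?case using FF_frob[OF t(1), of 1] by (auto simp: AS_def)
  qed (use that in simp)
  show ?thesis
  proof
    assume a: "x ^ q \<in> AS m"
    hence "x ^ q \<in> FF m" using FF_pow FF_diff by (auto simp: AS_def)
    hence xm: "x \<in> FF m" using FF_frob_iff[of x 1 m] by simp
    have "(x ^ q) ^ (q ^ (m - 1)) \<in> AS m" by (rule iter[OF a])
    moreover have "(x ^ q) ^ (q ^ (m - 1)) = x ^ (q ^ Suc (m - 1))" by (simp add: power_mult[symmetric] mult.commute)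
    ultimately show "x \<in> AS m" using xm assms by (simp add: FF_iff)
  next
    assume "x \<in> AS m" thus "x ^ q \<in> AS m" using iter[of x 1] by simp
  qed
qed

definition goodT :: "'k \<Rightarrow> 'k poly \<Rightarrow> bool" where
  "goodT x T \<longleftrightarrow> fqpoly T \<and> (\<exists>m. exact_deg m x \<and> poly T x \<notin> AS m)"

text \<open>Both 0 and 1 are sent to 0 by the Artin-Schreier map, so on a finite field it is not
  injective and hence not onto. Every element of the field of degree m generated by x is a
  polynomial in x over the small field.\<close>

lemma ex_goodT: "\<exists>T. goodT x T"
proof -
  obtain m where m: "exact_deg m x" using exact_deg_ex by blast
  hence m1: "m \<ge> 1" by (simp add: exact_deg_def)
  have "AS m \<noteq> FF m"
  proof
    assume "AS m = FF m"
    hence "inj_on (\<lambda>z. z ^ CHAR('k) - z) (FF m)"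
      unfolding AS_def using card_FF(1)[OF m1] by (intro eq_card_imp_inj_on) simp_all
    moreover have "(0::'k) ^ CHAR('k) - 0 = 1 ^ CHAR('k) - 1" using prime_char prime_gt_0_nat by (simp add: power_0_left)
    ultimately have "(0::'k) = 1" by (rule inj_onD[OF _ _ FF_0 FF_1])
    thus False by simp
  qed
  moreover have "AS m \<subseteq> FF m" using FF_pow FF_diff by (auto simp: AS_def)
  ultimately obtain t where t: "t \<in> FF m" "t \<notin> AS m" by blast
  have "inj_on (\<lambda>T. poly T x) (FP m)" using exact_deg_inj[OF m] by (auto intro: inj_onI)
  moreover have "(\<lambda>T. poly T x) ` FP m \<subseteq> FF m"
    using m poly_FF by (auto simp: FP_def exact_deg_def)
  ultimately have "(\<lambda>T. poly T x) ` FP m = FF m"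
    using card_FF[OF m1] card_FP by (intro card_subset_eq) (auto simp: card_image)
  then obtain T where "T \<in> FP m" "poly T x = t" using t(1) by (metis imageE)
  thus ?thesis using m t(2) by (auto simp: goodT_def FP_def)
qed

lemma goodT_frob: "goodT (x ^ q) T \<longleftrightarrow> goodT x T"
proof -
  have e: "exact_deg m (x ^ q) \<longleftrightarrow> exact_deg m x" for m using exact_deg_frob[of m x 1] by simp
  have "poly T (x ^ q) \<in> AS m \<longleftrightarrow> poly T x \<in> AS m" if "fqpoly T" "exact_deg m x" for m
    using poly_fr[OF that(1), of x 1] AS_frob[of m "poly T x"] that(2) by (simp add: exact_deg_def)
  thus ?thesis unfolding goodT_def e by blast
qed

text \<open>The polynomial chosen for x depends only on the conjugacy class of x, which makes the value
  Frobenius equivariant.\<close>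
definition vv :: "'k \<Rightarrow> 'k" where "vv x = poly (SOME T. goodT x T) x"

lemma vv: assumes "exact_deg m x" shows "vv x \<notin> AS m"
proof -
  have "goodT x (SOME T. goodT x T)" using ex_goodT by (rule someI_ex)
  thus ?thesis unfolding goodT_def vv_def using exact_deg_unique[OF assms] by blast
qed

lemma vv_frob: "vv (x ^ q) = vv x ^ q"
proof -
  have "goodT x (SOME T. goodT x T)" using ex_goodT by (rule someI_ex)
  hence f: "fqpoly (SOME T. goodT x T)" by (simp add: goodT_def)
  show ?thesis unfolding vv_def goodT_frob using poly_fr[OF f, of x 1] by simp
qed

text \<open>The right-hand side becomes one more unknown, indexed by \<open>None\<close>, with
  coefficient - val. \<open>descent\<close> then applies to a homogeneous system and keeps this
  unknown nonzero, so that it can be divided out.\<close>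

lemma fq_solution:
  fixes M :: "'i \<Rightarrow> 's \<Rightarrow> 'k" and val :: "'s \<Rightarrow> 'k"
  assumes fin: "finite I" and st: "\<And>s. s \<in> S \<Longrightarrow> \<exists>s'\<in>S. (\<forall>i\<in>I. M i s = M i s' ^ q) \<and> val s = val s' ^ q"
    and sol: "\<And>s. s \<in> S \<Longrightarrow> (\<Sum>i\<in>I. a i * M i s) = val s"
  shows "\<exists>b. (\<forall>i\<in>I. b i \<in> Fq q) \<and> (\<forall>s\<in>S. (\<Sum>i\<in>I. b i * M i s) = val s)"
proof -
  define vec where "vec s i = (case i of None \<Rightarrow> - val s | Some i \<Rightarrow> M i s)" for s i
  define J where "J = insert None (Some ` I)"
  have sumJ: "(\<Sum>i\<in>J. g i) = g None + (\<Sum>i\<in>I. g (Some i))" for g :: "'i option \<Rightarrow> 'k"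
    unfolding J_def using fin by (simp add: sum.reindex)
  let ?a = "\<lambda>i. case i of None \<Rightarrow> 1 | Some i \<Rightarrow> a i"
  have "\<exists>b. (\<forall>i\<in>J. b i \<in> Fq q) \<and> (\<forall>w\<in>vec ` S. (\<Sum>i\<in>J. b i * w i) = 0) \<and> (\<Sum>i\<in>J. b i * (if i = None then 1 else 0)) \<noteq> 0"
  proof (rule descent[where a = ?a])
    show "finite J" using fin by (simp add: J_def)
    fix w assume "w \<in> vec ` S"
    then obtain s where s: "s \<in> S" "w = vec s" by blast
    obtain s' where s': "s' \<in> S" "\<forall>i\<in>I. M i s = M i s' ^ q" "val s = val s' ^ q" using st[OF s(1)] by blast
    show "\<exists>w'\<in>vec ` S. \<forall>i\<in>J. w i = w' i ^ q"
      using s' fr_minus[of "val s'" 1] unfolding s(2) by (intro bexI[of _ "vec s'"]) (auto simp: J_def vec_def)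
    show "(\<Sum>i\<in>J. ?a i * w i) = 0" unfolding s(2) sumJ using sol[OF s(1)] by (simp add: vec_def)
  qed (simp add: sumJ)
  then obtain b where b: "\<And>i. i \<in> J \<Longrightarrow> b i \<in> Fq q" "\<And>s. s \<in> S \<Longrightarrow> (\<Sum>i\<in>J. b i * vec s i) = 0"
    "(\<Sum>i\<in>J. b i * (if i = None then 1 else 0)) \<noteq> 0" by blast
  have b0: "b None \<noteq> 0" using b(3) by (simp add: sumJ)
  have "(\<Sum>i\<in>I. b (Some i) / b None * M i s) = val s" if "s \<in> S" for s
  proof -
    have "(\<Sum>i\<in>I. b (Some i) * M i s) = b None * val s" using b(2)[OF that] by (simp add: sumJ vec_def)
    moreover have "(\<Sum>i\<in>I. b (Some i) / b None * M i s) = (\<Sum>i\<in>I. b (Some i) * M i s) / b None"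
      by (simp add: sum_divide_distrib)
    ultimately show ?thesis using b0 by simp
  qed
  moreover have "b (Some i) / b None \<in> Fq q" if "i \<in> I" for i
    using FF_divide[of "b (Some i)" 1 "b None"] b(1) that by (simp add: J_def)
  ultimately show ?thesis by (intro exI[of _ "\<lambda>i. b (Some i) / b None"]) blast
qed

definition fq2 :: "'k poly poly \<Rightarrow> bool" where "fq2 f \<longleftrightarrow> (\<forall>j. fqpoly (coeff f j))"

lemma fq2_add: "fq2 f \<Longrightarrow> fq2 g \<Longrightarrow> fq2 (f + g)" by (simp add: fq2_def fqpoly_add)
lemma fq2_mult: "fq2 f \<Longrightarrow> fq2 g \<Longrightarrow> fq2 (f * g)"
  by (auto simp: fq2_def coeff_mult intro!: fqpoly_sum fqpoly_mult)
lemma fq2_lift: "fqpoly f \<Longrightarrow> fq2 (lift f)"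
  by (auto simp: fq2_def coeff_map_poly fqpoly_def coeff_pCons split: nat.split intro: FF_0[of 1, simplified])


definition FP2 :: "nat \<Rightarrow> nat \<Rightarrow> 'k poly poly set" where "FP2 s t = {f. fq2 f \<and> dx f s \<and> degree f \<le> t}"

lemma finite_FP2: "finite (FP2 s t)"
proof -
  let ?F = "\<lambda>f::'k poly poly. restrict (\<lambda>j. coeff f j) {..t}"
  have "inj_on ?F (FP2 s t)"
  proof (rule inj_onI, rule poly_eqI)
    fix f g i assume fg: "f \<in> FP2 s t" "g \<in> FP2 s t" "?F f = ?F g"
    show "coeff f i = coeff g i"
    proof (cases "i \<le> t")
      case True
      thus ?thesis using fun_cong[OF fg(3), of i] by simp
    qed (use fg(1,2) in \<open>simp add: FP2_def coeff_eq_0\<close>)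
  qed
  moreover have "coeff f j \<in> FP (Suc s)" if f: "f \<in> FP2 s t" for f j
  proof -
    have "fqpoly (coeff f j)" "degree (coeff f j) \<le> s" using f by (auto simp: FP2_def fq2_def dx_def)
    thus ?thesis unfolding FP_def by (auto intro!: coeff_eq_0)
  qed
  hence "?F ` FP2 s t \<subseteq> PiE {..t} (\<lambda>_. FP (Suc s))" by (auto simp: PiE_def extensional_def)
  moreover have "finite (PiE {..t} (\<lambda>_. FP (Suc s)))" by (intro finite_PiE card_FP) auto
  ultimately show ?thesis by (meson inj_on_finite)
qed

definition p2 :: "nat \<Rightarrow> nat \<Rightarrow> (nat \<times> nat \<Rightarrow> 'k) \<Rightarrow> 'k poly poly" where
  "p2 s t b = (\<Sum>j\<le>t. monom (\<Sum>i\<le>s. monom (b (i, j)) i) j)"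

lemma coeff_p2: "coeff (coeff (p2 s t b) j) i = (if i \<le> s \<and> j \<le> t then b (i, j) else 0)"
  by (simp add: p2_def coeff_sum)

lemma ev2_p2: "ev2 (p2 s t b) x y = (\<Sum>m\<in>{..s} \<times> {..t}. b m * (x ^ fst m * y ^ snd m))"
proof -
  have "ev2 (p2 s t b) x y = (\<Sum>j\<le>t. \<Sum>i\<le>s. b (i, j) * (x ^ i * y ^ j))"
    unfolding p2_def by (simp add: poly_sum poly_monom sum_distrib_right mult.assoc)
  also have "\<dots> = (\<Sum>i\<le>s. \<Sum>j\<le>t. b (i, j) * (x ^ i * y ^ j))" by (rule sum.swap)
  finally show ?thesis by (simp add: sum.cartesian_product case_prod_unfold)
qed

lemma p2_FP2: "(\<And>m. m \<in> {..s} \<times> {..t} \<Longrightarrow> b m \<in> Fq q) \<Longrightarrow> p2 s t b \<in> FP2 s t"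
  unfolding FP2_def fq2_def fqpoly_def dx_def
  by (auto simp: coeff_p2 FF_0[of 1, simplified] intro!: degree_le poly_eqI)

lemma p2_coeff: "dx f s \<Longrightarrow> degree f \<le> t \<Longrightarrow> p2 s t (\<lambda>(i, j). coeff (coeff f j) i) = f"
proof (rule poly_eqI, rule poly_eqI)
  fix i j assume f: "dx f s" "degree f \<le> t"
  show "coeff (coeff (p2 s t (\<lambda>(i, j). coeff (coeff f j) i)) j) i = coeff (coeff f j) i"
  proof (cases "i \<le> s \<and> j \<le> t")
    case False
    have "degree (coeff f j) \<le> s" using f by (simp add: dx_def)
    hence "coeff (coeff f j) i = 0" using False f(2) by (cases "i \<le> s") (auto simp: coeff_eq_0)
    thus ?thesis using False by (simp add: coeff_p2)
  qed (simp add: coeff_p2)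
qed

end

section \<open>Lowering the degree in x by means of leading coefficients in x\<close>

definition xc :: "nat \<Rightarrow> 'k::comm_ring_1 poly poly \<Rightarrow> 'k poly" where "xc t f = map_poly (\<lambda>g. coeff g t) f"

lemma coeff_xc [simp]: "coeff (xc t f) j = coeff (coeff f j) t" by (simp add: xc_def coeff_map_poly)

lemma degree_xc: "degree (xc t f) \<le> degree f" unfolding xc_def by (rule degree_map_poly_le)

lemma xc_diff: "xc t (f - g) = xc t f - xc t g" by (rule poly_eqI) simp

lemma xc_shift: "xc (s + t) (smult (monom 1 s) f) = xc t f"
  by (rule poly_eqI) (simp add: coeff_monom_mult)

lemma xc_lift_mult: "xc t (lift r * f) = r * xc t f"
proof (rule poly_eqI)
  fix j
  have "coeff (xc t (lift r * f)) j = (\<Sum>i\<le>j. coeff ([:coeff r i:] * coeff f (j - i)) t)"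
    by (simp add: coeff_mult coeff_sum coeff_map_poly)
  also have "\<dots> = coeff (r * xc t f) j" by (simp add: coeff_mult)
  finally show "coeff (xc t (lift r * f)) j = coeff (r * xc t f) j" .
qed

lemma dx_pred:
  assumes "dx g (Suc t)" "xc (Suc t) g = 0" shows "dx g t"
  unfolding dx_def
proof (intro allI degree_le impI)
  fix j i assume i: "t < i"
  show "coeff (coeff g j) i = 0"
  proof (cases "i = Suc t")
    case True
    have "coeff (xc (Suc t) g) j = 0" using assms(2) by simp
    thus ?thesis using True by simp
  next
    case False
    hence "degree (coeff g j) < i" using assms(1) i unfolding dx_def by (metis Suc_lessI le_less_trans)
    thus ?thesis by (rule coeff_eq_0)
  qed
qed

text \<open>r2 interpolates l / l2 at the roots of B, after which B divides the rest. The bound 2 *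
  e - 2 is what a product of two polynomials of degree at most e - 1 can reach.\<close>

lemma bezout_roots:
  fixes B l l2 :: "'k::alg_closed_field poly"
  assumes B: "degree B = e" "B \<noteq> 0" "\<And>y. poly B y = 0 \<Longrightarrow> poly (pderiv B) y \<noteq> 0"
    and cop: "\<And>y. poly B y = 0 \<Longrightarrow> poly l2 y \<noteq> 0" and l2: "degree l2 \<le> e - 1" and l: "degree l \<le> 2 * e - 2" and e: "e \<ge> 1"
  shows "\<exists>r1 r2. l = r1 * B + r2 * l2 \<and> (r1 = 0 \<or> degree r1 + e \<le> 2 * e - 2) \<and> degree r2 \<le> e - 1"
proof -
  let ?S = "{y. poly B y = 0}"
  have fin: "finite ?S" "card ?S \<le> e" using card_proots_le[OF B(2)] B(1) by auto
  obtain L where L: "\<forall>r\<in>?S. degree (L r) < card ?S \<and> (\<forall>s\<in>?S. poly (L r) s = (if s = r then 1 else 0))"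
    using lagrange[OF fin(1)] by blast
  define r2 where "r2 = (\<Sum>r\<in>?S. smult (poly l r / poly l2 r) (L r))"
  have "degree (L r) \<le> e - 1" if "r \<in> ?S" for r
  proof -
    have "degree (L r) < card ?S" using L that by blast
    thus ?thesis using fin(2) by linarith
  qed
  hence d2: "degree r2 \<le> e - 1" unfolding r2_def
    by (intro degree_sum_le fin) (meson degree_smult_le order.trans)
  have "B dvd l - r2 * l2"
  proof (rule separable_dvd[OF B(2,3)])
    fix y assume y: "poly B y = 0"
    have "poly r2 y = (\<Sum>r\<in>?S. poly l r / poly l2 r * (if r = y then 1 else 0))"
      unfolding r2_def poly_sum using L y by (intro sum.cong) auto
    also have "\<dots> = (\<Sum>r\<in>{y}. poly l r / poly l2 r * (if r = y then 1 else 0))"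
      using y fin(1) by (intro sum.mono_neutral_right) auto
    also have "\<dots> = poly l y / poly l2 y" by simp
    finally show "poly (l - r2 * l2) y = 0" using cop[OF y] by simp
  qed
  then obtain r1 where r1: "l - r2 * l2 = B * r1" by (elim dvdE)
  have "degree (r2 * l2) \<le> 2 * e - 2" using degree_mult_le[of r2 l2] d2 l2 by linarith
  hence "degree (B * r1) \<le> 2 * e - 2" using l unfolding r1[symmetric] by (rule degree_diff_le[rotated])
  hence "r1 = 0 \<or> degree r1 + e \<le> 2 * e - 2" using B(1) degree_mult_eq[OF B(2), of r1] by (cases "r1 = 0") auto
  moreover have "l = r1 * B + r2 * l2" using r1 by (simp add: algebra_simps)
  ultimately show ?thesis using d2 by blast
qed

text \<open>Modulo the curve equation and a second function f vanishing on S the degree in x can be reduced,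
  since the leading coefficients in x of the two polynomials are coprime.\<close>
lemma realise:
  fixes E G B :: "'k::alg_closed_field poly" and f :: "'k poly poly"
  assumes E: "degree E = D" "degree G < D" and B: "degree B = e" "e \<ge> 1" "\<And>y. poly B y = 0 \<Longrightarrow> poly (pderiv B) y \<noteq> 0"
    and S: "finite S" "\<And>x y. (x, y) \<in> S \<Longrightarrow> poly E x * poly B y = poly G x" "\<And>x y. (x, y) \<in> S \<Longrightarrow> poly E x \<noteq> 0"
    and f: "\<And>x y. (x, y) \<in> S \<Longrightarrow> ev2 f x y = 0" "degree f \<le> e - 1" "dx f A"
    and cop: "\<And>y. poly B y = 0 \<Longrightarrow> poly (xc A f) y \<noteq> 0"
  shows "\<exists>g. degree g \<le> 2 * e - 2 \<and> dx g (max D A) \<and> (\<forall>(x, y)\<in>S. ev2 g x y = val (x, y))"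
proof -
  define F where "F = smult E (lift B) - [:G:]"
  have B0: "B \<noteq> 0" using B by auto
  have E0: "lead_coeff E \<noteq> 0" using E by auto
  have dF: "degree F \<le> e" unfolding F_def using B(1) by (intro degree_diff_le) (auto intro: order.trans[OF degree_smult_le] simp: degree_map_poly)
  have dxF: "dx F D" unfolding F_def using E
    by (intro dx_diff dx_const dx_smult[where s = D and t = 0, simplified] dx_lift) auto
  have xcF: "xc D F = smult (lead_coeff E) B" unfolding F_def
    by (rule poly_eqI) (use E in \<open>auto simp: coeff_pCons coeff_map_poly coeff_eq_0 split: nat.split\<close>)
  have evF: "ev2 F x y = 0" if "(x, y) \<in> S" for x y using S(2)[OF that] by (simp add: F_def)
  have red: "\<exists>g'. degree g' \<le> 2 * e - 2 \<and> dx g' (max D A) \<and> (\<forall>(x, y)\<in>S. ev2 g' x y = ev2 g x y)"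
    if "degree g \<le> 2 * e - 2" "dx g t" for g t
    using that
  proof (induction t arbitrary: g)
    case 0
    thus ?case by (intro exI[of _ g]) (auto intro: dx_mono)
  next
    case (Suc t)
    show ?case
    proof (cases "Suc t \<le> max D A")
      case True
      thus ?thesis using Suc.prems by (intro exI[of _ g]) (auto intro: dx_mono)
    next
      case False
      have dl: "degree (xc (Suc t) g) \<le> 2 * e - 2" by (rule order.trans[OF degree_xc Suc.prems(1)])
      have dA: "degree (xc A f) \<le> e - 1" by (rule order.trans[OF degree_xc f(2)])
      obtain r1 r2 where r: "xc (Suc t) g = r1 * B + r2 * xc A f" "r1 = 0 \<or> degree r1 + e \<le> 2 * e - 2" "degree r2 \<le> e - 1"
        using bezout_roots[OF B(1) B0 B(3) cop dA dl B(2)] by blast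
      define r1' where "r1' = smult (inverse (lead_coeff E)) r1"
      have r1': "r1' = 0 \<or> degree r1' + e \<le> 2 * e - 2" "r1' * smult (lead_coeff E) B = r1 * B"
        using r(2) E0 by (auto simp: r1'_def)
      \<comment> \<open>Both subtracted terms vanish on S, and their coefficients at x^(Suc t) add
        up to that of g by the Bezout identity. Their degrees in y are at most (e - 2) + e and (e -
        1) + (e - 1).\<close>
      define g1 where "g1 = g - smult (monom 1 (Suc t - D)) (lift r1' * F) - smult (monom 1 (Suc t - A)) (lift r2 * f)"
      have ts: "(Suc t - D) + D = Suc t" "(Suc t - A) + A = Suc t" using False by auto
      have "xc (Suc t) (smult (monom 1 (Suc t - D)) (lift r1' * F)) = r1 * B"
        using xc_shift[of "Suc t - D" D "lift r1' * F"] r1'(2) unfolding ts xc_lift_mult xcF by simp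
      moreover have "xc (Suc t) (smult (monom 1 (Suc t - A)) (lift r2 * f)) = r2 * xc A f"
        using xc_shift[of "Suc t - A" A "lift r2 * f"] unfolding ts xc_lift_mult by simp
      ultimately have x0: "xc (Suc t) g1 = 0" unfolding g1_def xc_diff r(1) by simp
      have "dx (smult (monom 1 (Suc t - D)) (lift r1' * F)) (Suc t - D + (0 + D))"
        by (intro dx_smult dx_mult dx_lift dxF) (simp add: degree_monom_eq)
      moreover have "dx (smult (monom 1 (Suc t - A)) (lift r2 * f)) (Suc t - A + (0 + A))"
        by (intro dx_smult dx_mult dx_lift f) (simp add: degree_monom_eq)
      ultimately have "dx g1 (Suc t)" unfolding g1_def add_0 ts by (intro dx_diff Suc.prems(2))
      hence dx1: "dx g1 t" using x0 by (rule dx_pred)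
      have "degree (lift r1' * F) \<le> 2 * e - 2"
      proof (cases "r1' = 0")
        case False
        have "degree (lift r1') \<le> degree r1'" by (rule degree_map_poly_le)
        thus ?thesis using degree_mult_le[of "lift r1'" F] dF r1'(1) False by linarith
      qed simp
      moreover have "degree (lift r2 * f) \<le> 2 * e - 2"
      proof -
        have "degree (lift r2) \<le> degree r2" by (rule degree_map_poly_le)
        thus ?thesis using degree_mult_le[of "lift r2" f] f(2) r(3) by linarith
      qed
      ultimately have "degree g1 \<le> 2 * e - 2" unfolding g1_def
        by (intro degree_diff_le Suc.prems(1)) (auto intro: order.trans[OF degree_smult_le])
      then obtain g' where g': "degree g' \<le> 2 * e - 2" "dx g' (max D A)" "\<forall>(x, y)\<in>S. ev2 g' x y = ev2 g1 x y"
        using Suc.IH dx1 by blast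
      have "ev2 g1 x y = ev2 g x y" if "(x, y) \<in> S" for x y
        using evF[OF that] f(1)[OF that] by (simp add: g1_def)
      thus ?thesis using g' by (intro exI[of _ g']) auto
    qed
  qed
  obtain L where L: "\<forall>r\<in>fst ` S. degree (L r) < card (fst ` S) \<and> (\<forall>s\<in>fst ` S. poly (L r) s = (if s = r then 1 else 0))"
    using lagrange[of "fst ` S"] S(1) by blast
  have fib: "finite {y. (x, y) \<in> S} \<and> card {y. (x, y) \<in> S} \<le> e" if xS: "x \<in> fst ` S" for x
  proof -
    have Ex: "poly E x \<noteq> 0" using xS S(3) by auto
    define k where "k = smult (poly E x) B - [:poly G x:]"
    have "coeff k e = poly E x * lead_coeff B" using B(1,2) by (simp add: k_def coeff_pCons split: nat.split)
    hence k0: "k \<noteq> 0" using Ex B0 by auto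
    have dk: "degree k \<le> e" unfolding k_def using B(1) by (intro degree_diff_le) auto
    have "{y. (x, y) \<in> S} \<subseteq> {y. poly k y = 0}" using S(2) by (auto simp: k_def)
    thus ?thesis using card_proots_le[OF k0] dk by (meson card_mono finite_subset le_trans)
  qed
  have "\<exists>M. \<forall>r\<in>{y. (x, y) \<in> S}. degree (M r) \<le> e - 1 \<and> (\<forall>s\<in>{y. (x, y) \<in> S}. poly (M r) s = (if s = r then 1 else 0))"
    if xS: "x \<in> fst ` S" for x
  proof -
    obtain M where M: "\<forall>r\<in>{y. (x, y) \<in> S}. degree (M r) < card {y. (x, y) \<in> S} \<and>
       (\<forall>s\<in>{y. (x, y) \<in> S}. poly (M r) s = (if s = r then 1 else 0))"
      using lagrange[of "{y. (x, y) \<in> S}"] fib[OF xS] by blast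
    have "degree (M r) \<le> e - 1" if "(x, r) \<in> S" for r
    proof -
      have "degree (M r) < card {y. (x, y) \<in> S}" using M that by blast
      thus ?thesis using fib[OF xS] by linarith
    qed
    thus ?thesis using M by (intro exI[of _ M]) blast
  qed
  then obtain M where M: "\<And>x r. x \<in> fst ` S \<Longrightarrow> (x, r) \<in> S \<Longrightarrow> degree (M x r) \<le> e - 1"
    "\<And>x r s. x \<in> fst ` S \<Longrightarrow> (x, r) \<in> S \<Longrightarrow> (x, s) \<in> S \<Longrightarrow> poly (M x r) s = (if s = r then 1 else 0)"
    by (simp add: Ball_def) metis
  \<comment> \<open>The right values by interpolation first in x and then in each fibre; the degree
    in y is below e, while the degree in x is reduced afterwards.\<close>
  define g0 where "g0 = (\<Sum>P\<in>S. smult (smult (val P) (L (fst P))) (lift (M (fst P) (snd P))))"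
  have dg0: "degree g0 \<le> 2 * e - 2"
    unfolding g0_def
  proof (intro degree_sum_le S(1))
    fix P assume P: "P \<in> S"
    have "degree (smult (smult (val P) (L (fst P))) (lift (M (fst P) (snd P)))) \<le> degree (M (fst P) (snd P))"
      by (rule order.trans[OF degree_smult_le degree_map_poly_le])
    also have "\<dots> \<le> 2 * e - 2" using M(1)[of "fst P" "snd P"] P B(2) by auto
    finally show "degree (smult (smult (val P) (L (fst P))) (lift (M (fst P) (snd P)))) \<le> 2 * e - 2" .
  qed
  have ev0: "ev2 g0 x y = val (x, y)" if xy: "(x, y) \<in> S" for x y
  proof -
    have "ev2 g0 x y = (\<Sum>P\<in>S. val P * poly (L (fst P)) x * poly (M (fst P) (snd P)) y)"
      by (simp add: g0_def mult_ac)
    also have "\<dots> = (\<Sum>P\<in>{(x, y)}. val P * poly (L (fst P)) x * poly (M (fst P) (snd P)) y)"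
    proof (intro sum.mono_neutral_right S(1) ballI)
      fix P assume P: "P \<in> S - {(x, y)}"
      obtain x' y' where P': "P = (x', y')" by (cases P)
      show "val P * poly (L (fst P)) x * poly (M (fst P) (snd P)) y = 0"
      proof (cases "x' = x")
        case True
        have xs: "x' \<in> fst ` S" and P1: "(x', y') \<in> S" and P2: "(x', y) \<in> S" and "y' \<noteq> y"
          using P P' xy True by force+
        hence "poly (M x' y') y = 0" using M(2)[OF xs P1 P2] by simp
        thus ?thesis using P' by simp
      next
        case False
        have "x' \<in> fst ` S" "x \<in> fst ` S" using P P' xy by force+
        hence "poly (L x') x = (if x = x' then 1 else 0)" using L by blast
        hence "poly (L x') x = 0" using False by simp
        thus ?thesis using P' by simp
      qed
    qed (use xy in auto)
    also have "\<dots> = val (x, y)"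
    proof -
      have xs: "x \<in> fst ` S" using xy by force
      hence "poly (L x) x = (if x = x then 1 else 0)" using L by blast
      hence "poly (L x) x = 1" by simp
      moreover have "poly (M x y) y = 1" using M(2)[OF xs xy xy] by simp
      ultimately show ?thesis by simp
    qed
    finally show ?thesis .
  qed
  obtain t where "dx g0 t" using ex_dx by blast
  from red[OF dg0 this] obtain g where "degree g \<le> 2 * e - 2" "dx g (max D A)" "\<forall>(x, y)\<in>S. ev2 g x y = ev2 g0 x y" by blast
  thus ?thesis using ev0 by (intro exI[of _ g]) auto
qed

context fq_closure begin

lemma fst_eq_frob: "(x ^ q) ^ i * (y ^ q) ^ j = (x ^ i * y ^ j) ^ q" for x y :: 'k
  by (simp add: power_mult_distrib power_mult[symmetric] mult.commute)

text \<open>The coefficients of g solve a linear system over K that Frobenius maps to itself, so a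
  solution over the small field exists within the same degree bounds.\<close>

lemma fq_interp2:
  assumes st: "\<And>x y. (x, y) \<in> S \<Longrightarrow> \<exists>x' y'. (x', y') \<in> S \<and> x = x' ^ q \<and> y = y' ^ q \<and> val (x, y) = val (x', y') ^ q"
    and g: "dx g s" "degree g \<le> t" "\<And>x y. (x, y) \<in> S \<Longrightarrow> ev2 g x y = val (x, y)"
  shows "\<exists>h\<in>FP2 s t. \<forall>(x, y)\<in>S. ev2 h x y = val (x, y)"
proof -
  let ?I = "{..s} \<times> {..t}" and ?M = "\<lambda>m P. fst P ^ fst m * snd P ^ snd m :: 'k"
  have ge: "ev2 g x y = (\<Sum>m\<in>?I. coeff (coeff g (snd m)) (fst m) * (x ^ fst m * y ^ snd m))" for x y
    using ev2_p2[of s t "\<lambda>(i, j). coeff (coeff g j) i" x y] unfolding p2_coeff[OF g(1,2)] by (simp add: case_prod_unfold)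
  have "\<exists>b. (\<forall>i\<in>?I. b i \<in> Fq q) \<and> (\<forall>P\<in>S. (\<Sum>i\<in>?I. b i * ?M i P) = val P)"
  proof (rule fq_solution)
    fix P assume P: "P \<in> S"
    obtain x y where xy: "P = (x, y)" by (cases P)
    obtain x' y' where "(x', y') \<in> S" "x = x' ^ q" "y = y' ^ q" "val (x, y) = val (x', y') ^ q" using st P xy by blast
    thus "\<exists>P'\<in>S. (\<forall>i\<in>?I. ?M i P = ?M i P' ^ q) \<and> val P = val P' ^ q"
      unfolding xy by (intro bexI[of _ "(x', y')"]) (simp_all add: fst_eq_frob)
    show "(\<Sum>i\<in>?I. coeff (coeff g (snd i)) (fst i) * ?M i P) = val P" using g(3) P ge xy by auto
  qed auto
  then obtain b where b: "\<forall>i\<in>?I. b i \<in> Fq q" "\<forall>P\<in>S. (\<Sum>i\<in>?I. b i * ?M i P) = val P" by blast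
  have "p2 s t b \<in> FP2 s t" by (rule p2_FP2) (use b(1) in blast)
  moreover have "\<forall>(x, y)\<in>S. ev2 (p2 s t b) x y = val (x, y)" unfolding ev2_p2 using b(2) by force
  ultimately show ?thesis by blast
qed

lemma fq_separate:
  assumes st: "\<And>x y. (x, y) \<in> S \<Longrightarrow> \<exists>x' y'. (x', y') \<in> S \<and> x = x' ^ q \<and> y = y' ^ q"
    and g: "dx g s" "degree g \<le> t" "\<And>x y. (x, y) \<in> S \<Longrightarrow> ev2 g x y = 0" "ev2 g x0 y0 \<noteq> 0"
  shows "\<exists>h\<in>FP2 s t. (\<forall>(x, y)\<in>S. ev2 h x y = 0) \<and> ev2 h x0 y0 \<noteq> 0"
proof -
  let ?I = "{..s} \<times> {..t}" and ?M = "\<lambda>P m. fst P ^ fst m * snd P ^ snd m :: 'k"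
  have ge: "ev2 g x y = (\<Sum>m\<in>?I. coeff (coeff g (snd m)) (fst m) * (x ^ fst m * y ^ snd m))" for x y
    using ev2_p2[of s t "\<lambda>(i, j). coeff (coeff g j) i" x y] unfolding p2_coeff[OF g(1,2)] by (simp add: case_prod_unfold)
  have "\<exists>b. (\<forall>i\<in>?I. b i \<in> Fq q) \<and> (\<forall>w\<in>?M ` S. (\<Sum>i\<in>?I. b i * w i) = 0) \<and> (\<Sum>i\<in>?I. b i * ?M (x0, y0) i) \<noteq> 0"
  proof (rule descent[where a = "\<lambda>m. coeff (coeff g (snd m)) (fst m)"])
    fix w assume "w \<in> ?M ` S"
    then obtain x y where w: "(x, y) \<in> S" "w = ?M (x, y)" by auto
    obtain x' y' where "(x', y') \<in> S" "x = x' ^ q" "y = y' ^ q" using st[OF w(1)] by blast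
    thus "\<exists>w'\<in>?M ` S. \<forall>i\<in>?I. w i = w' i ^ q"
      unfolding w(2) by (intro bexI[of _ "?M (x', y')"] imageI ballI) (simp_all add: fst_eq_frob)
    show "(\<Sum>i\<in>?I. coeff (coeff g (snd i)) (fst i) * w i) = 0" using g(3)[OF w(1)] unfolding ge w(2) by simp
  qed (use g(4) in \<open>auto simp: ge\<close>)
  then obtain b where b: "\<forall>i\<in>?I. b i \<in> Fq q" "\<forall>w\<in>?M ` S. (\<Sum>i\<in>?I. b i * w i) = 0" "(\<Sum>i\<in>?I. b i * ?M (x0, y0) i) \<noteq> 0" by blast
  have "p2 s t b \<in> FP2 s t" by (rule p2_FP2) (use b(1) in blast)
  moreover have "\<forall>(x, y)\<in>S. ev2 (p2 s t b) x y = 0" unfolding ev2_p2 using b(2) by force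
  moreover have "ev2 (p2 s t b) x0 y0 \<noteq> 0" unfolding ev2_p2 using b(3) by simp
  ultimately show ?thesis by blast
qed

text \<open>There are more monomials x^i y^j with i at most card S div e and j < e than points of S,
  so a relation exists over K, and by descent over the small field. A is its exact degree in x. A
  degree below e in y will keep the leading coefficient in x nonzero at elements of degree
  e.\<close>

lemma small_vanishing:
  assumes st: "\<And>x y. (x, y) \<in> S \<Longrightarrow> \<exists>x' y'. (x', y') \<in> S \<and> x = x' ^ q \<and> y = y' ^ q"
    and S: "finite S" and e: "e \<ge> 1"
  shows "\<exists>f A. A \<le> card S div e \<and> fq2 f \<and> degree f \<le> e - 1 \<and> dx f A \<and> xc A f \<noteq> 0 \<and> (\<forall>(x, y)\<in>S. ev2 f x y = 0)"
proof -
  let ?s = "card S div e" and ?t = "e - 1"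
  let ?I = "{..?s} \<times> {..?t}" and ?M = "\<lambda>P m. fst P ^ fst m * snd P ^ snd m :: 'k"
  have "card S < Suc ?s * e" using e dividend_less_times_div[of e "card S"] by (simp add: mult.commute)
  also have "Suc ?s * e = card ?I" using e by (simp add: card_cartesian_product)
  finally obtain l where l: "\<exists>i\<in>?I. l i \<noteq> 0" "\<forall>P\<in>S. (\<Sum>i\<in>?I. l i * ?M P i) = 0"
    using underdetermined[OF S, of ?I ?M] by auto
  obtain m where m: "m \<in> ?I" "l m \<noteq> 0" using l(1) by blast
  have "\<exists>b. (\<forall>i\<in>?I. b i \<in> Fq q) \<and> (\<forall>w\<in>?M ` S. (\<Sum>i\<in>?I. b i * w i) = 0) \<and> (\<Sum>i\<in>?I. b i * (if i = m then 1 else 0)) \<noteq> 0"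
  proof (rule descent[where a = l])
    fix w assume "w \<in> ?M ` S"
    then obtain x y where w: "(x, y) \<in> S" "w = ?M (x, y)" by auto
    obtain x' y' where "(x', y') \<in> S" "x = x' ^ q" "y = y' ^ q" using st[OF w(1)] by blast
    thus "\<exists>w'\<in>?M ` S. \<forall>i\<in>?I. w i = w' i ^ q"
      unfolding w(2) by (intro bexI[of _ "?M (x', y')"] imageI ballI) (simp_all add: fst_eq_frob)
    show "(\<Sum>i\<in>?I. l i * w i) = 0" using l(2) w by auto
  next
    have "(\<Sum>i\<in>?I. l i * (if i = m then 1 else 0)) = (\<Sum>i\<in>{m}. l i * (if i = m then 1 else 0))"
      using m(1) by (intro sum.mono_neutral_right) auto
    thus "(\<Sum>i\<in>?I. l i * (if i = m then 1 else 0)) \<noteq> 0" using m(2) by simp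
  qed auto
  then obtain b where b: "\<forall>i\<in>?I. b i \<in> Fq q" "\<forall>w\<in>?M ` S. (\<Sum>i\<in>?I. b i * w i) = 0" "(\<Sum>i\<in>?I. b i * (if i = m then 1 else 0)) \<noteq> 0" by blast
  have "(\<Sum>i\<in>?I. b i * (if i = m then 1 else 0)) = (\<Sum>i\<in>{m}. b i * (if i = m then 1 else 0))"
    using m(1) by (intro sum.mono_neutral_right) auto
  hence bm: "b m \<noteq> 0" using b(3) by simp
  define f where "f = p2 ?s ?t b"
  have f: "f \<in> FP2 ?s ?t" unfolding f_def by (rule p2_FP2) (use b(1) in blast)
  have van: "\<forall>(x, y)\<in>S. ev2 f x y = 0" unfolding f_def ev2_p2 using b(2) by force
  let ?P = "\<lambda>i. \<exists>j. coeff (coeff f j) i \<noteq> 0"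
  have "?P (fst m)" using bm m(1) unfolding f_def by (intro exI[of _ "snd m"]) (auto simp: coeff_p2)
  moreover have bd: "i \<le> ?s" if "?P i" for i using that unfolding f_def by (auto simp: coeff_p2 split: if_splits)
  ultimately obtain A where A: "?P A" "\<And>i. ?P i \<Longrightarrow> i \<le> A"
    using GreatestI_nat[of ?P "fst m" ?s] Greatest_le_nat[of ?P _ ?s] by blast
  have "xc A f \<noteq> 0"
  proof
    assume "xc A f = 0"
    hence "coeff (coeff f j) A = 0" for j by (metis coeff_xc coeff_0)
    thus False using A(1) by blast
  qed
  moreover have "dx f A" unfolding dx_def by (intro allI degree_le) (use A(2) in \<open>meson not_le\<close>)
  ultimately show ?thesis using f van bd[OF A(1)] by (intro exI[of _ f] exI[of _ A]) (auto simp: FP2_def)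
qed

end

section \<open>The choice of the curve\<close>

locale tower = fq_closure q c ty for q c and ty :: "'k::alg_closed_field itself" +
  fixes p n :: nat and \<beta> :: 'k
  assumes p_def: "p = CHAR('k)" and n1: "n \<ge> 1" and \<beta>: "exact_deg n \<beta>"
begin

definition B :: "'k poly" where "B = conj_poly n \<beta>"
definition w :: "'k poly" where "w = (\<Prod>m\<in>{1..n div 2}. monom 1 (q ^ m) - monom 1 1)"
definition h :: "'k poly \<Rightarrow> 'k poly" where "h C = C * w"
definition G :: "'k poly \<Rightarrow> 'k poly" where "G C = h C ^ p"
definition E :: "'k poly \<Rightarrow> 'k poly" where "E C = 1 + [:0, 1:] * G C"

text \<open>The affine points of degree below n on the plane curve, at which U has to be
  prescribed.\<close>

definition Z :: "'k poly \<Rightarrow> ('k \<times> 'k) set" where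
  "Z C = {(x, y). \<exists>m. 1 \<le> m \<and> m < n \<and> x \<in> FF m \<and> y \<in> FF m \<and> poly (E C) x * poly B y = poly (G C) x}"

lemma p_gt0: "p > 0" using prime_char prime_gt_0_nat unfolding p_def by blast

lemma B: "fqpoly B" "degree B = n" "lead_coeff B = 1" "poly B y = 0 \<Longrightarrow> exact_deg n y"
  "poly B y = 0 \<Longrightarrow> poly (pderiv B) y \<noteq> 0"
  using conj_poly[OF \<beta>] conjs_exact[OF \<beta>] unfolding B_def by auto

lemma w_root: "poly w x = 0 \<longleftrightarrow> (\<exists>m. 1 \<le> m \<and> m \<le> n div 2 \<and> x \<in> FF m)"
  by (auto simp: w_def poly_prod poly_monom FF_iff)

lemma w_fq: "fqpoly w" unfolding w_def by (intro fqpoly_prod fqpoly_diff fqpoly_monom) (use FF_1[of 1] in simp_all)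

lemma w_degree: "w \<noteq> 0" "degree w \<le> 2 * q ^ (n div 2)"
proof -
  have qm: "q ^ m > 1" if "m \<in> {1..n div 2}" for m using that q_ge2 by (intro one_less_power) auto
  have nz: "monom 1 (q ^ m) - monom 1 1 \<noteq> (0::'k poly)" if "m \<in> {1..n div 2}" for m
  proof
    assume "monom 1 (q ^ m) - monom 1 1 = (0::'k poly)"
    hence "coeff (monom 1 (q ^ m) - monom 1 1 :: 'k poly) 1 = 0" by simp
    thus False using qm[OF that] by (auto split: if_splits)
  qed
  thus "w \<noteq> 0" unfolding w_def by simp
  have "degree w \<le> (\<Sum>m\<in>{1..n div 2}. q ^ m)"
    unfolding w_def
  proof (rule order.trans[OF degree_prod_sum_le], simp, intro sum_mono)
    fix m assume "m \<in> {1..n div 2}"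
    thus "(degree \<circ> (\<lambda>m. monom 1 (q ^ m) - monom 1 1 :: 'k poly)) m \<le> q ^ m"
      using qm[of m] by (auto intro!: degree_diff_le simp: degree_monom_eq)
  qed
  also have "(\<Sum>m\<in>{1..k}. q ^ m) \<le> 2 * q ^ k" for k
  proof (induction k)
    case (Suc k)
    have "2 * q ^ k \<le> q * q ^ k" by (rule mult_right_mono[OF q_ge2]) simp
    moreover have "(\<Sum>m\<in>{1..Suc k}. q ^ m) = (\<Sum>m\<in>{1..k}. q ^ m) + q * q ^ k" by simp
    ultimately show ?case using Suc unfolding power_Suc by linarith
  qed simp
  finally show "degree w \<le> 2 * q ^ (n div 2)" .
qed

lemma pow_p_inj: "(x::'k) ^ p = y ^ p \<Longrightarrow> x = y"
proof -
  assume e: "x ^ p = y ^ p"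
  have "p ^ c = p * p ^ (c - 1)" using c_pos by (cases c) auto
  hence "x ^ (q ^ 1) = y ^ (q ^ 1)" by (simp only: q_def p_def[symmetric] power_one_right power_mult e)
  thus "x = y" by (rule fr_inj)
qed

lemma finite_Z: "finite (Z C)"
proof -
  have "Z C \<subseteq> (\<Union>m\<in>{1..<n}. FF m \<times> FF m)" by (auto simp: Z_def)
  moreover have "finite (\<Union>m\<in>{1..<n}. FF m \<times> FF m)" using card_FF by auto
  ultimately show ?thesis by (rule finite_subset)
qed

text \<open>The degree of x divides d and exceeds n div 2, so twice it exceeds d and it must equal
  d.\<close>

lemma small_exact:
  assumes "x \<in> FF d" "1 \<le> d" "d < n" "poly w x \<noteq> 0" shows "exact_deg d x"
proof -
  obtain m where m: "exact_deg m x" using exact_deg_ex by blast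
  hence "m dvd d" using exact_deg_iff assms(1) by blast
  then obtain k where k: "d = m * k" by (elim dvdE)
  have "m > n div 2"
  proof (rule ccontr)
    assume "\<not> ?thesis"
    hence "poly w x = 0" using m unfolding w_root by (intro exI[of _ m]) (auto simp: exact_deg_def)
    thus False using assms(4) by simp
  qed
  hence "2 * m > d" using assms(3) by linarith
  hence "k < 2" unfolding k by simp
  moreover have "k > 0" using k assms(2) by (cases k) auto
  ultimately have "k = 1" by simp
  thus ?thesis using m k by simp
qed

lemma B_small: "y \<in> FF m \<Longrightarrow> 1 \<le> m \<Longrightarrow> m < n \<Longrightarrow> poly B y \<noteq> 0"
  using B(4)[of y] exact_deg_dvd[of n y m] dvd_imp_le[of n m] by auto

text \<open>Where w vanishes, G is 0 and E is 1, so the curve equation reads B(y) = 0, which needs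
  an element y of degree n.\<close>

lemma w_nz_point:
  assumes "poly (E C) x * poly B y = poly (G C) x" "y \<in> FF m" "1 \<le> m" "m < n" shows "poly w x \<noteq> 0"
proof
  assume "poly w x = 0"
  hence "poly (G C) x = 0" using p_gt0 by (simp add: G_def h_def)
  thus False using assms(1) B_small[OF assms(2-4)] by (simp add: E_def)
qed

lemma E_nz_point: "poly (E C) x = 0 \<Longrightarrow> poly w x \<noteq> 0"
  using p_gt0 by (auto simp: E_def G_def h_def power_0_left)

lemma Z_exact: assumes "(x, y) \<in> Z C" shows "\<exists>m. 1 \<le> m \<and> m < n \<and> exact_deg m x \<and> y \<in> FF m"
proof -
  obtain m where m: "1 \<le> m" "m < n" "x \<in> FF m" "y \<in> FF m" "poly (E C) x * poly B y = poly (G C) x"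
    using assms by (auto simp: Z_def)
  thus ?thesis using small_exact[OF m(3,1,2) w_nz_point[OF m(5,4,1,2)]] by blast
qed

text \<open>Solved for h, the curve equation is h^p * (1 - x * B(y)) = B(y). The factor 1 - x * B(y)
  is nonzero, since otherwise B(y) = 0 and the factor would be 1; so the point determines C(x)^p,
  and p-th roots are unique in characteristic p.\<close>

lemma Z_value:
  assumes "(x, y) \<in> Z C" "(x, y) \<in> Z C'" shows "poly C x = poly C' x"
proof -
  have val: "poly C x ^ p * ((1 - x * poly B y) * poly w x ^ p) = poly B y \<and> (1 - x * poly B y) * poly w x ^ p \<noteq> 0"
    if z: "(x, y) \<in> Z C" for C
  proof -
    obtain m where m: "1 \<le> m" "m < n" "x \<in> FF m" "y \<in> FF m" "poly (E C) x * poly B y = poly (G C) x"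
      using z by (auto simp: Z_def)
    have w0: "poly w x \<noteq> 0" using w_nz_point[OF m(5,4,1,2)] .
    have eq: "(1 + x * (poly C x * poly w x) ^ p) * poly B y = (poly C x * poly w x) ^ p"
      using m(5) by (simp add: E_def G_def h_def)
    hence v: "poly C x ^ p * ((1 - x * poly B y) * poly w x ^ p) = poly B y"
      by (simp add: power_mult_distrib algebra_simps)
    have "1 - x * poly B y \<noteq> 0"
    proof
      assume a: "1 - x * poly B y = 0"
      hence "poly B y = 0" using v by simp
      thus False using a by simp
    qed
    thus ?thesis using v w0 by simp
  qed
  have "poly C x ^ p = poly C' x ^ p" using val[OF assms(1)] val[OF assms(2)] by (metis mult_cancel_right)
  thus ?thesis by (rule pow_p_inj)
qed

lemma sum_q: "(\<Sum>m\<in>{1..<k}. q ^ m) + 1 \<le> q ^ k" if "k \<ge> 1"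
  using that
proof (induction k rule: dec_induct)
  case (step k)
  have "2 * q ^ k \<le> q * q ^ k" by (rule mult_right_mono[OF q_ge2]) simp
  moreover have "(\<Sum>m\<in>{1..<Suc k}. q ^ m) = (\<Sum>m\<in>{1..<k}. q ^ m) + q ^ k" using step.hyps by simp
  ultimately show ?case using step.IH unfolding power_Suc by linarith
qed (use q_ge2 in simp)

text \<open>The bound holds on average over C, since a point of Z C determines the value of C at x.\<close>
lemma ex_C: "\<exists>C\<in>FP n. C \<noteq> 0 \<and> card (Z C) \<le> q ^ n"
proof (rule ccontr)
  assume neg: "\<not> ?thesis"
  let ?F = "FP n - {0}"
  define Pm where "Pm m = {(x, y). exact_deg m x \<and> y \<in> FF m}" for m
  have Psub: "Pm m \<subseteq> FF m \<times> FF m" for m by (auto simp: Pm_def exact_deg_def)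
  have finP: "finite (Pm m)" "card (Pm m) \<le> q ^ m * q ^ m" if "m \<ge> 1" for m
  proof -
    have f: "finite (FF m \<times> FF m)" using card_FF[OF that] by simp
    show "finite (Pm m)" by (rule finite_subset[OF Psub f])
    show "card (Pm m) \<le> q ^ m * q ^ m" using card_mono[OF f Psub] card_FF[OF that] by (simp add: card_cartesian_product)
  qed
  have finF: "finite ?F" "card ?F = q ^ n - 1"
    using card_FP[of n] by (auto simp: FP_def fqpoly_0)
  have fib: "card {C \<in> ?F. P \<in> Z C} \<le> q ^ (n - m)" if P: "P \<in> Pm m" and m: "m < n" for P m
  proof (cases "\<exists>C. C \<in> ?F \<and> P \<in> Z C")
    case False
    hence e: "{C \<in> ?F. P \<in> Z C} = {}" by blast
    show ?thesis unfolding e by simp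
  next
    case True
    then obtain C0 where C0: "P \<in> Z C0" by blast
    obtain x y where xy: "P = (x, y)" by (cases P)
    have "{C \<in> ?F. P \<in> Z C} \<subseteq> {C \<in> FP n. poly C x = poly C0 x}" using Z_value C0 unfolding xy by blast
    moreover have "finite {C \<in> FP n. poly C x = poly C0 x}" using card_FP(1)[of n] by simp
    ultimately have "card {C \<in> ?F. P \<in> Z C} \<le> card {C \<in> FP n. poly C x = poly C0 x}" by (rule card_mono[rotated])
    also have "\<dots> \<le> q ^ (n - m)" using P m unfolding xy by (intro card_fiber) (auto simp: Pm_def)
    finally show ?thesis .
  qed
  have bool: "(\<Sum>P\<in>Pm m. of_bool (P \<in> Z C)) = card (Z C \<inter> Pm m)" if "m \<ge> 1" for m C
    using finP(1)[OF that] by (simp add: Int_commute)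
  have cZ: "card (Z C) \<le> (\<Sum>m\<in>{1..<n}. card (Z C \<inter> Pm m))" for C
  proof -
    have "Z C = (\<Union>m\<in>{1..<n}. Z C \<inter> Pm m)" using Z_exact by (fastforce simp: Pm_def)
    thus ?thesis using card_UN_le[of "{1..<n}" "\<lambda>m. Z C \<inter> Pm m"] by simp
  qed
  have "(\<Sum>C\<in>?F. card (Z C)) \<le> (\<Sum>C\<in>?F. \<Sum>m\<in>{1..<n}. card (Z C \<inter> Pm m))" by (intro sum_mono cZ)
  also have "\<dots> = (\<Sum>m\<in>{1..<n}. \<Sum>C\<in>?F. card (Z C \<inter> Pm m))" by (rule sum.swap)
  \<comment> \<open>At most q^(2m) pairs (x, y) with x of degree m, each lying on the curves of at
    most q^(n-m) polynomials C. Per polynomial this is about q^m, and these powers sum to less than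
    q^n.\<close>
  also have "\<dots> \<le> (\<Sum>m\<in>{1..<n}. q ^ n * q ^ m)"
  proof (intro sum_mono)
    fix m assume m: "m \<in> {1..<n}"
    have "(\<Sum>C\<in>?F. card (Z C \<inter> Pm m)) = (\<Sum>C\<in>?F. \<Sum>P\<in>Pm m. of_bool (P \<in> Z C))" using m by (simp only: bool atLeastLessThan_iff)
    also have "\<dots> = (\<Sum>P\<in>Pm m. \<Sum>C\<in>?F. of_bool (P \<in> Z C))" by (rule sum.swap)
    also have "\<dots> = (\<Sum>P\<in>Pm m. card {C \<in> ?F. P \<in> Z C})"
      using finF(1) by (intro sum.cong) (auto simp: sum_of_bool_eq intro!: arg_cong[of _ _ card])
    also have "\<dots> \<le> (\<Sum>P\<in>Pm m. q ^ (n - m))" using m by (intro sum_mono fib) auto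
    also have "\<dots> = card (Pm m) * q ^ (n - m)" by simp
    also have "\<dots> \<le> q ^ m * q ^ m * q ^ (n - m)" using finP(2)[of m] m by (intro mult_right_mono) auto
    also have "\<dots> = q ^ n * q ^ m" using m by (simp add: power_add[symmetric] add.commute)
    finally show "(\<Sum>C\<in>?F. card (Z C \<inter> Pm m)) \<le> q ^ n * q ^ m" .
  qed
  also have "\<dots> = q ^ n * (\<Sum>m\<in>{1..<n}. q ^ m)" by (simp add: sum_distrib_left)
  also have "\<dots> \<le> q ^ n * (q ^ n - 1)" using sum_q[OF n1] by (intro mult_left_mono) auto
  finally have up: "(\<Sum>C\<in>?F. card (Z C)) \<le> q ^ n * (q ^ n - 1)" .
  have "(\<Sum>C\<in>?F. q ^ n + 1) \<le> (\<Sum>C\<in>?F. card (Z C))"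
    using neg by (intro sum_mono) (auto simp: not_le Suc_le_eq)
  hence "card ?F * (q ^ n + 1) \<le> q ^ n * (q ^ n - 1)" using up by (simp only: sum_constant of_nat_id)
  hence "(q ^ n - 1) * (q ^ n + 1) \<le> (q ^ n - 1) * q ^ n" unfolding finF(2) by (simp only: mult.commute)
  moreover have "q ^ n - 1 > 0" using sum_q[OF n1] one_less_power[of q n] q_ge2 n1 by simp
  hence "(q ^ n - 1) * q ^ n < (q ^ n - 1) * (q ^ n + 1)" by (intro mult_strict_left_mono) auto
  ultimately show False by simp
qed

end

text \<open>The constants: r + 1 is the number of free coefficients in the union bound, where
  q^(r+1) has to exceed the number of branch points; b - 1 = r + (2 * n - 2) makes room for
  multiplying a function of degree 2 * n - 2 in y by a polynomial of degree r in y; \<mu> exceeds b,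
  and its last summand makes a = D * \<mu> larger than A.\<close>

locale tower2 = tower q c ty p n \<beta> for q c and ty :: "'k::alg_closed_field itself" and p n \<beta> +
  fixes C :: "'k poly" and f :: "'k poly poly" and A D r b \<mu> a :: nat and \<nu> \<mu>0 :: 'k
  assumes C: "C \<in> FP n" "C \<noteq> 0" "card (Z C) \<le> q ^ n"
    and f: "fq2 f" "degree f \<le> n - 1" "dx f A" "xc A f \<noteq> 0" "\<And>x y. (x, y) \<in> Z C \<Longrightarrow> ev2 f x y = 0" "A \<le> card (Z C) div n"
    and D_def: "D = p * degree (h C) + 1" and r_def: "r = 2 * n + 10" and b_def: "b = 4 * n + 9"
    and \<mu>_def: "\<mu> = b + 2 + (q ^ n div n) div D" and a_def: "a = D * \<mu>"
    and \<nu>: "exact_deg b \<nu>" and \<mu>0: "exact_deg \<mu> \<mu>0"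
begin

abbreviation "EE \<equiv> E C"
abbreviation "GG \<equiv> G C"

definition NN :: "'k poly" where "NN = conj_poly b \<nu>"
text \<open>On the curve G = \<kappa> * E means B(y) = \<kappa>. The zeros of HH are therefore the
  points at which B(y) is a conjugate of \<mu>0, and every field containing y has degree divisible
  by \<mu>.\<close>

definition HH :: "'k poly" where "HH = (\<Prod>\<kappa>\<in>conjs \<mu> \<mu>0. GG - smult \<kappa> EE)"

lemma NN: "fqpoly NN" "degree NN = b" "lead_coeff NN = 1" "poly NN y = 0 \<Longrightarrow> exact_deg b y"
  "poly NN y = 0 \<Longrightarrow> poly (pderiv NN) y \<noteq> 0"
  using conj_poly[OF \<nu>] conjs_exact[OF \<nu>] unfolding NN_def by auto

lemma h_nz: "h C \<noteq> 0" using C(2) w_degree(1) by (simp add: h_def)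

lemma GG_nz: "GG \<noteq> 0" using h_nz by (simp add: G_def)

lemma degGG: "degree GG = p * degree (h C)" "degree GG < D"
  unfolding G_def by (simp_all add: degree_power_eq h_nz D_def)

lemma degEE: "degree EE = D"
proof -
  have "degree ([:0, 1:] * GG) = D" using GG_nz degGG(1) by (subst degree_mult_eq) (auto simp: D_def)
  thus ?thesis unfolding E_def by (subst degree_add_eq_right) (auto simp: D_def)
qed

lemma fq_h: "fqpoly (h C)" unfolding h_def using C(1) w_fq by (intro fqpoly_mult) (auto simp: FP_def)
lemma fq_GG: "fqpoly GG" unfolding G_def by (rule fqpoly_power[OF fq_h])
lemma fq_EE: "fqpoly EE" unfolding E_def by (intro fqpoly_add fqpoly_mult fqpoly_1 fqpoly_X fq_GG)

lemma pd_GG: "pderiv GG = 0" unfolding G_def by (simp add: pderiv_power p_def of_nat_CHAR)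
lemma pd_EE: "pderiv EE = GG" unfolding E_def by (simp add: pderiv_add pderiv_mult pd_GG pderiv_pCons)

lemma EG: "poly EE x = 0 \<Longrightarrow> poly GG x \<noteq> 0" by (auto simp: E_def)

lemma kap: assumes "\<kappa> \<in> conjs \<mu> \<mu>0" shows "exact_deg \<mu> \<kappa>" "\<kappa> \<noteq> 0"
proof -
  show e: "exact_deg \<mu> \<kappa>" by (rule conjs_exact[OF \<mu>0 assms])
  show "\<kappa> \<noteq> 0"
  proof
    assume "\<kappa> = 0"
    hence "\<mu> dvd 1" using exact_deg_dvd[OF e, of 1] FF_0[of 1] by simp
    thus False by (simp add: \<mu>_def b_def)
  qed
qed

lemma HH_factor: assumes "\<kappa> \<in> conjs \<mu> \<mu>0" shows "degree (GG - smult \<kappa> EE) = D"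
proof -
  have "degree (smult (- \<kappa>) EE) = D" using kap(2)[OF assms] degEE by simp
  hence "degree (GG + smult (- \<kappa>) EE) = D" using degGG(2) by (subst degree_add_eq_right) auto
  thus ?thesis by simp
qed

lemma HH_root: "poly HH x = 0 \<longleftrightarrow> (\<exists>\<kappa>\<in>conjs \<mu> \<mu>0. poly GG x = \<kappa> * poly EE x)"
  unfolding HH_def using card_conjs(1)[OF \<mu>0] by (simp add: poly_prod)

lemma degHH: "degree HH = a"
proof -
  have nz: "GG - smult \<kappa> EE \<noteq> 0" if "\<kappa> \<in> conjs \<mu> \<mu>0" for \<kappa> using HH_factor[OF that] by (auto simp: D_def)
  have "degree HH = (\<Sum>\<kappa>\<in>conjs \<mu> \<mu>0. degree (GG - smult \<kappa> EE))"
    unfolding HH_def by (rule degree_prod_eq_sum_degree) (use nz in blast)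
  also have "\<dots> = (\<Sum>\<kappa>\<in>conjs \<mu> \<mu>0. D)" by (rule sum.cong[OF refl HH_factor])
  finally show ?thesis using card_conjs(2)[OF \<mu>0] by (simp add: a_def)
qed

lemma fq_HH: "fqpoly HH"
proof -
  interpret fr: comm_ring_hom "\<lambda>x::'k. x ^ q" by (rule frob_hom)
  interpret mp: map_poly_comm_ring_hom "\<lambda>x::'k. x ^ q" ..
  let ?m = "map_poly (\<lambda>x::'k. x ^ q)"
  have e: "?m EE = EE" "?m GG = GG" using fq_EE fq_GG fqpoly_iff by auto
  have sm: "?m (smult \<kappa> EE) = smult (\<kappa> ^ q) EE" for \<kappa>
    by (rule poly_eqI) (use e(1) in \<open>simp add: coeff_map_poly poly_eq_iff power_mult_distrib q_pos power_0_left\<close>)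
  have inj: "inj_on (\<lambda>y. y ^ q) (conjs \<mu> \<mu>0)" using fr_inj[of _ 1] by (auto intro: inj_onI)
  have "?m HH = (\<Prod>\<kappa>\<in>conjs \<mu> \<mu>0. ?m (GG - smult \<kappa> EE))" unfolding HH_def by (rule mp.hom_prod)
  also have "\<dots> = (\<Prod>\<kappa>\<in>conjs \<mu> \<mu>0. GG - smult (\<kappa> ^ q) EE)" by (simp add: mp.hom_minus e sm)
  also have "\<dots> = (\<Prod>\<kappa>\<in>(\<lambda>y. y ^ q) ` conjs \<mu> \<mu>0. GG - smult \<kappa> EE)" by (simp add: prod.reindex[OF inj])
  also have "\<dots> = HH" unfolding conjs_frob[OF \<mu>0] HH_def ..
  finally show ?thesis unfolding fqpoly_iff .
qed

text \<open>Since E' = G and G' = 0, the factor vanishing at x has derivative - \<kappa> * G there,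
  and the other factors do not vanish.\<close>

lemma sepHH: assumes "poly HH x = 0" shows "poly (pderiv HH) x \<noteq> 0"
proof -
  obtain \<kappa> where \<kappa>: "\<kappa> \<in> conjs \<mu> \<mu>0" "poly GG x = \<kappa> * poly EE x" using assms HH_root by blast
  have E0: "poly EE x \<noteq> 0" using EG[of x] \<kappa>(2) by auto
  have G0: "poly GG x \<noteq> 0" using \<kappa> E0 kap(2) by auto
  define R where "R = (\<Prod>\<kappa>'\<in>conjs \<mu> \<mu>0 - {\<kappa>}. GG - smult \<kappa>' EE)"
  have HR: "HH = (GG - smult \<kappa> EE) * R" unfolding HH_def R_def by (rule prod.remove[OF card_conjs(1)[OF \<mu>0] \<kappa>(1)])
  have "poly R x \<noteq> 0" unfolding R_def using card_conjs(1)[OF \<mu>0] E0 \<kappa>(2) by (auto simp: poly_prod)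
  moreover have "pderiv HH = smult (- \<kappa>) GG * R + (GG - smult \<kappa> EE) * pderiv R"
    unfolding HR pderiv_mult by (simp add: pderiv_diff pderiv_smult pd_GG pd_EE mult.commute)
  ultimately show ?thesis using kap(2)[OF \<kappa>(1)] G0 \<kappa>(2) by simp
qed

definition onX :: "'k \<Rightarrow> 'k \<Rightarrow> bool" where "onX x y \<longleftrightarrow> poly EE x * poly B y = poly GG x"

lemma onX_E: "onX x y \<Longrightarrow> poly EE x \<noteq> 0" using EG by (auto simp: onX_def)

lemma H_point: assumes "poly HH x = 0" "onX x y" shows "exact_deg \<mu> (poly B y)"
proof -
  obtain \<kappa> where \<kappa>: "\<kappa> \<in> conjs \<mu> \<mu>0" "poly GG x = \<kappa> * poly EE x" using assms HH_root by blast
  have "poly B y = \<kappa>" using assms(2) \<kappa>(2) onX_E[OF assms(2)] by (simp add: onX_def)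
  thus ?thesis using kap(1)[OF \<kappa>(1)] by simp
qed

lemma big: "n < b" "b < \<mu>" by (auto simp: b_def \<mu>_def)

text \<open>B(y) has degree \<mu> at the zeros of H, and y has degree b at the zeros of N. Besides
  excluding branch points of small degree, this keeps polynomials in y of degree below b over the
  small field from vanishing at branch points.\<close>

lemma Gam_large:
  assumes "onX x y" "poly HH x * poly NN y = 0" "y \<in> FF m" "1 \<le> m" shows "b \<le> m"
proof (cases "poly HH x = 0")
  case True
  have "poly B y \<in> FF m" by (rule poly_FF[OF B(1) assms(3)])
  hence "\<mu> dvd m" using exact_deg_dvd[OF H_point[OF True assms(1)]] by blast
  thus ?thesis using assms(4) big dvd_imp_le[of \<mu> m] by simp
next
  case False
  hence "b dvd m" using exact_deg_dvd[OF NN(4) assms(3)] assms(2) by simp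
  thus ?thesis using assms(4) dvd_imp_le[of b m] by simp
qed

lemma NB: "poly NN y = 0 \<Longrightarrow> poly B y \<noteq> 0"
  using exact_deg_unique[OF NN(4) B(4)] big(1) by auto

lemma curve_ok:
  assumes "\<And>x y. onX x y \<Longrightarrow> poly HH x * poly NN y = 0 \<Longrightarrow> (\<Sum>i\<le>a. \<Sum>j\<le>b. u i j * x ^ i * y ^ j) \<noteq> 0"
  shows "curve EE GG B HH NN u p D n a b"
proof
  show "p = CHAR('k)" "prime p" using prime_char by (simp_all add: p_def)
  show "degree EE = D" "degree GG < D" "degree B = n" "1 \<le> n" "degree HH = a" "degree NN = b" "lead_coeff B = 1"
    using degEE degGG B n1 degHH NN by auto
  show "1 \<le> a" "1 \<le> b" by (auto simp: a_def D_def \<mu>_def b_def)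
  show "poly EE x = 0 \<Longrightarrow> poly GG x \<noteq> 0" for x by (rule EG)
  show "poly EE x = 0 \<Longrightarrow> poly (pderiv EE) x \<noteq> 0" for x using EG by (simp add: pd_EE)
  show "poly EE x * poly (pderiv B) y \<noteq> 0 \<or> poly (pderiv EE) x * poly B y \<noteq> poly (pderiv GG) x"
    if c: "poly EE x * poly B y = poly GG x" for x y
  proof -
    have E0: "poly EE x \<noteq> 0" using onX_E c by (auto simp: onX_def)
    show ?thesis using c B(5)[of y] E0 by (cases "poly B y = 0") (auto simp: pd_EE pd_GG)
  qed
  show "poly B y = 0 \<Longrightarrow> poly (pderiv B) y \<noteq> 0" for y by (rule B(5))
  show "poly HH x = 0 \<Longrightarrow> poly (pderiv HH) x \<noteq> 0" for x by (rule sepHH)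
  show "poly HH x = 0 \<Longrightarrow> poly EE x \<noteq> 0" for x using HH_root[of x] EG[of x] by auto
  \<comment> \<open>The derivative of B is a nonzero polynomial over the small field of degree below
    b, and y has degree at least b.\<close>
  show "poly (pderiv B) y \<noteq> 0" if "poly HH x = 0" "poly EE x * poly B y = poly GG x" for x y
  proof
    assume d0: "poly (pderiv B) y = 0"
    have "pderiv B \<noteq> 0"
    proof -
      obtain y0 where "poly B y0 = 0" using alg_closed_imp_poly_has_root[of B] B(2) n1 by auto
      thus ?thesis using B(5)[of y0] by auto
    qed
    moreover have "fqpoly (pderiv B)" unfolding fqpoly_def
    proof
      fix i
      have "of_nat k \<in> FF 1" for k using FF_0[of 1] FF_1[of 1] FF_add[of _ 1] by (induction k) auto
      moreover have "coeff B (Suc i) \<in> FF 1" using B(1) by (simp add: fqpoly_def)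
      ultimately have "of_nat (Suc i) * coeff B (Suc i) \<in> FF 1" by (intro FF_mult)
      thus "coeff (pderiv B) i \<in> Fq q" unfolding coeff_pderiv by (simp only: power_one_right)
    qed
    ultimately obtain k where k: "1 \<le> k" "k \<le> degree (pderiv B)" "y \<in> FF k"
      using root_fqpoly_in_FF[OF _ _ d0] by blast
    have "b \<le> k" by (rule Gam_large[of x y]) (use that k in \<open>auto simp: onX_def\<close>)
    thus False using k(2) degree_pderiv_le[of B] B(2) big(1) by linarith
  qed
  show "poly NN y \<noteq> 0" if "poly HH x = 0" "poly EE x * poly B y = poly GG x" for x y
  proof
    assume "poly NN y = 0"
    hence "y \<in> FF b" using NN(4)[of y] by (simp add: exact_deg_def)
    hence "poly B y \<in> FF b" by (rule poly_FF[OF B(1)])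
    hence "\<mu> dvd b" using exact_deg_dvd[OF H_point[OF that(1)]] that(2) by (auto simp: onX_def)
    thus False using big(2) dvd_imp_le[of \<mu> b] by (simp add: b_def)
  qed
  show "poly NN y = 0 \<Longrightarrow> poly (pderiv NN) y \<noteq> 0" for y by (rule NN(5))
  show "poly NN y = 0 \<Longrightarrow> poly B y \<noteq> 0" for y by (rule NB)
  show "poly (pderiv EE) x * poly B y \<noteq> poly (pderiv GG) x" if "poly NN y = 0" "poly EE x * poly B y = poly GG x" for x y
    using NB[OF that(1)] onX_E[of x y] that(2) by (auto simp: pd_EE pd_GG onX_def)
  show "(\<Sum>i\<le>a. \<Sum>j\<le>b. u i j * x ^ i * y ^ j) \<noteq> 0" if "poly EE x * poly B y = poly GG x" "poly HH x * poly NN y = 0" for x y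
    using assms that by (simp add: onX_def)
qed

definition Gm :: "('k \<times> 'k) set" where "Gm = {(x, y). onX x y \<and> poly HH x * poly NN y = 0}"

text \<open>The number of branch points is needed for the choice of U but does not depend on U, so
  it is taken from the curve with U = 1.\<close>

lemma card_Gm: "finite Gm" "card Gm = D * b + n * a"
proof -
  define u :: "nat \<Rightarrow> nat \<Rightarrow> 'k" where "u i j = (if i = 0 \<and> j = 0 then 1 else 0)" for i j
  have "(\<Sum>i\<le>a. \<Sum>j\<le>b. u i j * x ^ i * y ^ j) = 1" for x y
  proof -
    have "(\<Sum>i\<le>a. \<Sum>j\<le>b. u i j * x ^ i * y ^ j) = (\<Sum>m\<in>{..a} \<times> {..b}. u (fst m) (snd m) * x ^ fst m * y ^ snd m)"
      by (simp add: sum.cartesian_product case_prod_unfold)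
    also have "\<dots> = (\<Sum>m\<in>{(0, 0)}. u (fst m) (snd m) * x ^ fst m * y ^ snd m)"
      by (rule sum.mono_neutral_right) (auto simp: u_def prod_eq_iff)
    finally show ?thesis by (simp add: u_def)
  qed
  then interpret cv: curve EE GG B HH NN u p D n a b by (intro curve_ok) simp
  have "Gm = cv.Gam" by (auto simp: Gm_def cv.Gam_def onX_def)
  thus "finite Gm" "card Gm = D * b + n * a" using cv.card_Gam by simp_all
qed

lemma Z_onX: "(x, y) \<in> Z C \<Longrightarrow> onX x y" by (auto simp: Z_def onX_def)

lemma Z_notGm: "(x, y) \<in> Z C \<Longrightarrow> (x, y) \<notin> Gm"
proof
  assume z: "(x, y) \<in> Z C" and g: "(x, y) \<in> Gm"
  obtain m where m: "1 \<le> m" "m < n" "y \<in> FF m" using z by (auto simp: Z_def)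
  have "b \<le> m" by (rule Gam_large[OF _ _ m(3,1)]) (use g in \<open>auto simp: Gm_def\<close>)
  thus False using m(2) big(1) by simp
qed

lemma onX_frob: "onX (x ^ q ^ j) (y ^ q ^ j) \<longleftrightarrow> onX x y"
proof -
  have "onX (x ^ q ^ j) (y ^ q ^ j) \<longleftrightarrow> (poly EE x * poly B y) ^ q ^ j = poly GG x ^ q ^ j"
    by (simp add: onX_def poly_fr fq_EE fq_GG B(1) power_mult_distrib)
  moreover have "s ^ q ^ j = t ^ q ^ j \<longleftrightarrow> s = t" for s t :: 'k by (rule iffI[OF fr_inj]) auto
  ultimately show ?thesis unfolding onX_def by (simp only:)
qed

lemma Z_stable:
  assumes "(x, y) \<in> Z C" shows "\<exists>x' y'. (x', y') \<in> Z C \<and> x = x' ^ q \<and> y = y' ^ q"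
proof -
  obtain m where m: "1 \<le> m" "m < n" "x \<in> FF m" "y \<in> FF m" and o: "onX x y" using assms by (auto simp: Z_def onX_def)
  have e: "z = (z ^ q ^ (m - 1)) ^ q" if "z \<in> FF m" for z
  proof -
    have "(z ^ q ^ (m - 1)) ^ q = z ^ q ^ Suc (m - 1)" by (simp add: power_mult[symmetric] mult.commute)
    thus ?thesis using m(1) that by (simp add: FF_iff)
  qed
  have "(x ^ q ^ (m - 1), y ^ q ^ (m - 1)) \<in> Z C"
    using m o onX_frob FF_frob by (auto simp: Z_def onX_def[symmetric])
  thus ?thesis using e[OF m(3)] e[OF m(4)] by blast
qed

text \<open>A nonzero polynomial over the small field of degree below n cannot vanish at the roots
  of B, which have degree n. So the leading coefficients in x of f and of the curve equation are
  coprime, as \<open>realise\<close> demands.\<close>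

lemma xcA: assumes "poly B y = 0" shows "poly (xc A f) y \<noteq> 0"
proof (rule exact_deg_no_root[OF B(4)[OF assms]])
  show "fqpoly (xc A f)" using f(1) by (auto simp: fqpoly_def fq2_def)
  show "degree (xc A f) < n" using degree_xc[of A f] f(2) n1 by linarith
qed (rule f(4))

lemma sizes: "max D (A + 1) \<le> a" "2 * n - 2 \<le> b - 1" "r + (2 * n - 2) \<le> b - 1" "r < b" "D \<le> a"
proof -
  have D1: "D \<ge> 1" by (simp add: D_def)
  have "A \<le> q ^ n div n" using f(6) C(3) by (meson div_le_mono le_trans)
  also have "\<dots> < D * ((q ^ n div n) div D + 1)"
    using dividend_less_times_div[of D "q ^ n div n"] D1 by (simp add: mult.commute)
  also have "\<dots> \<le> a" unfolding a_def \<mu>_def by (intro mult_left_mono) auto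
  finally have "A + 1 \<le> a" by simp
  moreover show "D \<le> a" unfolding a_def \<mu>_def by simp
  ultimately show "max D (A + 1) \<le> a" by simp
qed (use n1 in \<open>auto simp: r_def b_def\<close>)

lemma realise_Z: "\<exists>g. degree g \<le> 2 * n - 2 \<and> dx g (max D A) \<and> (\<forall>(x, y)\<in>Z C. ev2 g x y = val (x, y))"
  by (rule realise[OF degEE degGG(2) B(2) n1 B(5) finite_Z _ _ f(5,2,3) xcA])
    (use Z_onX onX_E in \<open>auto simp: onX_def\<close>)

text \<open>Multiplying f by x - x0 makes it vanish at the additional point as well without changing
  its leading coefficient in x, so \<open>realise\<close> applies with A + 1 and gives a function
  that is 1 at the branch point and 0 on Z C.\<close>

lemma separate_Gm:
  assumes P: "(x0, y0) \<in> Gm"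
  shows "\<exists>g\<in>FP2 (max D (A + 1)) (2 * n - 2). (\<forall>(x, y)\<in>Z C. ev2 g x y = 0) \<and> ev2 g x0 y0 \<noteq> 0"
proof -
  let ?f = "smult [:- x0, 1:] f"
  have xcf: "xc (A + 1) ?f = xc A f"
  proof (rule poly_eqI)
    fix j
    have "degree (coeff f j) \<le> A" using f(3) by (simp add: dx_def)
    thus "coeff (xc (A + 1) ?f) j = coeff (xc A f) j" by (simp add: coeff_eq_0)
  qed
  have "\<exists>g. degree g \<le> 2 * n - 2 \<and> dx g (max D (A + 1)) \<and>
      (\<forall>(x, y)\<in>insert (x0, y0) (Z C). ev2 g x y = (if (x, y) = (x0, y0) then 1 else 0))"
  proof (rule realise[OF degEE degGG(2) B(2) n1 B(5), where f = ?f])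
    show "finite (insert (x0, y0) (Z C))" using finite_Z by simp
    show "poly EE x * poly B y = poly GG x" "poly EE x \<noteq> 0" if "(x, y) \<in> insert (x0, y0) (Z C)" for x y
      using that P Z_onX[of x y] onX_E[of x y] by (auto simp: Gm_def onX_def)
    show "ev2 ?f x y = 0" if "(x, y) \<in> insert (x0, y0) (Z C)" for x y using that f(5) by auto
    show "degree ?f \<le> n - 1" using f(2) by (rule order.trans[OF degree_smult_le])
    have "dx ?f (1 + A)" by (rule dx_smult) (use f(3) in auto)
    thus "dx ?f (A + 1)" by (simp add: add.commute)
    show "poly B y = 0 \<Longrightarrow> poly (xc (A + 1) ?f) y \<noteq> 0" for y unfolding xcf by (rule xcA)
  qed
  then obtain g where g: "degree g \<le> 2 * n - 2" "dx g (max D (A + 1))"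
    "\<And>x y. (x, y) \<in> insert (x0, y0) (Z C) \<Longrightarrow> ev2 g x y = (if (x, y) = (x0, y0) then 1 else 0)" by fast
  show ?thesis
  proof (rule fq_separate[OF Z_stable g(2,1)])
    show "ev2 g x y = 0" if "(x, y) \<in> Z C" for x y using g(3)[of x y] that Z_notGm[OF that] P by auto
    show "ev2 g x0 y0 \<noteq> 0" using g(3)[of x0 y0] by simp
  qed
qed

text \<open>The points with infinite y whose coordinate x has degree below n. The value of U there
  is its coefficient W at y^b, and N contributes its leading coefficient 1.\<close>

definition ZE :: "'k set" where "ZE = {x. poly EE x = 0 \<and> (\<exists>m. 1 \<le> m \<and> m < n \<and> x \<in> FF m)}"

lemma HH_frob: "poly HH (x ^ q) = poly HH x ^ q" using poly_fr[OF fq_HH, of x 1] by simp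

lemma ex_W: "\<exists>W. fqpoly W \<and> degree W \<le> D \<and> (\<forall>x\<in>ZE. poly W x = vv x * poly HH x)"
proof -
  have EE0: "EE \<noteq> 0" using degEE by (auto simp: D_def)
  have "ZE \<subseteq> {x. poly EE x = 0}" by (auto simp: ZE_def)
  hence fin: "finite ZE" "card ZE \<le> D"
    using card_proots_le[OF EE0] degEE by (meson finite_subset, meson card_mono le_trans order_refl)
  obtain L where L: "\<forall>x\<in>ZE. degree (L x) < card ZE \<and> (\<forall>s\<in>ZE. poly (L x) s = (if s = x then 1 else 0))"
    using lagrange[OF fin(1)] by blast
  define g where "g = (\<Sum>x\<in>ZE. smult (vv x * poly HH x) (L x))"
  have dg: "degree g \<le> D" unfolding g_def
  proof (intro degree_sum_le fin(1))
    fix x assume "x \<in> ZE"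
    hence "degree (L x) < card ZE" using L by blast
    thus "degree (smult (vv x * poly HH x) (L x)) \<le> D" using fin(2) degree_smult_le[of "vv x * poly HH x" "L x"] by linarith
  qed
  have ev: "poly g s = vv s * poly HH s" if s: "s \<in> ZE" for s
  proof -
    have "poly g s = (\<Sum>x\<in>ZE. vv x * poly HH x * (if s = x then 1 else 0))"
      unfolding g_def poly_sum using L s by (intro sum.cong) auto
    also have "\<dots> = (\<Sum>x\<in>{s}. vv x * poly HH x * (if s = x then 1 else 0))"
      using s fin(1) by (intro sum.mono_neutral_right) auto
    finally show ?thesis by simp
  qed
  \<comment> \<open>A dummy second coordinate 0 and degree 0 in y turn interpolation in x into a
    case of \<open>fq_interp2\<close>.\<close>
  have "\<exists>k\<in>FP2 D 0. \<forall>(x, y)\<in>ZE \<times> {0}. ev2 k x y = (\<lambda>P. vv (fst P) * poly HH (fst P)) (x, y)"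
  proof (rule fq_interp2[where g = "[:g:]"])
    show "dx [:g:] D" using dg by (rule dx_const)
    show "ev2 [:g:] x y = vv (fst (x, y)) * poly HH (fst (x, y))" if "(x, y) \<in> ZE \<times> {0}" for x y using ev that by auto
    fix x y :: 'k assume xy: "(x, y) \<in> ZE \<times> {0}"
    then obtain m where m: "1 \<le> m" "m < n" "x \<in> FF m" "poly EE x = 0" by (auto simp: ZE_def)
    let ?x = "x ^ q ^ (m - 1)"
    have "?x ^ q = x ^ q ^ Suc (m - 1)" by (simp add: power_mult[symmetric] mult.commute)
    hence e: "x = ?x ^ q" using m by (simp add: FF_iff)
    have "?x \<in> ZE" using m FF_frob poly_fr[OF fq_EE] q_pos by (auto simp: ZE_def)
    moreover have "vv x * poly HH x = (vv ?x * poly HH ?x) ^ q"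
      using vv_frob[of ?x] HH_frob[of ?x] e by (simp add: power_mult_distrib)
    ultimately show "\<exists>x' y'. (x', y') \<in> ZE \<times> {0} \<and> x = x' ^ q \<and> y = y' ^ q \<and>
        vv (fst (x, y)) * poly HH (fst (x, y)) = (vv (fst (x', y')) * poly HH (fst (x', y'))) ^ q"
      using e xy q_pos by (intro exI[of _ ?x] exI[of _ 0]) auto
  qed simp
  then obtain k where k: "k \<in> FP2 D 0" "\<And>x. x \<in> ZE \<Longrightarrow> ev2 k x 0 = vv x * poly HH x" by auto
  have "ev2 k x 0 = poly (coeff k 0) x" for x by (cases k) simp
  thus ?thesis using k by (intro exI[of _ "coeff k 0"]) (auto simp: FP2_def fq2_def dx_def)
qed

end

lemma th2_infinity: "th2 l m g P (1, 0) = hom1 l (coeff g m) P" for g :: "'k::field poly poly"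
proof -
  have "th2 l m g P (1, 0) = (\<Sum>i\<le>l. \<Sum>j\<in>{m}. coeff (coeff g j) i *
     (fst P ^ i * snd P ^ (l - i) * (fst (1::'k, 0::'k) ^ j * snd (1::'k, 0::'k) ^ (m - j))))"
    unfolding th2_def by (rule sum.cong[OF refl], rule sum.mono_neutral_right) auto
  thus ?thesis by (simp add: hom1_def)
qed

section \<open>Estimates for D and for the number of branch points\<close>

lemma square_le_two_power: "(k + 1) * (k + 1) \<le> 4 * (2::nat) ^ k"
proof (induction k)
  case (Suc k)
  show ?case
  proof (cases "k < 2")
    case True
    hence "k = 0 \<or> k = 1" by auto
    thus ?thesis by auto
  next
    case False
    hence "2 * 2 \<le> k * k" by (intro mult_le_mono) auto
    hence "(Suc k + 1) * (Suc k + 1) \<le> 2 * ((k + 1) * (k + 1))" by simp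
    thus ?thesis using Suc by simp
  qed
qed simp

context tower2 begin

lemma s_bounds: "n \<le> 3 * q ^ (n div 2)" "(n + 1) * (n + 1) \<le> 16 * q ^ (n div 2)" "q ^ (n div 2) * q ^ (n div 2) \<le> q ^ n"
proof -
  let ?k = "n div 2"
  have nk: "n \<le> 2 * ?k + 1" by simp
  have qk: "2 ^ ?k \<le> q ^ ?k" using q_ge2 by (rule power_mono) simp
  have "2 * k + 1 \<le> 3 * (2::nat) ^ k" for k
  proof (induction k)
    case (Suc k)
    have "(2::nat) * 1 \<le> 3 * 2 ^ k" by (intro mult_le_mono) auto
    hence "2 * k + 1 + 2 * 1 \<le> 3 * 2 ^ k + 3 * (2::nat) ^ k" by (rule add_mono[OF Suc])
    thus ?case by simp
  qed simp
  from this[of ?k] show "n \<le> 3 * q ^ ?k" using nk qk by linarith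
  have "(n + 1) * (n + 1) \<le> (2 * (?k + 1)) * (2 * (?k + 1))" using nk by (intro mult_le_mono) auto
  also have "\<dots> = 4 * ((?k + 1) * (?k + 1))" by simp
  also have "\<dots> \<le> 4 * (4 * 2 ^ ?k)" by (intro mult_le_mono square_le_two_power) simp
  also have "\<dots> \<le> 16 * q ^ ?k" using qk by simp
  finally show "(n + 1) * (n + 1) \<le> 16 * q ^ ?k" .
  have "q ^ ?k * q ^ ?k = q ^ (?k + ?k)" by (simp add: power_add)
  also have "\<dots> \<le> q ^ n" using q_ge2 by (intro power_increasing) auto
  finally show "q ^ ?k * q ^ ?k \<le> q ^ n" .
qed

text \<open>With s = q^(n div 2), the degree of w is at most 2 * s and that of C below n, which is
  at most 3 * s.\<close>

lemma D_bound: "D \<le> 5 * p * q ^ (n div 2)"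
proof -
  have "C \<noteq> 0" "C \<in> FP n" using C by auto
  hence "degree C \<le> n - 1" using FP_degree[of C n] by simp
  hence "degree (h C) \<le> (n - 1) + 2 * q ^ (n div 2)" unfolding h_def
    using degree_mult_le[of C w] w_degree(2) by linarith
  hence "degree (h C) + 1 \<le> 5 * q ^ (n div 2)" using s_bounds(1) n1 by linarith
  hence "p * (degree (h C) + 1) \<le> p * (5 * q ^ (n div 2))" by (intro mult_le_mono) auto
  thus ?thesis using p_gt0 unfolding D_def by (simp add: algebra_simps)
qed

text \<open>The last summand of \<mu> contributes at most n * (q^n div n) to n * a, that is q^n
  without a factor n. The rest is D * (n + 1) * (b + 2), where b + 2 is at most 11 * (n + 1), and (n
  + 1)^2 and D are each bounded by a multiple of q^(n div 2); 880 = 5 * 11 * 16.\<close>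

lemma Gm_bound: "card Gm \<le> 881 * p * q ^ n"
proof -
  let ?s = "q ^ (n div 2)" and ?t = "q ^ n div n"
  have "D * (?t div D) \<le> ?t" by simp
  hence "a \<le> D * (b + 2) + ?t" unfolding a_def \<mu>_def by (simp add: distrib_left)
  hence "n * a \<le> n * (D * (b + 2) + ?t)" by (intro mult_le_mono) auto
  also have "\<dots> = n * D * (b + 2) + n * ?t" by (simp add: algebra_simps)
  also have "n * ?t \<le> q ^ n" by simp
  finally have "n * a \<le> n * D * (b + 2) + q ^ n" by simp
  hence "card Gm \<le> D * (b + 2) + n * D * (b + 2) + q ^ n" unfolding card_Gm(2) by (simp add: algebra_simps)
  also have "D * (b + 2) + n * D * (b + 2) = D * ((n + 1) * (b + 2))" by (simp add: algebra_simps)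
  also have "(n + 1) * (b + 2) \<le> (n + 1) * (11 * (n + 1))" by (intro mult_le_mono) (auto simp: b_def)
  also have "\<dots> = 11 * ((n + 1) * (n + 1))" by (simp only: mult.left_commute)
  also have "\<dots> \<le> 11 * (16 * ?s)" by (intro mult_le_mono s_bounds order.refl)
  also have "D * (11 * (16 * ?s)) \<le> (5 * p * ?s) * (11 * (16 * ?s))" by (intro mult_le_mono D_bound order.refl)
  also have "\<dots> = 880 * p * (?s * ?s)" by (simp add: algebra_simps)
  also have "\<dots> \<le> 880 * p * q ^ n" by (intro mult_le_mono s_bounds order.refl)
  also have "880 * p * q ^ n + q ^ n \<le> 881 * p * q ^ n"
  proof -
    have "1 * q ^ n \<le> p * q ^ n" using p_gt0 by (intro mult_le_mono) auto
    thus ?thesis by simp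
  qed
  finally show ?thesis by simp
qed

text \<open>As 881 < 2^10 and p is at most q, the number is below q^(n + 11); this is the origin of
  the 10 in r.\<close>

lemma Gm_small: "card Gm < q ^ (r + 1)"
proof -
  have pq: "p \<le> q"
  proof -
    have "p ^ 1 \<le> p ^ c" using c_pos p_gt0 by (intro power_increasing) auto
    thus ?thesis by (simp add: q_def p_def)
  qed
  have "(2::nat) ^ 10 \<le> q ^ 10" using q_ge2 by (rule power_mono) simp
  hence t: "881 < q ^ 10" by simp
  have "card Gm \<le> 881 * p * q ^ n" by (rule Gm_bound)
  also have "\<dots> \<le> 881 * (q * q ^ n)" using pq by simp
  also have "\<dots> < q ^ 10 * (q * q ^ n)" using t q_pos by (intro mult_strict_right_mono) auto
  also have "\<dots> = q ^ (n + 11)" by (simp add: power_add mult_ac eval_nat_numeral)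
  also have "\<dots> \<le> q ^ (r + 1)" using q_ge2 by (intro power_increasing) (auto simp: r_def)
  finally show ?thesis .
qed

text \<open>A union bound over the points of Gm: among the functions with the prescribed values on Z C, at
  most a fraction of q^-(r+1) has a given value at such a point.\<close>
lemma ex_k:
  assumes W: "fqpoly W"
  shows "\<exists>k\<in>FP2 a (b - 1). (\<forall>(x, y)\<in>Z C. ev2 k x y = vv x * poly HH x * poly NN y - poly W x * y ^ b) \<and>
     (\<forall>(x, y)\<in>Gm. ev2 k x y + poly W x * y ^ b \<noteq> 0)"
proof -
  \<comment> \<open>U will be k + W * y^b, so the part W * y^b is subtracted from the value wanted
    for U.\<close>
  define val where "val P = vv (fst P) * poly HH (fst P) * poly NN (snd P) - poly W (fst P) * snd P ^ b" for P
  define UU where "UU = {k \<in> FP2 a (b - 1). \<forall>P\<in>Z C. ev2 k (fst P) (snd P) = val P}"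
  have finU: "finite UU" using finite_FP2 by (simp add: UU_def)
  have val_frob: "val (x ^ q, y ^ q) = val (x, y) ^ q" for x y
  proof -
    have "poly NN (y ^ q) = poly NN y ^ q" "poly W (x ^ q) = poly W x ^ q"
      using poly_fr[OF NN(1), of y 1] poly_fr[OF W, of x 1] by simp_all
    moreover have "(s - t) ^ q = s ^ q - t ^ q" for s t :: 'k using fr_diff[of s t 1] by simp
    ultimately show ?thesis
      by (simp add: val_def vv_frob HH_frob power_mult_distrib power_mult[symmetric] mult.commute)
  qed
  have "UU \<noteq> {}"
  proof -
    obtain g where g: "degree g \<le> 2 * n - 2" "dx g (max D A)" "\<forall>(x, y)\<in>Z C. ev2 g x y = val (x, y)"
      using realise_Z by blast
    have "\<exists>k\<in>FP2 a (b - 1). \<forall>(x, y)\<in>Z C. ev2 k x y = val (x, y)"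
    proof (rule fq_interp2)
      show "dx g a" by (rule dx_mono[OF g(2)]) (use sizes(1) in auto)
      show "degree g \<le> b - 1" using g(1) sizes(2) by linarith
      show "ev2 g x y = val (x, y)" if "(x, y) \<in> Z C" for x y using g(3) that by blast
      show "\<exists>x' y'. (x', y') \<in> Z C \<and> x = x' ^ q \<and> y = y' ^ q \<and> val (x, y) = val (x', y') ^ q"
        if "(x, y) \<in> Z C" for x y
        using Z_stable[OF that] val_frob by metis
    qed
    then obtain k where "k \<in> FP2 a (b - 1)" "\<forall>(x, y)\<in>Z C. ev2 k x y = val (x, y)" by blast
    hence "k \<in> UU" unfolding UU_def by auto
    thus ?thesis by blast
  qed
  hence U0: "card UU > 0" using finU by (simp add: card_gt_0_iff)
  define bad where "bad P = {k \<in> UU. ev2 k (fst P) (snd P) + poly W (fst P) * snd P ^ b = 0}" for P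
  have bad: "card (bad P) * q ^ (r + 1) \<le> card UU" if P: "P \<in> Gm" for P
  proof -
    obtain x0 y0 where xy: "P = (x0, y0)" by (cases P)
    obtain g where g: "g \<in> FP2 (max D (A + 1)) (2 * n - 2)" "\<forall>(x, y)\<in>Z C. ev2 g x y = 0" "ev2 g x0 y0 \<noteq> 0"
      using separate_Gm P xy by blast
    \<comment> \<open>The translates by R(y) * g keep the values on Z C. At the branch point all bad
      k take the same value, so a translate reveals R(y0), and as y0 has degree at least b > r also
      R and then k. The bad functions are thus at most a fraction q^-(r+1) of all.\<close>
    let ?F = "\<lambda>(k, R). k + lift R * g"
    have mem: "k + lift R * g \<in> UU" if k: "k \<in> UU" and R: "R \<in> FP (r + 1)" for k R
    proof -
      have k': "k \<in> FP2 a (b - 1)" using k by (simp add: UU_def)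
      have dR: "degree R \<le> r" using FP_degree[OF R] by (cases "R = 0") auto
      have "degree (lift R) \<le> degree R" by (rule degree_map_poly_le)
      moreover have "degree g \<le> 2 * n - 2" using g(1) by (simp add: FP2_def)
      ultimately have "degree (lift R * g) \<le> b - 1" using degree_mult_le[of "lift R" g] dR sizes(3) by linarith
      moreover have "dx (lift R * g) (0 + a)"
        by (rule dx_mult[OF dx_lift dx_mono[OF _ sizes(1)]]) (use g(1) in \<open>simp add: FP2_def\<close>)
      moreover have "fq2 (lift R * g)" using g(1) R by (intro fq2_mult fq2_lift) (auto simp: FP2_def FP_def)
      ultimately have "k + lift R * g \<in> FP2 a (b - 1)" using k'
        by (auto simp: FP2_def intro: fq2_add dx_add degree_add_le)
      moreover have "ev2 (k + lift R * g) (fst P) (snd P) = val P" if "P \<in> Z C" for P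
        using k g(2) that by (auto simp: UU_def)
      ultimately show ?thesis by (simp add: UU_def)
    qed
    have "inj_on ?F (bad P \<times> FP (r + 1))"
    proof (rule inj_onI, clarify)
      fix k R k' R' assume a: "k \<in> bad P" "k' \<in> bad P" "R \<in> FP (r + 1)" "R' \<in> FP (r + 1)" "k + lift R * g = k' + lift R' * g"
      have "ev2 (k + lift R * g) x0 y0 = ev2 (k' + lift R' * g) x0 y0" using a(5) by simp
      moreover have "ev2 k x0 y0 = - (poly W x0 * y0 ^ b)" "ev2 k' x0 y0 = - (poly W x0 * y0 ^ b)"
        using a(1,2) by (simp_all add: bad_def xy eq_neg_iff_add_eq_0)
      ultimately have eq: "poly (R - R') y0 = 0" using g(3) by simp
      have "R = R'"
      proof (rule ccontr)
        assume "R \<noteq> R'"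
        hence nz: "R - R' \<noteq> 0" by simp
        have FPR: "R - R' \<in> FP (r + 1)" by (rule FP_diff[OF a(3,4)])
        hence "fqpoly (R - R')" by (simp add: FP_def)
        then obtain m where m: "1 \<le> m" "m \<le> degree (R - R')" "y0 \<in> FF m"
          using root_fqpoly_in_FF[OF _ nz eq] by blast
        have "b \<le> m" by (rule Gam_large[OF _ _ m(3,1)]) (use P xy in \<open>auto simp: Gm_def\<close>)
        thus False using m(2) FP_degree[OF FPR nz] sizes(4) by linarith
      qed
      thus "k = k' \<and> R = R'" using a(5) by simp
    qed
    moreover have "?F ` (bad P \<times> FP (r + 1)) \<subseteq> UU" using mem by (auto simp: bad_def)
    ultimately have "card (bad P \<times> FP (r + 1)) \<le> card UU" using finU by (rule card_inj_on_le)
    thus ?thesis by (simp only: card_cartesian_product card_FP)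
  qed
  have "\<exists>k\<in>UU. \<forall>P\<in>Gm. k \<notin> bad P"
  proof (rule ccontr)
    assume "\<not> ?thesis"
    hence "UU \<subseteq> (\<Union>P\<in>Gm. bad P)" by blast
    moreover have "finite (\<Union>P\<in>Gm. bad P)" using card_Gm(1) finU by (auto simp: bad_def)
    ultimately have "card UU \<le> card (\<Union>P\<in>Gm. bad P)" by (rule card_mono[rotated])
    also have "\<dots> \<le> (\<Sum>P\<in>Gm. card (bad P))" by (rule card_UN_le[OF card_Gm(1)])
    finally have "card UU * q ^ (r + 1) \<le> (\<Sum>P\<in>Gm. card (bad P)) * q ^ (r + 1)" by (rule mult_right_mono) simp
    also have "\<dots> = (\<Sum>P\<in>Gm. card (bad P) * q ^ (r + 1))" by (rule sum_distrib_right)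
    also have "\<dots> \<le> (\<Sum>P\<in>Gm. card UU)" by (intro sum_mono bad)
    also have "\<dots> = card UU * card Gm" by simp
    also have "\<dots> < card UU * q ^ (r + 1)" using Gm_small U0 by (rule mult_strict_left_mono)
    finally show False by simp
  qed
  then obtain k where k: "k \<in> UU" "\<forall>P\<in>Gm. k \<notin> bad P" by blast
  show ?thesis
  proof (intro bexI[of _ k] conjI ballI)
    show "k \<in> FP2 a (b - 1)" using k(1) by (simp add: UU_def)
    fix P
    show "case P of (x, y) \<Rightarrow> ev2 k x y = vv x * poly HH x * poly NN y - poly W x * y ^ b" if "P \<in> Z C"
      using k(1) that by (auto simp: UU_def val_def)
    show "case P of (x, y) \<Rightarrow> ev2 k x y + poly W x * y ^ b \<noteq> 0" if "P \<in> Gm"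
      using k that by (auto simp: bad_def)
  qed
qed

lemma result:
  "\<exists>V g. smooth_proj_abs_irreducible_curve q 7 (V :: 'k proj_point set) \<and> has_genus 7 V g \<and> g \<le> 896 * p ^ 2 * q ^ n \<and>
     (\<forall>P\<in>V. \<forall>x\<in>P. \<forall>d. 1 \<le> d \<longrightarrow> d < n \<longrightarrow> \<not> (\<forall>i j. x j \<noteq> 0 \<longrightarrow> x i / x j \<in> FF d))"
proof -
  obtain W where W: "fqpoly W" "degree W \<le> D" "\<And>x. x \<in> ZE \<Longrightarrow> poly W x = vv x * poly HH x" using ex_W by blast
  obtain k where k: "k \<in> FP2 a (b - 1)"
    "\<And>x y. (x, y) \<in> Z C \<Longrightarrow> ev2 k x y = vv x * poly HH x * poly NN y - poly W x * y ^ b"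
    "\<And>x y. (x, y) \<in> Gm \<Longrightarrow> ev2 k x y + poly W x * y ^ b \<noteq> 0" using ex_k[OF W(1)] by blast
  \<comment> \<open>The coefficients of U: k fills the degrees in y up to b - 1, and W is the
    coefficient of y^b.\<close>
  define u where "u i j = coeff (coeff k j) i + (if j = b then coeff W i else 0)" for i j
  have degW: "degree W \<le> a" using W(2) sizes(5) by linarith
  have kk: "dx k a" "degree k \<le> b - 1" "b \<ge> 1" using k(1) by (auto simp: FP2_def b_def)
  have "p2 a b (\<lambda>(i, j). u i j) = k + monom W b"
  proof (rule poly_eqI, rule poly_eqI)
    fix i j
    have "coeff (coeff k j) i = 0" if "i > a" using kk(1) that le_less_trans by (intro coeff_eq_0) (auto simp: dx_def)
    moreover have "coeff W i = 0" if "i > a" using degW that by (intro coeff_eq_0) auto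
    moreover have "coeff k j = 0" if "j > b" using kk(2) that by (intro coeff_eq_0) auto
    ultimately show "coeff (coeff (p2 a b (\<lambda>(i, j). u i j)) j) i = coeff (coeff (k + monom W b) j) i"
      by (auto simp: coeff_p2 u_def not_le)
  qed
  hence Uev: "(\<Sum>i\<le>a. \<Sum>j\<le>b. u i j * x ^ i * y ^ j) = ev2 k x y + poly W x * y ^ b" for x y
    using ev2_p2[of a b "\<lambda>(i, j). u i j" x y] by (simp add: sum.cartesian_product case_prod_unfold mult.assoc)
  have cv: "curve EE GG B HH NN u p D n a b"
    by (rule curve_ok) (use k(3) in \<open>auto simp: Uev Gm_def\<close>)
  interpret cv: curve_fq EE GG B HH NN u p D n a b q c ty
  proof (rule curve_fq.intro[OF cv fq_closure_axioms], unfold_locales)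
    show "fqpoly EE" "fqpoly GG" "fqpoly B" "fqpoly HH" "fqpoly NN" by (rule fq_EE fq_GG B(1) fq_HH NN(1))+
    fix i j
    have "coeff (coeff k j) i \<in> FF 1" "coeff W i \<in> FF 1" using k(1) W(1) by (auto simp: FP2_def fq2_def fqpoly_def)
    hence "u i j \<in> FF 1" unfolding u_def using FF_0[of 1] by (intro FF_add) auto
    thus "u i j \<in> Fq q" by simp
  qed
  have U: "cv.U x y = ev2 k x y + poly W x * y ^ b" for x y unfolding cv.U_def by (rule Uev)
  have Uinf: "th2 a b cv.U2 (x, 1) (1, 0) = poly W x" for x
  proof -
    have "coeff k b = 0" using kk(2,3) by (intro coeff_eq_0) auto
    hence "coeff cv.U2 b = (\<Sum>i\<le>a. monom (coeff W i) i)" by (simp add: cv.U2_def coeff_sum u_def)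
    also have "\<dots> = W" by (rule poly_as_sum_of_monoms'[OF degW])
    finally show ?thesis unfolding th2_infinity using hom1_affine[OF degW] by simp
  qed
  have Gm: "cv.Gam = Gm" by (auto simp: Gm_def cv.Gam_def onX_def)
  have AS: "vv x \<in> AS d" if "z ^ p - z = vv x" "z \<in> FF d" for x z d
    using that unfolding AS_def p_def by (intro image_eqI[of _ _ z]) simp_all
  have pointless: False if P0: "P0 \<in> cv.V" "x0 \<in> P0" and d: "1 \<le> d" "d < n"
    and rat: "\<forall>i j. x0 j \<noteq> 0 \<longrightarrow> x0 i / x0 j \<in> FF d" for P0 x0 d
  proof -
    obtain l P Q R where dc: "l \<noteq> 0" "nrm P" "nrm Q" "nrm R" "x0 = (\<lambda>i. l * psi P Q R i)"
    and cs: "(\<exists>x y z. P = (x, 1) \<and> Q = (y, 1) \<and> R = (z, 1) \<and> (x, y, z) \<in> cv.X0 \<and> cv.infinite_case P Q z) \<or>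
     (\<exists>x y. P = (x, 1) \<and> Q = (y, 1) \<and> R = (1, 0) \<and> (x, y) \<in> cv.Gam) \<or>
     (\<exists>y z. P = (1, 0) \<and> Q = (y, 1) \<and> R = (z, 1) \<and> poly B y = 0 \<and> cv.infinite_case P Q z) \<or>
     (\<exists>x z. P = (x, 1) \<and> Q = (1, 0) \<and> R = (z, 1) \<and> poly EE x = 0 \<and> cv.infinite_case P Q z)"
      by (rule cv.V_cases[OF P0])
    \<comment> \<open>The pivot coordinate of the normalised point is 1, so the ratios to it are the
      Segre coordinates themselves; with the other two digits at coordinates equal to 1 they give x,
      y and z.\<close>
    let ?j = "ix (snd P = 0) (snd Q = 0) (snd R = 0)"
    have pj: "psi P Q R ?j = 1" using dc by (simp add: nrm_pivot)
    have "x0 (ix s1 s2 s3) / x0 ?j = psi P Q R (ix s1 s2 s3)" "x0 ?j \<noteq> 0" for s1 s2 s3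
      unfolding dc(5) pj using dc(1) by simp_all
    hence mem: "sel s1 P * sel s2 Q * sel s3 R \<in> FF d" for s1 s2 s3
      using rat unfolding psi_ix by metis
    \<comment> \<open>Above a finite point of degree d the choice of k turns the equation into z^p -
      z = \<open>vv x\<close>, where x has exact degree d, so z is not in \<open>FF d\<close>. If z
      is infinite, y has degree at least b; if x is infinite, y is a root of B; if y is infinite, W
      plays the part of k.\<close>
    from cs show False
    proof (elim disjE exE conjE)
      fix x y z assume c: "P = (x, 1)" "Q = (y, 1)" "R = (z, 1)" "(x, y, z) \<in> cv.X0"
      have m: "x \<in> FF d" "y \<in> FF d" "z \<in> FF d"
        using mem[of True False False] mem[of False True False] mem[of False False True] by (simp_all add: c sel_def)
      have on: "poly EE x * poly B y = poly GG x" and eq: "poly HH x * poly NN y * (z ^ p - z) = cv.U x y"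
        using c(4) by (auto simp: cv.X0_def)
      have "(x, y) \<in> Z C" using m d on by (auto simp: Z_def)
      hence "cv.U x y = vv x * poly HH x * poly NN y" unfolding U k(2)[OF \<open>(x, y) \<in> Z C\<close>] by simp
      hence "z ^ p - z = vv x" using eq cv.X0_HN[OF c(4)] by (simp add: mult_ac)
      hence "vv x \<in> AS d" using AS m(3) by blast
      thus False using vv[OF small_exact[OF m(1) d w_nz_point[OF on m(2) d]]] by blast
    next
      fix x y assume c: "P = (x, 1)" "Q = (y, 1)" "R = (1, 0)" "(x, y) \<in> cv.Gam"
      have "y \<in> FF d" using mem[of False True True] by (simp add: c sel_def)
      hence "b \<le> d" by (rule Gam_large[rotated 2]) (use c(4) d in \<open>auto simp: Gm Gm_def\<close>)
      thus False using d(2) big(1) by linarith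
    next
      fix y z assume c: "P = (1, 0)" "Q = (y, 1)" "R = (z, 1)" "poly B y = 0"
      have "y \<in> FF d" using mem[of True True False] by (simp add: c sel_def)
      thus False using B_small d c(4) by blast
    next
      fix x z assume c: "P = (x, 1)" "Q = (1, 0)" "R = (z, 1)" "poly EE x = 0" "cv.infinite_case P Q z"
      have m: "x \<in> FF d" "z \<in> FF d"
        using mem[of True True False] mem[of False True True] by (simp_all add: c sel_def)
      have dg: "degree HH \<le> a" "coeff NN b = 1" using degHH NN by auto
      have H0: "poly HH x \<noteq> 0" using cv.HE[of x] c(4) by blast
      have "poly HH x * (z ^ p - z) = poly W x"
        using c(5) unfolding c cv.infinite_case_def Uinf hom1_infinity hom1_affine[OF dg(1)] by (simp add: dg(2))
      moreover have "x \<in> ZE" using c(4) m d by (auto simp: ZE_def)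
      ultimately have "z ^ p - z = vv x" using W(3) H0 by simp
      hence "vv x \<in> AS d" using AS m(2) by blast
      thus False using vv[OF small_exact[OF m(1) d E_nz_point[OF c(4)]]] by blast
    qed
  qed
  let ?g = "p * ((n - 1) * (D - 1)) + (p - 1) * (D * b + n * a - 1)"
  \<comment> \<open>The constant 896 is 15 + 881: the bounds 3 for n and 5 * p for D, relative to
    q^(n div 2), give 15 * p, and 881 * p comes from the branch points.\<close>
  have "?g \<le> p * (n * D) + p * card Gm" unfolding card_Gm(2) by (intro add_mono mult_le_mono) auto
  also have "n * D \<le> (3 * q ^ (n div 2)) * (5 * p * q ^ (n div 2))" by (intro mult_le_mono s_bounds D_bound)
  also have "\<dots> = 15 * p * (q ^ (n div 2) * q ^ (n div 2))" by (simp add: algebra_simps)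
  also have "\<dots> \<le> 15 * p * q ^ n" by (intro mult_le_mono s_bounds order.refl)
  also have "p * (15 * p * q ^ n) + p * card Gm \<le> p * (15 * p * q ^ n) + p * (881 * p * q ^ n)"
    by (intro add_mono mult_le_mono Gm_bound order.refl)
  also have "\<dots> = 896 * p ^ 2 * q ^ n" by (simp add: power2_eq_square algebra_simps)
  finally have "?g \<le> 896 * p ^ 2 * q ^ n" by simp
  thus ?thesis using cv.V_curve cv.V_genus pointless by (intro exI[of _ cv.V] exI[of _ ?g]) blast
qed

end

section \<open>Assembling the choices\<close>

context fq_closure begin

lemma pointless_curve:
  assumes n: "n \<ge> 1"
  shows "\<exists>V g. smooth_proj_abs_irreducible_curve q 7 (V :: 'k proj_point set) \<and> has_genus 7 V g \<and> g \<le> 896 * CHAR('k) ^ 2 * q ^ n \<and>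
     (\<forall>P\<in>V. \<forall>x\<in>P. \<forall>d. 1 \<le> d \<longrightarrow> d < n \<longrightarrow> \<not> (\<forall>i j. x j \<noteq> 0 \<longrightarrow> x i / x j \<in> FF d))"
proof -
  obtain \<beta> :: 'k where \<beta>: "exact_deg n \<beta>" using exact_deg_exists[OF n] by blast
  interpret tower q c ty "CHAR('k)" n \<beta> by unfold_locales (use n \<beta> in auto)
  obtain C where C: "C \<in> FP n" "C \<noteq> 0" "card (Z C) \<le> q ^ n" using ex_C by blast
  \<comment> \<open>Frobenius stability of Z C is required already for finding f, before
    \<open>tower2\<close> can be interpreted with it.\<close>
  have st: "\<exists>x' y'. (x', y') \<in> Z C \<and> x = x' ^ q \<and> y = y' ^ q" if z: "(x, y) \<in> Z C" for x y
  proof -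
    obtain m where m: "1 \<le> m" "m < n" "x \<in> FF m" "y \<in> FF m" "poly (E C) x * poly B y = poly (G C) x" using z by (auto simp: Z_def)
    have e: "z = (z ^ q ^ (m - 1)) ^ q" if "z \<in> FF m" for z
    proof -
      have "(z ^ q ^ (m - 1)) ^ q = z ^ q ^ Suc (m - 1)" by (simp add: power_mult[symmetric] mult.commute)
      thus ?thesis using m(1) that by (simp add: FF_iff)
    qed
    have fh: "fqpoly (h C)" unfolding h_def using C(1) w_fq by (intro fqpoly_mult) (auto simp: FP_def)
    hence fG: "fqpoly (G C)" unfolding G_def by (rule fqpoly_power)
    hence fE: "fqpoly (E C)" unfolding E_def by (intro fqpoly_add fqpoly_mult fqpoly_1 fqpoly_X)
    have "poly (E C) (x ^ q ^ (m - 1)) * poly B (y ^ q ^ (m - 1)) = poly (G C) (x ^ q ^ (m - 1))"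
      by (simp add: poly_fr fE fG B(1) m(5) flip: power_mult_distrib)
    hence "(x ^ q ^ (m - 1), y ^ q ^ (m - 1)) \<in> Z C" using m FF_frob by (auto simp: Z_def)
    thus ?thesis using e[OF m(3)] e[OF m(4)] by blast
  qed
  obtain f A where f: "A \<le> card (Z C) div n" "fq2 f" "degree f \<le> n - 1" "dx f A" "xc A f \<noteq> 0" "\<forall>(x, y)\<in>Z C. ev2 f x y = 0"
    using small_vanishing[of "Z C" n] st finite_Z n by blast
  define D where "D = CHAR('k) * degree (h C) + 1"
  define \<mu> where "\<mu> = (4 * n + 9) + 2 + (q ^ n div n) div D"
  obtain \<nu> :: 'k where \<nu>: "exact_deg (4 * n + 9) \<nu>" using exact_deg_exists[of "4 * n + 9"] by auto
  obtain \<mu>0 :: 'k where \<mu>0: "exact_deg \<mu> \<mu>0" using exact_deg_exists[of \<mu>] by (auto simp: \<mu>_def)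
  interpret tower2 q c ty "CHAR('k)" n \<beta> C f A D "2 * n + 10" "4 * n + 9" \<mu> "D * \<mu>" \<nu> \<mu>0
    by unfold_locales (use C f \<nu> \<mu>0 in \<open>auto simp: D_def \<mu>_def\<close>)
  show ?thesis by (rule result)
qed

end

text \<open>x is a root of a nonzero polynomial whose coefficients lie in the prime field and are
  fixed by Frobenius. The iterates of x stay among the finitely many roots, so two agree, and
  injectivity of Frobenius brings the coincidence back to x.\<close>

lemma mod_ring_closure_algebraic:
  fixes x :: "'p::prime_card mod_ring alg_closure"
  assumes ch: "CHAR('p mod_ring alg_closure) = p" and p: "prime p" and c: "c \<ge> 1" "q = p ^ c"
  shows "\<exists>k\<ge>1. x ^ q ^ k = x"
proof -
  have pr: "prime CHAR('p mod_ring alg_closure)" and qk: "q ^ k = CHAR('p mod_ring alg_closure) ^ (c * k)" for k using p ch c by (auto simp: power_mult)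
  have add: "((x::'p mod_ring alg_closure) + y) ^ q ^ k = x ^ q ^ k + y ^ q ^ k" for x y k by (rule freshmans_dream'[OF pr qk])
  have sum: "(sum f A :: 'p mod_ring alg_closure) ^ q ^ k = (\<Sum>i\<in>A. f i ^ q ^ k)" for f :: "nat \<Rightarrow> 'p mod_ring alg_closure" and A k
    by (rule freshmans_dream_sum'[OF pr qk])
  have q0: "q > 0" using c p prime_gt_0_nat by simp
  have nat: "(of_nat i :: 'p mod_ring alg_closure) ^ q ^ k = of_nat i" for i k
    by (induction i) (use q0 in \<open>simp_all add: add power_0_left\<close>)
  have inj: "x = y" if "x ^ q ^ k = y ^ q ^ k" for x y :: "'p mod_ring alg_closure" and k
  proof -
    have "(x - y) ^ q ^ k = 0" using add[of "x - y" y k] that by simp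
    thus ?thesis by simp
  qed
  obtain g :: "'p mod_ring poly" where g: "g \<noteq> 0" "poly (map_poly to_ac g) x = 0" by (rule alg_closure_algebraic)
  define f where "f = map_poly to_ac g"
  have f0: "f \<noteq> 0"
  proof
    assume "f = 0"
    hence "to_ac (coeff g (degree g)) = 0" unfolding f_def by (metis coeff_0 coeff_map_poly to_ac_0)
    thus False using g(1) by simp
  qed
  have cf: "coeff f i ^ q ^ k = coeff f i" for i k
  proof -
    obtain j where "coeff g i = of_nat j" using surj_of_nat_mod_ring by blast
    hence "coeff f i = of_nat j" by (simp add: f_def coeff_map_poly)
    thus ?thesis using nat by simp
  qed
  have "poly f (x ^ q ^ k) = poly f x ^ q ^ k" for k
  proof -
    have "poly f x ^ q ^ k = (\<Sum>i\<le>degree f. (coeff f i * x ^ i) ^ q ^ k)" by (simp add: poly_altdef sum)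
    also have "\<dots> = (\<Sum>i\<le>degree f. coeff f i * (x ^ q ^ k) ^ i)"
      by (intro sum.cong refl) (simp add: power_mult_distrib cf mult.commute flip: power_mult)
    finally show ?thesis by (simp add: poly_altdef)
  qed
  hence "range (\<lambda>k. x ^ q ^ k) \<subseteq> {y. poly f y = 0}" using g(2) q0 by (auto simp: f_def power_0_left)
  hence "finite (range (\<lambda>k. x ^ q ^ k))" using poly_roots_finite[OF f0] finite_subset by blast
  hence "\<not> inj (\<lambda>k. x ^ q ^ k)" using finite_imageD infinite_UNIV_nat by blast
  then obtain i j where "x ^ q ^ i = x ^ q ^ j" "i \<noteq> j" by (auto simp: inj_on_def)
  then obtain i j where ij: "x ^ q ^ i = x ^ q ^ j" "i < j" by (metis linorder_neqE_nat)
  have "(x ^ q ^ (j - i)) ^ q ^ i = x ^ q ^ i" unfolding ij(1) using ij(2) by (simp flip: power_mult power_add)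
  hence "x ^ q ^ (j - i) = x" by (rule inj)
  thus ?thesis using ij(2) by (intro exI[of _ "j - i"]) auto
qed

theorem theorem1p1:
  fixes p :: nat
  assumes "prime p" and "CARD('p::prime_card) = p"
  shows "\<exists>C::real. C > 0 \<and>
    (\<forall>n::nat. n > 0 \<longrightarrow> (\<forall>q::nat. (\<exists>c::nat. c \<ge> 1 \<and> q = p ^ c) \<longrightarrow>
      (\<exists>(N::nat) (V :: 'p mod_ring alg_closure proj_point set) (g::nat).
         smooth_proj_abs_irreducible_curve q N V \<and>
         has_genus N V g \<and> real g \<le> C * real q ^ n \<and>
         \<not> (\<exists>x\<in>closed_points q V. \<exists>d. has_degree q x d \<and> d < n))))"
proof (intro exI[of _ "896 * real p ^ 2"] conjI allI impI)
  show "896 * real p ^ 2 > 0" using prime_gt_0_nat[OF assms(1)] by simp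
  fix n q :: nat assume n: "n > 0" and "\<exists>c::nat. c \<ge> 1 \<and> q = p ^ c"
  then obtain c where c: "c \<ge> 1" "q = p ^ c" by blast
  have ch: "CHAR('p mod_ring alg_closure) = p"
    using assms(2) by (simp add: CHAR_alg_closure semiring_char_mod_ring)
  have fqs: "fq_closure TYPE('p mod_ring alg_closure) q c"
  proof
    show "prime (CHAR('p mod_ring alg_closure))" "q = CHAR('p mod_ring alg_closure) ^ c" "c \<ge> 1"
      using ch assms(1) c by simp_all
    show "\<exists>k\<ge>1. x ^ q ^ k = x" for x :: "'p mod_ring alg_closure"
      by (rule mod_ring_closure_algebraic[OF ch assms(1) c])
  qed
  obtain V :: "'p mod_ring alg_closure proj_point set" and g where V: "smooth_proj_abs_irreducible_curve q 7 V"
    "has_genus 7 V g" "g \<le> 896 * p ^ 2 * q ^ n"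
    "\<And>P x d. P \<in> V \<Longrightarrow> x \<in> P \<Longrightarrow> 1 \<le> d \<Longrightarrow> d < n \<Longrightarrow> \<not> (\<forall>i j. x j \<noteq> 0 \<longrightarrow> x i / x j \<in> Fq (q ^ d))"
    using fq_closure.pointless_curve[OF fqs, of n] n unfolding ch by (metis Suc_leI One_nat_def)
  have "real g \<le> real (896 * p ^ 2 * q ^ n)" using V(3) by (simp only: of_nat_le_iff)
  hence gb: "real g \<le> 896 * real p ^ 2 * real q ^ n" by simp
  have "\<not> (\<exists>x\<in>closed_points q V. \<exists>d. has_degree q x d \<and> d < n)"
  proof (intro notI, elim bexE exE conjE)
    fix X0 d assume X0: "X0 \<in> closed_points q V" and deg: "has_degree q X0 d" and dn: "d < n"
    obtain P where P: "P \<in> V" "X0 = frobenius_orbit q P" using X0 by (auto simp: closed_points_def)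
    \<comment> \<open>P lies in its own orbit, so a closed point of degree d would put all ratios of
      its coordinates into the field with q^d elements.\<close>
    have "P = (\<lambda>x i. x i ^ (q ^ 0)) ` P" by simp
    hence "P \<in> X0" unfolding P(2) frobenius_orbit_def by blast
    hence res: "d > 0" "residue_field q P = Fq (q ^ d)" using deg by (auto simp: has_degree_def)
    have "V \<subseteq> proj_space 7" using V(1) closed_sub by (auto simp: smooth_proj_abs_irreducible_curve_def)
    then obtain x where x: "x \<in> P" using P(1) cls_self by (auto simp: proj_space_eq)
    have "x i / x j \<in> Fq (q ^ d)" if "x j \<noteq> 0" for i j
      unfolding res(2)[symmetric] residue_field_def using x that by blast
    thus False using V(4)[OF P(1) x _ dn] res(1) by auto
  qed
  thus "\<exists>N (V :: 'p mod_ring alg_closure proj_point set) g. smooth_proj_abs_irreducible_curve q N V \<and>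
         has_genus N V g \<and> real g \<le> 896 * real p ^ 2 * real q ^ n \<and>
         \<not> (\<exists>x\<in>closed_points q V. \<exists>d. has_degree q x d \<and> d < n)"
    using V(1,2) gb by blast
qed

end
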